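(* Let $R$ be a commutative ring with unity, $G$ a discrete group, and $\mathcal{H}$ a collection of subgroups of $G$ closed under conjugation. For every right $R\mathcal{T}_{\mathcal{H}}(G)$-module $M$, there is a spectral sequence $$E_2^{p,q}=H^p(\mathcal{O}_{\mathcal{H}}(G);\mathcal{H}^q_M)\Rightarrow H^{p+q}(\mathcal{T}_{\mathcal{H}}(G);M),$$ where $\mathcal{H}^q_M$ is the right $R\mathcal{O}_{\mathcal{H}}(G)$-module such that $\mathcal{H}^q_M(K)=H^q(K;M(K))$ for every $K\in\mathcal{H}$.
   Context: A right $R\mathcal{C}$-module is a contravariant functor $\mathcal{C}^{op}\to R\text{-Mod}$, and $H^*(\mathcal{C};M)=\mathrm{Ext}^*_{R\mathcal{C}}(\underline R,M)$ with $\underline R$ the constant functor. "$E_2^{p,q}\Rightarrow H^{p+q}$" means a convergent first quadrant cohomological spectral sequence. The transporter category $\mathcal{T}_{\mathcal{H}}(G)$ has objects the subgroups $H\in\mathcal{H}$ and morphisms $\mathrm{Mor}(H,K)=N_G(H,K)=\{g\in G: gHg^{-1}\le K\}$, with composition given by group multiplication. The orbit category $\mathcal{O}_{\mathcal{H}}(G)$ has the same objects and morphisms $\mathrm{Mor}(H,K)=K\backslash N_G(H,K)=\{Kg: g\in G,\ gHg^{-1}\le K\}$ (equivalently, $G$-maps $G/H\to G/K$). $M(K)$ is a $K$-module via $K\le N_G(K,K)=\mathrm{Aut}$-monoid of $K$ in $\mathcal{T}_{\mathcal{H}}(G)$. For a morphism $Kg:H\to K$, let $c_g:H\to K$, $c_g(h)=ghg^{-1}$;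 the module map $\mathcal{H}^q_M(K)\to\mathcal{H}^q_M(H)$ is the composite $$H^q(K;M(K))\xrightarrow{c_g^*}H^q(H;\mathrm{Res}_{c_g}M(K))\xrightarrow{M(g)_*}H^q(H;M(H)),$$ which is independent of the representative $g$. *)

theory Defs
  imports "HOL-Algebra.Module" "HOL-Algebra.AbelCoset"
begin

section \<open>Modules\<close>

definition mod_hom ::
  "('r, 'x) ring_scheme \<Rightarrow> ('r, 'a) module \<Rightarrow> ('r, 'b) module \<Rightarrow> ('a \<Rightarrow> 'b) set" where
  "mod_hom R M N = {f \<in> carrier M \<rightarrow> carrier N.
     (\<forall>x\<in>carrier M. \<forall>y\<in>carrier M. f (x \<oplus>\<^bsub>M\<^esub> y) = f x \<oplus>\<^bsub>N\<^esub> f y) \<and>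
     (\<forall>r\<in>carrier R. \<forall>x\<in>carrier M. f (r \<odot>\<^bsub>M\<^esub> x) = r \<odot>\<^bsub>N\<^esub> f x)}"

definition mod_iso ::
  "('r, 'x) ring_scheme \<Rightarrow> ('r, 'a) module \<Rightarrow> ('r, 'b) module \<Rightarrow> bool" where
  "mod_iso R M N \<longleftrightarrow> (\<exists>f\<in>mod_hom R M N. bij_betw f (carrier M) (carrier N))"

text \<open>The library's module records extend ring records; the fields \<^const>\<open>monoid.mult\<close> and
  \<^const>\<open>one\<close> play no role for modules and are left undefined. The summand \<open>N\<close> in the
  scalar multiplication only matters when \<open>r\<close> does not map \<open>X\<close> onto a full coset
  (e.g. \<open>r = 0\<close>).\<close>

definition quot_mod :: "('r, 'a) module \<Rightarrow> 'a set \<Rightarrow> ('r, 'a set) module" where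
  "quot_mod M N = \<lparr>carrier = a_rcosets\<^bsub>M\<^esub> N, mult = undefined, one = undefined,
     zero = N, add = set_add M, smult = (\<lambda>r X. set_add M N ((\<lambda>x. r \<odot>\<^bsub>M\<^esub> x) ` X))\<rparr>"

definition cohom :: "(nat \<Rightarrow> ('r, 'a) module) \<Rightarrow> (nat \<Rightarrow> 'a \<Rightarrow> 'a) \<Rightarrow> nat \<Rightarrow> ('r, 'a set) module" where
  "cohom X \<delta> n =
     quot_mod (X n\<lparr>carrier := a_kernel (X n) (X (Suc n)) (\<delta> n)\<rparr>)
       (case n of 0 \<Rightarrow> {\<zero>\<^bsub>X 0\<^esub>} | Suc m \<Rightarrow> \<delta> m ` carrier (X m))"

section \<open>Small categories and right modules over them\<close>

record ('o, 'm) cat =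
  Ob :: "'o set"
  Mor :: "'o \<Rightarrow> 'o \<Rightarrow> 'm set"
  Cmp :: "'m \<Rightarrow> 'm \<Rightarrow> 'm"
  Idn :: "'o \<Rightarrow> 'm"

text \<open>Hom-sets need not be disjoint: a morphism is an element of \<^const>\<open>Mor\<close> together with
  its source and target. \<open>Cmp C g f\<close> is \<open>g\<close> after \<open>f\<close>.\<close>

locale small_category =
  fixes C :: "('o, 'm) cat"
  assumes Idn_closed: "x \<in> Ob C \<Longrightarrow> Idn C x \<in> Mor C x x"
    and Cmp_closed: "\<lbrakk>x \<in> Ob C; y \<in> Ob C; z \<in> Ob C; f \<in> Mor C x y; g \<in> Mor C y z\<rbrakk>
      \<Longrightarrow> Cmp C g f \<in> Mor C x z"
    and Cmp_Idn: "\<lbrakk>x \<in> Ob C; y \<in> Ob C; f \<in> Mor C x y\<rbrakk> \<Longrightarrow> Cmp C f (Idn C x) = f"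
    and Idn_Cmp: "\<lbrakk>x \<in> Ob C; y \<in> Ob C; f \<in> Mor C x y\<rbrakk> \<Longrightarrow> Cmp C (Idn C y) f = f"
    and Cmp_assoc: "\<lbrakk>w \<in> Ob C; x \<in> Ob C; y \<in> Ob C; z \<in> Ob C;
        f \<in> Mor C w x; g \<in> Mor C x y; h \<in> Mor C y z\<rbrakk>
      \<Longrightarrow> Cmp C h (Cmp C g f) = Cmp C (Cmp C h g) f"

text \<open>\<open>act M x y f\<close> is the map \<open>M(f) : M(y) \<rightarrow> M(x)\<close> induced by \<open>f : x \<rightarrow> y\<close>.\<close>

record ('o, 'm, 'r, 'a) rcmod =
  val :: "'o \<Rightarrow> ('r, 'a) module"
  act :: "'o \<Rightarrow> 'o \<Rightarrow> 'm \<Rightarrow> 'a \<Rightarrow> 'a"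

locale right_module = R?: cring R + small_category C
  for R :: "('r, 'x) ring_scheme" (structure) and C :: "('o, 'm) cat" +
  fixes M :: "('o, 'm, 'r, 'a) rcmod"
  assumes val_module: "x \<in> Ob C \<Longrightarrow> module R (val M x)"
    and act_hom: "\<lbrakk>x \<in> Ob C; y \<in> Ob C; f \<in> Mor C x y\<rbrakk>
      \<Longrightarrow> act M x y f \<in> mod_hom R (val M y) (val M x)"
    and act_Idn: "\<lbrakk>x \<in> Ob C; a \<in> carrier (val M x)\<rbrakk> \<Longrightarrow> act M x x (Idn C x) a = a"
    and act_Cmp: "\<lbrakk>x \<in> Ob C; y \<in> Ob C; z \<in> Ob C; f \<in> Mor C x y; g \<in> Mor C y z;
        a \<in> carrier (val M z)\<rbrakk>
      \<Longrightarrow> act M x z (Cmp C g f) a = act M x y f (act M y z g a)"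

definition const_rcmod :: "('r, 'x) ring_scheme \<Rightarrow> ('o, 'm, 'r, 'r) rcmod" where
  "const_rcmod R = \<lparr>val = (\<lambda>_. \<lparr>carrier = carrier R, mult = mult R, one = one R,
       zero = zero R, add = add R, smult = mult R\<rparr>),
     act = (\<lambda>_ _ _ a. a)\<rparr>"

text \<open>Natural transformations are taken extensional, so that equality of functions is equality
  of natural transformations.\<close>

definition nat_trans ::
  "('r, 'x) ring_scheme \<Rightarrow> ('o, 'm) cat \<Rightarrow> ('o, 'm, 'r, 'a) rcmod \<Rightarrow> ('o, 'm, 'r, 'b) rcmod
    \<Rightarrow> ('o \<Rightarrow> 'a \<Rightarrow> 'b) set" where
  "nat_trans R C M N =
     {\<eta> \<in> (\<Pi>\<^sub>E x\<in>Ob C. mod_hom R (val M x) (val N x) \<inter> extensional (carrier (val M x))).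
       \<forall>x\<in>Ob C. \<forall>y\<in>Ob C. \<forall>f\<in>Mor C x y. \<forall>a\<in>carrier (val M y).
         \<eta> x (act M x y f a) = act N x y f (\<eta> y a)}"

definition Hom_mod ::
  "('r, 'x) ring_scheme \<Rightarrow> ('o, 'm) cat \<Rightarrow> ('o, 'm, 'r, 'a) rcmod \<Rightarrow> ('o, 'm, 'r, 'b) rcmod
    \<Rightarrow> ('r, 'o \<Rightarrow> 'a \<Rightarrow> 'b) module" where
  "Hom_mod R C M N = \<lparr>carrier = nat_trans R C M N, mult = undefined, one = undefined,
     zero = (\<lambda>x\<in>Ob C. \<lambda>a\<in>carrier (val M x). \<zero>\<^bsub>val N x\<^esub>),
     add = (\<lambda>\<eta> \<theta>. \<lambda>x\<in>Ob C. \<lambda>a\<in>carrier (val M x). \<eta> x a \<oplus>\<^bsub>val N x\<^esub> \<theta> x a),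
     smult = (\<lambda>r \<eta>. \<lambda>x\<in>Ob C. \<lambda>a\<in>carrier (val M x). r \<odot>\<^bsub>val N x\<^esub> \<eta> x a)\<rparr>"

section \<open>Projective resolutions and Ext\<close>

text \<open>Lifting against (objectwise) surjections. HOL cannot quantify over types, so the test
  modules \<open>A\<close>, \<open>B\<close> have to live in fixed types: \<open>B\<close> in the type of \<open>P\<close>, and
  \<open>A\<close> in \<^typ>\<open>'o \<times> 'm \<times> 'p \<Rightarrow> 'r\<close>. The latter contains the canonical free cover of \<open>P\<close>,
  whose value at \<open>x\<close> consists of the finitely supported functions on the triples \<open>(y, f, e)\<close>
  with \<open>f : x \<rightarrow> y\<close> and \<open>e \<in> P(y)\<close>. Hence \<open>P\<close> is a direct summand of a free module, and so
  the condition implies (and is equivalent to) lifting against surjections in all types.\<close>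

definition projective ::
  "('r, 'x) ring_scheme \<Rightarrow> ('o, 'm) cat \<Rightarrow> ('o, 'm, 'r, 'p) rcmod \<Rightarrow> bool" where
  "projective R C P \<longleftrightarrow> right_module R C P \<and>
     (\<forall>(A :: ('o, 'm, 'r, 'o \<times> 'm \<times> 'p \<Rightarrow> 'r) rcmod) (B :: ('o, 'm, 'r, 'p) rcmod).
       \<forall>\<pi>\<in>nat_trans R C A B. \<forall>\<phi>\<in>nat_trans R C P B.
         right_module R C A \<longrightarrow> right_module R C B \<longrightarrow>
         (\<forall>x\<in>Ob C. \<pi> x ` carrier (val A x) = carrier (val B x)) \<longrightarrow>
         (\<exists>\<psi>\<in>nat_trans R C P A. \<forall>x\<in>Ob C. \<forall>a\<in>carrier (val P x). \<pi> x (\<psi> x a) = \<phi> x a))"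

text \<open>\<open>\<dots> \<rightarrow> P\<^sub>1 \<rightarrow> P\<^sub>0 \<rightarrow> N \<rightarrow> 0\<close> with boundary maps \<open>d n : P (n + 1) \<rightarrow> P n\<close> and
  augmentation \<open>\<epsilon>\<close>.\<close>

definition projective_resolution ::
  "('r, 'x) ring_scheme \<Rightarrow> ('o, 'm) cat \<Rightarrow> ('o, 'm, 'r, 'b) rcmod
    \<Rightarrow> (nat \<Rightarrow> ('o, 'm, 'r, 'p) rcmod) \<Rightarrow> (nat \<Rightarrow> 'o \<Rightarrow> 'p \<Rightarrow> 'p) \<Rightarrow> ('o \<Rightarrow> 'p \<Rightarrow> 'b) \<Rightarrow> bool" where
  "projective_resolution R C N P d \<epsilon> \<longleftrightarrow>
     right_module R C N \<and>
     (\<forall>n. projective R C (P n)) \<and>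
     (\<forall>n. d n \<in> nat_trans R C (P (Suc n)) (P n)) \<and>
     \<epsilon> \<in> nat_trans R C (P 0) N \<and>
     (\<forall>x\<in>Ob C.
       \<epsilon> x ` carrier (val (P 0) x) = carrier (val N x) \<and>
       d 0 x ` carrier (val (P 1) x) = a_kernel (val (P 0) x) (val N x) (\<epsilon> x) \<and>
       (\<forall>n. d (Suc n) x ` carrier (val (P (Suc (Suc n))) x) =
              a_kernel (val (P (Suc n)) x) (val (P n) x) (d n x)))"

definition precomp ::
  "('o, 'm) cat \<Rightarrow> (nat \<Rightarrow> ('o, 'm, 'r, 'p) rcmod) \<Rightarrow> (nat \<Rightarrow> 'o \<Rightarrow> 'p \<Rightarrow> 'p)
    \<Rightarrow> nat \<Rightarrow> ('o \<Rightarrow> 'p \<Rightarrow> 'a) \<Rightarrow> ('o \<Rightarrow> 'p \<Rightarrow> 'a)" where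
  "precomp C P d n \<phi> = (\<lambda>x\<in>Ob C. \<lambda>a\<in>carrier (val (P (Suc n)) x). \<phi> x (d n x a))"

text \<open>For a projective resolution \<open>(P, d)\<close> of \<open>N\<close>, this is \<open>Ext\<^sup>n(N, M)\<close> computed from
  that resolution; for \<open>N\<close> the constant module it is \<open>H\<^sup>n(C; M)\<close>.\<close>

definition Ext ::
  "('r, 'x) ring_scheme \<Rightarrow> ('o, 'm) cat \<Rightarrow> (nat \<Rightarrow> ('o, 'm, 'r, 'p) rcmod)
    \<Rightarrow> (nat \<Rightarrow> 'o \<Rightarrow> 'p \<Rightarrow> 'p) \<Rightarrow> ('o, 'm, 'r, 'a) rcmod \<Rightarrow> nat
    \<Rightarrow> ('r, ('o \<Rightarrow> 'p \<Rightarrow> 'a) set) module" where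
  "Ext R C P d M n = cohom (\<lambda>k. Hom_mod R C (P k) M) (precomp C P d) n"

section \<open>Group cohomology\<close>

text \<open>Inhomogeneous cochains of a group \<open>K\<close> with coefficients in a left \<open>K\<close>-module \<open>A\<close>, whose
  action is \<open>l :: 'g \<Rightarrow> 'a \<Rightarrow> 'a\<close>. A \<open>q\<close>-tuple of group elements is a list of length \<open>q\<close>.\<close>

definition tuples :: "('g, 'y) monoid_scheme \<Rightarrow> nat \<Rightarrow> 'g list set" where
  "tuples K q = {ks. length ks = q \<and> set ks \<subseteq> carrier K}"

definition grp_cochains ::
  "('g, 'y) monoid_scheme \<Rightarrow> ('r, 'a) module \<Rightarrow> nat \<Rightarrow> ('r, 'g list \<Rightarrow> 'a) module" where
  "grp_cochains K A q = \<lparr>carrier = (tuples K q \<rightarrow>\<^sub>E carrier A), mult = undefined, one = undefined,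
     zero = (\<lambda>ks\<in>tuples K q. \<zero>\<^bsub>A\<^esub>),
     add = (\<lambda>u v. \<lambda>ks\<in>tuples K q. u ks \<oplus>\<^bsub>A\<^esub> v ks),
     smult = (\<lambda>r u. \<lambda>ks\<in>tuples K q. r \<odot>\<^bsub>A\<^esub> u ks)\<rparr>"

definition grp_coboundary ::
  "('r, 'x) ring_scheme \<Rightarrow> ('g, 'y) monoid_scheme \<Rightarrow> ('r, 'a) module \<Rightarrow> ('g \<Rightarrow> 'a \<Rightarrow> 'a)
    \<Rightarrow> nat \<Rightarrow> ('g list \<Rightarrow> 'a) \<Rightarrow> ('g list \<Rightarrow> 'a)" where
  "grp_coboundary R K A l q u = (\<lambda>ks\<in>tuples K (Suc q).
     l (hd ks) (u (tl ks)) \<oplus>\<^bsub>A\<^esub>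
     (\<Oplus>\<^bsub>A\<^esub>i\<in>{..<q}. ((\<ominus>\<^bsub>R\<^esub> \<one>\<^bsub>R\<^esub>) [^]\<^bsub>R\<^esub> Suc i) \<odot>\<^bsub>A\<^esub>
        u (take i ks @ [ks ! i \<otimes>\<^bsub>K\<^esub> ks ! Suc i] @ drop (i + 2) ks)) \<oplus>\<^bsub>A\<^esub>
     ((\<ominus>\<^bsub>R\<^esub> \<one>\<^bsub>R\<^esub>) [^]\<^bsub>R\<^esub> Suc q) \<odot>\<^bsub>A\<^esub> u (butlast ks))"

definition grp_cohom ::
  "('r, 'x) ring_scheme \<Rightarrow> ('g, 'y) monoid_scheme \<Rightarrow> ('r, 'a) module \<Rightarrow> ('g \<Rightarrow> 'a \<Rightarrow> 'a)
    \<Rightarrow> nat \<Rightarrow> ('r, ('g list \<Rightarrow> 'a) set) module" where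
  "grp_cohom R K A l q = cohom (grp_cochains K A) (grp_coboundary R K A l) q"

section \<open>Transporter and orbit categories\<close>

definition transporter :: "('g, 'y) monoid_scheme \<Rightarrow> 'g set \<Rightarrow> 'g set \<Rightarrow> 'g set" where
  "transporter G H K = {g \<in> carrier G. g <#\<^bsub>G\<^esub> H #>\<^bsub>G\<^esub> inv\<^bsub>G\<^esub> g \<subseteq> K}"

definition transporter_category :: "('g, 'y) monoid_scheme \<Rightarrow> 'g set set \<Rightarrow> ('g set, 'g) cat" where
  "transporter_category G \<H> = \<lparr>Ob = \<H>, Mor = transporter G,
     Cmp = (\<lambda>g' g. g' \<otimes>\<^bsub>G\<^esub> g), Idn = (\<lambda>_. \<one>\<^bsub>G\<^esub>)\<rparr>"

text \<open>The composite \<open>Lg'g\<close> of \<open>Kg : H \<rightarrow> K\<close> and \<open>Lg' : K \<rightarrow> L\<close> is the product of subsets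
  \<open>(Lg')(Kg)\<close>, because \<open>g'K \<subseteq> Lg'\<close>.\<close>

definition orbit_category :: "('g, 'y) monoid_scheme \<Rightarrow> 'g set set \<Rightarrow> ('g set, 'g set) cat" where
  "orbit_category G \<H> = \<lparr>Ob = \<H>, Mor = (\<lambda>H K. (\<lambda>g. K #>\<^bsub>G\<^esub> g) ` transporter G H K),
     Cmp = (\<lambda>X' X. X' <#>\<^bsub>G\<^esub> X), Idn = (\<lambda>K. K)\<rparr>"
lemma conj_eq_image: "g <#\<^bsub>G\<^esub> H #>\<^bsub>G\<^esub> inv\<^bsub>G\<^esub> g = (\<lambda>h. g \<otimes>\<^bsub>G\<^esub> h \<otimes>\<^bsub>G\<^esub> inv\<^bsub>G\<^esub> g) ` H"
  by (auto simp: l_coset_def r_coset_def)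

lemma (in group) transporter_one: "subgroup H G \<Longrightarrow> \<one> \<in> transporter G H H"
  by (auto simp: transporter_def conj_eq_image subgroup.mem_carrier)

lemma (in group) transporter_mult:
  assumes "subgroup H G" "g \<in> transporter G H K" "g' \<in> transporter G K L"
  shows "g' \<otimes> g \<in> transporter G H L"
proof -
  have g: "g \<in> carrier G" "g' \<in> carrier G"
    using assms by (auto simp: transporter_def)
  have "g' \<otimes> g \<otimes> h \<otimes> inv (g' \<otimes> g) = g' \<otimes> (g \<otimes> h \<otimes> inv g) \<otimes> inv g'" if "h \<in> H" for h
    using that g assms(1) by (simp add: subgroup.mem_carrier inv_mult_group m_assoc)
  then show ?thesis
    using g assms unfolding transporter_def conj_eq_image by auto
qed

lemma (in group) orbit_comp:
  assumes "subgroup K G" "subgroup L G" "g \<in> carrier G" "g' \<in> transporter G K L"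
  shows "(L #> g') <#> (K #> g) = L #> (g' \<otimes> g)"
proof
  have g': "g' \<in> carrier G" and tr: "\<And>k. k \<in> K \<Longrightarrow> g' \<otimes> k \<otimes> inv g' \<in> L"
    using assms(4) by (auto simp: transporter_def conj_eq_image)
  show "(L #> g') <#> (K #> g) \<subseteq> L #> (g' \<otimes> g)"
  proof
    fix x assume "x \<in> (L #> g') <#> (K #> g)"
    then obtain l k where lk: "l \<in> L" "k \<in> K" "x = (l \<otimes> g') \<otimes> (k \<otimes> g)"
      by (auto simp: set_mult_def r_coset_def)
    have c: "l \<in> carrier G" "k \<in> carrier G"
      using lk assms(1,2) by (auto simp: subgroup.mem_carrier)
    have "inv g' \<otimes> (g' \<otimes> g) = g"
      using g' assms(3) m_assoc[of "inv g'" g' g] by simp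
    then have "x = (l \<otimes> (g' \<otimes> k \<otimes> inv g')) \<otimes> (g' \<otimes> g)"
      using lk(3) c g' assms(3) by (simp add: m_assoc)
    moreover have "l \<otimes> (g' \<otimes> k \<otimes> inv g') \<in> L"
      using lk tr assms(2) by (simp add: subgroup.m_closed)
    ultimately show "x \<in> L #> (g' \<otimes> g)"
      by (auto simp: r_coset_def)
  qed
  show "L #> (g' \<otimes> g) \<subseteq> (L #> g') <#> (K #> g)"
  proof
    fix x assume "x \<in> L #> (g' \<otimes> g)"
    then obtain l where l: "l \<in> L" "x = l \<otimes> (g' \<otimes> g)"
      by (auto simp: r_coset_def)
    then have "x = (l \<otimes> g') \<otimes> (\<one> \<otimes> g)"
      using g' assms(2,3) by (simp add: m_assoc subgroup.mem_carrier)
    then show "x \<in> (L #> g') <#> (K #> g)"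
      using l(1) subgroup.one_closed[OF assms(1)]
      unfolding set_mult_def r_coset_def by blast
  qed
qed

lemma (in group) small_category_transporter:
  assumes "\<And>H. H \<in> \<H> \<Longrightarrow> subgroup H G"
  shows "small_category (transporter_category G \<H>)"
proof
  fix w x y z f g h
  assume "w \<in> Ob (transporter_category G \<H>)" "x \<in> Ob (transporter_category G \<H>)"
    "f \<in> Mor (transporter_category G \<H>) w x" "g \<in> Mor (transporter_category G \<H>) x y"
    "h \<in> Mor (transporter_category G \<H>) y z"
  then show "Cmp (transporter_category G \<H>) h (Cmp (transporter_category G \<H>) g f) =
      Cmp (transporter_category G \<H>) (Cmp (transporter_category G \<H>) h g) f"
    by (auto simp: transporter_category_def transporter_def m_assoc)
next
  fix x y z f g
  assume "x \<in> Ob (transporter_category G \<H>)" "f \<in> Mor (transporter_category G \<H>) x y"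
    "g \<in> Mor (transporter_category G \<H>) y z"
  then show "Cmp (transporter_category G \<H>) g f \<in> Mor (transporter_category G \<H>) x z"
    using transporter_mult assms by (simp add: transporter_category_def)
next
  fix x y f
  assume "f \<in> Mor (transporter_category G \<H>) x y"
  then show "Cmp (transporter_category G \<H>) f (Idn (transporter_category G \<H>) x) = f"
    and "Cmp (transporter_category G \<H>) (Idn (transporter_category G \<H>) y) f = f"
    by (simp_all add: transporter_category_def transporter_def)
qed (simp add: assms transporter_category_def transporter_one)

lemma (in group) small_category_orbit:
  assumes \<H>: "\<And>H. H \<in> \<H> \<Longrightarrow> subgroup H G"
  shows "small_category (orbit_category G \<H>)"
proof -
  have carr: "g \<in> carrier G" if "g \<in> transporter G H K" for g H K
    using that by (simp add: transporter_def)
  have one: "K #> \<one> = K" if "K \<in> \<H>" for K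
    using \<H>[OF that] by (simp add: subgroup.subset)
  show ?thesis
  proof
    fix x assume "x \<in> Ob (orbit_category G \<H>)"
    then show "Idn (orbit_category G \<H>) x \<in> Mor (orbit_category G \<H>) x x"
      using transporter_one[OF \<H>] one by (force simp: orbit_category_def)
  next
    fix x y z f g
    assume "x \<in> Ob (orbit_category G \<H>)" "y \<in> Ob (orbit_category G \<H>)"
      "z \<in> Ob (orbit_category G \<H>)" "f \<in> Mor (orbit_category G \<H>) x y"
      "g \<in> Mor (orbit_category G \<H>) y z"
    then show "Cmp (orbit_category G \<H>) g f \<in> Mor (orbit_category G \<H>) x z"
      by (auto simp: orbit_category_def orbit_comp \<H> carr transporter_mult)
  next
    fix x y f
    assume xy: "x \<in> Ob (orbit_category G \<H>)" "y \<in> Ob (orbit_category G \<H>)"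
      and "f \<in> Mor (orbit_category G \<H>) x y"
    then obtain g where g: "g \<in> transporter G x y" "f = y #> g" and m: "x \<in> \<H>" "y \<in> \<H>"
      by (auto simp: orbit_category_def)
    show "Cmp (orbit_category G \<H>) f (Idn (orbit_category G \<H>) x) = f"
      using orbit_comp[OF \<H>[OF m(1)] \<H>[OF m(2)] one_closed g(1)] g one[OF m(1)] carr[OF g(1)]
      by (simp add: orbit_category_def)
    show "Cmp (orbit_category G \<H>) (Idn (orbit_category G \<H>) y) f = f"
      using orbit_comp[OF \<H>[OF m(2)] \<H>[OF m(2)] carr[OF g(1)] transporter_one[OF \<H>[OF m(2)]]]
        g one[OF m(2)] carr[OF g(1)]
      by (simp add: orbit_category_def)
  next
    fix w x y z f g h
    assume "w \<in> Ob (orbit_category G \<H>)" "x \<in> Ob (orbit_category G \<H>)"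
      "y \<in> Ob (orbit_category G \<H>)" "z \<in> Ob (orbit_category G \<H>)"
      "f \<in> Mor (orbit_category G \<H>) w x" "g \<in> Mor (orbit_category G \<H>) x y"
      "h \<in> Mor (orbit_category G \<H>) y z"
    then show "Cmp (orbit_category G \<H>) h (Cmp (orbit_category G \<H>) g f) =
        Cmp (orbit_category G \<H>) (Cmp (orbit_category G \<H>) h g) f"
      by (auto simp: orbit_category_def orbit_comp \<H> carr transporter_mult m_assoc)
  qed
qed

section \<open>The coefficient system \<open>H\<^sup>q(K; M(K))\<close>\<close>

text \<open>The right action of \<open>K \<subseteq> Mor(K, K)\<close> on \<open>M(K)\<close> is turned into a left one by inversion.\<close>

definition left_act :: "('g, 'y) monoid_scheme \<Rightarrow> ('g set, 'g, 'r, 'a) rcmod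
    \<Rightarrow> 'g set \<Rightarrow> 'g \<Rightarrow> 'a \<Rightarrow> 'a" where
  "left_act G M K k = act M K K (inv\<^bsub>G\<^esub> k)"

definition pullback_cochain :: "('g, 'y) monoid_scheme \<Rightarrow> ('g set, 'g, 'r, 'a) rcmod \<Rightarrow> nat
    \<Rightarrow> 'g set \<Rightarrow> 'g set \<Rightarrow> 'g \<Rightarrow> ('g list \<Rightarrow> 'a) \<Rightarrow> ('g list \<Rightarrow> 'a)" where
  "pullback_cochain G M q H K g u = (\<lambda>hs\<in>tuples (G\<lparr>carrier := H\<rparr>) q.
     act M H K g (u (map (\<lambda>h. g \<otimes>\<^bsub>G\<^esub> h \<otimes>\<^bsub>G\<^esub> inv\<^bsub>G\<^esub> g) hs)))"

text \<open>A morphism \<open>X = Kg\<close> acts through a chosen representative. A cohomology class \<open>c\<close> is a coset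
  of cocycles, and adding the coboundaries (the zero of cohomology) to the image of \<open>c\<close> under the
  cochain map gives the image class.\<close>

definition cohom_rcmod :: "('r, 'x) ring_scheme \<Rightarrow> ('g, 'y) monoid_scheme
    \<Rightarrow> ('g set, 'g, 'r, 'a) rcmod \<Rightarrow> nat \<Rightarrow> ('g set, 'g set, 'r, ('g list \<Rightarrow> 'a) set) rcmod" where
  "cohom_rcmod R G M q =
     (let HH = (\<lambda>K. grp_cohom R (G\<lparr>carrier := K\<rparr>) (val M K) (left_act G M K) q) in
      \<lparr>val = HH,
       act = (\<lambda>H K X c. set_add (grp_cochains (G\<lparr>carrier := H\<rparr>) (val M H) q) \<zero>\<^bsub>HH H\<^esub>
                (pullback_cochain G M q H K (SOME g. g \<in> X) ` c))\<rparr>)"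

section \<open>First quadrant cohomological spectral sequences\<close>

definition first_quadrant_ss :: "('r, 'x) ring_scheme
    \<Rightarrow> (nat \<Rightarrow> int \<Rightarrow> int \<Rightarrow> ('r, 'e) module) \<Rightarrow> (nat \<Rightarrow> int \<Rightarrow> int \<Rightarrow> 'e \<Rightarrow> 'e) \<Rightarrow> bool" where
  "first_quadrant_ss R E d \<longleftrightarrow> (\<forall>r\<ge>2. \<forall>p q.
     module R (E r p q) \<and>
     (p < 0 \<or> q < 0 \<longrightarrow> carrier (E r p q) = {\<zero>\<^bsub>E r p q\<^esub>}) \<and>
     d r p q \<in> mod_hom R (E r p q) (E r (p + int r) (q - int r + 1)) \<and>
     (\<forall>x\<in>carrier (E r p q).
       d r (p + int r) (q - int r + 1) (d r p q x) = \<zero>\<^bsub>E r (p + 2 * int r) (q - 2 * int r + 2)\<^esub>) \<and>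
     mod_iso R (E (Suc r) p q)
       (quot_mod
         (E r p q\<lparr>carrier := a_kernel (E r p q) (E r (p + int r) (q - int r + 1)) (d r p q)\<rparr>)
         (d r (p - int r) (q + int r - 1) ` carrier (E r (p - int r) (q + int r - 1)))))"

text \<open>For \<open>r > max p (q + 1)\<close> no nonzero differential enters or leaves position \<open>(p, q)\<close>, so that
  \<open>E r p q\<close> is \<open>E\<^sub>\<infinity>\<close> there.\<close>

definition converges_to :: "('r, 'x) ring_scheme
    \<Rightarrow> (nat \<Rightarrow> int \<Rightarrow> int \<Rightarrow> ('r, 'e) module) \<Rightarrow> (nat \<Rightarrow> ('r, 'h) module) \<Rightarrow> bool" where
  "converges_to R E H \<longleftrightarrow> (\<exists>F :: nat \<Rightarrow> nat \<Rightarrow> 'h set.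
     (\<forall>n. F 0 n = carrier (H n) \<and> F (Suc n) n = {\<zero>\<^bsub>H n\<^esub>}) \<and>
     (\<forall>p n. submodule (F p n) R (H n) \<and> F (Suc p) n \<subseteq> F p n) \<and>
     (\<forall>p q r. 2 \<le> r \<and> max p (q + 1) < r \<longrightarrow>
       mod_iso R (E r (int p) (int q))
         (quot_mod (H (p + q)\<lparr>carrier := F p (p + q)\<rparr>) (F (Suc p) (p + q)))))"

end

theory Submission
  imports Defs
begin

text \<open>Pull a projective resolution \<open>P\<close> of \<open>R\<close> over the orbit category back to the transporter category
  and tensor it with the standard complex \<open>R[G\<^sup>*\<^sup>+\<^sup>1]\<close>. The total complex resolves \<open>R\<close> and its maps lift
  along surjections, so maps from it to \<open>M\<close> compute the cohomology of the transporter category. They are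
  also the total complex of \<open>Hom(P\<^sub>p, D\<^sup>q)\<close> over the orbit category, \<open>D\<^sup>q(K)\<close> being the \<open>K\<close>-equivariant
  homogeneous \<open>q\<close>-cochains with values in \<open>M(K)\<close>. Filter by \<open>p\<close>: since \<open>P\<^sub>p\<close> is projective,
  \<open>Hom(P\<^sub>p, -)\<close> is exact and \<open>E\<^sub>1 = Hom(P\<^sub>p, H\<^sup>q(D))\<close>, where \<open>H\<^sup>q(D)\<close> is the coefficient system of the
  statement; hence \<open>E\<^sub>2\<close>. The pages are then moved into the prescribed type along an injection of \<open>E\<^sub>2\<close>,
  of which all later pages are subquotients.\<close>

section \<open>Modules and subquotients\<close>

text \<open>The pullback of \<open>P\<close> alone cannot serve over the transporter category: there
  \<open>K\<close> sits inside the monoid of endomorphisms of the object \<open>K\<close> and acts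
  trivially on the pullback, so a map to \<open>M\<close> sees only the invariants of
  \<open>M(K)\<close>. The factor R[G^{q+1}] repairs this, because the lists over G form a free left
  \<open>K\<close>-set for every \<open>K\<close> at once, with the same lists at all objects. The
  contraction that prepends \<open>\<one>\<close> is not equivariant, but exactness is tested object
  by object. Freeness enters through one device, a \<open>K\<close>-map s : G -> K that is the
  identity on \<open>K\<close>; it yields the lifting property of the total complex as well as the
  comparison of equivariant with inhomogeneous cochains. The delicate point is the action on
  cohomology: the coefficient system conjugates the arguments of cochains by g, while
  \<open>D\<close> translates them by g. Both x -> g x and x -> g x g^{-1} satisfy a(h x) = (g h
  g^{-1}) a(x), and a prism operator joins any two such maps. At E_2, projectivity of
  \<open>P\<close> turns preimages found object by object into natural ones, so that a cochain can
  be corrected one bidegree at a time.\<close>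

lemma mod_homI:
  assumes "\<And>x. x \<in> carrier M \<Longrightarrow> f x \<in> carrier N"
    and "\<And>x y. x \<in> carrier M \<Longrightarrow> y \<in> carrier M \<Longrightarrow> f (x \<oplus>\<^bsub>M\<^esub> y) = f x \<oplus>\<^bsub>N\<^esub> f y"
    and "\<And>r x. r \<in> carrier R \<Longrightarrow> x \<in> carrier M \<Longrightarrow> f (r \<odot>\<^bsub>M\<^esub> x) = r \<odot>\<^bsub>N\<^esub> f x"
  shows "f \<in> mod_hom R M N"
  using assms by (auto simp: mod_hom_def)

lemma mod_hom_closed: "f \<in> mod_hom R M N \<Longrightarrow> x \<in> carrier M \<Longrightarrow> f x \<in> carrier N"
  by (auto simp: mod_hom_def)

lemma mod_hom_add: "f \<in> mod_hom R M N \<Longrightarrow> x \<in> carrier M \<Longrightarrow> y \<in> carrier M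
    \<Longrightarrow> f (x \<oplus>\<^bsub>M\<^esub> y) = f x \<oplus>\<^bsub>N\<^esub> f y"
  by (auto simp: mod_hom_def)

lemma mod_hom_smult: "f \<in> mod_hom R M N \<Longrightarrow> r \<in> carrier R \<Longrightarrow> x \<in> carrier M
    \<Longrightarrow> f (r \<odot>\<^bsub>M\<^esub> x) = r \<odot>\<^bsub>N\<^esub> f x"
  by (auto simp: mod_hom_def)

lemma mod_hom_zero:
  assumes "module R M" "module R N" "f \<in> mod_hom R M N"
  shows "f \<zero>\<^bsub>M\<^esub> = \<zero>\<^bsub>N\<^esub>"
proof -
  interpret M: module R M by fact
  interpret N: module R N by fact
  have "f \<zero>\<^bsub>M\<^esub> = f \<zero>\<^bsub>M\<^esub> \<oplus>\<^bsub>N\<^esub> f \<zero>\<^bsub>M\<^esub>"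
    using mod_hom_add[OF assms(3), of "\<zero>\<^bsub>M\<^esub>" "\<zero>\<^bsub>M\<^esub>"] by simp
  then show ?thesis
    by (metis M.M.zero_closed N.M.add.r_cancel_one' assms(3) mod_hom_closed)
qed

lemma mod_hom_uminus:
  assumes "module R M" "module R N" "f \<in> mod_hom R M N" "x \<in> carrier M"
  shows "f (\<ominus>\<^bsub>M\<^esub> x) = \<ominus>\<^bsub>N\<^esub> f x"
proof -
  interpret M: module R M by fact
  interpret N: module R N by fact
  have "f (\<ominus>\<^bsub>M\<^esub> x) \<oplus>\<^bsub>N\<^esub> f x = \<zero>\<^bsub>N\<^esub>"
    using mod_hom_add[OF assms(3), of "\<ominus>\<^bsub>M\<^esub> x" x] assms(4) mod_hom_zero[OF assms(1-3)]
    by (simp add: M.M.l_neg)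
  then show ?thesis
    by (metis M.M.a_inv_closed N.M.minus_equality assms(3,4) mod_hom_closed)
qed

lemma mod_hom_minus:
  assumes "module R M" "module R N" "f \<in> mod_hom R M N" "x \<in> carrier M" "y \<in> carrier M"
  shows "f (x \<ominus>\<^bsub>M\<^esub> y) = f x \<ominus>\<^bsub>N\<^esub> f y"
proof -
  interpret M: module R M by fact
  show ?thesis
    using assms(4,5) mod_hom_add[OF assms(3), of x "\<ominus>\<^bsub>M\<^esub> y"] mod_hom_uminus[OF assms(1-3,5)]
    by (simp add: a_minus_def)
qed

lemma mod_hom_comp:
  "f \<in> mod_hom R M N \<Longrightarrow> g \<in> mod_hom R N L \<Longrightarrow> (\<lambda>x. g (f x)) \<in> mod_hom R M L"
  by (auto simp: mod_hom_def Pi_iff)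

lemma mod_hom_cong:
  assumes "module R M" "\<And>x. x \<in> carrier M \<Longrightarrow> f x = g x"
  shows "f \<in> mod_hom R M N \<longleftrightarrow> g \<in> mod_hom R M N"
proof -
  interpret module R M by fact
  show ?thesis by (auto simp: mod_hom_def Pi_iff assms(2))
qed

lemma mod_isoI: "f \<in> mod_hom R M N \<Longrightarrow> bij_betw f (carrier M) (carrier N) \<Longrightarrow> mod_iso R M N"
  by (auto simp: mod_iso_def)

lemma mod_iso_trans: "mod_iso R M N \<Longrightarrow> mod_iso R N L \<Longrightarrow> mod_iso R M L"
proof -
  assume "mod_iso R M N" "mod_iso R N L"
  then obtain f g where "f \<in> mod_hom R M N" "bij_betw f (carrier M) (carrier N)"
    "g \<in> mod_hom R N L" "bij_betw g (carrier N) (carrier L)"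
    by (auto simp: mod_iso_def)
  then have "(\<lambda>x. g (f x)) \<in> mod_hom R M L" "bij_betw (\<lambda>x. g (f x)) (carrier M) (carrier L)"
    using mod_hom_comp bij_betw_trans[of f _ _ g] by (auto simp: comp_def)
  then show ?thesis by (rule mod_isoI)
qed

lemma mod_iso_inv:
  assumes "module R M" "f \<in> mod_hom R M N" "bij_betw f (carrier M) (carrier N)"
  shows "inv_into (carrier M) f \<in> mod_hom R N M"
proof -
  interpret M: module R M by fact
  let ?g = "inv_into (carrier M) f"
  have g: "?g y \<in> carrier M" "f (?g y) = y" if "y \<in> carrier N" for y
    using that assms(3) by (auto simp: bij_betw_def inv_into_into f_inv_into_f)
  have inj: "x = y" if "f x = f y" "x \<in> carrier M" "y \<in> carrier M" for x y
    using that assms(3) by (auto simp: bij_betw_def inj_on_def)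
  \<comment> \<open>\<open>N\<close> is any record here, not known to be a module; that its
    operations stay inside the carrier follows from \<open>f\<close> being onto.\<close>
  have N: "x \<oplus>\<^bsub>N\<^esub> y \<in> carrier N" "r \<in> carrier R \<Longrightarrow> r \<odot>\<^bsub>N\<^esub> x \<in> carrier N"
    if "x \<in> carrier N" "y \<in> carrier N" for x y r
  proof -
    show "x \<oplus>\<^bsub>N\<^esub> y \<in> carrier N"
      using mod_hom_closed[OF assms(2), of "?g x \<oplus>\<^bsub>M\<^esub> ?g y"] mod_hom_add[OF assms(2), of "?g x" "?g y"]
        g[OF that(1)] g[OF that(2)] by simp
    show "r \<odot>\<^bsub>N\<^esub> x \<in> carrier N" if "r \<in> carrier R"
      using mod_hom_closed[OF assms(2), of "r \<odot>\<^bsub>M\<^esub> ?g x"] mod_hom_smult[OF assms(2), of r "?g x"]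
        g[OF \<open>x \<in> carrier N\<close>] that by simp
  qed
  show ?thesis
  proof (rule mod_homI)
    fix x y assume "x \<in> carrier N" "y \<in> carrier N"
    then show "?g (x \<oplus>\<^bsub>N\<^esub> y) = ?g x \<oplus>\<^bsub>M\<^esub> ?g y"
      by (intro inj) (simp_all add: g N mod_hom_add[OF assms(2)])
  next
    fix r x assume "r \<in> carrier R" "x \<in> carrier N"
    then show "?g (r \<odot>\<^bsub>N\<^esub> x) = r \<odot>\<^bsub>M\<^esub> ?g x"
      by (intro inj) (simp_all add: g N mod_hom_smult[OF assms(2)])
  qed (rule g)
qed

lemma mod_iso_sym: "module R M \<Longrightarrow> mod_iso R M N \<Longrightarrow> mod_iso R N M"
  unfolding mod_iso_def by (meson bij_betw_inv_into mod_iso_inv)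

lemma module_restrict: "module R M \<Longrightarrow> submodule Z R M \<Longrightarrow> module R (M\<lparr>carrier := Z\<rparr>)"
  by (simp add: submodule.submodule_is_module)

lemma submodule_subset: "submodule Z R M \<Longrightarrow> x \<in> Z \<Longrightarrow> x \<in> carrier M"
  using subgroup.mem_carrier[OF submodule.axioms(1)] by fastforce

lemma submodule_zero: "submodule Z R M \<Longrightarrow> \<zero>\<^bsub>M\<^esub> \<in> Z"
  using subgroup.one_closed[OF submodule.axioms(1)] by fastforce

lemma submodule_add: "submodule Z R M \<Longrightarrow> x \<in> Z \<Longrightarrow> y \<in> Z \<Longrightarrow> x \<oplus>\<^bsub>M\<^esub> y \<in> Z"
  using subgroup.m_closed[OF submodule.axioms(1)] by fastforce

lemma submodule_uminus: "submodule Z R M \<Longrightarrow> x \<in> Z \<Longrightarrow> \<ominus>\<^bsub>M\<^esub> x \<in> Z"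
  using subgroup.m_inv_closed[OF submodule.axioms(1)] by (fastforce simp: a_inv_def)

lemma submodule_minus: "submodule Z R M \<Longrightarrow> x \<in> Z \<Longrightarrow> y \<in> Z \<Longrightarrow> x \<ominus>\<^bsub>M\<^esub> y \<in> Z"
  by (simp add: a_minus_def submodule_add submodule_uminus)

lemma submodule_smult: "submodule Z R M \<Longrightarrow> r \<in> carrier R \<Longrightarrow> x \<in> Z \<Longrightarrow> r \<odot>\<^bsub>M\<^esub> x \<in> Z"
  by (rule submodule.smult_closed)

text \<open>The additive inverse is defined by a description that mentions the carrier, whereas
  scalar multiplication is a field that survives a change of carrier. Writing negation as a scalar
  makes it computable in submodules and in modules of functions.\<close>

lemma module_minus_one:
  assumes "module R M" "x \<in> carrier M"
  shows "\<ominus>\<^bsub>M\<^esub> x = (\<ominus>\<^bsub>R\<^esub> \<one>\<^bsub>R\<^esub>) \<odot>\<^bsub>M\<^esub> x"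
proof -
  interpret module R M by fact
  show ?thesis using assms(2) by (simp add: smult_l_minus)
qed

lemma submoduleI':
  assumes "module R M" "Z \<subseteq> carrier M" "\<zero>\<^bsub>M\<^esub> \<in> Z"
    "\<And>x y. x \<in> Z \<Longrightarrow> y \<in> Z \<Longrightarrow> x \<oplus>\<^bsub>M\<^esub> y \<in> Z"
    "\<And>r x. r \<in> carrier R \<Longrightarrow> x \<in> Z \<Longrightarrow> r \<odot>\<^bsub>M\<^esub> x \<in> Z"
  shows "submodule Z R M"
proof -
  interpret module R M by fact
  show ?thesis
  proof (rule submoduleI)
    fix a assume a: "a \<in> Z"
    then have "a \<in> carrier M" using assms(2) by auto
    then show "\<ominus>\<^bsub>M\<^esub> a \<in> Z"
      using assms(5)[of "\<ominus>\<^bsub>R\<^esub> \<one>\<^bsub>R\<^esub>" a] a by (simp add: module_minus_one[OF assms(1)])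
  qed (use assms in auto)
qed

lemma submodule_zero_set: "module R M \<Longrightarrow> submodule {\<zero>\<^bsub>M\<^esub>} R M"
proof -
  assume M: "module R M"
  interpret module R M by fact
  show ?thesis by (rule submoduleI'[OF M]) auto
qed

lemma submodule_kernel:
  assumes "module R M" "module R N" "f \<in> mod_hom R M N"
  shows "submodule (a_kernel M N f) R M"
proof -
  interpret M: module R M by fact
  interpret N: module R N by fact
  show ?thesis
    by (rule submoduleI'[OF assms(1)])
      (auto simp: a_kernel_def' mod_hom_add[OF assms(3)] mod_hom_smult[OF assms(3)] mod_hom_zero[OF assms])
qed

lemma submodule_image:
  assumes "module R M" "module R N" "f \<in> mod_hom R M N" "submodule Z R M"
  shows "submodule (f ` Z) R N"
proof (rule submoduleI'[OF assms(2)])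
  note sub = submodule_subset[OF assms(4)]
  show "f ` Z \<subseteq> carrier N" using mod_hom_closed[OF assms(3)] sub by auto
  show "\<zero>\<^bsub>N\<^esub> \<in> f ` Z"
    using mod_hom_zero[OF assms(1-3)] submodule_zero[OF assms(4)] by (metis imageI)
  fix x y assume "x \<in> f ` Z" "y \<in> f ` Z"
  then show "x \<oplus>\<^bsub>N\<^esub> y \<in> f ` Z"
    by (auto simp: mod_hom_add[OF assms(3), symmetric] sub intro!: imageI submodule_add[OF assms(4)])
next
  note sub = submodule_subset[OF assms(4)]
  fix r x assume "r \<in> carrier R" "x \<in> f ` Z"
  then show "r \<odot>\<^bsub>N\<^esub> x \<in> f ` Z"
    by (auto simp: mod_hom_smult[OF assms(3), symmetric] sub intro!: imageI submodule_smult[OF assms(4)])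
qed

lemma submodule_carrier: "module R M \<Longrightarrow> submodule (carrier M) R M"
  by (rule module.carrier_is_submodule)

lemma submodule_vimage:
  assumes "module R M" "module R N" "f \<in> mod_hom R M N" "submodule V R M" "submodule W R N"
  shows "submodule {a \<in> V. f a \<in> W} R M"
  by (rule submoduleI'[OF assms(1)])
    (auto simp: mod_hom_add[OF assms(3)] mod_hom_smult[OF assms(3)] mod_hom_zero[OF assms(1-3)]
      submodule_subset[OF assms(4)] submodule_zero[OF assms(4)] submodule_add[OF assms(4)]
      submodule_smult[OF assms(4)] submodule_zero[OF assms(5)] submodule_add[OF assms(5)]
      submodule_smult[OF assms(5)])

lemma submodule_sum:
  assumes "module R M" "submodule V R M" "submodule W R M"
  shows "submodule (V <+>\<^bsub>M\<^esub> W) R M"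
proof -
  interpret M: module R M by fact
  note s = submodule_subset[OF assms(2)] submodule_subset[OF assms(3)]
  show ?thesis
  proof (rule submoduleI'[OF assms(1)])
    show "V <+>\<^bsub>M\<^esub> W \<subseteq> carrier M" using s by (auto simp: set_add_def')
    show "\<zero>\<^bsub>M\<^esub> \<in> V <+>\<^bsub>M\<^esub> W"
      using submodule_zero[OF assms(2)] submodule_zero[OF assms(3)] by (force simp: set_add_def')
  next
    fix x y assume "x \<in> V <+>\<^bsub>M\<^esub> W" "y \<in> V <+>\<^bsub>M\<^esub> W"
    then obtain v w v' w' where *: "v \<in> V" "w \<in> W" "v' \<in> V" "w' \<in> W" "x = v \<oplus>\<^bsub>M\<^esub> w" "y = v' \<oplus>\<^bsub>M\<^esub> w'"
      by (auto simp: set_add_def')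
    then have "x \<oplus>\<^bsub>M\<^esub> y = (v \<oplus>\<^bsub>M\<^esub> v') \<oplus>\<^bsub>M\<^esub> (w \<oplus>\<^bsub>M\<^esub> w')"
      using s by (simp add: M.M.a_ac)
    then show "x \<oplus>\<^bsub>M\<^esub> y \<in> V <+>\<^bsub>M\<^esub> W"
      using * submodule_add[OF assms(2)] submodule_add[OF assms(3)] by (force simp: set_add_def')
  next
    fix r x assume "r \<in> carrier R" "x \<in> V <+>\<^bsub>M\<^esub> W"
    then obtain v w where *: "v \<in> V" "w \<in> W" "x = v \<oplus>\<^bsub>M\<^esub> w"
      by (auto simp: set_add_def')
    then have "r \<odot>\<^bsub>M\<^esub> x = (r \<odot>\<^bsub>M\<^esub> v) \<oplus>\<^bsub>M\<^esub> (r \<odot>\<^bsub>M\<^esub> w)"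
      using s \<open>r \<in> carrier R\<close> by (simp add: M.smult_r_distr)
    then show "r \<odot>\<^bsub>M\<^esub> x \<in> V <+>\<^bsub>M\<^esub> W"
      using * submodule_smult[OF assms(2)] submodule_smult[OF assms(3)] \<open>r \<in> carrier R\<close>
      by (force simp: set_add_def')
  qed
qed

lemma mem_set_add: "x \<in> V <+>\<^bsub>M\<^esub> W \<longleftrightarrow> (\<exists>v\<in>V. \<exists>w\<in>W. x = v \<oplus>\<^bsub>M\<^esub> w)"
  by (auto simp: set_add_def')

lemma uminus_restrict:
  assumes "module R M" "submodule Z R M" "x \<in> Z"
  shows "\<ominus>\<^bsub>M\<lparr>carrier := Z\<rparr>\<^esub> x = \<ominus>\<^bsub>M\<^esub> x"
  using module_minus_one[OF module_restrict[OF assms(1,2)], of x] module_minus_one[OF assms(1), of x]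
    submodule_subset[OF assms(2,3)] assms(3) by simp

lemma a_minus_restrict:
  assumes "module R M" "submodule Z R M" "x \<in> Z"
  shows "y \<ominus>\<^bsub>M\<lparr>carrier := Z\<rparr>\<^esub> x = y \<ominus>\<^bsub>M\<^esub> x"
  using uminus_restrict[OF assms] by (simp add: a_minus_def)

lemma submodule_restrict:
  assumes "module R M" "submodule Z R M" "submodule B R M" "B \<subseteq> Z"
  shows "submodule B R (M\<lparr>carrier := Z\<rparr>)"
  by (rule submoduleI'[OF module_restrict[OF assms(1,2)]])
    (use assms in \<open>auto simp: submodule_zero submodule_add submodule_smult\<close>)

section \<open>Subtraction in abelian groups\<close>

context abelian_group
begin

lemma minus_self: "x \<in> carrier G \<Longrightarrow> x \<ominus> x = \<zero>"
  by (simp add: a_minus_def r_neg)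

lemma minus_zero_right: "x \<in> carrier G \<Longrightarrow> x \<ominus> \<zero> = x"
  by (simp add: a_minus_def)

lemma minus_add_self: "\<lbrakk>x \<in> carrier G; y \<in> carrier G\<rbrakk> \<Longrightarrow> (x \<ominus> y) \<oplus> y = x"
  by (simp add: a_minus_def a_assoc l_neg)

lemma add_minus_self: "\<lbrakk>x \<in> carrier G; y \<in> carrier G\<rbrakk> \<Longrightarrow> (x \<oplus> y) \<ominus> y = x"
  by (simp add: a_minus_def a_assoc r_neg)

lemma minus_eq_zero_iff: "\<lbrakk>x \<in> carrier G; y \<in> carrier G\<rbrakk> \<Longrightarrow> x \<ominus> y = \<zero> \<longleftrightarrow> x = y"
  by (metis minus_self minus_add_self l_zero)

lemma minus_telescope: "\<lbrakk>x \<in> carrier G; y \<in> carrier G; z \<in> carrier G\<rbrakk> \<Longrightarrow> (z \<ominus> x) \<oplus> (x \<ominus> y) = z \<ominus> y"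
  by (simp add: a_minus_def a_assoc r_neg1)

lemma minus_swap: "\<lbrakk>x \<in> carrier G; y \<in> carrier G\<rbrakk> \<Longrightarrow> \<ominus> (x \<ominus> y) = y \<ominus> x"
  by (simp add: a_minus_def minus_add a_comm)

lemma eq_minus_iff: "\<lbrakk>x \<in> carrier G; y \<in> carrier G; z \<in> carrier G\<rbrakk> \<Longrightarrow> x = y \<ominus> z \<longleftrightarrow> x \<oplus> z = y"
  by (metis minus_add_self add_minus_self)

lemma minus_minus_minus: "\<lbrakk>x \<in> carrier G; y \<in> carrier G; z \<in> carrier G; w \<in> carrier G\<rbrakk>
    \<Longrightarrow> (x \<ominus> y) \<ominus> (z \<ominus> w) = (x \<ominus> z) \<ominus> (y \<ominus> w)"
  by (simp add: a_minus_def minus_add a_ac)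

end

text \<open>Cohomology, the pages of a filtered complex and the graded pieces of the abutment all
  have the form Z/B inside one ambient module, so computations can stay with representatives in
  \<open>M\<close>.\<close>

locale subquotient = module R M for R :: "('r, 'x) ring_scheme" (structure) and M :: "('r, 'a) module" (structure) +
  fixes Z B :: "'a set"
  assumes Z: "submodule Z R M" and B: "submodule B R M" and BZ: "B \<subseteq> Z"
begin

lemma Z_carrier: "x \<in> Z \<Longrightarrow> x \<in> carrier M" using submodule_subset[OF Z] .
lemma B_carrier: "x \<in> B \<Longrightarrow> x \<in> carrier M" using submodule_subset[OF B] .

lemma module_M: "module R M" by (rule module_axioms)

lemma mem_coset: "x \<in> carrier M \<Longrightarrow> y \<in> B +>\<^bsub>M\<^esub> x \<longleftrightarrow> y \<in> carrier M \<and> y \<ominus>\<^bsub>M\<^esub> x \<in> B"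
proof
  assume "x \<in> carrier M" "y \<in> B +>\<^bsub>M\<^esub> x"
  then obtain b where b: "b \<in> B" "y = b \<oplus>\<^bsub>M\<^esub> x" by (auto simp: a_r_coset_def')
  with \<open>x \<in> carrier M\<close> B_carrier[OF b(1)] show "y \<in> carrier M \<and> y \<ominus>\<^bsub>M\<^esub> x \<in> B"
    by (simp add: a_minus_def M.a_assoc M.r_neg)
next
  assume x: "x \<in> carrier M" "y \<in> carrier M \<and> y \<ominus>\<^bsub>M\<^esub> x \<in> B"
  then have "y = (y \<ominus>\<^bsub>M\<^esub> x) \<oplus>\<^bsub>M\<^esub> x" by (simp add: a_minus_def M.a_assoc M.l_neg)
  with x show "y \<in> B +>\<^bsub>M\<^esub> x" by (auto simp: a_r_coset_def')
qed

lemma coset_eq: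
  assumes "x \<in> carrier M" "y \<in> carrier M"
  shows "B +>\<^bsub>M\<^esub> x = B +>\<^bsub>M\<^esub> y \<longleftrightarrow> x \<ominus>\<^bsub>M\<^esub> y \<in> B"
proof
  assume "B +>\<^bsub>M\<^esub> x = B +>\<^bsub>M\<^esub> y"
  moreover have "x \<in> B +>\<^bsub>M\<^esub> x"
    using mem_coset[OF assms(1), of x] assms submodule_zero[OF B] by (simp add: a_minus_def M.r_neg)
  ultimately show "x \<ominus>\<^bsub>M\<^esub> y \<in> B" using mem_coset[OF assms(2), of x] by simp
next
  assume *: "x \<ominus>\<^bsub>M\<^esub> y \<in> B"
  have "z \<ominus>\<^bsub>M\<^esub> x \<in> B \<longleftrightarrow> z \<ominus>\<^bsub>M\<^esub> y \<in> B" if z: "z \<in> carrier M" for z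
  proof -
    have "z \<ominus>\<^bsub>M\<^esub> y = (z \<ominus>\<^bsub>M\<^esub> x) \<oplus>\<^bsub>M\<^esub> (x \<ominus>\<^bsub>M\<^esub> y)"
      using assms z by (simp add: M.minus_telescope)
    moreover have "z \<ominus>\<^bsub>M\<^esub> x = (z \<ominus>\<^bsub>M\<^esub> y) \<oplus>\<^bsub>M\<^esub> \<ominus>\<^bsub>M\<^esub> (x \<ominus>\<^bsub>M\<^esub> y)"
      using assms z by (simp add: M.minus_telescope M.minus_swap)
    ultimately show ?thesis using submodule_add[OF B] submodule_uminus[OF B *] * by metis
  qed
  then show "B +>\<^bsub>M\<^esub> x = B +>\<^bsub>M\<^esub> y"
    using mem_coset[OF assms(1)] mem_coset[OF assms(2)] by auto
qed

lemma coset_eq_zero: "x \<in> carrier M \<Longrightarrow> B +>\<^bsub>M\<^esub> x = B \<longleftrightarrow> x \<in> B"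
  using coset_eq[of x "\<zero>\<^bsub>M\<^esub>"] M.a_coset_add_zero[of B] B_carrier
  by (simp add: M.minus_zero_right subsetI)

lemma self_coset: "x \<in> carrier M \<Longrightarrow> x \<in> B +>\<^bsub>M\<^esub> x"
  using mem_coset[of x x] submodule_zero[OF B] by (simp add: a_minus_def M.r_neg)

abbreviation "SQ \<equiv> quot_mod (M\<lparr>carrier := Z\<rparr>) B"

lemma coset_restrict: "a_r_coset (M\<lparr>carrier := Z\<rparr>) = a_r_coset M"
  by (intro ext) (simp add: a_r_coset_def')

lemma set_add_restrict: "set_add (M\<lparr>carrier := Z\<rparr>) = set_add M"
  by (intro ext) (simp add: set_add_def')

lemma carrier_SQ: "carrier SQ = (\<lambda>z. B +>\<^bsub>M\<^esub> z) ` Z"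
  by (auto simp: quot_mod_def A_RCOSETS_def' coset_restrict)

lemma zero_SQ: "\<zero>\<^bsub>SQ\<^esub> = B"
  by (simp add: quot_mod_def)

lemma add_coset:
  assumes "x \<in> carrier M" "y \<in> carrier M"
  shows "(B +>\<^bsub>M\<^esub> x) <+>\<^bsub>M\<^esub> (B +>\<^bsub>M\<^esub> y) = B +>\<^bsub>M\<^esub> (x \<oplus>\<^bsub>M\<^esub> y)"
proof -
  have "abelian_subgroup B M"
    using B by (intro abelian_subgroupI3 additive_subgroup.intro)
      (auto intro: submodule.axioms M.abelian_group_axioms)
  then show ?thesis by (rule abelian_subgroup.a_rcos_sum) (fact assms)+
qed

lemma add_SQ:
  assumes "x \<in> Z" "y \<in> Z"
  shows "(B +>\<^bsub>M\<^esub> x) \<oplus>\<^bsub>SQ\<^esub> (B +>\<^bsub>M\<^esub> y) = B +>\<^bsub>M\<^esub> (x \<oplus>\<^bsub>M\<^esub> y)"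
  using add_coset assms Z_carrier by (simp add: quot_mod_def set_add_restrict)

lemma smult_SQ:
  assumes r: "r \<in> carrier R" and x: "x \<in> Z"
  shows "r \<odot>\<^bsub>SQ\<^esub> (B +>\<^bsub>M\<^esub> x) = B +>\<^bsub>M\<^esub> (r \<odot>\<^bsub>M\<^esub> x)"
proof -
  have "B <+>\<^bsub>M\<^esub> (\<lambda>x. r \<odot>\<^bsub>M\<^esub> x) ` (B +>\<^bsub>M\<^esub> x) = B +>\<^bsub>M\<^esub> (r \<odot>\<^bsub>M\<^esub> x)" (is "?L = ?R")
  proof
    show "?L \<subseteq> ?R"
    proof
      fix y assume "y \<in> ?L"
      then obtain b b' where *: "b \<in> B" "b' \<in> B" "y = b \<oplus>\<^bsub>M\<^esub> r \<odot>\<^bsub>M\<^esub> (b' \<oplus>\<^bsub>M\<^esub> x)"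
        by (auto simp: set_add_def' a_r_coset_def')
      then have "y = (b \<oplus>\<^bsub>M\<^esub> r \<odot>\<^bsub>M\<^esub> b') \<oplus>\<^bsub>M\<^esub> r \<odot>\<^bsub>M\<^esub> x"
        using B_carrier Z_carrier r x by (simp add: smult_r_distr M.a_assoc)
      then show "y \<in> ?R"
        using submodule_add[OF B *(1) submodule_smult[OF B r *(2)]] by (auto simp: a_r_coset_def')
    qed
    show "?R \<subseteq> ?L"
      using self_coset[of x] Z_carrier[OF x] by (force simp: set_add_def' a_r_coset_def')
  qed
  then show ?thesis by (simp add: quot_mod_def set_add_restrict)
qed

lemmas SQ_simps = carrier_SQ zero_SQ add_SQ smult_SQ

lemma coset_zero: "B +>\<^bsub>M\<^esub> \<zero>\<^bsub>M\<^esub> = B"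
  using coset_eq_zero[of "\<zero>\<^bsub>M\<^esub>"] submodule_zero[OF B] by simp

lemma module_SQ: "module R SQ"
proof (rule moduleI)
  note cl = Z_carrier submodule_add[OF Z] submodule_smult[OF Z]
  note zz = submodule_zero[OF Z]
  show "abelian_group SQ"
  proof (rule abelian_groupI)
    show "\<zero>\<^bsub>SQ\<^esub> \<in> carrier SQ"
      using zz coset_zero by (auto simp: carrier_SQ zero_SQ intro!: image_eqI)
    fix x assume "x \<in> carrier SQ"
    then obtain z where z: "z \<in> Z" "x = B +>\<^bsub>M\<^esub> z" by (auto simp: carrier_SQ)
    have "(B +>\<^bsub>M\<^esub> \<zero>\<^bsub>M\<^esub>) \<oplus>\<^bsub>SQ\<^esub> (B +>\<^bsub>M\<^esub> z) = B +>\<^bsub>M\<^esub> z"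
      by (subst add_SQ) (auto simp: zz z cl)
    then show "\<zero>\<^bsub>SQ\<^esub> \<oplus>\<^bsub>SQ\<^esub> x = x" by (simp add: zero_SQ coset_zero z)
    have "(B +>\<^bsub>M\<^esub> \<ominus>\<^bsub>M\<^esub> z) \<oplus>\<^bsub>SQ\<^esub> x = \<zero>\<^bsub>SQ\<^esub>"
      by (simp add: z add_SQ submodule_uminus[OF Z] cl M.l_neg zero_SQ coset_zero)
    then show "\<exists>y\<in>carrier SQ. y \<oplus>\<^bsub>SQ\<^esub> x = \<zero>\<^bsub>SQ\<^esub>"
      using submodule_uminus[OF Z z(1)] by (auto simp: carrier_SQ)
  qed (auto simp: carrier_SQ add_SQ cl M.a_ac)
qed (auto simp: carrier_SQ add_SQ smult_SQ submodule_add[OF Z] submodule_smult[OF Z]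
    Z_carrier smult_l_distr smult_r_distr smult_assoc1 R.is_cring)

lemma coset_hom: "(\<lambda>z. B +>\<^bsub>M\<^esub> z) \<in> mod_hom R (M\<lparr>carrier := Z\<rparr>) SQ"
  by (rule mod_homI) (auto simp: SQ_simps)

lemma factor:
  assumes N: "module R N" and g: "g \<in> mod_hom R (M\<lparr>carrier := Z\<rparr>) N" and gB: "\<And>b. b \<in> B \<Longrightarrow> g b = \<zero>\<^bsub>N\<^esub>"
  obtains \<phi> where "\<phi> \<in> mod_hom R SQ N" "\<And>z. z \<in> Z \<Longrightarrow> \<phi> (B +>\<^bsub>M\<^esub> z) = g z"
proof -
  interpret N: module R N by fact
  \<comment> \<open>An arbitrary representative will do: two of them differ by an element of
    \<open>B\<close>, which \<open>g\<close> kills.\<close>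
  define \<phi> where "\<phi> X = g (SOME z. z \<in> X)" for X
  have val: "\<phi> (B +>\<^bsub>M\<^esub> z) = g z" if z: "z \<in> Z" for z
  proof -
    define w where "w = (SOME w. w \<in> B +>\<^bsub>M\<^esub> z)"
    have "w \<in> B +>\<^bsub>M\<^esub> z" unfolding w_def using self_coset[OF Z_carrier[OF z]] by (rule someI)
    then obtain b where b: "b \<in> B" "w = b \<oplus>\<^bsub>M\<^esub> z" by (auto simp: a_r_coset_def')
    have "g w = g b \<oplus>\<^bsub>N\<^esub> g z"
      using mod_hom_add[OF g, of b z] b BZ z by auto
    then show ?thesis
      using gB[OF b(1)] mod_hom_closed[OF g, of z] z by (simp add: \<phi>_def w_def)
  qed
  have "\<phi> \<in> mod_hom R SQ N"
    by (rule mod_homI)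
      (auto simp: SQ_simps val mod_hom_closed[OF g, simplified] mod_hom_add[OF g, simplified]
        mod_hom_smult[OF g, simplified] submodule_add[OF Z] submodule_smult[OF Z])
  then show ?thesis using val that by blast
qed

text \<open>The first isomorphism theorem; injectivity is the kernel condition applied to a
  difference of representatives.\<close>

lemma factor_bij:
  assumes N: "module R N" and g: "g \<in> mod_hom R (M\<lparr>carrier := Z\<rparr>) N"
    and gB: "\<And>z. z \<in> Z \<Longrightarrow> g z = \<zero>\<^bsub>N\<^esub> \<longleftrightarrow> z \<in> B" and surj: "carrier N \<subseteq> g ` Z"
  obtains \<phi> where "\<phi> \<in> mod_hom R SQ N" "bij_betw \<phi> (carrier SQ) (carrier N)"
    "\<And>z. z \<in> Z \<Longrightarrow> \<phi> (B +>\<^bsub>M\<^esub> z) = g z"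
proof -
  interpret N: module R N by fact
  obtain \<phi> where \<phi>: "\<phi> \<in> mod_hom R SQ N" "\<And>z. z \<in> Z \<Longrightarrow> \<phi> (B +>\<^bsub>M\<^esub> z) = g z"
    using factor[OF N g] gB BZ by blast
  have "inj_on \<phi> (carrier SQ)"
  proof (rule inj_onI)
    fix X Y assume "X \<in> carrier SQ" "Y \<in> carrier SQ" and eq: "\<phi> X = \<phi> Y"
    then obtain x y where xy: "x \<in> Z" "y \<in> Z" "X = B +>\<^bsub>M\<^esub> x" "Y = B +>\<^bsub>M\<^esub> y" by (auto simp: carrier_SQ)
    have "g (x \<ominus>\<^bsub>M\<^esub> y) = \<zero>\<^bsub>N\<^esub>"
      using mod_hom_minus[OF module_restrict[OF module_M Z] N g, of x y] eq xy \<phi>(2) mod_hom_closed[OF g, of y]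
      by (simp add: a_minus_restrict[OF module_M Z] N.M.r_neg a_minus_def[of N])
    then show "X = Y" using gB[OF submodule_minus[OF Z xy(1,2)]] coset_eq xy Z_carrier by simp
  qed
  moreover have "\<phi> ` carrier SQ = carrier N"
  proof
    show "\<phi> ` carrier SQ \<subseteq> carrier N" using mod_hom_closed[OF \<phi>(1)] by blast
    show "carrier N \<subseteq> \<phi> ` carrier SQ"
    proof
      fix n assume "n \<in> carrier N"
      then obtain z where "z \<in> Z" "n = g z" using surj by blast
      then show "n \<in> \<phi> ` carrier SQ" using \<phi>(2) by (auto simp: carrier_SQ intro!: image_eqI)
    qed
  qed
  ultimately show ?thesis using \<phi> that by (auto simp: bij_betw_def)
qed

lemma factor_iso:
  assumes "module R N" "g \<in> mod_hom R (M\<lparr>carrier := Z\<rparr>) N"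
    "\<And>z. z \<in> Z \<Longrightarrow> g z = \<zero>\<^bsub>N\<^esub> \<longleftrightarrow> z \<in> B" "carrier N \<subseteq> g ` Z"
  shows "mod_iso R SQ N"
proof -
  obtain \<phi> where "\<phi> \<in> mod_hom R SQ N" "bij_betw \<phi> (carrier SQ) (carrier N)"
    using factor_bij[OF assms(1,2,3,4)] .
  then show ?thesis by (rule mod_isoI)
qed

end

text \<open>The third isomorphism theorem. \<open>C\<close> is only a set of representatives for the
  inner denominator, and the last premise says that \<open>B'\<close> is the intersection of
  \<open>Z'\<close> with C + B. It serves both for the next page of a spectral sequence and for the
  graded pieces of the abutment.\<close>

lemma subquotient_of_subquotient:
  assumes T: "subquotient R M Z B" and S: "subquotient R M Z' B'" and Z': "Z' \<subseteq> Z" and C: "C \<subseteq> carrier M"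
    and K: "subquotient R (quot_mod (M\<lparr>carrier := Z\<rparr>) B) ((\<lambda>z. B +>\<^bsub>M\<^esub> z) ` Z') ((\<lambda>z. B +>\<^bsub>M\<^esub> z) ` C)"
    and B': "\<And>z. z \<in> Z' \<Longrightarrow> z \<in> B' \<longleftrightarrow> (\<exists>c\<in>C. z \<ominus>\<^bsub>M\<^esub> c \<in> B)"
  shows "mod_iso R (quot_mod (M\<lparr>carrier := Z'\<rparr>) B')
    (quot_mod ((quot_mod (M\<lparr>carrier := Z\<rparr>) B)\<lparr>carrier := (\<lambda>z. B +>\<^bsub>M\<^esub> z) ` Z'\<rparr>) ((\<lambda>z. B +>\<^bsub>M\<^esub> z) ` C))"
    (is "mod_iso R _ (quot_mod (?Q\<lparr>carrier := ?\<pi> ` Z'\<rparr>) _)")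
proof -
  interpret T: subquotient R M Z B by fact
  interpret S: subquotient R M Z' B' by fact
  interpret K: subquotient R ?Q "?\<pi> ` Z'" "?\<pi> ` C" by fact
  have hom: "?\<pi> \<in> mod_hom R (M\<lparr>carrier := Z'\<rparr>) (?Q\<lparr>carrier := ?\<pi> ` Z'\<rparr>)"
    by (rule mod_homI) (auto simp: T.add_SQ T.smult_SQ subsetD[OF Z'])
  show ?thesis
  proof (rule S.factor_iso[OF K.module_SQ mod_hom_comp[OF hom K.coset_hom]])
    fix z assume z: "z \<in> Z'"
    have "?\<pi> z \<in> ?\<pi> ` C \<longleftrightarrow> (\<exists>c\<in>C. z \<ominus>\<^bsub>M\<^esub> c \<in> B)"
      unfolding image_iff by (intro bex_cong refl T.coset_eq S.Z_carrier[OF z]) (use C in auto)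
    then show "(?\<pi> ` C) +>\<^bsub>?Q\<^esub> ?\<pi> z = \<zero>\<^bsub>K.SQ\<^esub> \<longleftrightarrow> z \<in> B'"
      using K.coset_eq_zero[OF K.Z_carrier[OF imageI[OF z]]] B'[OF z] by (simp add: K.zero_SQ)
  qed (auto simp: K.carrier_SQ)
qed

lemma mod_hom_restrict:
  assumes "f \<in> mod_hom R M N" "Z \<subseteq> carrier M" "f ` Z \<subseteq> Z'"
  shows "f \<in> mod_hom R (M\<lparr>carrier := Z\<rparr>) (N\<lparr>carrier := Z'\<rparr>)"
  using assms by (auto simp: mod_hom_def subset_iff)

text \<open>\<open>F\<close> has to be onto only up to \<open>B'\<close>, and it has to reflect
  \<open>B'\<close>. This is what a chain map provides that is invertible only up to
  homotopy.\<close>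

lemma subquotient_iso:
  assumes sq: "subquotient R M Z B" and sq': "subquotient R N Z' B'"
    and F: "F \<in> mod_hom R (M\<lparr>carrier := Z\<rparr>) (N\<lparr>carrier := Z'\<rparr>)"
    and FB: "\<And>z. z \<in> Z \<Longrightarrow> F z \<in> B' \<longleftrightarrow> z \<in> B"
    and surj: "\<And>z'. z' \<in> Z' \<Longrightarrow> \<exists>z\<in>Z. F z \<ominus>\<^bsub>N\<^esub> z' \<in> B'"
  obtains \<phi> where "\<phi> \<in> mod_hom R (quot_mod (M\<lparr>carrier := Z\<rparr>) B) (quot_mod (N\<lparr>carrier := Z'\<rparr>) B')"
    "bij_betw \<phi> (carrier (quot_mod (M\<lparr>carrier := Z\<rparr>) B)) (carrier (quot_mod (N\<lparr>carrier := Z'\<rparr>) B'))"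
    "\<And>z. z \<in> Z \<Longrightarrow> \<phi> (B +>\<^bsub>M\<^esub> z) = B' +>\<^bsub>N\<^esub> F z"
proof -
  interpret A: subquotient R M Z B by fact
  interpret A': subquotient R N Z' B' by fact
  have FZ: "F z \<in> Z'" if "z \<in> Z" for z using mod_hom_closed[OF F] that by simp
  show ?thesis
  proof (rule A.factor_bij[OF A'.module_SQ mod_hom_comp[OF F A'.coset_hom]])
    fix z assume "z \<in> Z"
    then show "B' +>\<^bsub>N\<^esub> F z = \<zero>\<^bsub>A'.SQ\<^esub> \<longleftrightarrow> z \<in> B"
      using FB[of z] A'.coset_eq_zero[of "F z"] FZ[of z] A'.Z_carrier by (auto simp: A'.zero_SQ)
  next
    show "carrier A'.SQ \<subseteq> (\<lambda>z. B' +>\<^bsub>N\<^esub> F z) ` Z"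
    proof
      fix X assume "X \<in> carrier A'.SQ"
      then obtain z' where z': "z' \<in> Z'" "X = B' +>\<^bsub>N\<^esub> z'" by (auto simp: A'.carrier_SQ)
      then obtain z where "z \<in> Z" "F z \<ominus>\<^bsub>N\<^esub> z' \<in> B'" using surj by blast
      then show "X \<in> (\<lambda>z. B' +>\<^bsub>N\<^esub> F z) ` Z"
        using A'.coset_eq[of "F z" z'] FZ[of z] A'.Z_carrier z' by auto
    qed
  qed (fact that)
qed

section \<open>Products of modules\<close>

definition prod_mod :: "'i set \<Rightarrow> ('i \<Rightarrow> ('r, 'a) module) \<Rightarrow> ('r, 'i \<Rightarrow> 'a) module" where
  "prod_mod I N = \<lparr>carrier = (\<Pi>\<^sub>E i\<in>I. carrier (N i)), mult = undefined, one = undefined,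
     zero = (\<lambda>i\<in>I. \<zero>\<^bsub>N i\<^esub>), add = (\<lambda>s t. \<lambda>i\<in>I. s i \<oplus>\<^bsub>N i\<^esub> t i), smult = (\<lambda>r t. \<lambda>i\<in>I. r \<odot>\<^bsub>N i\<^esub> t i)\<rparr>"

text \<open>The module axioms are checked here once: cochain modules are such products, and
  \<open>Hom_mod\<close> and direct sums are submodules of them.\<close>

lemma module_prod:
  assumes R: "cring R" and N: "\<And>i. i \<in> I \<Longrightarrow> module R (N i)"
  shows "module R (prod_mod I N)"
proof -
  interpret R: cring R by (rule R)
  have ab: "abelian_group (N i)" if "i \<in> I" for i using N[OF that] by (simp add: module_def)
  have am: "abelian_monoid (N i)" if "i \<in> I" for i using ab[OF that] by (simp add: abelian_group_def)
  note sim = prod_mod_def PiE_iff abelian_monoid.l_zero[OF am] abelian_monoid.a_assoc[OF am]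
    abelian_monoid.a_closed[OF am] abelian_monoid.zero_closed[OF am] module.smult_closed[OF N]
  have "abelian_group (prod_mod I N)"
  proof (rule abelian_groupI)
    fix t assume t: "t \<in> carrier (prod_mod I N)"
    let ?s = "(\<ominus>\<^bsub>R\<^esub> \<one>\<^bsub>R\<^esub>) \<odot>\<^bsub>prod_mod I N\<^esub> t"
    have "?s \<in> carrier (prod_mod I N)" "?s \<oplus>\<^bsub>prod_mod I N\<^esub> t = \<zero>\<^bsub>prod_mod I N\<^esub>"
      using t by (auto simp: sim module_minus_one[OF N, symmetric] abelian_group.l_neg[OF ab] abelian_group.a_inv_closed[OF ab]
          intro!: restrict_ext)
    then show "\<exists>s\<in>carrier (prod_mod I N). s \<oplus>\<^bsub>prod_mod I N\<^esub> t = \<zero>\<^bsub>prod_mod I N\<^esub>" by blast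
    show "\<zero>\<^bsub>prod_mod I N\<^esub> \<oplus>\<^bsub>prod_mod I N\<^esub> t = t"
      using t by (simp add: sim cong: restrict_cong) (simp add: extensional_restrict)
  qed (auto simp: sim intro!: restrict_ext, metis am abelian_monoid.a_comm)
  then show ?thesis
  proof (rule moduleI[OF R])
    fix t assume t: "t \<in> carrier (prod_mod I N)"
    then show "\<one>\<^bsub>R\<^esub> \<odot>\<^bsub>prod_mod I N\<^esub> t = t"
      by (simp add: sim module.smult_one[OF N] cong: restrict_cong) (simp add: extensional_restrict)
  qed (auto simp: sim module.smult_l_distr[OF N] module.smult_r_distr[OF N] module.smult_assoc1[OF N] intro!: restrict_ext)
qed

lemma prod_hom:
  assumes "\<And>a. a \<in> carrier A \<Longrightarrow> f a \<in> S" "S \<subseteq> carrier (prod_mod I N)" "module R A"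
    and "\<And>i. i \<in> I \<Longrightarrow> (\<lambda>a. f a i) \<in> mod_hom R A (N i)"
  shows "f \<in> mod_hom R A (prod_mod I N\<lparr>carrier := S\<rparr>)"
proof -
  interpret A: module R A by fact
  have ext: "f a = (\<lambda>i\<in>I. f a i)" if "a \<in> carrier A" for a
    using assms(1)[OF that] assms(2) by (auto simp: prod_mod_def PiE_iff extensional_restrict)
  show ?thesis
  proof (rule mod_homI)
    fix a assume a: "a \<in> carrier A"
    then show "f a \<in> carrier (prod_mod I N\<lparr>carrier := S\<rparr>)" using assms(1) by simp
    show "f (a \<oplus>\<^bsub>A\<^esub> b) = f a \<oplus>\<^bsub>prod_mod I N\<lparr>carrier := S\<rparr>\<^esub> f b" if b: "b \<in> carrier A" for b
      by (rule trans[OF ext[OF A.M.a_closed[OF a b]]]) (auto simp: prod_mod_def mod_hom_add[OF assms(4) a b] intro!: restrict_ext)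
    show "f (r \<odot>\<^bsub>A\<^esub> a) = r \<odot>\<^bsub>prod_mod I N\<lparr>carrier := S\<rparr>\<^esub> f a" if r: "r \<in> carrier R" for r
      by (rule trans[OF ext[OF A.smult_closed[OF r a]]]) (auto simp: prod_mod_def mod_hom_smult[OF assms(4) r a] intro!: restrict_ext)
  qed
qed

section \<open>The spectral sequence of a filtered complex\<close>

text \<open>Integer indices keep shifts such as p - r free of truncation. The filtration is constant
  up to step 0 and vanishes above the total degree, which makes the spectral sequence first quadrant
  and finite at each spot. In negative degrees \<open>V\<close> is forced to be zero, but
  \<open>A\<close> is not.\<close>

locale filtered_complex =
  fixes R :: "('r, 'x) ring_scheme" and A :: "int \<Rightarrow> ('r, 'a) module" and d :: "int \<Rightarrow> 'a \<Rightarrow> 'a"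
    and V :: "int \<Rightarrow> int \<Rightarrow> 'a set"
  assumes module_A: "module R (A n)"
    and d_hom: "d n \<in> mod_hom R (A n) (A (n + 1))"
    and d_d: "a \<in> carrier (A n) \<Longrightarrow> d (n + 1) (d n a) = \<zero>\<^bsub>A (n + 2)\<^esub>"
    and V_sub: "submodule (V p n) R (A n)"
    and V_Suc: "V (p + 1) n \<subseteq> V p n"
    and d_V: "a \<in> V p n \<Longrightarrow> d n a \<in> V p (n + 1)"
    and V_low: "p \<le> 0 \<Longrightarrow> V p n = V 0 n"
    and V_high: "p > n \<Longrightarrow> V p n = {\<zero>\<^bsub>A n\<^esub>}"
    and V_0: "n \<ge> 0 \<Longrightarrow> V 0 n = carrier (A n)"
begin

lemma V_mono: "p \<le> p' \<Longrightarrow> V p' n \<subseteq> V p n"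
proof (induction "nat (p' - p)" arbitrary: p')
  case (Suc k)
  then have "V (p' - 1) n \<subseteq> V p n" by (intro Suc.hyps(1)) auto
  then show ?case using V_Suc[of "p' - 1" n] by simp
qed simp

lemma V_monoD: "a \<in> V p' n \<Longrightarrow> p \<le> p' \<Longrightarrow> a \<in> V p n"
  using V_mono by blast

lemmas V_closed = submodule_subset[OF V_sub]

lemma d_prev: "d (n - 1) \<in> mod_hom R (A (n - 1)) (A n)"
  using d_hom[of "n - 1"] by simp

lemma d_d_prev: "a \<in> carrier (A (n - 1)) \<Longrightarrow> d n (d (n - 1) a) = \<zero>\<^bsub>A (n + 1)\<^esub>"
  using d_d[of a "n - 1"] by (simp add: algebra_simps)

definition cyc :: "int \<Rightarrow> int \<Rightarrow> int \<Rightarrow> 'a set" where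
  "cyc r p n = {a \<in> V p n. d n a \<in> V (p + r) (n + 1)}"

text \<open>With \<open>cyc r p n\<close> in the role of Z_r^p in total degree n, this is the usual
  denominator Z_{r-1}^{p+1} + d Z_{r-1}^{p-r+1} of E_r^p.\<close>

definition bnd :: "int \<Rightarrow> int \<Rightarrow> int \<Rightarrow> 'a set" where
  "bnd r p n = cyc (r - 1) (p + 1) n <+>\<^bsub>A n\<^esub> d (n - 1) ` cyc (r - 1) (p - r + 1) (n - 1)"

lemma cyc_sub: "submodule (cyc r p n) R (A n)"
  unfolding cyc_def by (rule submodule_vimage[OF module_A module_A d_hom V_sub V_sub])

lemmas cyc_closed = submodule_subset[OF cyc_sub]

lemma bnd_sub: "submodule (bnd r p n) R (A n)"
  unfolding bnd_def
  by (intro submodule_sum module_A cyc_sub submodule_image[OF module_A module_A d_prev])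

text \<open>The parameter \<open>s\<close> is free, since the image is a cocycle and its
  differential, being zero, lies in every filtration step.\<close>

lemma d_mem_cyc: "a \<in> cyc r p n \<Longrightarrow> d n a \<in> cyc s (p + r) (n + 1)"
  using d_d[of a n] submodule_zero[OF V_sub, of "n + 2" "p + r + s"] cyc_closed[of a]
  by (auto simp: cyc_def add.commute)

lemma d_mem_cyc': "a \<in> cyc r p (n - 1) \<Longrightarrow> d (n - 1) a \<in> cyc s (p + r) n"
  using d_mem_cyc[of a r p "n - 1" s] by simp

lemma bndE:
  assumes "a \<in> bnd r p n"
  obtains u v where "u \<in> cyc (r - 1) (p + 1) n" "v \<in> cyc (r - 1) (p - r + 1) (n - 1)"
    "a = u \<oplus>\<^bsub>A n\<^esub> d (n - 1) v"
  using assms by (auto simp: bnd_def mem_set_add)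

lemma bndI:
  "u \<in> cyc (r - 1) (p + 1) n \<Longrightarrow> v \<in> cyc (r - 1) (p - r + 1) (n - 1)
    \<Longrightarrow> u \<oplus>\<^bsub>A n\<^esub> d (n - 1) v \<in> bnd r p n"
  by (auto simp: bnd_def mem_set_add)

lemma bnd_left: "u \<in> cyc (r - 1) (p + 1) n \<Longrightarrow> u \<in> bnd r p n"
proof -
  interpret module R "A n" by (rule module_A)
  assume u: "u \<in> cyc (r - 1) (p + 1) n"
  have "d (n - 1) \<zero>\<^bsub>A (n - 1)\<^esub> = \<zero>\<^bsub>A n\<^esub>"
    using mod_hom_zero[OF module_A module_A d_prev] .
  with bndI[OF u submodule_zero[OF cyc_sub]] show ?thesis
    using cyc_closed[OF u] by simp
qed

lemma bnd_right: "v \<in> cyc (r - 1) (p - r + 1) (n - 1) \<Longrightarrow> d (n - 1) v \<in> bnd r p n"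
proof -
  interpret module R "A n" by (rule module_A)
  assume v: "v \<in> cyc (r - 1) (p - r + 1) (n - 1)"
  show ?thesis
    using bndI[OF submodule_zero[OF cyc_sub] v] mod_hom_closed[OF d_prev cyc_closed[OF v]] by simp
qed

lemma bnd_cyc: "bnd r p n \<subseteq> cyc r p n"
proof
  fix a assume "a \<in> bnd r p n"
  then obtain u v where uv: "u \<in> cyc (r - 1) (p + 1) n" "v \<in> cyc (r - 1) (p - r + 1) (n - 1)"
    "a = u \<oplus>\<^bsub>A n\<^esub> d (n - 1) v" by (rule bndE)
  have "u \<in> cyc r p n" using uv(1) V_Suc by (auto simp: cyc_def)
  moreover have "d (n - 1) v \<in> cyc r p n" using d_mem_cyc'[OF uv(2), of r] by simp
  ultimately show "a \<in> cyc r p n" unfolding uv(3) by (rule submodule_add[OF cyc_sub])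
qed

lemma sq: "subquotient R (A n) (cyc r p n) (bnd r p n)"
  by (intro subquotient.intro subquotient_axioms.intro module_A cyc_sub bnd_sub bnd_cyc)

definition EE :: "nat \<Rightarrow> int \<Rightarrow> int \<Rightarrow> ('r, 'a set) module" where
  "EE r p n = quot_mod (A n\<lparr>carrier := cyc (int r) p n\<rparr>) (bnd (int r) p n)"

definition DD :: "nat \<Rightarrow> int \<Rightarrow> int \<Rightarrow> 'a set \<Rightarrow> 'a set" where
  "DD r p n X = bnd (int r) (p + int r) (n + 1) +>\<^bsub>A (n + 1)\<^esub> d n (SOME z. z \<in> X)"

lemma module_EE: "module R (EE r p n)"
  unfolding EE_def by (rule subquotient.module_SQ[OF sq])

lemma carrier_EE: "carrier (EE r p n) = (\<lambda>z. bnd (int r) p n +>\<^bsub>A n\<^esub> z) ` cyc (int r) p n"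
  unfolding EE_def by (rule subquotient.carrier_SQ[OF sq])

lemma zero_EE: "\<zero>\<^bsub>EE r p n\<^esub> = bnd (int r) p n"
  unfolding EE_def by (rule subquotient.zero_SQ[OF sq])

text \<open>This makes \<open>DD\<close> well defined. The differential kills the second summand of
  an element of \<open>bnd\<close> and turns the first into a second summand at p + r, because p + 1
  = (p + r) - r + 1.\<close>

lemma d_bnd: "b \<in> bnd r p n \<Longrightarrow> d n b \<in> bnd r (p + r) (n + 1)"
proof -
  assume "b \<in> bnd r p n"
  then obtain u v where uv: "u \<in> cyc (r - 1) (p + 1) n" "v \<in> cyc (r - 1) (p - r + 1) (n - 1)"
    "b = u \<oplus>\<^bsub>A n\<^esub> d (n - 1) v" by (rule bndE)
  have v: "d (n - 1) v \<in> carrier (A n)" by (rule mod_hom_closed[OF d_prev cyc_closed[OF uv(2)]])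
  interpret N: module R "A (n + 1)" by (rule module_A)
  have "d n b = d n u"
    using mod_hom_add[OF d_hom cyc_closed[OF uv(1)] v] mod_hom_closed[OF d_hom cyc_closed[OF uv(1)]]
      d_d_prev[OF cyc_closed[OF uv(2)]] by (simp add: uv(3))
  moreover have "d n u \<in> bnd r (p + r) (n + 1)"
    using bnd_right[of u r "p + r" "n + 1"] uv(1) by simp
  ultimately show ?thesis by simp
qed

lemma DD_coset:
  assumes z: "z \<in> cyc (int r) p n"
  shows "DD r p n (bnd (int r) p n +>\<^bsub>A n\<^esub> z) = bnd (int r) (p + int r) (n + 1) +>\<^bsub>A (n + 1)\<^esub> d n z"
proof -
  interpret S: subquotient R "A n" "cyc (int r) p n" "bnd (int r) p n" by (rule sq)
  interpret S': subquotient R "A (n + 1)" "cyc (int r) (p + int r) (n + 1)" "bnd (int r) (p + int r) (n + 1)"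
    by (rule sq)
  define w where "w = (SOME w. w \<in> bnd (int r) p n +>\<^bsub>A n\<^esub> z)"
  have "w \<in> bnd (int r) p n +>\<^bsub>A n\<^esub> z"
    unfolding w_def using S.self_coset[OF S.Z_carrier[OF z]] by (rule someI)
  then have w: "w \<in> carrier (A n)" "w \<ominus>\<^bsub>A n\<^esub> z \<in> bnd (int r) p n"
    using S.mem_coset[OF S.Z_carrier[OF z]] by auto
  have "d n w \<ominus>\<^bsub>A (n + 1)\<^esub> d n z \<in> bnd (int r) (p + int r) (n + 1)"
    using d_bnd[OF w(2)] mod_hom_minus[OF module_A module_A d_hom w(1) S.Z_carrier[OF z]] by simp
  then show ?thesis
    using S'.coset_eq[OF mod_hom_closed[OF d_hom w(1)] mod_hom_closed[OF d_hom S.Z_carrier[OF z]]]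
    by (simp add: DD_def w_def)
qed

lemma DD_hom: "DD r p n \<in> mod_hom R (EE r p n) (EE r (p + int r) (n + 1))"
proof -
  interpret S: subquotient R "A n" "cyc (int r) p n" "bnd (int r) p n" by (rule sq)
  interpret S': subquotient R "A (n + 1)" "cyc (int r) (p + int r) (n + 1)" "bnd (int r) (p + int r) (n + 1)"
    by (rule sq)
  note d = d_mem_cyc
  show ?thesis unfolding EE_def
  proof (rule mod_homI)
    fix X assume "X \<in> carrier S.SQ"
    then obtain x where x: "x \<in> cyc (int r) p n" "X = bnd (int r) p n +>\<^bsub>A n\<^esub> x"
      by (auto simp: S.carrier_SQ)
    then show "DD r p n X \<in> carrier S'.SQ" by (auto simp: DD_coset S'.carrier_SQ d)
    { fix Y assume "Y \<in> carrier S.SQ"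
      then obtain y where y: "y \<in> cyc (int r) p n" "Y = bnd (int r) p n +>\<^bsub>A n\<^esub> y"
        by (auto simp: S.carrier_SQ)
      show "DD r p n (X \<oplus>\<^bsub>S.SQ\<^esub> Y) = DD r p n X \<oplus>\<^bsub>S'.SQ\<^esub> DD r p n Y"
        by (simp add: x y S.add_SQ DD_coset submodule_add[OF cyc_sub] S'.add_SQ d
            mod_hom_add[OF d_hom] cyc_closed[of _ "int r" p n]) }
    { fix k assume k: "k \<in> carrier R"
      show "DD r p n (k \<odot>\<^bsub>S.SQ\<^esub> X) = k \<odot>\<^bsub>S'.SQ\<^esub> DD r p n X"
        by (simp add: x k S.smult_SQ DD_coset submodule_smult[OF cyc_sub] S'.smult_SQ d
            mod_hom_smult[OF d_hom] cyc_closed[of _ "int r" p n]) }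
  qed
qed

lemma DD_DD:
  assumes "X \<in> carrier (EE r p n)"
  shows "DD r (p + int r) (n + 1) (DD r p n X) = \<zero>\<^bsub>EE r (p + 2 * int r) (n + 2)\<^esub>"
proof -
  obtain x where x: "x \<in> cyc (int r) p n" "X = bnd (int r) p n +>\<^bsub>A n\<^esub> x"
    using assms by (auto simp: carrier_EE)
  interpret S: subquotient R "A (n + 2)" "cyc (int r) (p + 2 * int r) (n + 2)" "bnd (int r) (p + 2 * int r) (n + 2)"
    by (rule sq)
  have "DD r (p + int r) (n + 1) (DD r p n X)
      = bnd (int r) (p + int r + int r) (n + 1 + 1) +>\<^bsub>A (n + 1 + 1)\<^esub> \<zero>\<^bsub>A (n + 2)\<^esub>"
    by (simp only: x DD_coset d_mem_cyc d_d cyc_closed[OF x(1)])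
  then show ?thesis using S.coset_zero by (simp add: zero_EE algebra_simps)
qed

text \<open>If d z = u + d v with \<open>u\<close> in filtration step p + r + 1, then z - v has
  differential \<open>u\<close>, so it lies in Z_{r+1}, while \<open>v\<close> lies in the
  denominator. Hence the kernel of \<open>DD\<close> is the image of Z_{r+1}.\<close>

lemma DD_zero_iff:
  assumes z: "z \<in> cyc (int r) p n"
  shows "DD r p n (bnd (int r) p n +>\<^bsub>A n\<^esub> z) = \<zero>\<^bsub>EE r (p + int r) (n + 1)\<^esub>
    \<longleftrightarrow> (\<exists>y\<in>cyc (int r + 1) p n. bnd (int r) p n +>\<^bsub>A n\<^esub> z = bnd (int r) p n +>\<^bsub>A n\<^esub> y)"
proof -
  interpret S: subquotient R "A n" "cyc (int r) p n" "bnd (int r) p n" by (rule sq)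
  interpret S': subquotient R "A (n + 1)" "cyc (int r) (p + int r) (n + 1)" "bnd (int r) (p + int r) (n + 1)"
    by (rule sq)
  note zc = S.Z_carrier[OF z]
  have eq: "DD r p n (bnd (int r) p n +>\<^bsub>A n\<^esub> z) = \<zero>\<^bsub>EE r (p + int r) (n + 1)\<^esub>
      \<longleftrightarrow> d n z \<in> bnd (int r) (p + int r) (n + 1)"
    using S'.coset_eq_zero[OF mod_hom_closed[OF d_hom zc]] by (simp add: DD_coset[OF z] zero_EE)
  show ?thesis unfolding eq
  proof
    assume "d n z \<in> bnd (int r) (p + int r) (n + 1)"
    then obtain u v where uv: "u \<in> cyc (int r - 1) (p + int r + 1) (n + 1)" "v \<in> cyc (int r - 1) (p + 1) n"
      "d n z = u \<oplus>\<^bsub>A (n + 1)\<^esub> d n v" by (rule bndE) simp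
    let ?y = "z \<ominus>\<^bsub>A n\<^esub> v"
    have vc: "v \<in> carrier (A n)" and dv: "d n v \<in> carrier (A (n + 1))"
      using cyc_closed[OF uv(2)] mod_hom_closed[OF d_hom] by auto
    have dy: "d n ?y = u"
      using mod_hom_minus[OF module_A module_A d_hom zc vc] uv(3) cyc_closed[OF uv(1)] dv
      by (simp add: S'.M.add_minus_self)
    have vb: "v \<in> bnd (int r) p n" by (rule bnd_left[OF uv(2)])
    then have "v \<in> cyc (int r) p n" using bnd_cyc by auto
    then have "?y \<in> V p n" using submodule_minus[OF cyc_sub z] by (auto simp: cyc_def)
    moreover have "d n ?y \<in> V (p + (int r + 1)) (n + 1)"
      using uv(1) unfolding dy by (simp add: cyc_def algebra_simps)
    ultimately have "?y \<in> cyc (int r + 1) p n" by (simp add: cyc_def)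
    moreover have "z \<ominus>\<^bsub>A n\<^esub> ?y = v"
      using zc vc by (simp add: a_minus_def S.M.minus_add S.M.r_neg1 flip: S.M.a_assoc) (simp add: S.M.r_neg)
    then have "bnd (int r) p n +>\<^bsub>A n\<^esub> z = bnd (int r) p n +>\<^bsub>A n\<^esub> ?y"
      using S.coset_eq[OF zc, of ?y] zc vc vb by simp
    ultimately show "\<exists>y\<in>cyc (int r + 1) p n. bnd (int r) p n +>\<^bsub>A n\<^esub> z = bnd (int r) p n +>\<^bsub>A n\<^esub> y" by blast
  next
    assume "\<exists>y\<in>cyc (int r + 1) p n. bnd (int r) p n +>\<^bsub>A n\<^esub> z = bnd (int r) p n +>\<^bsub>A n\<^esub> y"
    then obtain y where y: "y \<in> cyc (int r + 1) p n"
      "bnd (int r) p n +>\<^bsub>A n\<^esub> z = bnd (int r) p n +>\<^bsub>A n\<^esub> y" by blast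
    have yc: "y \<in> carrier (A n)" using cyc_closed[OF y(1)] .
    have "d n y \<in> cyc (int r - 1) (p + int r + 1) (n + 1)"
      using d_mem_cyc[OF y(1), of "int r - 1"] by (simp add: algebra_simps)
    then have "d n y \<in> bnd (int r) (p + int r) (n + 1)" by (rule bnd_left)
    moreover have "d n (z \<ominus>\<^bsub>A n\<^esub> y) \<in> bnd (int r) (p + int r) (n + 1)"
      using d_bnd S.coset_eq[OF zc yc] y(2) by blast
    ultimately have "d n (z \<ominus>\<^bsub>A n\<^esub> y) \<oplus>\<^bsub>A (n + 1)\<^esub> d n y \<in> bnd (int r) (p + int r) (n + 1)"
      using submodule_add[OF bnd_sub] by blast
    then show "d n z \<in> bnd (int r) (p + int r) (n + 1)"
      using mod_hom_add[OF d_hom, of "z \<ominus>\<^bsub>A n\<^esub> y" n y] zc yc by (simp add: S.M.minus_add_self)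
  qed
qed

text \<open>Kernel and image of \<open>DD\<close> are the images of Z_{r+1}^p and of d Z_r^{p-r} in
  E_r. What remains for the third isomorphism theorem is that the denominator of E_{r+1} is the part
  of Z_{r+1}^p lying in d Z_r^{p-r} plus the denominator of E_r.\<close>

lemma EE_Suc:
  "mod_iso R (EE (Suc r) p n)
    (quot_mod (EE r p n\<lparr>carrier := a_kernel (EE r p n) (EE r (p + int r) (n + 1)) (DD r p n)\<rparr>)
      (DD r (p - int r) (n - 1) ` carrier (EE r (p - int r) (n - 1))))"
proof -
  let ?K = "a_kernel (EE r p n) (EE r (p + int r) (n + 1)) (DD r p n)"
  let ?I = "DD r (p - int r) (n - 1) ` carrier (EE r (p - int r) (n - 1))"
  let ?B = "bnd (int r) p n"
  have h: "DD r (p - int r) (n - 1) \<in> mod_hom R (EE r (p - int r) (n - 1)) (EE r p n)"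
    using DD_hom[of r "p - int r" "n - 1"] by simp
  have KI: "subquotient R (EE r p n) ?K ?I"
  proof (intro subquotient.intro subquotient_axioms.intro module_EE)
    show "submodule ?K R (EE r p n)" by (rule submodule_kernel[OF module_EE module_EE DD_hom])
    show "submodule ?I R (EE r p n)"
      by (rule submodule_image[OF module_EE module_EE h submodule_carrier[OF module_EE]])
    show "?I \<subseteq> ?K"
      using DD_DD[of _ r "p - int r" "n - 1"] mod_hom_closed[OF h]
      by (auto simp: a_kernel_def' algebra_simps)
  qed
  interpret S: subquotient R "A n" "cyc (int (Suc r)) p n" "bnd (int (Suc r)) p n" by (rule sq)
  interpret T: subquotient R "A n" "cyc (int r) p n" ?B by (rule sq)
  have cyc': "z \<in> cyc (int r) p n" if "z \<in> cyc (int (Suc r)) p n" for z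
    using that V_monoD[of _ "p + int (Suc r)" "n + 1" "p + int r"] by (auto simp: cyc_def)
  let ?C = "d (n - 1) ` cyc (int r) (p - int r) (n - 1)" and ?\<pi> = "\<lambda>z. ?B +>\<^bsub>A n\<^esub> z"
  have K: "?K = ?\<pi> ` cyc (int (Suc r)) p n"
  proof
    show "?K \<subseteq> ?\<pi> ` cyc (int (Suc r)) p n"
    proof
      fix Y assume Y: "Y \<in> ?K"
      then obtain z where "z \<in> cyc (int r) p n" "Y = ?\<pi> z" by (auto simp: a_kernel_def' carrier_EE)
      with Y show "Y \<in> ?\<pi> ` cyc (int (Suc r)) p n"
        using DD_zero_iff[of z r p n] by (auto simp: a_kernel_def' add.commute)
    qed
    show "?\<pi> ` cyc (int (Suc r)) p n \<subseteq> ?K"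
      using DD_zero_iff[OF cyc'] cyc' by (auto simp: a_kernel_def' carrier_EE add.commute)
  qed
  have I: "?I = ?\<pi> ` ?C" using DD_coset[of _ r "p - int r" "n - 1"] by (auto simp: carrier_EE image_image)
  have "mod_iso R S.SQ (quot_mod (T.SQ\<lparr>carrier := ?\<pi> ` cyc (int (Suc r)) p n\<rparr>) (?\<pi> ` ?C))"
  proof (rule subquotient_of_subquotient[OF sq sq _ _ KI[unfolded K I, unfolded EE_def]])
    show "?C \<subseteq> carrier (A n)" using mod_hom_closed[OF d_prev cyc_closed] by blast
    fix z assume z: "z \<in> cyc (int (Suc r)) p n"
    then have zc: "z \<in> carrier (A n)" using cyc_closed by blast
    show "z \<in> bnd (int (Suc r)) p n \<longleftrightarrow> (\<exists>c\<in>?C. z \<ominus>\<^bsub>A n\<^esub> c \<in> ?B)"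
      unfolding bex_simps
    proof
      assume "\<exists>b\<in>cyc (int r) (p - int r) (n - 1). z \<ominus>\<^bsub>A n\<^esub> d (n - 1) b \<in> ?B"
      then obtain b where b: "b \<in> cyc (int r) (p - int r) (n - 1)" "z \<ominus>\<^bsub>A n\<^esub> d (n - 1) b \<in> ?B" by blast
      obtain u v where uv: "u \<in> cyc (int r - 1) (p + 1) n" "v \<in> cyc (int r - 1) (p - int r + 1) (n - 1)"
        "z \<ominus>\<^bsub>A n\<^esub> d (n - 1) b = u \<oplus>\<^bsub>A n\<^esub> d (n - 1) v" using b(2) by (rule bndE)
      have v: "v \<in> cyc (int r) (p - int r) (n - 1)"
        using uv(2) V_monoD[of v "p - int r + 1" "n - 1" "p - int r"] by (simp add: cyc_def)
      \<comment> \<open>The old second summand \<open>v\<close> lies in Z_r^{p-r} too, so it is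
        absorbed into \<open>b\<close>; then d u = d z shows that \<open>u\<close> has the depth
        required on the next page.\<close>
      let ?w = "b \<oplus>\<^bsub>A (n - 1)\<^esub> v"
      have w: "?w \<in> cyc (int r) (p - int r) (n - 1)" using submodule_add[OF cyc_sub b(1) v] .
      have c: "d (n - 1) b \<in> carrier (A n)" "d (n - 1) v \<in> carrier (A n)" "u \<in> carrier (A n)"
        using mod_hom_closed[OF d_prev cyc_closed[OF b(1)]] mod_hom_closed[OF d_prev cyc_closed[OF v]]
          cyc_closed[OF uv(1)] by auto
      have "z = (z \<ominus>\<^bsub>A n\<^esub> d (n - 1) b) \<oplus>\<^bsub>A n\<^esub> d (n - 1) b" using zc c by (simp add: S.M.minus_add_self)
      also have "\<dots> = u \<oplus>\<^bsub>A n\<^esub> d (n - 1) ?w"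
        unfolding uv(3) using c mod_hom_add[OF d_prev cyc_closed[OF b(1)] cyc_closed[OF v]]
        by (simp add: S.M.a_ac)
      finally have zu: "z = u \<oplus>\<^bsub>A n\<^esub> d (n - 1) ?w" .
      have wc: "d (n - 1) ?w \<in> carrier (A n)" "d n (d (n - 1) ?w) = \<zero>\<^bsub>A (n + 1)\<^esub>"
        using mod_hom_closed[OF d_prev cyc_closed[OF w]] d_d_prev[OF cyc_closed[OF w]] by auto
      interpret N: module R "A (n + 1)" by (rule module_A)
      have "d n u = d n z"
        using mod_hom_add[OF d_hom c(3) wc(1)] wc(2) mod_hom_closed[OF d_hom c(3)] by (simp add: zu)
      then have "u \<in> cyc (int r) (p + 1) n"
        using uv(1) z by (simp add: cyc_def algebra_simps)
      then show "z \<in> bnd (int (Suc r)) p n"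
        unfolding zu using w by (intro bndI) simp_all
    next
      assume "z \<in> bnd (int (Suc r)) p n"
      then obtain u v where uv: "u \<in> cyc (int r) (p + 1) n" "v \<in> cyc (int r) (p - int r) (n - 1)"
        "z = u \<oplus>\<^bsub>A n\<^esub> d (n - 1) v" by (rule bndE) simp
      have "u \<in> cyc (int r - 1) (p + 1) n"
        using uv(1) V_monoD[of _ "p + 1 + int r" "n + 1" "p + 1 + (int r - 1)"] by (auto simp: cyc_def)
      then have "u \<in> ?B" by (rule bnd_left)
      moreover have "z \<ominus>\<^bsub>A n\<^esub> d (n - 1) v = u"
        unfolding uv(3) using cyc_closed[OF uv(1)] mod_hom_closed[OF d_prev cyc_closed[OF uv(2)]]
        by (rule S.M.add_minus_self)
      ultimately show "\<exists>b\<in>cyc (int r) (p - int r) (n - 1). z \<ominus>\<^bsub>A n\<^esub> d (n - 1) b \<in> ?B"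
        using uv(2) by metis
    qed
  qed (use cyc' in blast)
  then show ?thesis unfolding K I unfolding EE_def .
qed

section \<open>Bidegrees and the first quadrant\<close>

definition E where "E r p q = EE r p (p + q)"
definition D where "D r p q = DD r p (p + q)"

text \<open>For p < 0 the filtration does not change from p to p + 1, so all of Z_r^p is already in
  the first summand of the denominator; for n < p, that is q < 0, the filtration step itself is
  zero.\<close>

lemma EE_trivial:
  assumes "p < 0 \<or> n < p"
  shows "carrier (EE r p n) = {\<zero>\<^bsub>EE r p n\<^esub>}"
proof -
  interpret S: subquotient R "A n" "cyc (int r) p n" "bnd (int r) p n" by (rule sq)
  have "cyc (int r) p n \<subseteq> bnd (int r) p n"
  proof
    fix z assume z: "z \<in> cyc (int r) p n"
    show "z \<in> bnd (int r) p n"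
    proof (cases "p < 0")
      case True
      then have "V p n = V (p + 1) n" using V_low[of p n] V_low[of "p + 1" n] by simp
      then have "z \<in> cyc (int r - 1) (p + 1) n" using z by (simp add: cyc_def)
      then show ?thesis by (rule bnd_left)
    next
      case False
      then have "z = \<zero>\<^bsub>A n\<^esub>" using z assms V_high[of n p] by (auto simp: cyc_def)
      then show ?thesis using submodule_zero[OF bnd_sub] by simp
    qed
  qed
  then have "\<And>z. z \<in> cyc (int r) p n \<Longrightarrow> bnd (int r) p n +>\<^bsub>A n\<^esub> z = bnd (int r) p n"
    using S.coset_eq_zero[OF S.Z_carrier] by blast
  then show ?thesis
    using submodule_zero[OF cyc_sub, of n "int r" p] by (force simp: carrier_EE zero_EE)
qed

theorem first_quadrant: "first_quadrant_ss R E D"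
  unfolding first_quadrant_ss_def
proof (intro allI impI conjI ballI)
  fix r p q
  have i1: "p + int r + (q - int r + 1) = p + q + 1" and i2: "p - int r + (q + int r - 1) = p + q - 1"
    and i3: "p + 2 * int r + (q - 2 * int r + 2) = p + q + 2" by simp_all
  show "module R (E r p q)" by (simp add: E_def module_EE)
  show "carrier (E r p q) = {\<zero>\<^bsub>E r p q\<^esub>}" if "p < 0 \<or> q < 0"
    using that unfolding E_def by (intro EE_trivial) auto
  show "D r p q \<in> mod_hom R (E r p q) (E r (p + int r) (q - int r + 1))"
    unfolding E_def D_def i1 by (rule DD_hom)
  show "D r (p + int r) (q - int r + 1) (D r p q x) = \<zero>\<^bsub>E r (p + 2 * int r) (q - 2 * int r + 2)\<^esub>"
    if "x \<in> carrier (E r p q)" for x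
    using DD_DD that unfolding E_def D_def i1 i3 by blast
  show "mod_iso R (E (Suc r) p q)
       (quot_mod
         (E r p q\<lparr>carrier := a_kernel (E r p q) (E r (p + int r) (q - int r + 1)) (D r p q)\<rparr>)
         (D r (p - int r) (q + int r - 1) ` carrier (E r (p - int r) (q + int r - 1))))"
    unfolding E_def D_def i1 i2 by (rule EE_Suc)
qed

section \<open>The abutment and its filtration\<close>

definition HH :: "int \<Rightarrow> ('r, 'a set) module" where
  "HH n = quot_mod (A n\<lparr>carrier := a_kernel (A n) (A (n + 1)) (d n)\<rparr>) (d (n - 1) ` V 0 (n - 1))"

text \<open>The coboundaries come from \<open>V 0 (n - 1)\<close>: this is all of
  \<open>A (n - 1)\<close> for positive n, but zero for n = 0, where \<open>A (- 1)\<close> may be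
  nonzero.\<close>

lemma sq_HH: "subquotient R (A n) (a_kernel (A n) (A (n + 1)) (d n)) (d (n - 1) ` V 0 (n - 1))"
proof (intro subquotient.intro subquotient_axioms.intro module_A)
  show "submodule (a_kernel (A n) (A (n + 1)) (d n)) R (A n)"
    by (rule submodule_kernel[OF module_A module_A d_hom])
  show "submodule (d (n - 1) ` V 0 (n - 1)) R (A n)"
    by (rule submodule_image[OF module_A module_A d_prev V_sub])
  show "d (n - 1) ` V 0 (n - 1) \<subseteq> a_kernel (A n) (A (n + 1)) (d n)"
    using d_d_prev[OF V_closed] mod_hom_closed[OF d_prev V_closed] by (auto simp: a_kernel_def')
qed

lemma converges: "converges_to R E (\<lambda>n. HH (int n))"
proof -
  let ?K = "\<lambda>n. a_kernel (A n) (A (n + 1)) (d n)" and ?B = "\<lambda>n. d (n - 1) ` V 0 (n - 1)"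
  define F where "F p n = (\<lambda>z. ?B n +>\<^bsub>A n\<^esub> z) ` (V p n \<inter> ?K n)" for p n
  have Fsub: "submodule (F p n) R (HH n)" for p n
  proof -
    interpret S: subquotient R "A n" "?K n" "?B n" by (rule sq_HH)
    have "submodule (V p n \<inter> ?K n) R (A n)"
      using submodule_vimage[OF module_A module_A d_hom V_sub submodule_zero_set[OF module_A]]
      by (rule back_subst[of "\<lambda>X. submodule X R (A n)"]) (auto simp: a_kernel_def' V_closed)
    then have "submodule (V p n \<inter> ?K n) R (A n\<lparr>carrier := ?K n\<rparr>)"
      by (rule submodule_restrict[OF module_A S.Z]) auto
    then show ?thesis
      unfolding F_def HH_def
      by (rule submodule_image[OF module_restrict[OF module_A S.Z] S.module_SQ S.coset_hom])
  qed
  have Fdec: "F (p + 1) n \<subseteq> F p n" for p n using V_Suc by (auto simp: F_def)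
  \<comment> \<open>The first bound puts the sources of incoming differentials at step 0 or lower,
    so they are all of \<open>V 0 (n - 1)\<close>; the second puts the targets of outgoing ones
    above the total degree, so they are zero. With n = p + q these are the bounds in
    \<open>converges_to\<close>.\<close>
  have main: "mod_iso R (EE r p n) (quot_mod (HH n\<lparr>carrier := F p n\<rparr>) (F (p + 1) n))"
    if "p < int r" "n - p + 1 < int r" for r p n
  proof -
    interpret S: subquotient R "A n" "cyc (int r) p n" "bnd (int r) p n" by (rule sq)
    interpret H: subquotient R "A n" "?K n" "?B n" by (rule sq_HH)
    have cyc: "cyc (int r) p n = V p n \<inter> ?K n"
      using that V_high[of "n + 1" "p + int r"] V_closed by (auto simp: cyc_def a_kernel_def')
    have cyc': "cyc (int r - 1) (p + 1) n = V (p + 1) n \<inter> ?K n"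
      using that V_high[of "n + 1" "p + int r"] V_closed by (auto simp: cyc_def a_kernel_def')
    have "mod_iso R S.SQ (quot_mod (H.SQ\<lparr>carrier := (\<lambda>z. ?B n +>\<^bsub>A n\<^esub> z) ` cyc (int r) p n\<rparr>)
        ((\<lambda>z. ?B n +>\<^bsub>A n\<^esub> z) ` (V (p + 1) n \<inter> ?K n)))"
    proof (rule subquotient_of_subquotient[OF sq_HH sq])
      show "subquotient R H.SQ ((\<lambda>z. ?B n +>\<^bsub>A n\<^esub> z) ` cyc (int r) p n) ((\<lambda>z. ?B n +>\<^bsub>A n\<^esub> z) ` (V (p + 1) n \<inter> ?K n))"
        using Fsub[of p] Fsub[of "p + 1"] Fdec H.module_SQ unfolding cyc F_def HH_def
        by (intro subquotient.intro subquotient_axioms.intro)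
      fix z assume z: "z \<in> cyc (int r) p n"
      then have zc: "z \<in> carrier (A n)" using cyc_closed by blast
      show "z \<in> bnd (int r) p n \<longleftrightarrow> (\<exists>y\<in>V (p + 1) n \<inter> ?K n. z \<ominus>\<^bsub>A n\<^esub> y \<in> ?B n)"
      proof
        assume "\<exists>y\<in>V (p + 1) n \<inter> ?K n. z \<ominus>\<^bsub>A n\<^esub> y \<in> ?B n"
        then obtain y b where *: "y \<in> V (p + 1) n" "y \<in> ?K n" "b \<in> V 0 (n - 1)" "z \<ominus>\<^bsub>A n\<^esub> y = d (n - 1) b"
          by auto
        have "y \<in> cyc (int r - 1) (p + 1) n" using * by (simp add: cyc')
        moreover have "b \<in> cyc (int r - 1) (p - int r + 1) (n - 1)"
        proof -
          have "y \<in> V p n" using *(1) V_Suc by auto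
          then have "d (n - 1) b \<in> V p n"
            using z *(4) submodule_minus[OF V_sub, of z p n y] by (simp add: cyc)
          then show ?thesis using *(3) V_low[of "p - int r + 1" "n - 1"] that by (simp add: cyc_def)
        qed
        moreover have "z = y \<oplus>\<^bsub>A n\<^esub> d (n - 1) b"
        proof -
          have yc: "y \<in> carrier (A n)" using V_closed[OF *(1)] .
          show ?thesis using S.M.minus_add_self[OF zc yc] *(4) zc yc
            by (metis S.M.a_comm S.M.minus_closed)
        qed
        ultimately show "z \<in> bnd (int r) p n" using bndI by blast
      next
        assume "z \<in> bnd (int r) p n"
        then obtain u v where uv: "u \<in> cyc (int r - 1) (p + 1) n" "v \<in> cyc (int r - 1) (p - int r + 1) (n - 1)"
          "z = u \<oplus>\<^bsub>A n\<^esub> d (n - 1) v" by (rule bndE)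
        have "z \<ominus>\<^bsub>A n\<^esub> u = d (n - 1) v"
          using uv(3) cyc_closed[OF uv(1)] mod_hom_closed[OF d_prev cyc_closed[OF uv(2)]]
          by (metis S.M.a_comm S.M.add_minus_self)
        moreover have "v \<in> V 0 (n - 1)"
          using uv(2) V_low[of "p - int r + 1" "n - 1"] that by (simp add: cyc_def)
        ultimately show "\<exists>y\<in>V (p + 1) n \<inter> ?K n. z \<ominus>\<^bsub>A n\<^esub> y \<in> ?B n"
          using uv(1) cyc' by auto
      qed
    qed (use V_closed cyc in auto)
    then show ?thesis unfolding EE_def HH_def F_def cyc .
  qed
  show ?thesis unfolding converges_to_def
  proof (intro exI[of _ "\<lambda>p n. F (int p) (int n)"] conjI allI impI)
    fix n
    interpret H: subquotient R "A (int n)" "?K (int n)" "?B (int n)" by (rule sq_HH)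
    show "F (int 0) (int n) = carrier (HH (int n))"
      using V_0[of "int n"] H.Z_carrier unfolding F_def HH_def H.carrier_SQ by auto
    have "?B (int n) +>\<^bsub>A (int n)\<^esub> \<zero>\<^bsub>A (int n)\<^esub> = ?B (int n)" by (rule H.coset_zero)
    moreover have "V (int (Suc n)) (int n) \<inter> ?K (int n) = {\<zero>\<^bsub>A (int n)\<^esub>}"
      using V_high[of "int n" "int (Suc n)"] submodule_zero[OF H.Z] by auto
    ultimately show "F (int (Suc n)) (int n) = {\<zero>\<^bsub>HH (int n)\<^esub>}"
      by (simp add: F_def HH_def H.zero_SQ)
  next
    fix p n show "submodule (F (int p) (int n)) R (HH (int n))" by (rule Fsub)
    show "F (int (Suc p)) (int n) \<subseteq> F (int p) (int n)" using Fdec[of "int p"] by (simp add: add.commute)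
  next
    fix p q r :: nat assume "2 \<le> r \<and> max p (q + 1) < r"
    then show "mod_iso R (E r (int p) (int q)) (quot_mod (HH (int (p + q))\<lparr>carrier := F (int p) (int (p + q))\<rparr>)
        (F (int (Suc p)) (int (p + q))))"
      using main[of "int p" r "int (p + q)"] by (simp add: E_def add.commute)
  qed
qed

end

subsection \<open>Transport along isomorphisms\<close>

definition transport_mod :: "('r, 'a) module \<Rightarrow> ('a \<Rightarrow> 'b) \<Rightarrow> ('r, 'b) module" where
  "transport_mod M j = (let i = inv_into (carrier M) j in
     \<lparr>carrier = j ` carrier M, mult = undefined, one = undefined, zero = j \<zero>\<^bsub>M\<^esub>,
      add = (\<lambda>x y. j (i x \<oplus>\<^bsub>M\<^esub> i y)), smult = (\<lambda>r x. j (r \<odot>\<^bsub>M\<^esub> i x))\<rparr>)"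

context
  fixes R :: "('r, 'x) ring_scheme" and M :: "('r, 'a) module" and j :: "'a \<Rightarrow> 'b"
  assumes M: "module R M" and j: "inj_on j (carrier M)"
begin

interpretation module R M by (rule M)

lemma carrier_transport: "carrier (transport_mod M j) = j ` carrier M"
  by (simp add: transport_mod_def Let_def)

lemma transport_hom: "j \<in> mod_hom R M (transport_mod M j)"
  by (rule mod_homI) (auto simp: transport_mod_def Let_def inv_into_f_f[OF j])

lemma transport_bij: "bij_betw j (carrier M) (carrier (transport_mod M j))"
  by (simp add: bij_betw_def carrier_transport j)

lemma module_transport: "module R (transport_mod M j)"
proof -
  note f = inv_into_f_f[OF j]
  have "abelian_group (transport_mod M j)"
  proof (rule abelian_groupI)
    fix x assume "x \<in> carrier (transport_mod M j)"
    then obtain y where y: "y \<in> carrier M" "x = j y" by (auto simp: carrier_transport)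
    then have "j (\<ominus>\<^bsub>M\<^esub> y) \<in> carrier (transport_mod M j) \<and>
        j (\<ominus>\<^bsub>M\<^esub> y) \<oplus>\<^bsub>transport_mod M j\<^esub> x = \<zero>\<^bsub>transport_mod M j\<^esub>"
      by (auto simp: transport_mod_def Let_def f M.l_neg)
    then show "\<exists>y\<in>carrier (transport_mod M j). y \<oplus>\<^bsub>transport_mod M j\<^esub> x = \<zero>\<^bsub>transport_mod M j\<^esub>"
      by blast
  qed (auto simp: transport_mod_def Let_def f M.a_ac)
  then show ?thesis
    by (rule moduleI[OF R.is_cring])
      (auto simp: transport_mod_def Let_def f smult_l_distr smult_r_distr smult_assoc1)
qed

end

lemma zero_mod_iso:
  assumes "module R M" "module R N" "f \<in> mod_hom R M N" "inj_on f (carrier M)" "x \<in> carrier M"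
  shows "f x = \<zero>\<^bsub>N\<^esub> \<longleftrightarrow> x = \<zero>\<^bsub>M\<^esub>"
proof -
  interpret M: module R M by fact
  show ?thesis using mod_hom_zero[OF assms(1-3)] inj_onD[OF assms(4), of x "\<zero>\<^bsub>M\<^esub>"] assms(5) by auto
qed

lemma subquotient_image:
  assumes sq: "subquotient R M Z B" and N: "module R N" and f: "f \<in> mod_hom R M N"
    and inj: "inj_on f (carrier M)"
  shows "subquotient R N (f ` Z) (f ` B)"
    and "mod_iso R (quot_mod (M\<lparr>carrier := Z\<rparr>) B) (quot_mod (N\<lparr>carrier := f ` Z\<rparr>) (f ` B))"
proof -
  interpret S: subquotient R M Z B by fact
  interpret N: module R N by fact
  show sq': "subquotient R N (f ` Z) (f ` B)"
    using S.BZ by (intro subquotient.intro subquotient_axioms.intro submodule_image[OF S.module_M N f]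
      S.Z S.B N) auto
  interpret S': subquotient R N "f ` Z" "f ` B" by fact
  have F: "f \<in> mod_hom R (M\<lparr>carrier := Z\<rparr>) (N\<lparr>carrier := f ` Z\<rparr>)"
    using S.Z_carrier by (intro mod_hom_restrict[OF f]) auto
  obtain \<phi> where "\<phi> \<in> mod_hom R S.SQ S'.SQ" "bij_betw \<phi> (carrier S.SQ) (carrier S'.SQ)"
  proof (rule subquotient_iso[OF sq sq' F])
    show "f z \<in> f ` B \<longleftrightarrow> z \<in> B" if "z \<in> Z" for z
      using inj_on_image_mem_iff[OF inj S.Z_carrier[OF that], of B] S.B_carrier by auto
    show "\<exists>z\<in>Z. f z \<ominus>\<^bsub>N\<^esub> z' \<in> f ` B" if "z' \<in> f ` Z" for z'
      using that submodule_zero[OF S'.B] S'.Z_carrier by (force simp: N.M.minus_self)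
  qed
  then show "mod_iso R S.SQ S'.SQ" by (rule mod_isoI)
qed

text \<open>Reindexing: the definition states d d = 0 for the differential leaving (p, q), and here
  it is needed for the one arriving there.\<close>

lemma first_quadrant_ss_subquotient:
  assumes ss: "first_quadrant_ss R E d" and r: "2 \<le> r"
  shows "subquotient R (E r p q) (a_kernel (E r p q) (E r (p + int r) (q - int r + 1)) (d r p q))
    (d r (p - int r) (q + int r - 1) ` carrier (E r (p - int r) (q + int r - 1)))"
    (is "subquotient R _ ?Z (d r ?p ?q ` _)")
proof -
  note ss' = ss[unfolded first_quadrant_ss_def, rule_format, OF r]
  have mod: "module R (E r p q)" for p q using ss' by blast
  have dh: "d r p q \<in> mod_hom R (E r p q) (E r (p + int r) (q - int r + 1))" for p q using ss' by blast
  have idx: "?p + int r = p" "?q - int r + 1 = q" by simp_all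
  have dh': "d r ?p ?q \<in> mod_hom R (E r ?p ?q) (E r p q)" using dh[of ?p ?q] by (simp only: idx)
  have "d r p q (d r ?p ?q y) = \<zero>\<^bsub>E r (p + int r) (q - int r + 1)\<^esub>" if "y \<in> carrier (E r ?p ?q)" for y
  proof -
    have "d r (?p + int r) (?q - int r + 1) (d r ?p ?q y)
        = \<zero>\<^bsub>E r (?p + 2 * int r) (?q - 2 * int r + 2)\<^esub>" using ss' that by blast
    moreover have "?p + 2 * int r = p + int r" "?q - 2 * int r + 2 = q - int r + 1" by simp_all
    ultimately show ?thesis by (simp only: idx)
  qed
  then show ?thesis
    using mod_hom_closed[OF dh'] submodule_kernel[OF mod mod dh, of p q]
      submodule_image[OF mod mod dh' submodule_carrier[OF mod]]
    by (intro subquotient.intro subquotient_axioms.intro mod) (auto simp: a_kernel_def')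
qed

lemma first_quadrant_ss_transport:
  assumes ss: "first_quadrant_ss R E d"
    and J: "\<And>r p q. 2 \<le> r \<Longrightarrow> inj_on (J r p q) (carrier (E r p q))"
  shows "first_quadrant_ss R (\<lambda>r p q. transport_mod (E r p q) (J r p q))
    (\<lambda>r p q y. J r (p + int r) (q - int r + 1) (d r p q (inv_into (carrier (E r p q)) (J r p q) y)))"
    (is "first_quadrant_ss R ?E ?d")
  unfolding first_quadrant_ss_def
proof (intro allI impI conjI ballI)
  fix r :: nat and p q :: int assume r: "2 \<le> r"
  note ss' = ss[unfolded first_quadrant_ss_def, rule_format, OF r]
  have mod: "module R (E r p q)" for p q using ss' by blast
  have dh: "d r p q \<in> mod_hom R (E r p q) (E r (p + int r) (q - int r + 1))" for p q using ss' by blast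
  note jm = module_transport[OF mod J[OF r]] and jh = transport_hom[OF mod J[OF r]]
    and jc = carrier_transport[OF mod J[OF r]]
  have ji: "inv_into (carrier (E r p q)) (J r p q) (J r p q x) = x" if "x \<in> carrier (E r p q)" for p q x
    by (rule inv_into_f_f[OF J[OF r] that])
  show "module R (?E r p q)" by (rule jm)
  show "carrier (?E r p q) = {\<zero>\<^bsub>?E r p q\<^esub>}" if "p < 0 \<or> q < 0"
  proof -
    have "carrier (E r p q) = {\<zero>\<^bsub>E r p q\<^esub>}" using ss' that by blast
    then show ?thesis using mod_hom_zero[OF mod jm jh] by (simp add: jc)
  qed
  have inv: "inv_into (carrier (E r p q)) (J r p q) \<in> mod_hom R (?E r p q) (E r p q)" for p q
    by (rule mod_iso_inv[OF mod jh transport_bij[OF mod J[OF r]]])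
  show "?d r p q \<in> mod_hom R (?E r p q) (?E r (p + int r) (q - int r + 1))"
    by (rule mod_hom_comp[OF mod_hom_comp[OF inv dh] jh])
  { fix x assume "x \<in> carrier (?E r p q)"
    then obtain y where y: "y \<in> carrier (E r p q)" "x = J r p q y" by (auto simp: jc)
    let ?p = "p + int r" and ?q = "q - int r + 1"
    have z: "d r ?p ?q (d r p q y) = \<zero>\<^bsub>E r (p + 2 * int r) (q - 2 * int r + 2)\<^esub>" using ss' y(1) by blast
    have idx: "?p + int r = p + 2 * int r" "?q - int r + 1 = q - 2 * int r + 2" by simp_all
    show "?d r ?p ?q (?d r p q x) = \<zero>\<^bsub>?E r (p + 2 * int r) (q - 2 * int r + 2)\<^esub>"
      using y mod_hom_closed[OF dh y(1)] mod_hom_zero[OF mod jm jh] by (simp only: ji z idx) }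
  let ?p = "p - int r" and ?q = "q + int r - 1"
  let ?Z = "a_kernel (E r p q) (E r (p + int r) (q - int r + 1)) (d r p q)"
    and ?B = "d r ?p ?q ` carrier (E r ?p ?q)"
  have sq: "subquotient R (E r p q) ?Z ?B" by (rule first_quadrant_ss_subquotient[OF ss r])
  have K: "J r p q ` ?Z = a_kernel (?E r p q) (?E r (p + int r) (q - int r + 1)) (?d r p q)"
  proof -
    have "J r (p + int r) (q - int r + 1) (d r p q y) = \<zero>\<^bsub>?E r (p + int r) (q - int r + 1)\<^esub>
        \<longleftrightarrow> d r p q y = \<zero>\<^bsub>E r (p + int r) (q - int r + 1)\<^esub>" if "y \<in> carrier (E r p q)" for y
      by (rule zero_mod_iso[OF mod jm jh J[OF r] mod_hom_closed[OF dh that]])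
    then show ?thesis using mod_hom_zero[OF mod jm jh] by (auto simp: a_kernel_def' jc ji)
  qed
  have I: "J r p q ` ?B = ?d r ?p ?q ` carrier (?E r ?p ?q)"
    by (simp add: jc image_image ji cong: image_cong)
  have "mod_iso R (?E (Suc r) p q) (E (Suc r) p q)"
  proof -
    have m: "module R (E (Suc r) p q)" using ss r unfolding first_quadrant_ss_def by (metis le_SucI)
    have j: "inj_on (J (Suc r) p q) (carrier (E (Suc r) p q))" using J r by simp
    show ?thesis
      by (rule mod_iso_sym[OF m mod_isoI[OF transport_hom[OF m j] transport_bij[OF m j]]])
  qed
  moreover have "mod_iso R (E (Suc r) p q) (quot_mod (E r p q\<lparr>carrier := ?Z\<rparr>) ?B)" using ss' by blast
  ultimately show "mod_iso R (?E (Suc r) p q)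
       (quot_mod (?E r p q\<lparr>carrier := a_kernel (?E r p q) (?E r (p + int r) (q - int r + 1)) (?d r p q)\<rparr>)
         (?d r ?p ?q ` carrier (?E r ?p ?q)))"
    using subquotient_image(2)[OF sq jm jh J[OF r]] unfolding K I by (blast intro: mod_iso_trans)
qed

text \<open>As a set, though not as a module, a subquotient embeds into the ambient module by a
  choice of representatives; this suffices to fit later pages into a prescribed type.\<close>

lemma (in subquotient) inj_representative: "inj_on (\<lambda>X. SOME x. x \<in> X) (carrier SQ)"
  and representative_carrier: "X \<in> carrier SQ \<Longrightarrow> (SOME x. x \<in> X) \<in> carrier M"
proof -
  have *: "(SOME x. x \<in> X) \<in> X" "(SOME x. x \<in> X) \<in> carrier M" "X = B +>\<^bsub>M\<^esub> (SOME x. x \<in> X)"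
    if "X \<in> carrier SQ" for X
  proof -
    from that obtain z where z: "z \<in> Z" "X = B +>\<^bsub>M\<^esub> z" by (auto simp: carrier_SQ)
    show s: "(SOME x. x \<in> X) \<in> X" using self_coset[OF Z_carrier[OF z(1)]] z(2) by (auto intro: someI)
    then show c: "(SOME x. x \<in> X) \<in> carrier M" using mem_coset[OF Z_carrier[OF z(1)]] z(2) by blast
    show "X = B +>\<^bsub>M\<^esub> (SOME x. x \<in> X)"
      using mem_coset[OF Z_carrier[OF z(1)]] coset_eq[OF c Z_carrier[OF z(1)]] s z(2) by simp
  qed
  show "inj_on (\<lambda>X. SOME x. x \<in> X) (carrier SQ)" by (rule inj_onI) (metis *(3))
  show "X \<in> carrier SQ \<Longrightarrow> (SOME x. x \<in> X) \<in> carrier M" by (rule *(2))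
qed

text \<open>Each page is isomorphic to a subquotient of the preceding one, so an injection of its
  carrier is passed on by choosing representatives.\<close>

lemma first_quadrant_ss_injection:
  assumes ss: "first_quadrant_ss R E d"
    and J: "\<And>p q. \<exists>j :: 'a \<Rightarrow> 'b. inj_on j (carrier (E 2 p q))"
    and r: "2 \<le> r"
  shows "\<exists>j :: 'a \<Rightarrow> 'b. inj_on j (carrier (E r p q))"
  using r
proof (induction r rule: dec_induct)
  case (step r)
  note ss' = ss[unfolded first_quadrant_ss_def, rule_format, OF step(1)]
  let ?Z = "a_kernel (E r p q) (E r (p + int r) (q - int r + 1)) (d r p q)"
  let ?p = "p - int r" and ?q = "q + int r - 1"
  let ?B = "d r ?p ?q ` carrier (E r ?p ?q)"
  have sq: "subquotient R (E r p q) ?Z ?B" by (rule first_quadrant_ss_subquotient[OF ss step(1)])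
  interpret S: subquotient R "E r p q" ?Z ?B by fact
  obtain \<phi> where "bij_betw \<phi> (carrier (E (Suc r) p q)) (carrier S.SQ)"
    using ss' unfolding mod_iso_def by blast
  then have \<phi>: "inj_on \<phi> (carrier (E (Suc r) p q))" "\<phi> ` carrier (E (Suc r) p q) = carrier S.SQ"
    by (auto simp: bij_betw_def)
  obtain j :: "'a \<Rightarrow> 'b" where j: "inj_on j (carrier (E r p q))" using step by blast
  have "inj_on (j \<circ> ((\<lambda>X. SOME x. x \<in> X) \<circ> \<phi>)) (carrier (E (Suc r) p q))"
  proof (intro comp_inj_on \<phi>)
    show "inj_on (\<lambda>X. SOME x. x \<in> X) (\<phi> ` carrier (E (Suc r) p q))"
      unfolding \<phi>(2) by (rule S.inj_representative)
    have "((\<lambda>X. SOME x. x \<in> X) \<circ> \<phi>) ` carrier (E (Suc r) p q) \<subseteq> carrier (E r p q)"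
      using S.representative_carrier \<phi>(2) by auto
    then show "inj_on j (((\<lambda>X. SOME x. x \<in> X) \<circ> \<phi>) ` carrier (E (Suc r) p q))"
      by (rule inj_on_subset[OF j])
  qed
  then show ?case by blast
qed (rule J)

lemma converges_to_transport:
  assumes conv: "converges_to R E H"
    and E': "\<And>r p q. 2 \<le> r \<Longrightarrow> mod_iso R (E' r p q) (E r p q)"
    and H: "\<And>n. module R (H n)" and H': "\<And>n. module R (H' n)"
    and iso: "\<And>n. mod_iso R (H n) (H' n)"
  shows "converges_to R E' H'"
proof -
  obtain F where F: "\<And>n. F 0 n = carrier (H n) \<and> F (Suc n) n = {\<zero>\<^bsub>H n\<^esub>}"
    "\<And>p n. submodule (F p n) R (H n) \<and> F (Suc p) n \<subseteq> F p n"
    "\<And>p q r. 2 \<le> r \<and> max p (q + 1) < r \<Longrightarrow>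
       mod_iso R (E r (int p) (int q))
         (quot_mod (H (p + q)\<lparr>carrier := F p (p + q)\<rparr>) (F (Suc p) (p + q)))"
    using conv unfolding converges_to_def by metis
  have "\<forall>n. \<exists>f. f \<in> mod_hom R (H n) (H' n) \<and> bij_betw f (carrier (H n)) (carrier (H' n))"
    using iso by (auto simp: mod_iso_def)
  then obtain f where f: "\<And>n. f n \<in> mod_hom R (H n) (H' n)"
    "\<And>n. bij_betw (f n) (carrier (H n)) (carrier (H' n))" by metis
  have inj: "inj_on (f n) (carrier (H n))" for n using f(2) by (simp add: bij_betw_def)
  have sq: "subquotient R (H n) (F p n) (F (Suc p) n)" for p n
    using F(2) by (intro subquotient.intro subquotient_axioms.intro H) auto
  show ?thesis unfolding converges_to_def
  proof (intro exI[of _ "\<lambda>p n. f n ` F p n"] conjI allI impI)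
    fix n show "f n ` F 0 n = carrier (H' n)" using F(1) f(2) by (auto simp: bij_betw_def)
    show "f n ` F (Suc n) n = {\<zero>\<^bsub>H' n\<^esub>}" using F(1) mod_hom_zero[OF H H' f(1)] by simp
  next
    fix p n show "submodule (f n ` F p n) R (H' n)"
      using F(2) by (intro submodule_image[OF H H' f(1)]) auto
    show "f n ` F (Suc p) n \<subseteq> f n ` F p n" using F(2) by blast
  next
    fix p q r :: nat assume r: "2 \<le> r \<and> max p (q + 1) < r"
    show "mod_iso R (E' r (int p) (int q)) (quot_mod (H' (p + q)\<lparr>carrier := f (p + q) ` F p (p + q)\<rparr>)
      (f (p + q) ` F (Suc p) (p + q)))"
      using mod_iso_trans[OF mod_iso_trans[OF E' F(3)[OF r]] subquotient_image(2)[OF sq H' f(1) inj]] r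
      by blast
  qed
qed

theorem spectral_sequence_transport:
  fixes E :: "nat \<Rightarrow> int \<Rightarrow> int \<Rightarrow> ('r, 'a) module" and X :: "nat \<Rightarrow> nat \<Rightarrow> ('r, 'b) module"
  assumes ss: "first_quadrant_ss R E d"
    and E2: "\<And>p q. mod_iso R (E 2 (int p) (int q)) (X p q)"
    and conv: "converges_to R E H"
    and H: "\<And>n. module R (H n)" "\<And>n. module R (H' n)" "\<And>n. mod_iso R (H n) (H' n)"
  shows "\<exists>(E' :: nat \<Rightarrow> int \<Rightarrow> int \<Rightarrow> ('r, 'b) module) d'. first_quadrant_ss R E' d' \<and>
    (\<forall>p q. mod_iso R (E' 2 (int p) (int q)) (X p q)) \<and> converges_to R E' H'"
proof -
  have mod: "module R (E r p q)" if "2 \<le> r" for r p q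
    using ss that unfolding first_quadrant_ss_def by blast
  \<comment> \<open>The premise on E_2 speaks of nonnegative positions only; elsewhere the page has
    a single element and any map is injective on it.\<close>
  have "\<exists>j :: 'a \<Rightarrow> 'b. inj_on j (carrier (E 2 p q))" for p q
  proof (cases "p < 0 \<or> q < 0")
    case True
    then have "carrier (E 2 p q) = {\<zero>\<^bsub>E 2 p q\<^esub>}"
      using ss unfolding first_quadrant_ss_def by (meson order_refl)
    then show ?thesis by auto
  next
    case False
    then show ?thesis using E2[of "nat p" "nat q"] by (auto simp: mod_iso_def bij_betw_def)
  qed
  then have "\<forall>r p q. \<exists>j :: 'a \<Rightarrow> 'b. 2 \<le> r \<longrightarrow> inj_on j (carrier (E r p q))"
    using first_quadrant_ss_injection[OF ss] by blast
  then obtain J :: "nat \<Rightarrow> int \<Rightarrow> int \<Rightarrow> 'a \<Rightarrow> 'b"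
    where J: "\<And>r p q. 2 \<le> r \<Longrightarrow> inj_on (J r p q) (carrier (E r p q))" by metis
  let ?E = "\<lambda>r p q. transport_mod (E r p q) (J r p q)"
  have iso: "mod_iso R (?E r p q) (E r p q)" if "2 \<le> r" for r p q
    by (rule mod_iso_sym[OF mod[OF that] mod_isoI[OF transport_hom[OF mod[OF that] J[OF that]]
      transport_bij[OF mod[OF that] J[OF that]]]])
  have "mod_iso R (?E 2 (int p) (int q)) (X p q)" for p q
    by (rule mod_iso_trans[OF iso E2]) simp
  then show ?thesis
    using first_quadrant_ss_transport[OF ss J] converges_to_transport[OF conv iso H] by blast
qed

section \<open>Natural transformations\<close>

abbreviation elts :: "('o, 'm, 'r, 'a) rcmod \<Rightarrow> 'o \<Rightarrow> 'a set" where "elts M x \<equiv> carrier (val M x)"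

text \<open>Members of \<open>nat_trans\<close> are extensional, so a transformation given by a
  formula is a member only after this restriction.\<close>

definition nt :: "('o, 'm) cat \<Rightarrow> ('o, 'm, 'r, 'a) rcmod \<Rightarrow> ('o \<Rightarrow> 'a \<Rightarrow> 'b) \<Rightarrow> ('o \<Rightarrow> 'a \<Rightarrow> 'b)" where
  "nt C M \<eta> = (\<lambda>x\<in>Ob C. \<lambda>a\<in>elts M x. \<eta> x a)"

lemma nt_apply [simp]: "x \<in> Ob C \<Longrightarrow> a \<in> elts M x \<Longrightarrow> nt C M \<eta> x a = \<eta> x a"
  by (simp add: nt_def)

lemma nat_trans_hom: "\<eta> \<in> nat_trans R C M N \<Longrightarrow> x \<in> Ob C \<Longrightarrow> \<eta> x \<in> mod_hom R (val M x) (val N x)"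
  by (auto simp: nat_trans_def PiE_iff)

lemma nat_trans_closed:
  "\<eta> \<in> nat_trans R C M N \<Longrightarrow> x \<in> Ob C \<Longrightarrow> a \<in> elts M x \<Longrightarrow> \<eta> x a \<in> elts N x"
  by (meson nat_trans_hom mod_hom_closed)

lemma nat_trans_natural: "\<eta> \<in> nat_trans R C M N \<Longrightarrow> x \<in> Ob C \<Longrightarrow> y \<in> Ob C \<Longrightarrow> f \<in> Mor C x y
    \<Longrightarrow> a \<in> elts M y \<Longrightarrow> \<eta> x (act M x y f a) = act N x y f (\<eta> y a)"
  by (auto simp: nat_trans_def)

lemma nat_trans_add: "\<eta> \<in> nat_trans R C M N \<Longrightarrow> x \<in> Ob C \<Longrightarrow> a \<in> elts M x \<Longrightarrow> b \<in> elts M x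
    \<Longrightarrow> \<eta> x (a \<oplus>\<^bsub>val M x\<^esub> b) = \<eta> x a \<oplus>\<^bsub>val N x\<^esub> \<eta> x b"
  by (meson nat_trans_hom mod_hom_add)

lemma nat_trans_smult: "\<eta> \<in> nat_trans R C M N \<Longrightarrow> x \<in> Ob C \<Longrightarrow> r \<in> carrier R \<Longrightarrow> a \<in> elts M x
    \<Longrightarrow> \<eta> x (r \<odot>\<^bsub>val M x\<^esub> a) = r \<odot>\<^bsub>val N x\<^esub> \<eta> x a"
  by (meson nat_trans_hom mod_hom_smult)

lemma nat_trans_eqI:
  assumes "\<eta> \<in> nat_trans R C M N" "\<theta> \<in> nat_trans R C M N'"
    and "\<And>x a. x \<in> Ob C \<Longrightarrow> a \<in> elts M x \<Longrightarrow> \<eta> x a = \<theta> x a"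
  shows "\<eta> = \<theta>"
proof
  fix x show "\<eta> x = \<theta> x"
  proof (cases "x \<in> Ob C")
    case True
    then have "\<eta> x \<in> extensional (elts M x)" "\<theta> x \<in> extensional (elts M x)"
      using assms(1,2) by (auto simp: nat_trans_def PiE_iff)
    then show ?thesis by (rule extensionalityI) (use assms(3) True in auto)
  next
    case False
    then show ?thesis using assms(1,2) by (simp add: nat_trans_def PiE_iff extensional_def)
  qed
qed

lemma nt_eqI:
  assumes "\<And>x a. x \<in> Ob C \<Longrightarrow> a \<in> elts M x \<Longrightarrow> \<eta> x a = \<theta> x a"
  shows "nt C M \<eta> = nt C M \<theta>"
  unfolding nt_def using assms by (intro restrict_ext ext) (auto intro!: restrict_ext)

lemmas val_mod = right_module.val_module

lemma act_closed: "right_module R C M \<Longrightarrow> x \<in> Ob C \<Longrightarrow> y \<in> Ob C \<Longrightarrow> f \<in> Mor C x y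
    \<Longrightarrow> a \<in> elts M y \<Longrightarrow> act M x y f a \<in> elts M x"
  by (meson mod_hom_closed right_module.act_hom)

lemma act_add: "right_module R C M \<Longrightarrow> x \<in> Ob C \<Longrightarrow> y \<in> Ob C \<Longrightarrow> f \<in> Mor C x y
    \<Longrightarrow> a \<in> elts M y \<Longrightarrow> b \<in> elts M y
    \<Longrightarrow> act M x y f (a \<oplus>\<^bsub>val M y\<^esub> b) = act M x y f a \<oplus>\<^bsub>val M x\<^esub> act M x y f b"
  by (meson mod_hom_add right_module.act_hom)

lemma act_smult: "right_module R C M \<Longrightarrow> x \<in> Ob C \<Longrightarrow> y \<in> Ob C \<Longrightarrow> f \<in> Mor C x y
    \<Longrightarrow> r \<in> carrier R \<Longrightarrow> a \<in> elts M y
    \<Longrightarrow> act M x y f (r \<odot>\<^bsub>val M y\<^esub> a) = r \<odot>\<^bsub>val M x\<^esub> act M x y f a"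
  by (meson mod_hom_smult right_module.act_hom)

lemma act_zero: "right_module R C M \<Longrightarrow> x \<in> Ob C \<Longrightarrow> y \<in> Ob C \<Longrightarrow> f \<in> Mor C x y
    \<Longrightarrow> act M x y f \<zero>\<^bsub>val M y\<^esub> = \<zero>\<^bsub>val M x\<^esub>"
  by (meson mod_hom_zero right_module.act_hom val_mod)

lemma nat_transI:
  assumes M: "right_module R C M"
    and hom: "\<And>x. x \<in> Ob C \<Longrightarrow> \<eta> x \<in> mod_hom R (val M x) (val N x)"
    and nat: "\<And>x y f a. x \<in> Ob C \<Longrightarrow> y \<in> Ob C \<Longrightarrow> f \<in> Mor C x y \<Longrightarrow> a \<in> elts M y
      \<Longrightarrow> \<eta> x (act M x y f a) = act N x y f (\<eta> y a)"
  shows "nt C M \<eta> \<in> nat_trans R C M N"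
proof -
  have "nt C M \<eta> x \<in> mod_hom R (val M x) (val N x)" if "x \<in> Ob C" for x
    using mod_hom_cong[OF val_mod[OF M that], of "nt C M \<eta> x" "\<eta> x"] hom[OF that] that by simp
  then show ?thesis
    using nat by (auto simp: nat_trans_def act_closed[OF M] nt_def)
qed

abbreviation nt_comp where "nt_comp C M g f \<equiv> nt C M (\<lambda>x a. g x (f x a))"

lemma nt_comp_mem:
  assumes "right_module R C M" "f \<in> nat_trans R C M N" "g \<in> nat_trans R C N L"
  shows "nt_comp C M g f \<in> nat_trans R C M L"
proof (rule nat_transI[OF assms(1)])
  fix x assume x: "x \<in> Ob C"
  show "(\<lambda>a. g x (f x a)) \<in> mod_hom R (val M x) (val L x)"
    using mod_hom_comp[OF nat_trans_hom[OF assms(2) x] nat_trans_hom[OF assms(3) x]] .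
next
  fix x y h a assume "x \<in> Ob C" "y \<in> Ob C" "h \<in> Mor C x y" "a \<in> elts M y"
  then show "g x (f x (act M x y h a)) = act L x y h (g y (f y a))"
    by (simp add: nat_trans_natural[OF assms(2)] nat_trans_natural[OF assms(3)] nat_trans_closed[OF assms(2)])
qed

lemma nt_ident_mem: "right_module R C M \<Longrightarrow> nt C M (\<lambda>x a. a) \<in> nat_trans R C M M"
  by (rule nat_transI) (auto simp: mod_hom_def)

lemma carrier_Hom_mod: "carrier (Hom_mod R C M N) = nat_trans R C M N"
  by (simp add: Hom_mod_def)

context
  fixes R :: "('r, 'x) ring_scheme" and C :: "('o, 'm) cat" and M :: "('o, 'm, 'r, 'a) rcmod"
    and N :: "('o, 'm, 'r, 'b) rcmod"
  assumes M: "right_module R C M" and N: "right_module R C N"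
begin

lemma nt_zero_mem: "nt C M (\<lambda>x a. \<zero>\<^bsub>val N x\<^esub>) \<in> nat_trans R C M N"
proof (rule nat_transI[OF M])
  fix x assume x: "x \<in> Ob C"
  interpret module R "val N x" by (rule val_mod[OF N x])
  show "(\<lambda>a. \<zero>\<^bsub>val N x\<^esub>) \<in> mod_hom R (val M x) (val N x)" by (simp add: mod_hom_def)
qed (simp add: act_zero[OF N])

lemma nt_add_mem:
  assumes "\<eta> \<in> nat_trans R C M N" "\<theta> \<in> nat_trans R C M N"
  shows "nt C M (\<lambda>x a. \<eta> x a \<oplus>\<^bsub>val N x\<^esub> \<theta> x a) \<in> nat_trans R C M N"
proof (rule nat_transI[OF M])
  fix x assume x: "x \<in> Ob C"
  interpret module R "val N x" by (rule val_mod[OF N x])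
  note cl = nat_trans_closed[OF assms(1) x] nat_trans_closed[OF assms(2) x]
  show "(\<lambda>a. \<eta> x a \<oplus>\<^bsub>val N x\<^esub> \<theta> x a) \<in> mod_hom R (val M x) (val N x)"
    by (rule mod_homI)
      (simp_all add: x nat_trans_add[OF assms(1)] nat_trans_add[OF assms(2)] nat_trans_smult[OF assms(1)]
        nat_trans_smult[OF assms(2)] cl M.a_ac smult_r_distr)
qed (simp add: nat_trans_natural[OF assms(1)] nat_trans_natural[OF assms(2)] act_add[OF N]
    nat_trans_closed[OF assms(1)] nat_trans_closed[OF assms(2)])

lemma nt_smult_mem:
  assumes "r \<in> carrier R" "\<eta> \<in> nat_trans R C M N"
  shows "nt C M (\<lambda>x a. r \<odot>\<^bsub>val N x\<^esub> \<eta> x a) \<in> nat_trans R C M N"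
proof (rule nat_transI[OF M])
  fix x assume x: "x \<in> Ob C"
  interpret module R "val N x" by (rule val_mod[OF N x])
  show "(\<lambda>a. r \<odot>\<^bsub>val N x\<^esub> \<eta> x a) \<in> mod_hom R (val M x) (val N x)"
    by (rule mod_homI)
      (simp_all add: x assms(1) nat_trans_add[OF assms(2)] nat_trans_smult[OF assms(2)]
        nat_trans_closed[OF assms(2)] smult_r_distr R.m_comm flip: smult_assoc1)
qed (simp add: assms(1) nat_trans_natural[OF assms(2)] act_smult[OF N] nat_trans_closed[OF assms(2)])

lemma Hom_mod_add: "\<eta> \<oplus>\<^bsub>Hom_mod R C M N\<^esub> \<theta> = nt C M (\<lambda>x a. \<eta> x a \<oplus>\<^bsub>val N x\<^esub> \<theta> x a)"
  and Hom_mod_smult: "r \<odot>\<^bsub>Hom_mod R C M N\<^esub> \<eta> = nt C M (\<lambda>x a. r \<odot>\<^bsub>val N x\<^esub> \<eta> x a)"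
  and Hom_mod_zero: "\<zero>\<^bsub>Hom_mod R C M N\<^esub> = nt C M (\<lambda>x a. \<zero>\<^bsub>val N x\<^esub>)"
  by (simp_all add: Hom_mod_def nt_def)

lemma module_Hom: "module R (Hom_mod R C M N)"
proof -
  interpret M: right_module R C M by (rule M)
  \<comment> \<open>The natural transformations are a submodule of a product over objects of
    products over elements.\<close>
  let ?N = "prod_mod (Ob C) (\<lambda>x. prod_mod (elts M x) (\<lambda>_. val N x))"
  have N': "module R ?N" by (intro module_prod M.R.is_cring val_mod[OF N])
  have "submodule (nat_trans R C M N) R ?N"
  proof (rule submoduleI'[OF N'])
    show "nat_trans R C M N \<subseteq> carrier ?N"
    proof
      fix \<eta> assume \<eta>: "\<eta> \<in> nat_trans R C M N"
      then have "\<eta> \<in> extensional (Ob C)" "\<eta> x \<in> extensional (elts M x)" if "x \<in> Ob C" for x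
        using that by (auto simp: nat_trans_def PiE_iff)
      then show "\<eta> \<in> carrier ?N" using nat_trans_closed[OF \<eta>] \<eta> by (simp add: prod_mod_def nat_trans_def PiE_iff)
    qed
  qed (use nt_zero_mem nt_add_mem nt_smult_mem in \<open>simp_all add: prod_mod_def nt_def\<close>)
  from module_restrict[OF N' this] show ?thesis by (simp add: Hom_mod_def prod_mod_def)
qed

lemma Hom_mod_uminus:
  assumes "\<eta> \<in> nat_trans R C M N" "x \<in> Ob C" "a \<in> elts M x"
  shows "(\<ominus>\<^bsub>Hom_mod R C M N\<^esub> \<eta>) x a = \<ominus>\<^bsub>val N x\<^esub> \<eta> x a"
  using assms module_minus_one[OF module_Hom, of \<eta>] module_minus_one[OF val_mod[OF N assms(2)], of "\<eta> x a"]
    nat_trans_closed[OF assms] by (simp add: carrier_Hom_mod Hom_mod_smult)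

lemma Hom_mod_minus:
  assumes "\<eta> \<in> nat_trans R C M N" "\<theta> \<in> nat_trans R C M N" "x \<in> Ob C" "a \<in> elts M x"
  shows "(\<eta> \<ominus>\<^bsub>Hom_mod R C M N\<^esub> \<theta>) x a = \<eta> x a \<ominus>\<^bsub>val N x\<^esub> \<theta> x a"
  using assms by (simp add: a_minus_def Hom_mod_add Hom_mod_uminus)

lemma Hom_mod_minus_mem:
  assumes "\<eta> \<in> nat_trans R C M N" "\<theta> \<in> nat_trans R C M N"
  shows "\<eta> \<ominus>\<^bsub>Hom_mod R C M N\<^esub> \<theta> \<in> nat_trans R C M N"
  using abelian_group.minus_closed[OF module.axioms(2)[OF module_Hom]] assms by (simp add: carrier_Hom_mod)

lemma Hom_mod_eq_zero_iff:
  assumes "\<eta> \<in> nat_trans R C M N"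
  shows "\<eta> = \<zero>\<^bsub>Hom_mod R C M N\<^esub> \<longleftrightarrow> (\<forall>x\<in>Ob C. \<forall>a\<in>elts M x. \<eta> x a = \<zero>\<^bsub>val N x\<^esub>)"
  using nat_trans_eqI[OF assms nt_zero_mem] by (auto simp: Hom_mod_zero)

end

lemma nt_precomp_hom:
  assumes M: "right_module R C M" and N: "right_module R C N" and L: "right_module R C L"
    and f: "f \<in> nat_trans R C M N"
  shows "(\<lambda>\<phi>. nt_comp C M \<phi> f) \<in> mod_hom R (Hom_mod R C N L) (Hom_mod R C M L)"
proof (rule mod_homI)
  fix \<phi> \<psi> assume "\<phi> \<in> carrier (Hom_mod R C N L)" "\<psi> \<in> carrier (Hom_mod R C N L)"
  then show "nt_comp C M (\<phi> \<oplus>\<^bsub>Hom_mod R C N L\<^esub> \<psi>) f = nt_comp C M \<phi> f \<oplus>\<^bsub>Hom_mod R C M L\<^esub> nt_comp C M \<psi> f"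
    unfolding Hom_mod_add[OF M L] Hom_mod_add[OF N L]
    by (intro nt_eqI) (simp add: nat_trans_closed[OF f])
next
  fix r \<phi> assume "\<phi> \<in> carrier (Hom_mod R C N L)"
  then show "nt_comp C M (r \<odot>\<^bsub>Hom_mod R C N L\<^esub> \<phi>) f = r \<odot>\<^bsub>Hom_mod R C M L\<^esub> nt_comp C M \<phi> f"
    unfolding Hom_mod_smult[OF M L] Hom_mod_smult[OF N L]
    by (intro nt_eqI) (simp add: nat_trans_closed[OF f])
qed (simp add: carrier_Hom_mod nt_comp_mem[OF M f])

lemma precomp_eq: "precomp C P d n \<phi> = nt_comp C (P (Suc n)) \<phi> (d n)"
  by (simp add: precomp_def nt_def)

definition sub_rcmod :: "('o, 'm, 'r, 'a) rcmod \<Rightarrow> ('o \<Rightarrow> 'a set) \<Rightarrow> ('o, 'm, 'r, 'a) rcmod" where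
  "sub_rcmod M S = M\<lparr>val := (\<lambda>x. val M x\<lparr>carrier := S x\<rparr>)\<rparr>"

lemma sub_rcmod_simps [simp]:
  "val (sub_rcmod M S) x = val M x\<lparr>carrier := S x\<rparr>" "act (sub_rcmod M S) = act M"
  by (simp_all add: sub_rcmod_def)

lemma right_module_sub:
  assumes M: "right_module R C M" and S: "\<And>x. x \<in> Ob C \<Longrightarrow> submodule (S x) R (val M x)"
    and act: "\<And>x y f a. x \<in> Ob C \<Longrightarrow> y \<in> Ob C \<Longrightarrow> f \<in> Mor C x y \<Longrightarrow> a \<in> S y \<Longrightarrow> act M x y f a \<in> S x"
  shows "right_module R C (sub_rcmod M S)"
proof -
  interpret right_module R C M by fact
  note S' = submodule_subset[OF S]
  show ?thesis
  proof (intro right_module.intro right_module_axioms.intro R.is_cring small_category_axioms)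
    fix x y f assume "x \<in> Ob C" "y \<in> Ob C" "f \<in> Mor C x y"
    then show "act (sub_rcmod M S) x y f \<in> mod_hom R (val (sub_rcmod M S) y) (val (sub_rcmod M S) x)"
      using act S' by (auto intro!: mod_hom_restrict[OF act_hom])
  qed (auto simp: act_Idn act_Cmp S' module_restrict[OF val_module S])
qed

lemma nat_trans_sub:
  assumes "\<eta> \<in> nat_trans R C M N" "\<And>x a. x \<in> Ob C \<Longrightarrow> a \<in> elts M x \<Longrightarrow> \<eta> x a \<in> S x"
  shows "\<eta> \<in> nat_trans R C M (sub_rcmod N S)"
proof -
  have "\<eta> x \<in> mod_hom R (val M x) (val N x\<lparr>carrier := S x\<rparr>)" if "x \<in> Ob C" for x
    using nat_trans_hom[OF assms(1) that] assms(2)[OF that] by (auto simp: mod_hom_def)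
  then show ?thesis using assms(1) by (auto simp: nat_trans_def PiE_iff)
qed

lemma nat_trans_sub_incl:
  assumes "\<eta> \<in> nat_trans R C M (sub_rcmod N S)" "\<And>x. x \<in> Ob C \<Longrightarrow> S x \<subseteq> elts N x"
  shows "\<eta> \<in> nat_trans R C M N"
proof -
  have "\<eta> x \<in> mod_hom R (val M x) (val N x)" if "x \<in> Ob C" for x
    using nat_trans_hom[OF assms(1) that] assms(2)[OF that] by (auto simp: mod_hom_def)
  then show ?thesis using assms(1) by (auto simp: nat_trans_def PiE_iff)
qed

section \<open>Direct sums\<close>

definition dsum :: "'i set \<Rightarrow> ('i \<Rightarrow> ('r, 'a) module) \<Rightarrow> ('r, 'i \<Rightarrow> 'a) module" where
  "dsum I N = prod_mod I N\<lparr>carrier := {t \<in> \<Pi>\<^sub>E i\<in>I. carrier (N i). finite {i \<in> I. t i \<noteq> \<zero>\<^bsub>N i\<^esub>}}\<rparr>"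

text \<open>For \<open>i\<close> outside \<open>I\<close> this is the zero of the sum. The boundary
  of the total complex relies on that convention for the empty list and for lists that are too
  long.\<close>

definition single :: "'i set \<Rightarrow> ('i \<Rightarrow> ('r, 'a) module) \<Rightarrow> 'i \<Rightarrow> 'a \<Rightarrow> ('i \<Rightarrow> 'a)" where
  "single I N i a = (\<lambda>k\<in>I. if k = i then a else \<zero>\<^bsub>N k\<^esub>)"

definition dsum_ext :: "'i set \<Rightarrow> ('i \<Rightarrow> ('r, 'a) module) \<Rightarrow> ('r, 'b) module \<Rightarrow> ('i \<Rightarrow> 'a \<Rightarrow> 'b) \<Rightarrow> ('i \<Rightarrow> 'a) \<Rightarrow> 'b" where
  "dsum_ext I N Y \<phi> t = (\<Oplus>\<^bsub>Y\<^esub>i\<in>{i \<in> I. t i \<noteq> \<zero>\<^bsub>N i\<^esub>}. \<phi> i (t i))"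

context
  fixes R :: "('r, 'x) ring_scheme" and I :: "'i set" and N :: "'i \<Rightarrow> ('r, 'a) module"
  assumes R: "cring R" and N: "\<And>i. i \<in> I \<Longrightarrow> module R (N i)"
begin

lemma dsum_ops:
  "i \<in> I \<Longrightarrow> (s \<oplus>\<^bsub>dsum I N\<^esub> t) i = s i \<oplus>\<^bsub>N i\<^esub> t i" "i \<in> I \<Longrightarrow> (r \<odot>\<^bsub>dsum I N\<^esub> t) i = r \<odot>\<^bsub>N i\<^esub> t i"
  "i \<in> I \<Longrightarrow> \<zero>\<^bsub>dsum I N\<^esub> i = \<zero>\<^bsub>N i\<^esub>"
  by (simp_all add: dsum_def prod_mod_def)

lemma dsum_mem: "t \<in> carrier (dsum I N) \<Longrightarrow> i \<in> I \<Longrightarrow> t i \<in> carrier (N i)"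
  by (auto simp: dsum_def PiE_iff)

lemma dsum_finite: "t \<in> carrier (dsum I N) \<Longrightarrow> finite {i \<in> I. t i \<noteq> \<zero>\<^bsub>N i\<^esub>}"
  by (simp add: dsum_def)

lemma dsum_eqI:
  assumes "s \<in> carrier (dsum I N)" "t \<in> carrier (dsum I N)" "\<And>i. i \<in> I \<Longrightarrow> s i = t i"
  shows "s = t"
  using assms by (auto simp: dsum_def intro: PiE_ext)

lemma dsum_sub: "submodule (carrier (dsum I N)) R (prod_mod I N)"
proof (rule submoduleI'[OF module_prod[OF R N]])
  have am: "abelian_monoid (N i)" if "i \<in> I" for i using N[OF that] by (simp add: module_def abelian_group_def)
  note sim = dsum_def prod_mod_def PiE_iff abelian_monoid.l_zero[OF am] abelian_monoid.zero_closed[OF am]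
    abelian_monoid.a_closed[OF am] module.smult_closed[OF N] module.smult_r_null[OF N]
  show "\<zero>\<^bsub>prod_mod I N\<^esub> \<in> carrier (dsum I N)" by (simp add: sim)
  fix s t assume s: "s \<in> carrier (dsum I N)" and t: "t \<in> carrier (dsum I N)"
  have "{i \<in> I. s i \<oplus>\<^bsub>N i\<^esub> t i \<noteq> \<zero>\<^bsub>N i\<^esub>} \<subseteq> {i \<in> I. s i \<noteq> \<zero>\<^bsub>N i\<^esub>} \<union> {i \<in> I. t i \<noteq> \<zero>\<^bsub>N i\<^esub>}"
    by (auto simp: sim)
  from finite_subset[OF this] show "s \<oplus>\<^bsub>prod_mod I N\<^esub> t \<in> carrier (dsum I N)"
    using s t by (simp add: sim cong: conj_cong)
next
  fix r t assume r: "r \<in> carrier R" and t: "t \<in> carrier (dsum I N)"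
  have "{i \<in> I. r \<odot>\<^bsub>N i\<^esub> t i \<noteq> \<zero>\<^bsub>N i\<^esub>} \<subseteq> {i \<in> I. t i \<noteq> \<zero>\<^bsub>N i\<^esub>}"
    using module.smult_r_null[OF N r] by auto
  from finite_subset[OF this] show "r \<odot>\<^bsub>prod_mod I N\<^esub> t \<in> carrier (dsum I N)"
    using r t by (simp add: dsum_def prod_mod_def PiE_iff module.smult_closed[OF N] cong: conj_cong)
qed (auto simp: dsum_def prod_mod_def)

lemma dsum_closed:
  "s \<in> carrier (dsum I N) \<Longrightarrow> t \<in> carrier (dsum I N) \<Longrightarrow> s \<oplus>\<^bsub>dsum I N\<^esub> t \<in> carrier (dsum I N)"
  "r \<in> carrier R \<Longrightarrow> t \<in> carrier (dsum I N) \<Longrightarrow> r \<odot>\<^bsub>dsum I N\<^esub> t \<in> carrier (dsum I N)"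
  "\<zero>\<^bsub>dsum I N\<^esub> \<in> carrier (dsum I N)"
  using submodule_add[OF dsum_sub] submodule_smult[OF dsum_sub] submodule_zero[OF dsum_sub] by (simp_all add: dsum_def)

lemma module_dsum: "module R (dsum I N)"
  using module_restrict[OF module_prod[OF R N] dsum_sub] by (simp add: dsum_def)

lemma single_mem: "(i \<in> I \<Longrightarrow> a \<in> carrier (N i)) \<Longrightarrow> single I N i a \<in> carrier (dsum I N)"
proof -
  assume a: "i \<in> I \<Longrightarrow> a \<in> carrier (N i)"
  have z: "\<zero>\<^bsub>N k\<^esub> \<in> carrier (N k)" if "k \<in> I" for k
    using N[OF that] by (simp add: module_def abelian_group_def abelian_monoid.zero_closed)
  have "{k \<in> I. single I N i a k \<noteq> \<zero>\<^bsub>N k\<^esub>} \<subseteq> {i}" by (auto simp: single_def)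
  then have "finite {k \<in> I. single I N i a k \<noteq> \<zero>\<^bsub>N k\<^esub>}" by (rule finite_subset) simp
  then show ?thesis using a z by (auto simp: dsum_def single_def)
qed

lemma single_apply: "k \<in> I \<Longrightarrow> single I N i a k = (if k = i then a else \<zero>\<^bsub>N k\<^esub>)"
  by (simp add: single_def)

lemma single_hom: "i \<in> I \<Longrightarrow> single I N i \<in> mod_hom R (N i) (dsum I N)"
proof (rule mod_homI)
  assume i: "i \<in> I"
  interpret module R "N i" by (rule N[OF i])
  have z: "abelian_monoid (N k)" if "k \<in> I" for k
    using N[OF that] by (simp add: module_def abelian_group_def)
  fix a b assume ab: "a \<in> carrier (N i)" "b \<in> carrier (N i)"
  show "single I N i a \<in> carrier (dsum I N)" using ab by (simp add: single_mem)
  show "single I N i (a \<oplus>\<^bsub>N i\<^esub> b) = single I N i a \<oplus>\<^bsub>dsum I N\<^esub> single I N i b"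
    by (rule dsum_eqI) (use ab in \<open>auto simp: single_mem dsum_closed single_apply dsum_ops
      abelian_monoid.l_zero[OF z] abelian_monoid.zero_closed[OF z]\<close>)
next
  assume i: "i \<in> I"
  interpret module R "N i" by (rule N[OF i])
  fix r a assume ab: "r \<in> carrier R" "a \<in> carrier (N i)"
  show "single I N i (r \<odot>\<^bsub>N i\<^esub> a) = r \<odot>\<^bsub>dsum I N\<^esub> single I N i a"
    by (rule dsum_eqI) (use ab in \<open>auto simp: single_mem dsum_closed single_apply dsum_ops
      module.smult_r_null[OF N]\<close>)
qed

lemma dsum_induct [consumes 1, case_names zero add]:
  assumes t: "t \<in> carrier (dsum I N)" and zero: "P \<zero>\<^bsub>dsum I N\<^esub>"
    and add: "\<And>i a t. i \<in> I \<Longrightarrow> a \<in> carrier (N i) \<Longrightarrow> t \<in> carrier (dsum I N) \<Longrightarrow> P t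
      \<Longrightarrow> P (single I N i a \<oplus>\<^bsub>dsum I N\<^esub> t)"
  shows "P t"
  using t
proof (induction "card {i \<in> I. t i \<noteq> \<zero>\<^bsub>N i\<^esub>}" arbitrary: t)
  case 0
  then have "{i \<in> I. t i \<noteq> \<zero>\<^bsub>N i\<^esub>} = {}" using dsum_finite[OF 0(2)] by simp
  then have "t = \<zero>\<^bsub>dsum I N\<^esub>" by (intro dsum_eqI 0 dsum_closed) (auto simp: dsum_ops)
  then show ?case using zero by simp
next
  case (Suc n)
  then have "{i \<in> I. t i \<noteq> \<zero>\<^bsub>N i\<^esub>} \<noteq> {}" by (metis card.empty nat.distinct(1))
  then obtain i where i: "i \<in> I" "t i \<noteq> \<zero>\<^bsub>N i\<^esub>" by auto
  have z: "abelian_monoid (N k)" if "k \<in> I" for k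
    using N[OF that] by (simp add: module_def abelian_group_def)
  define s where "s = (\<lambda>k\<in>I. if k = i then \<zero>\<^bsub>N k\<^esub> else t k)"
  have sup: "{k \<in> I. s k \<noteq> \<zero>\<^bsub>N k\<^esub>} = {k \<in> I. t k \<noteq> \<zero>\<^bsub>N k\<^esub>} - {i}" by (auto simp: s_def)
  have fin: "finite {k \<in> I. s k \<noteq> \<zero>\<^bsub>N k\<^esub>}" unfolding sup using dsum_finite[OF Suc(3)] by simp
  have sc: "s \<in> carrier (dsum I N)"
    using fin dsum_mem[OF Suc(3)] abelian_monoid.zero_closed[OF z] by (auto simp: dsum_def s_def)
  have "n = card {k \<in> I. s k \<noteq> \<zero>\<^bsub>N k\<^esub>}"
    unfolding sup using Suc(2) i dsum_finite[OF Suc(3)] by simp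
  then have "P s" using Suc(1) sc by blast
  moreover have "t = single I N i (t i) \<oplus>\<^bsub>dsum I N\<^esub> s"
    by (rule dsum_eqI[OF Suc(3)])
      (use i sc dsum_mem[OF Suc(3)] in \<open>auto simp: single_mem dsum_closed single_apply dsum_ops s_def
        abelian_monoid.l_zero[OF z] abelian_monoid.r_zero[OF z]\<close>)
  ultimately show ?case using add[OF i(1) dsum_mem[OF Suc(3) i(1)] sc] by simp
qed

text \<open>By this, identities between maps on the free cover and on the total complex are checked
  on one summand at a time.\<close>

lemma dsum_hom_eqI:
  assumes Y: "module R Y" and f: "f \<in> mod_hom R (dsum I N) Y" and g: "g \<in> mod_hom R (dsum I N) Y"
    and eq: "\<And>i a. i \<in> I \<Longrightarrow> a \<in> carrier (N i) \<Longrightarrow> f (single I N i a) = g (single I N i a)"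
    and t: "t \<in> carrier (dsum I N)"
  shows "f t = g t"
  using t
proof (induction rule: dsum_induct)
  case zero
  show ?case using mod_hom_zero[OF module_dsum Y f] mod_hom_zero[OF module_dsum Y g] by simp
next
  case (add i a t)
  then show ?case by (simp add: mod_hom_add[OF f] mod_hom_add[OF g] single_mem eq)
qed

context
  fixes Y :: "('r, 'b) module" and \<phi>
  assumes Y: "module R Y" and \<phi>: "\<And>i. i \<in> I \<Longrightarrow> \<phi> i \<in> mod_hom R (N i) Y"
begin

interpretation Y: module R Y by (rule Y)

text \<open>The support of a sum need not be the union of the supports. Enlarging all of them to a
  common finite set makes additivity a statement about one index set.\<close>

lemma dsum_ext_superset:
  assumes t: "t \<in> carrier (dsum I N)" and S: "finite S" "{i \<in> I. t i \<noteq> \<zero>\<^bsub>N i\<^esub>} \<subseteq> S" "S \<subseteq> I"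
  shows "dsum_ext I N Y \<phi> t = (\<Oplus>\<^bsub>Y\<^esub>i\<in>S. \<phi> i (t i))"
  unfolding dsum_ext_def
proof (rule Y.M.add.finprod_mono_neutral_cong_left[OF S(1,2)])
  fix i assume "i \<in> S - {i \<in> I. t i \<noteq> \<zero>\<^bsub>N i\<^esub>}"
  then show "\<phi> i (t i) = \<zero>\<^bsub>Y\<^esub>" using S(3) mod_hom_zero[OF N Y \<phi>] by auto
qed (use S(3) mod_hom_closed[OF \<phi> dsum_mem[OF t]] in auto)

lemma dsum_ext_hom: "dsum_ext I N Y \<phi> \<in> mod_hom R (dsum I N) Y"
proof (rule mod_homI)
  note cl = mod_hom_closed[OF \<phi> dsum_mem]
  show "dsum_ext I N Y \<phi> t \<in> carrier Y" if t: "t \<in> carrier (dsum I N)" for t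
    unfolding dsum_ext_def by (rule Y.M.finsum_closed) (auto intro: cl[OF _ t])
  { fix s t assume st: "s \<in> carrier (dsum I N)" "t \<in> carrier (dsum I N)"
    let ?S = "{i \<in> I. s i \<noteq> \<zero>\<^bsub>N i\<^esub>} \<union> {i \<in> I. t i \<noteq> \<zero>\<^bsub>N i\<^esub>}"
    have fin: "finite ?S" using dsum_finite[OF st(1)] dsum_finite[OF st(2)] by simp
    have z: "abelian_monoid (N k)" if "k \<in> I" for k
      using N[OF that] by (simp add: module_def abelian_group_def)
    have "dsum_ext I N Y \<phi> (s \<oplus>\<^bsub>dsum I N\<^esub> t) = (\<Oplus>\<^bsub>Y\<^esub>i\<in>?S. \<phi> i ((s \<oplus>\<^bsub>dsum I N\<^esub> t) i))"
      by (rule dsum_ext_superset[OF dsum_closed(1)[OF st] fin])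
        (auto simp: dsum_ops abelian_monoid.l_zero[OF z] abelian_monoid.zero_closed[OF z])
    also have "\<dots> = (\<Oplus>\<^bsub>Y\<^esub>i\<in>?S. \<phi> i (s i) \<oplus>\<^bsub>Y\<^esub> \<phi> i (t i))"
      by (rule Y.M.finsum_cong') (auto simp: dsum_ops mod_hom_add[OF \<phi>] dsum_mem st cl)
    also have "\<dots> = (\<Oplus>\<^bsub>Y\<^esub>i\<in>?S. \<phi> i (s i)) \<oplus>\<^bsub>Y\<^esub> (\<Oplus>\<^bsub>Y\<^esub>i\<in>?S. \<phi> i (t i))"
      by (rule Y.M.finsum_addf) (auto intro: cl st)
    also have "\<dots> = dsum_ext I N Y \<phi> s \<oplus>\<^bsub>Y\<^esub> dsum_ext I N Y \<phi> t"
      using dsum_ext_superset[OF st(1) fin] dsum_ext_superset[OF st(2) fin] by simp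
    finally show "dsum_ext I N Y \<phi> (s \<oplus>\<^bsub>dsum I N\<^esub> t) = dsum_ext I N Y \<phi> s \<oplus>\<^bsub>Y\<^esub> dsum_ext I N Y \<phi> t" . }
  { fix r t assume rt: "r \<in> carrier R" "t \<in> carrier (dsum I N)"
    let ?S = "{i \<in> I. t i \<noteq> \<zero>\<^bsub>N i\<^esub>}"
    have fin: "finite ?S" using dsum_finite[OF rt(2)] by simp
    have "dsum_ext I N Y \<phi> (r \<odot>\<^bsub>dsum I N\<^esub> t) = (\<Oplus>\<^bsub>Y\<^esub>i\<in>?S. \<phi> i ((r \<odot>\<^bsub>dsum I N\<^esub> t) i))"
      by (rule dsum_ext_superset[OF dsum_closed(2)[OF rt] fin])
        (auto simp: dsum_ops module.smult_r_null[OF N rt(1)])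
    also have "\<dots> = (\<Oplus>\<^bsub>Y\<^esub>i\<in>?S. r \<odot>\<^bsub>Y\<^esub> \<phi> i (t i))"
      by (rule Y.M.finsum_cong') (auto simp: dsum_ops mod_hom_smult[OF \<phi>] dsum_mem rt cl)
    also have "\<dots> = r \<odot>\<^bsub>Y\<^esub> dsum_ext I N Y \<phi> t"
      unfolding dsum_ext_def by (rule Y.finsum_smult_ldistr[symmetric, OF fin rt(1)]) (auto intro: cl rt)
    finally show "dsum_ext I N Y \<phi> (r \<odot>\<^bsub>dsum I N\<^esub> t) = r \<odot>\<^bsub>Y\<^esub> dsum_ext I N Y \<phi> t" . }
qed

lemma dsum_ext_single:
  assumes i: "i \<in> I" and a: "a \<in> carrier (N i)"
  shows "dsum_ext I N Y \<phi> (single I N i a) = \<phi> i a"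
proof -
  have "dsum_ext I N Y \<phi> (single I N i a) = (\<Oplus>\<^bsub>Y\<^esub>k\<in>{i}. \<phi> k (single I N i a k))"
    by (rule dsum_ext_superset[OF single_mem]) (use i a in \<open>auto simp: single_def\<close>)
  also have "\<dots> = \<phi> i a" using i a mod_hom_closed[OF \<phi>] by (simp add: single_apply Pi_iff)
  finally show ?thesis .
qed

end

end

text \<open>A morphism \<open>f : x \<rightarrow> y\<close> carries the summand \<open>i\<close> at \<open>y\<close> to the summand \<open>m x y f i\<close> at \<open>x\<close> by the
  homomorphism \<open>h x y f i\<close>.\<close>

definition monomial_rcmod :: "('o \<Rightarrow> 'i set) \<Rightarrow> ('o \<Rightarrow> 'i \<Rightarrow> ('r, 'a) module) \<Rightarrow> ('o \<Rightarrow> 'o \<Rightarrow> 'm \<Rightarrow> 'i \<Rightarrow> 'i)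
    \<Rightarrow> ('o \<Rightarrow> 'o \<Rightarrow> 'm \<Rightarrow> 'i \<Rightarrow> 'a \<Rightarrow> 'a) \<Rightarrow> ('o, 'm, 'r, 'i \<Rightarrow> 'a) rcmod" where
  "monomial_rcmod I N m h = \<lparr>val = (\<lambda>x. dsum (I x) (N x)),
     act = (\<lambda>x y f. dsum_ext (I y) (N y) (dsum (I x) (N x)) (\<lambda>i a. single (I x) (N x) (m x y f i) (h x y f i a)))\<rparr>"

text \<open>There are two instances: the free cover, with coefficients in the ring and indices moved
  by composition, and the total complex, with coefficients in \<open>P\<close> and lists moved by
  translation.\<close>

locale monomial_module = small_category C for C :: "('o, 'm) cat" +
  fixes R :: "('r, 'x) ring_scheme" and I :: "'o \<Rightarrow> 'i set" and N :: "'o \<Rightarrow> 'i \<Rightarrow> ('r, 'a) module"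
    and m :: "'o \<Rightarrow> 'o \<Rightarrow> 'm \<Rightarrow> 'i \<Rightarrow> 'i" and h :: "'o \<Rightarrow> 'o \<Rightarrow> 'm \<Rightarrow> 'i \<Rightarrow> 'a \<Rightarrow> 'a"
  assumes R: "cring R" and N: "x \<in> Ob C \<Longrightarrow> i \<in> I x \<Longrightarrow> module R (N x i)"
    and m: "x \<in> Ob C \<Longrightarrow> y \<in> Ob C \<Longrightarrow> f \<in> Mor C x y \<Longrightarrow> i \<in> I y \<Longrightarrow> m x y f i \<in> I x"
    and h: "x \<in> Ob C \<Longrightarrow> y \<in> Ob C \<Longrightarrow> f \<in> Mor C x y \<Longrightarrow> i \<in> I y \<Longrightarrow> h x y f i \<in> mod_hom R (N y i) (N x (m x y f i))"
    and Idn: "x \<in> Ob C \<Longrightarrow> i \<in> I x \<Longrightarrow> a \<in> carrier (N x i) \<Longrightarrow> m x x (Idn C x) i = i \<and> h x x (Idn C x) i a = a"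
    and Cmp: "x \<in> Ob C \<Longrightarrow> y \<in> Ob C \<Longrightarrow> z \<in> Ob C \<Longrightarrow> f \<in> Mor C x y \<Longrightarrow> g \<in> Mor C y z \<Longrightarrow> i \<in> I z \<Longrightarrow> a \<in> carrier (N z i)
      \<Longrightarrow> m x z (Cmp C g f) i = m x y f (m y z g i) \<and> h x z (Cmp C g f) i a = h x y f (m y z g i) (h y z g i a)"
begin

abbreviation "F \<equiv> monomial_rcmod I N m h"
abbreviation "FD x \<equiv> dsum (I x) (N x)"
abbreviation "FS x \<equiv> single (I x) (N x)"

lemma val_F [simp]: "val F x = FD x"
  by (simp add: monomial_rcmod_def)

lemma FD: "x \<in> Ob C \<Longrightarrow> module R (FD x)"
  by (rule module_dsum[OF R N])

lemma FD_eqI: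
  assumes "x \<in> Ob C" "module R Y" "f \<in> mod_hom R (FD x) Y" "g \<in> mod_hom R (FD x) Y"
    and "\<And>i a. i \<in> I x \<Longrightarrow> a \<in> carrier (N x i) \<Longrightarrow> f (FS x i a) = g (FS x i a)" "t \<in> carrier (FD x)"
  shows "f t = g t"
  using dsum_hom_eqI[where N = "N x" and I = "I x", OF R N[OF assms(1)] assms(2-6)] .

lemma FS_mem: "x \<in> Ob C \<Longrightarrow> i \<in> I x \<Longrightarrow> a \<in> carrier (N x i) \<Longrightarrow> FS x i a \<in> carrier (FD x)"
  by (rule single_mem[OF R N])

lemma act_F_aux:
  assumes "x \<in> Ob C" "y \<in> Ob C" "f \<in> Mor C x y" "i \<in> I y"
  shows "(\<lambda>a. FS x (m x y f i) (h x y f i a)) \<in> mod_hom R (N y i) (FD x)"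
  using mod_hom_comp[OF h[OF assms] single_hom[where I = "I x" and N = "N x", OF R N[OF assms(1)] m[OF assms]]] .

lemma act_F_hom: "x \<in> Ob C \<Longrightarrow> y \<in> Ob C \<Longrightarrow> f \<in> Mor C x y \<Longrightarrow> act F x y f \<in> mod_hom R (FD y) (FD x)"
  unfolding monomial_rcmod_def rcmod.simps by (rule dsum_ext_hom[OF R N FD act_F_aux])

lemma act_single: "x \<in> Ob C \<Longrightarrow> y \<in> Ob C \<Longrightarrow> f \<in> Mor C x y \<Longrightarrow> i \<in> I y \<Longrightarrow> a \<in> carrier (N y i)
    \<Longrightarrow> act F x y f (FS y i a) = FS x (m x y f i) (h x y f i a)"
  unfolding monomial_rcmod_def rcmod.simps by (rule dsum_ext_single[OF R N FD act_F_aux])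

lemma right_module_F: "right_module R C F"
proof (intro right_module.intro right_module_axioms.intro R small_category_axioms)
  show "module R (val F x)" if "x \<in> Ob C" for x using FD[OF that] by simp
  show "act F x y f \<in> mod_hom R (val F y) (val F x)" if "x \<in> Ob C" "y \<in> Ob C" "f \<in> Mor C x y" for x y f
    using act_F_hom[OF that] by simp
  show "act F x x (Idn C x) t = t" if x: "x \<in> Ob C" and t: "t \<in> elts F x" for x t
  proof (rule FD_eqI[OF x FD[OF x] act_F_hom[OF x x Idn_closed[OF x]], where g = "\<lambda>t. t"])
    show "act F x x (Idn C x) (FS x i a) = FS x i a" if "i \<in> I x" "a \<in> carrier (N x i)" for i a
      using act_single[OF x x Idn_closed[OF x] that] Idn[OF x that] by simp
  qed (use t in \<open>simp_all add: mod_hom_def\<close>)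
  fix x y z f g t assume xyz: "x \<in> Ob C" "y \<in> Ob C" "z \<in> Ob C" and f: "f \<in> Mor C x y" and g: "g \<in> Mor C y z"
    and t: "t \<in> elts F z"
  note gf = Cmp_closed[OF xyz f g]
  show "act F x z (Cmp C g f) t = act F x y f (act F y z g t)"
  proof (rule FD_eqI[OF xyz(3) FD[OF xyz(1)] act_F_hom[OF xyz(1,3) gf]
        mod_hom_comp[OF act_F_hom[OF xyz(2,3) g] act_F_hom[OF xyz(1,2) f]]])
    fix i a assume i: "i \<in> I z" and a: "a \<in> carrier (N z i)"
    show "act F x z (Cmp C g f) (FS z i a) = act F x y f (act F y z g (FS z i a))"
      using act_single[OF xyz(1,3) gf i a] act_single[OF xyz(2,3) g i a] Cmp[OF xyz f g i a]
        act_single[OF xyz(1,2) f m[OF xyz(2,3) g i] mod_hom_closed[OF h[OF xyz(2,3) g i] a]] by simp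
  qed (use t in simp)
qed

context
  fixes M :: "('o, 'm, 'r, 'b) rcmod" and \<phi>
  assumes M: "right_module R C M"
    and \<phi>: "\<And>x i. x \<in> Ob C \<Longrightarrow> i \<in> I x \<Longrightarrow> \<phi> x i \<in> mod_hom R (N x i) (val M x)"
begin

lemma F_ext_single: "x \<in> Ob C \<Longrightarrow> i \<in> I x \<Longrightarrow> a \<in> carrier (N x i)
    \<Longrightarrow> dsum_ext (I x) (N x) (val M x) (\<phi> x) (FS x i a) = \<phi> x i a"
  by (rule dsum_ext_single[OF R N val_mod[OF M] \<phi>])

lemma F_nat_trans:
  assumes "\<And>x y f i a. x \<in> Ob C \<Longrightarrow> y \<in> Ob C \<Longrightarrow> f \<in> Mor C x y \<Longrightarrow> i \<in> I y \<Longrightarrow> a \<in> carrier (N y i)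
      \<Longrightarrow> \<phi> x (m x y f i) (h x y f i a) = act M x y f (\<phi> y i a)"
  shows "nt C F (\<lambda>x. dsum_ext (I x) (N x) (val M x) (\<phi> x)) \<in> nat_trans R C F M"
proof (rule nat_transI[OF right_module_F])
  let ?\<phi> = "\<lambda>x. dsum_ext (I x) (N x) (val M x) (\<phi> x)"
  have hom: "?\<phi> x \<in> mod_hom R (FD x) (val M x)" if "x \<in> Ob C" for x
    by (rule dsum_ext_hom[OF R N[OF that] val_mod[OF M that] \<phi>[OF that]])
  then show "?\<phi> x \<in> mod_hom R (val F x) (val M x)" if "x \<in> Ob C" for x using that by simp
  fix x y f t assume xy: "x \<in> Ob C" "y \<in> Ob C" and f: "f \<in> Mor C x y" and t: "t \<in> elts F y"
  show "?\<phi> x (act F x y f t) = act M x y f (?\<phi> y t)"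
  proof (rule FD_eqI[OF xy(2) val_mod[OF M xy(1)] mod_hom_comp[OF act_F_hom[OF xy f] hom[OF xy(1)]]
        mod_hom_comp[OF hom[OF xy(2)] right_module.act_hom[OF M xy f]]])
    fix i a assume i: "i \<in> I y" and a: "a \<in> carrier (N y i)"
    show "?\<phi> x (act F x y f (FS y i a)) = act M x y f (?\<phi> y (FS y i a))"
      unfolding act_single[OF xy f i a] F_ext_single[OF xy(2) i a]
        F_ext_single[OF xy(1) m[OF xy f i] mod_hom_closed[OF h[OF xy f i] a]] by (rule assms[OF xy f i a])
  qed (use t in simp)
qed

end

end

section \<open>Lifting properties of projective modules\<close>

text \<open>The image of \<delta> has only to contain the values of \<phi>, which is the form in
  which exactness gets used. The three modules may have different types, fixed anew at each
  use.\<close>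

definition lifts :: "('r, 'x) ring_scheme \<Rightarrow> ('o, 'm) cat \<Rightarrow> ('o, 'm, 'r, 'p) rcmod
    \<Rightarrow> ('o, 'm, 'r, 'a) rcmod \<Rightarrow> ('o, 'm, 'r, 'b) rcmod \<Rightarrow> bool" where
  "lifts R C P A B \<longleftrightarrow> (\<forall>\<delta>\<in>nat_trans R C A B. \<forall>\<phi>\<in>nat_trans R C P B.
     (\<forall>x\<in>Ob C. \<forall>a\<in>elts P x. \<phi> x a \<in> \<delta> x ` elts A x) \<longrightarrow>
     (\<exists>\<psi>\<in>nat_trans R C P A. \<forall>x\<in>Ob C. \<forall>a\<in>elts P x. \<delta> x (\<psi> x a) = \<phi> x a))"

lemma liftsE:
  assumes "lifts R C P A B" "\<delta> \<in> nat_trans R C A B" "\<phi> \<in> nat_trans R C P B"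
    "\<And>x a. x \<in> Ob C \<Longrightarrow> a \<in> elts P x \<Longrightarrow> \<phi> x a \<in> \<delta> x ` elts A x"
  obtains \<psi> where "\<psi> \<in> nat_trans R C P A" "\<And>x a. x \<in> Ob C \<Longrightarrow> a \<in> elts P x \<Longrightarrow> \<delta> x (\<psi> x a) = \<phi> x a"
proof -
  have "\<exists>\<psi>\<in>nat_trans R C P A. \<forall>x\<in>Ob C. \<forall>a\<in>elts P x. \<delta> x (\<psi> x a) = \<phi> x a"
    using assms(4) by (intro bspec[OF bspec[OF assms(1)[unfolded lifts_def] assms(2)] assms(3), THEN mp]) simp
  then show ?thesis using that by auto
qed

abbreviation regular_mod :: "('r, 'x) ring_scheme \<Rightarrow> ('r, 'r) module" where
  "regular_mod R \<equiv> \<lparr>carrier = carrier R, mult = mult R, one = one R, zero = zero R, add = add R, smult = mult R\<rparr>"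

lemma module_regular: "cring R \<Longrightarrow> module R (regular_mod R)"
proof -
  assume R: "cring R"
  interpret cring R by fact
  have "abelian_group (regular_mod R)"
  proof (rule abelian_groupI)
    fix x assume "x \<in> carrier (regular_mod R)"
    then have "\<ominus>\<^bsub>R\<^esub> x \<in> carrier R \<and> \<ominus>\<^bsub>R\<^esub> x \<oplus>\<^bsub>R\<^esub> x = \<zero>\<^bsub>R\<^esub>" by (simp add: l_neg)
    then show "\<exists>y\<in>carrier (regular_mod R). y \<oplus>\<^bsub>regular_mod R\<^esub> x = \<zero>\<^bsub>regular_mod R\<^esub>" by auto
  qed (simp_all add: a_ac)
  then show ?thesis by (rule moduleI[OF R]) (simp_all add: l_distr r_distr m_assoc)
qed

text \<open>A triple (y, f, e) is the basis element \<open>f\<close> in the copy of the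
  representable functor R Mor(-, y) that belongs to the element \<open>e\<close>; the free cover is
  the sum of these copies.\<close>

definition generators :: "('o, 'm) cat \<Rightarrow> ('o, 'm, 'r, 'p) rcmod \<Rightarrow> 'o \<Rightarrow> ('o \<times> 'm \<times> 'p) set" where
  "generators C P x = {(y, f, e). y \<in> Ob C \<and> f \<in> Mor C x y \<and> e \<in> elts P y}"

definition free_cover :: "('r, 'x) ring_scheme \<Rightarrow> ('o, 'm) cat \<Rightarrow> ('o, 'm, 'r, 'p) rcmod
    \<Rightarrow> ('o, 'm, 'r, 'o \<times> 'm \<times> 'p \<Rightarrow> 'r) rcmod" where
  "free_cover R C P = monomial_rcmod (generators C P) (\<lambda>_ _. regular_mod R)
     (\<lambda>_ _ h (y, f, e). (y, Cmp C f h, e)) (\<lambda>_ _ _ _ r. r)"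

lemma free_cover_val: "val (free_cover R C P) x = dsum (generators C P x) (\<lambda>_. regular_mod R)"
  by (simp add: free_cover_def monomial_rcmod_def)

context
  fixes R :: "('r, 'x) ring_scheme" and C :: "('o, 'm) cat" and P :: "('o, 'm, 'r, 'p) rcmod"
  assumes P: "right_module R C P"
begin

interpretation P: right_module R C P by (rule P)

abbreviation "FG x \<equiv> single (generators C P x) (\<lambda>_. regular_mod R)"

interpretation FC: monomial_module C R "generators C P" "\<lambda>_ _. regular_mod R" "\<lambda>_ _ h (y, f, e). (y, Cmp C f h, e)" "\<lambda>_ _ _ _ r. r"
proof (intro monomial_module.intro P.small_category_axioms monomial_module_axioms.intro P.R.is_cring module_regular)
  fix x y z f g i
  assume xyz: "x \<in> Ob C" "y \<in> Ob C" "f \<in> Mor C x y"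
  { assume "i \<in> generators C P y"
    then show "(case i of (y, f', e) \<Rightarrow> (y, Cmp C f' f, e)) \<in> generators C P x"
      using xyz P.Cmp_closed[of x y] by (auto simp: generators_def) }
  assume "z \<in> Ob C" "g \<in> Mor C y z" "i \<in> generators C P z"
  then show "(case i of (y, f', e) \<Rightarrow> (y, Cmp C f' (Cmp C g f), e))
      = (case case i of (y, f', e) \<Rightarrow> (y, Cmp C f' g, e) of (y, f', e) \<Rightarrow> (y, Cmp C f' f, e)) \<and> a = a" for a
    using xyz P.Cmp_assoc[of x y z] by (auto simp: generators_def)
qed (auto simp: generators_def P.Cmp_Idn mod_hom_def)

lemma right_module_free_cover: "right_module R C (free_cover R C P)"
  unfolding free_cover_def by (rule FC.right_module_F)

lemma free_cover_act_single:
  assumes "x \<in> Ob C" "y \<in> Ob C" "h \<in> Mor C x y" "(z, f, e) \<in> generators C P y" "r \<in> carrier R"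
  shows "act (free_cover R C P) x y h (FG y (z, f, e) r) = FG x (z, Cmp C f h, e) r"
  using FC.act_single[OF assms(1-4), of r] assms(5) by (simp add: free_cover_def)

lemma free_cover_eqI:
  assumes "x \<in> Ob C" "module R Y" "f \<in> mod_hom R (dsum (generators C P x) (\<lambda>_. regular_mod R)) Y"
    "g \<in> mod_hom R (dsum (generators C P x) (\<lambda>_. regular_mod R)) Y"
    and "\<And>z f' e r. (z, f', e) \<in> generators C P x \<Longrightarrow> r \<in> carrier R \<Longrightarrow> f (FG x (z, f', e) r) = g (FG x (z, f', e) r)"
    and "t \<in> carrier (dsum (generators C P x) (\<lambda>_. regular_mod R))"
  shows "f t = g t"
  by (rule FC.FD_eqI[OF assms(1-4) _ assms(6)]) (use assms(5) in auto)

text \<open>Yoneda: the images \<open>s y e\<close> of the generators whose morphism is the identity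
  of \<open>y\<close> can be prescribed freely, and naturality dictates the rest.\<close>

lemma free_cover_map:
  fixes A :: "('o, 'm, 'r, 'a) rcmod"
  assumes A: "right_module R C A" and s: "\<And>y e. y \<in> Ob C \<Longrightarrow> e \<in> elts P y \<Longrightarrow> s y e \<in> elts A y"
  obtains \<psi> where "\<psi> \<in> nat_trans R C (free_cover R C P) A"
    "\<And>x y f e r. x \<in> Ob C \<Longrightarrow> (y, f, e) \<in> generators C P x \<Longrightarrow> r \<in> carrier R
      \<Longrightarrow> \<psi> x (FG x (y, f, e) r) = r \<odot>\<^bsub>val A x\<^esub> act A x y f (s y e)"
proof -
  interpret A: right_module R C A by (rule A)
  let ?\<phi> = "\<lambda>x (y, f, e) r. r \<odot>\<^bsub>val A x\<^esub> act A x y f (s y e)"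
  have cl: "act A x y f (s y e) \<in> elts A x" if "x \<in> Ob C" "(y, f, e) \<in> generators C P x" for x y f e
    using that act_closed[OF A] s by (auto simp: generators_def)
  have aux: "?\<phi> x i \<in> mod_hom R (regular_mod R) (val A x)" if x: "x \<in> Ob C" and i: "i \<in> generators C P x" for x i
  proof -
    interpret Ax: module R "val A x" by (rule val_mod[OF A x])
    obtain y f e where "i = (y, f, e)" by (cases i) auto
    then show ?thesis using cl[OF x] i
      by (auto intro!: mod_homI simp: Ax.smult_l_distr Ax.smult_assoc1)
  qed
  have mem: "nt C FC.F (\<lambda>x. dsum_ext (generators C P x) (\<lambda>_. regular_mod R) (val A x) (?\<phi> x)) \<in> nat_trans R C FC.F A"
  proof (rule FC.F_nat_trans[OF A aux])
    fix x y h i r assume h: "x \<in> Ob C" "y \<in> Ob C" "h \<in> Mor C x y" and i: "i \<in> generators C P y" and r: "r \<in> carrier (regular_mod R)"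
    obtain z f e where z: "i = (z, f, e)" "z \<in> Ob C" "f \<in> Mor C y z" "e \<in> elts P z"
      using i by (auto simp: generators_def)
    show "?\<phi> x (case i of (y, f, e) \<Rightarrow> (y, Cmp C f h, e)) r = act A x y h (?\<phi> y i r)"
      using h i r z by (simp add: act_smult[OF A] cl A.act_Cmp[of x y z] s)
  qed
  have v: "dsum_ext (generators C P x) (\<lambda>_. regular_mod R) (val A x) (?\<phi> x) (FG x i r) = ?\<phi> x i r"
    if "x \<in> Ob C" "i \<in> generators C P x" "r \<in> carrier R" for x i r
    by (rule FC.F_ext_single[OF A aux that(1,2)]) (use that in simp_all)
  show ?thesis by (rule that[OF mem[folded free_cover_def]]) (simp add: v free_cover_val FC.FS_mem)
qed

end

lemma free_cover_lifts:
  assumes P: "right_module R C P" and A: "right_module R C A" and B: "right_module R C B"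
  shows "lifts R C (free_cover R C P) A B"
  unfolding lifts_def
proof (intro ballI impI)
  fix \<delta> \<phi> assume \<delta>: "\<delta> \<in> nat_trans R C A B" and \<phi>: "\<phi> \<in> nat_trans R C (free_cover R C P) B"
    and img: "\<forall>x\<in>Ob C. \<forall>a\<in>elts (free_cover R C P) x. \<phi> x a \<in> \<delta> x ` elts A x"
  interpret P: right_module R C P by (rule P)
  let ?S = "\<lambda>x. single (generators C P x) (\<lambda>_. regular_mod R)"
  \<comment> \<open>The value of \<phi> on the universal generator for \<open>e\<close>, the one
    whose morphism is the identity.\<close>
  let ?g = "\<lambda>y e. \<phi> y (?S y (y, Idn C y, e) \<one>\<^bsub>R\<^esub>)"
  note RM = module_regular[OF P.R.is_cring]
  have mem: "?S x i r \<in> elts (free_cover R C P) x" if "r \<in> carrier R" for x i r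
    unfolding free_cover_val by (rule single_mem[OF P.R.is_cring RM]) (simp add: that)
  define s where "s y e = (SOME a. a \<in> elts A y \<and> \<delta> y a = ?g y e)" for y e
  have s: "s y e \<in> elts A y \<and> \<delta> y (s y e) = ?g y e" if "y \<in> Ob C" for y e
  proof -
    have "?g y e \<in> \<delta> y ` elts A y" using img that mem by simp
    then have "\<exists>a. a \<in> elts A y \<and> \<delta> y a = ?g y e" by auto
    then show ?thesis unfolding s_def by (rule someI_ex)
  qed
  obtain \<psi> where \<psi>: "\<psi> \<in> nat_trans R C (free_cover R C P) A"
    "\<And>x y f e r. x \<in> Ob C \<Longrightarrow> (y, f, e) \<in> generators C P x \<Longrightarrow> r \<in> carrier R
      \<Longrightarrow> \<psi> x (?S x (y, f, e) r) = r \<odot>\<^bsub>val A x\<^esub> act A x y f (s y e)"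
    using free_cover_map[OF P A, of s] s by blast
  show "\<exists>\<psi>\<in>nat_trans R C (free_cover R C P) A. \<forall>x\<in>Ob C. \<forall>a\<in>elts (free_cover R C P) x. \<delta> x (\<psi> x a) = \<phi> x a"
  proof (intro bexI[OF _ \<psi>(1)] ballI)
    fix x a assume x: "x \<in> Ob C" and a: "a \<in> elts (free_cover R C P) x"
    show "\<delta> x (\<psi> x a) = \<phi> x a"
    proof (rule free_cover_eqI[OF P x, where f = "\<lambda>a. \<delta> x (\<psi> x a)" and g = "\<phi> x"])
      show "module R (val B x)" by (rule val_mod[OF B x])
      show "(\<lambda>a. \<delta> x (\<psi> x a)) \<in> mod_hom R (dsum (generators C P x) (\<lambda>_. regular_mod R)) (val B x)"
        "\<phi> x \<in> mod_hom R (dsum (generators C P x) (\<lambda>_. regular_mod R)) (val B x)"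
        using mod_hom_comp[OF nat_trans_hom[OF \<psi>(1) x] nat_trans_hom[OF \<delta> x]] nat_trans_hom[OF \<phi> x]
        by (simp_all add: free_cover_val)
      show "a \<in> carrier (dsum (generators C P x) (\<lambda>_. regular_mod R))" using a by (simp add: free_cover_val)
      fix y f e r assume g: "(y, f, e) \<in> generators C P x" and r: "r \<in> carrier R"
      have y: "y \<in> Ob C" "f \<in> Mor C x y" "e \<in> elts P y" using g by (auto simp: generators_def)
      have gy: "(y, Idn C y, e) \<in> generators C P y" using y P.Idn_closed by (simp add: generators_def)
      have "\<delta> x (\<psi> x (?S x (y, f, e) r)) = r \<odot>\<^bsub>val B x\<^esub> act B x y f (\<delta> y (s y e))"
        using x y g r s[OF y(1)]
        by (simp add: \<psi>(2) nat_trans_smult[OF \<delta>] act_closed[OF A] nat_trans_natural[OF \<delta>])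
      also have "\<delta> y (s y e) = ?g y e" using s[OF y(1)] by blast
      also have "act B x y f (?g y e) = \<phi> x (act (free_cover R C P) x y f (?S y (y, Idn C y, e) \<one>\<^bsub>R\<^esub>))"
        using nat_trans_natural[OF \<phi> x y(1,2)] mem by simp
      also have "act (free_cover R C P) x y f (?S y (y, Idn C y, e) \<one>\<^bsub>R\<^esub>) = ?S x (y, f, e) \<one>\<^bsub>R\<^esub>"
        using free_cover_act_single[OF P x y(1,2) gy] P.Idn_Cmp[OF x y(1,2)] by simp
      also have "r \<odot>\<^bsub>val B x\<^esub> \<phi> x (?S x (y, f, e) \<one>\<^bsub>R\<^esub>) = \<phi> x (r \<odot>\<^bsub>val (free_cover R C P) x\<^esub> ?S x (y, f, e) \<one>\<^bsub>R\<^esub>)"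
        using nat_trans_smult[OF \<phi> x r] mem by simp
      also have "r \<odot>\<^bsub>val (free_cover R C P) x\<^esub> ?S x (y, f, e) \<one>\<^bsub>R\<^esub> = ?S x (y, f, e) r"
        using mod_hom_smult[OF single_hom[OF P.R.is_cring RM g] r, of "\<one>\<^bsub>R\<^esub>"] r
        by (simp add: free_cover_val)
      finally show "\<delta> x (\<psi> x (?S x (y, f, e) r)) = \<phi> x (?S x (y, f, e) r)" .
    qed
  qed
qed

text \<open>The definition of projectivity, tested on the free cover of \<open>P\<close> itself,
  splits that cover. So \<open>P\<close> is a retract of a module for which preimages can be chosen
  generator by generator, at all types.\<close>

theorem projective_lifts:
  assumes P: "projective R C P" and A: "right_module R C A" and B: "right_module R C B"
  shows "lifts R C P A B"
  unfolding lifts_def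
proof (intro ballI impI)
  fix \<delta> \<phi> assume \<delta>: "\<delta> \<in> nat_trans R C A B" and \<phi>: "\<phi> \<in> nat_trans R C P B"
    and img: "\<forall>x\<in>Ob C. \<forall>a\<in>elts P x. \<phi> x a \<in> \<delta> x ` elts A x"
  have Pm: "right_module R C P" using P by (simp add: projective_def)
  interpret P: right_module R C P by (rule Pm)
  let ?F = "free_cover R C P"
  let ?S = "\<lambda>x. single (generators C P x) (\<lambda>_. regular_mod R)"
  note F = right_module_free_cover[OF Pm] and RM = module_regular[OF P.R.is_cring]
  obtain \<pi> where \<pi>: "\<pi> \<in> nat_trans R C ?F P"
    "\<And>x y f e r. x \<in> Ob C \<Longrightarrow> (y, f, e) \<in> generators C P x \<Longrightarrow> r \<in> carrier R
      \<Longrightarrow> \<pi> x (?S x (y, f, e) r) = r \<odot>\<^bsub>val P x\<^esub> act P x y f e"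
    using free_cover_map[OF Pm Pm, of "\<lambda>y e. e"] by blast
  have "\<pi> x ` elts ?F x = elts P x" if x: "x \<in> Ob C" for x
  proof
    show "\<pi> x ` elts ?F x \<subseteq> elts P x" using nat_trans_closed[OF \<pi>(1) x] by blast
    show "elts P x \<subseteq> \<pi> x ` elts ?F x"
    proof
      fix e assume e: "e \<in> elts P x"
      interpret Px: module R "val P x" by (rule val_mod[OF Pm x])
      have "(x, Idn C x, e) \<in> generators C P x" using e x P.Idn_closed by (simp add: generators_def)
      then have "\<pi> x (?S x (x, Idn C x, e) \<one>\<^bsub>R\<^esub>) = e" using e x by (simp add: \<pi>(2) P.act_Idn)
      moreover have "?S x (x, Idn C x, e) \<one>\<^bsub>R\<^esub> \<in> elts ?F x"
        unfolding free_cover_val by (rule single_mem[OF P.R.is_cring RM]) simp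
      ultimately show "e \<in> \<pi> x ` elts ?F x" by (metis imageI)
    qed
  qed
  then have "\<exists>\<sigma>\<in>nat_trans R C P ?F. \<forall>x\<in>Ob C. \<forall>a\<in>elts P x. \<pi> x (\<sigma> x a) = nt C P (\<lambda>x a. a) x a"
    using P[unfolded projective_def, THEN conjunct2, rule_format, OF \<pi>(1) nt_ident_mem[OF Pm] F Pm] by blast
  then obtain \<sigma> where \<sigma>: "\<sigma> \<in> nat_trans R C P ?F"
    "\<And>x a. x \<in> Ob C \<Longrightarrow> a \<in> elts P x \<Longrightarrow> \<pi> x (\<sigma> x a) = a"
    by auto
  \<comment> \<open>The lifting is done after precomposing with the cover and is then restricted
    along the section \<sigma>.\<close>
  let ?\<phi> = "nt_comp C ?F \<phi> \<pi>"
  obtain \<psi> where \<psi>: "\<psi> \<in> nat_trans R C ?F A"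
    "\<And>x a. x \<in> Ob C \<Longrightarrow> a \<in> elts ?F x \<Longrightarrow> \<delta> x (\<psi> x a) = ?\<phi> x a"
  proof (rule liftsE[OF free_cover_lifts[OF Pm A B] \<delta> nt_comp_mem[OF F \<pi>(1) \<phi>]])
    show "?\<phi> x a \<in> \<delta> x ` elts A x" if "x \<in> Ob C" "a \<in> elts ?F x" for x a
      using img nat_trans_closed[OF \<pi>(1) that] that by simp
  qed blast
  show "\<exists>\<psi>\<in>nat_trans R C P A. \<forall>x\<in>Ob C. \<forall>a\<in>elts P x. \<delta> x (\<psi> x a) = \<phi> x a"
    by (rule bexI[OF _ nt_comp_mem[OF Pm \<sigma>(1) \<psi>(1)]])
      (simp add: \<psi>(2) \<sigma>(2) nat_trans_closed[OF \<sigma>(1)])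
qed

section \<open>Comparison of resolutions\<close>

text \<open>Exactness is separated from projectivity: the comparison arguments take the lifting
  property as \<open>lifts\<close> premises, each for the modules at which it is used.\<close>

definition resolution ::
  "('r, 'x) ring_scheme \<Rightarrow> ('o, 'm) cat \<Rightarrow> ('o, 'm, 'r, 'b) rcmod
    \<Rightarrow> (nat \<Rightarrow> ('o, 'm, 'r, 'p) rcmod) \<Rightarrow> (nat \<Rightarrow> 'o \<Rightarrow> 'p \<Rightarrow> 'p) \<Rightarrow> ('o \<Rightarrow> 'p \<Rightarrow> 'b) \<Rightarrow> bool" where
  "resolution R C N X d \<epsilon> \<longleftrightarrow>
     right_module R C N \<and> (\<forall>n. right_module R C (X n)) \<and>
     (\<forall>n. d n \<in> nat_trans R C (X (Suc n)) (X n)) \<and> \<epsilon> \<in> nat_trans R C (X 0) N \<and>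
     (\<forall>x\<in>Ob C.
       \<epsilon> x ` elts (X 0) x = elts N x \<and>
       d 0 x ` elts (X 1) x = a_kernel (val (X 0) x) (val N x) (\<epsilon> x) \<and>
       (\<forall>n. d (Suc n) x ` elts (X (Suc (Suc n))) x =
              a_kernel (val (X (Suc n)) x) (val (X n) x) (d n x)))"

locale res =
  fixes R :: "('r, 'x) ring_scheme" and C :: "('o, 'm) cat" and N :: "('o, 'm, 'r, 'b) rcmod"
    and X :: "nat \<Rightarrow> ('o, 'm, 'r, 'p) rcmod" and d \<epsilon>
  assumes res: "resolution R C N X d \<epsilon>"
begin

lemma mod_N: "right_module R C N" and mod_X: "right_module R C (X n)"
  and d_nat: "d n \<in> nat_trans R C (X (Suc n)) (X n)" and \<epsilon>_nat: "\<epsilon> \<in> nat_trans R C (X 0) N"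
  using res by (simp_all add: resolution_def)

text \<open>In degree 0 the augmentation takes the place of the differential, so that exactness
  becomes a single statement for all degrees.\<close>

definition cycle :: "nat \<Rightarrow> 'o \<Rightarrow> 'p \<Rightarrow> bool" where
  "cycle n x a \<longleftrightarrow> (case n of 0 \<Rightarrow> \<epsilon> x a = \<zero>\<^bsub>val N x\<^esub> | Suc m \<Rightarrow> d m x a = \<zero>\<^bsub>val (X m) x\<^esub>)"

lemma exact: "x \<in> Ob C \<Longrightarrow> a \<in> elts (X n) x \<Longrightarrow> cycle n x a \<longleftrightarrow> a \<in> d n x ` elts (X (Suc n)) x"
  using res by (cases n) (auto simp: resolution_def cycle_def a_kernel_def')

lemma cycle_d: "x \<in> Ob C \<Longrightarrow> a \<in> elts (X (Suc n)) x \<Longrightarrow> cycle n x (d n x a)"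
  using exact[of x "d n x a" n] nat_trans_closed[OF d_nat] by blast

lemma d_d: "x \<in> Ob C \<Longrightarrow> a \<in> elts (X (Suc (Suc n))) x \<Longrightarrow> d n x (d (Suc n) x a) = \<zero>\<^bsub>val (X n) x\<^esub>"
  using cycle_d[of x a "Suc n"] by (simp add: cycle_def)

lemma surj: "x \<in> Ob C \<Longrightarrow> \<epsilon> x ` elts (X 0) x = elts N x"
  using res by (simp add: resolution_def)

lemma zero_closed: "x \<in> Ob C \<Longrightarrow> \<zero>\<^bsub>val (X n) x\<^esub> \<in> elts (X n) x"
  using val_mod[OF mod_X] by (simp add: module_def abelian_group_def abelian_monoid.zero_closed)

end

text \<open>The next map is a lift of f d, which exists because f d a is a cycle and hence a
  boundary. The dependent choice therefore carries along that each map sends cycles to cycles; in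
  degree 0 this comes from compatibility with the augmentations.\<close>

lemma comparison_map:
  assumes X: "resolution R C N X dX \<epsilon>X" and Y: "resolution R C N Y dY \<epsilon>Y"
    and l0: "lifts R C (X 0) (Y 0) N" and l: "\<And>n. lifts R C (X (Suc n)) (Y (Suc n)) (Y n)"
  obtains f where "\<And>n. f n \<in> nat_trans R C (X n) (Y n)"
    "\<And>x a. x \<in> Ob C \<Longrightarrow> a \<in> elts (X 0) x \<Longrightarrow> \<epsilon>Y x (f 0 x a) = \<epsilon>X x a"
    "\<And>n x a. x \<in> Ob C \<Longrightarrow> a \<in> elts (X (Suc n)) x \<Longrightarrow> dY n x (f (Suc n) x a) = f n x (dX n x a)"
proof -
  interpret X: res R C N X dX \<epsilon>X by (rule res.intro[OF X])
  interpret Y: res R C N Y dY \<epsilon>Y by (rule res.intro[OF Y])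
  let ?P = "\<lambda>n f. f \<in> nat_trans R C (X n) (Y n) \<and>
    (n = 0 \<longrightarrow> (\<forall>x\<in>Ob C. \<forall>a\<in>elts (X n) x. \<epsilon>Y x (f x a) = \<epsilon>X x a)) \<and>
    (\<forall>x\<in>Ob C. \<forall>a\<in>elts (X n) x. X.cycle n x a \<longrightarrow> Y.cycle n x (f x a))"
  let ?Q = "\<lambda>n f f'. \<forall>x\<in>Ob C. \<forall>a\<in>elts (X (Suc n)) x. dY n x (f' x a) = f x (dX n x a)"
  have "\<exists>f. \<forall>n. ?P n (f n) \<and> ?Q n (f n) (f (Suc n))"
  proof (rule dependent_nat_choice)
    obtain f where f: "f \<in> nat_trans R C (X 0) (Y 0)"
      "\<And>x a. x \<in> Ob C \<Longrightarrow> a \<in> elts (X 0) x \<Longrightarrow> \<epsilon>Y x (f x a) = \<epsilon>X x a"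
      using liftsE[OF l0 Y.\<epsilon>_nat X.\<epsilon>_nat] Y.surj nat_trans_closed[OF X.\<epsilon>_nat] by metis
    then show "\<exists>f. ?P 0 f" by (intro exI[of _ f]) (auto simp: X.cycle_def Y.cycle_def)
  next
    fix f n assume f: "?P n f"
    let ?\<phi> = "nt_comp C (X (Suc n)) f (dX n)"
    obtain f' where f': "f' \<in> nat_trans R C (X (Suc n)) (Y (Suc n))"
      "\<And>x a. x \<in> Ob C \<Longrightarrow> a \<in> elts (X (Suc n)) x \<Longrightarrow> dY n x (f' x a) = ?\<phi> x a"
    proof (rule liftsE[OF l Y.d_nat nt_comp_mem[OF X.mod_X X.d_nat]])
      show "f \<in> nat_trans R C (X n) (Y n)" using f by blast
      fix x a assume xa: "x \<in> Ob C" "a \<in> elts (X (Suc n)) x"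
      have c: "dX n x a \<in> elts (X n) x" using nat_trans_closed[OF X.d_nat xa] .
      then have "Y.cycle n x (f x (dX n x a))" using f X.cycle_d[OF xa] xa by blast
      then show "?\<phi> x a \<in> dY n x ` elts (Y (Suc n)) x"
        using Y.exact[OF xa(1), of "f x (dX n x a)" n] nat_trans_closed[of f R C "X n" "Y n" x] f xa c by simp
    qed blast
    have "Y.cycle (Suc n) x (f' x a)" if "x \<in> Ob C" "a \<in> elts (X (Suc n)) x" "X.cycle (Suc n) x a" for x a
      using that f f'(2)[OF that(1,2)]
        mod_hom_zero[OF val_mod[OF X.mod_X that(1)] val_mod[OF Y.mod_X that(1)] nat_trans_hom[of f R C "X n" "Y n" x]]
      by (simp add: X.cycle_def Y.cycle_def)
    then show "\<exists>f'. ?P (Suc n) f' \<and> ?Q n f f'" using f' by (intro exI[of _ f']) auto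
  qed
  then obtain f where P: "\<And>n. ?P n (f n)" and Q: "\<And>n. ?Q n (f n) (f (Suc n))" by metis
  show ?thesis
  proof (rule that[of f])
    show "\<epsilon>Y x (f 0 x a) = \<epsilon>X x a" if "x \<in> Ob C" "a \<in> elts (X 0) x" for x a
      using P[of 0] that by simp
  qed (use P Q in simp_all)
qed

text \<open>A chain map over the zero map is null-homotopic. Before f - h d can be lifted it has to
  be a cycle, and the invariant for this is d h = f on cycles, where the term with h d drops out; in
  degree 0 that equation holds everywhere.\<close>

lemma comparison_homotopy:
  assumes X: "resolution R C N X dX \<epsilon>X" and Y: "resolution R C N' Y dY \<epsilon>Y"
    and l: "\<And>n. lifts R C (X n) (Y (Suc n)) (Y n)"
    and f: "\<And>n. f n \<in> nat_trans R C (X n) (Y n)"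
    and f0: "\<And>x a. x \<in> Ob C \<Longrightarrow> a \<in> elts (X 0) x \<Longrightarrow> \<epsilon>Y x (f 0 x a) = \<zero>\<^bsub>val N' x\<^esub>"
    and fd: "\<And>n x a. x \<in> Ob C \<Longrightarrow> a \<in> elts (X (Suc n)) x \<Longrightarrow> dY n x (f (Suc n) x a) = f n x (dX n x a)"
  obtains h where "\<And>n. h n \<in> nat_trans R C (X n) (Y (Suc n))"
    "\<And>x a. x \<in> Ob C \<Longrightarrow> a \<in> elts (X 0) x \<Longrightarrow> dY 0 x (h 0 x a) = f 0 x a"
    "\<And>n x a. x \<in> Ob C \<Longrightarrow> a \<in> elts (X (Suc n)) x
      \<Longrightarrow> dY (Suc n) x (h (Suc n) x a) = f (Suc n) x a \<ominus>\<^bsub>val (Y (Suc n)) x\<^esub> h n x (dX n x a)"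
proof -
  interpret X: res R C N X dX \<epsilon>X by (rule res.intro[OF X])
  interpret Y: res R C N' Y dY \<epsilon>Y by (rule res.intro[OF Y])
  note Xd = nat_trans_closed[OF X.d_nat] and fc = nat_trans_closed[OF f]
  let ?P = "\<lambda>n h. h \<in> nat_trans R C (X n) (Y (Suc n)) \<and>
    (\<forall>x\<in>Ob C. \<forall>a\<in>elts (X n) x. n = 0 \<or> X.cycle n x a \<longrightarrow> dY n x (h x a) = f n x a)"
  let ?Q = "\<lambda>n h h'. \<forall>x\<in>Ob C. \<forall>a\<in>elts (X (Suc n)) x.
    dY (Suc n) x (h' x a) = f (Suc n) x a \<ominus>\<^bsub>val (Y (Suc n)) x\<^esub> h x (dX n x a)"
  have "\<exists>h. \<forall>n. ?P n (h n) \<and> ?Q n (h n) (h (Suc n))"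
  proof (rule dependent_nat_choice)
    obtain h where "h \<in> nat_trans R C (X 0) (Y (Suc 0))"
      "\<And>x a. x \<in> Ob C \<Longrightarrow> a \<in> elts (X 0) x \<Longrightarrow> dY 0 x (h x a) = f 0 x a"
    proof (rule liftsE[OF l Y.d_nat f])
      show "f 0 x a \<in> dY 0 x ` elts (Y (Suc 0)) x" if "x \<in> Ob C" "a \<in> elts (X 0) x" for x a
        using Y.exact[OF that(1) fc[OF that]] f0[OF that] by (simp add: Y.cycle_def)
    qed blast
    then show "\<exists>h. ?P 0 h" by blast
  next
    fix h n assume h: "?P n h"
    then have hn: "h \<in> nat_trans R C (X n) (Y (Suc n))" by blast
    note hc = nat_trans_closed[OF hn]
    let ?hd = "nt_comp C (X (Suc n)) h (dX n)"
    have hd: "?hd \<in> nat_trans R C (X (Suc n)) (Y (Suc n))" by (rule nt_comp_mem[OF X.mod_X X.d_nat hn])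
    let ?\<phi> = "f (Suc n) \<ominus>\<^bsub>Hom_mod R C (X (Suc n)) (Y (Suc n))\<^esub> ?hd"
    have \<phi>: "?\<phi> \<in> nat_trans R C (X (Suc n)) (Y (Suc n))"
      by (rule Hom_mod_minus_mem[OF X.mod_X Y.mod_X f hd])
    have \<phi>v: "?\<phi> x a = f (Suc n) x a \<ominus>\<^bsub>val (Y (Suc n)) x\<^esub> h x (dX n x a)"
      if "x \<in> Ob C" "a \<in> elts (X (Suc n)) x" for x a
      using Hom_mod_minus[OF X.mod_X Y.mod_X f hd that] that by simp
    obtain h' where h': "h' \<in> nat_trans R C (X (Suc n)) (Y (Suc (Suc n)))"
      "\<And>x a. x \<in> Ob C \<Longrightarrow> a \<in> elts (X (Suc n)) x \<Longrightarrow> dY (Suc n) x (h' x a) = ?\<phi> x a"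
    proof (rule liftsE[OF l Y.d_nat \<phi>])
      fix x a assume xa: "x \<in> Ob C" "a \<in> elts (X (Suc n)) x"
      interpret Yn: module R "val (Y n) x" by (rule val_mod[OF Y.mod_X xa(1)])
      have "dY n x (h x (dX n x a)) = f n x (dX n x a)" using h xa X.cycle_d[OF xa] Xd[OF xa] by blast
      then have "dY n x (?\<phi> x a) = \<zero>\<^bsub>val (Y n) x\<^esub>"
        using mod_hom_minus[OF val_mod[OF Y.mod_X xa(1)] val_mod[OF Y.mod_X xa(1)] nat_trans_hom[OF Y.d_nat xa(1)]
            fc[OF xa] hc[OF xa(1) Xd[OF xa]]] fd[OF xa] fc[OF xa(1) Xd[OF xa]]
        by (simp add: \<phi>v[OF xa] Yn.M.minus_self)
      then show "?\<phi> x a \<in> dY (Suc n) x ` elts (Y (Suc (Suc n))) x"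
        using Y.exact[OF xa(1) nat_trans_closed[OF \<phi> xa]] by (simp add: Y.cycle_def)
    qed blast
    have "dY (Suc n) x (h' x a) = f (Suc n) x a"
      if xa: "x \<in> Ob C" "a \<in> elts (X (Suc n)) x" "X.cycle (Suc n) x a" for x a
    proof -
      interpret Yn: module R "val (Y (Suc n)) x" by (rule val_mod[OF Y.mod_X xa(1)])
      have "h x (dX n x a) = \<zero>\<^bsub>val (Y (Suc n)) x\<^esub>"
        using mod_hom_zero[OF val_mod[OF X.mod_X xa(1)] val_mod[OF Y.mod_X xa(1)] nat_trans_hom[OF hn xa(1)]] xa(3)
        by (simp add: X.cycle_def)
      then show ?thesis using h'(2)[OF xa(1,2)] \<phi>v[OF xa(1,2)] fc[OF xa(1,2)] by (simp add: Yn.M.minus_zero_right)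
    qed
    then show "\<exists>h'. ?P (Suc n) h' \<and> ?Q n h h'" using h' \<phi>v by (intro exI[of _ h']) auto
  qed
  then obtain h where P: "\<And>n. ?P n (h n)" and Q: "\<And>n. ?Q n (h n) (h (Suc n))" by metis
  show ?thesis
  proof (rule that[of h])
    show "dY 0 x (h 0 x a) = f 0 x a" if "x \<in> Ob C" "a \<in> elts (X 0) x" for x a
      using P[of 0] that by simp
  qed (use P Q in simp_all)
qed

section \<open>Ext as cocycles modulo coboundaries\<close>

definition coboundaries :: "('r, 'x) ring_scheme \<Rightarrow> ('o, 'm) cat \<Rightarrow> (nat \<Rightarrow> ('o, 'm, 'r, 'p) rcmod)
    \<Rightarrow> (nat \<Rightarrow> 'o \<Rightarrow> 'p \<Rightarrow> 'p) \<Rightarrow> ('o, 'm, 'r, 'a) rcmod \<Rightarrow> nat \<Rightarrow> ('o \<Rightarrow> 'p \<Rightarrow> 'a) set" where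
  "coboundaries R C X d M n = (case n of 0 \<Rightarrow> {\<zero>\<^bsub>Hom_mod R C (X 0) M\<^esub>}
     | Suc m \<Rightarrow> precomp C X d m ` carrier (Hom_mod R C (X m) M))"

definition cocycles :: "('r, 'x) ring_scheme \<Rightarrow> ('o, 'm) cat \<Rightarrow> (nat \<Rightarrow> ('o, 'm, 'r, 'p) rcmod)
    \<Rightarrow> (nat \<Rightarrow> 'o \<Rightarrow> 'p \<Rightarrow> 'p) \<Rightarrow> ('o, 'm, 'r, 'a) rcmod \<Rightarrow> nat \<Rightarrow> ('o \<Rightarrow> 'p \<Rightarrow> 'a) set" where
  "cocycles R C X d M n = a_kernel (Hom_mod R C (X n) M) (Hom_mod R C (X (Suc n)) M) (precomp C X d n)"

lemma Ext_eq: "Ext R C X d M n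
    = quot_mod (Hom_mod R C (X n) M\<lparr>carrier := cocycles R C X d M n\<rparr>) (coboundaries R C X d M n)"
  by (simp add: Ext_def cohom_def cocycles_def coboundaries_def split: nat.split)

context res
begin

lemma precomp_hom: "right_module R C M \<Longrightarrow> precomp C X d n \<in> mod_hom R (Hom_mod R C (X n) M) (Hom_mod R C (X (Suc n)) M)"
  using nt_precomp_hom[OF mod_X mod_X _ d_nat] by (simp add: precomp_eq[abs_def])

lemma precomp_apply: "x \<in> Ob C \<Longrightarrow> a \<in> elts (X (Suc n)) x \<Longrightarrow> precomp C X d n \<phi> x a = \<phi> x (d n x a)"
  by (simp add: precomp_eq)

lemma precomp_mem: "right_module R C M \<Longrightarrow> \<phi> \<in> nat_trans R C (X n) M \<Longrightarrow> precomp C X d n \<phi> \<in> nat_trans R C (X (Suc n)) M"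
  using mod_hom_closed[OF precomp_hom] by (simp add: carrier_Hom_mod)

lemma precomp_precomp:
  assumes "right_module R C M" "\<phi> \<in> nat_trans R C (X n) M"
  shows "precomp C X d (Suc n) (precomp C X d n \<phi>) = \<zero>\<^bsub>Hom_mod R C (X (Suc (Suc n))) M\<^esub>"
proof -
  have "precomp C X d (Suc n) (precomp C X d n \<phi>) x a = \<zero>\<^bsub>val M x\<^esub>"
    if xa: "x \<in> Ob C" "a \<in> elts (X (Suc (Suc n))) x" for x a
    using xa d_d[OF xa] nat_trans_closed[OF d_nat xa]
      mod_hom_zero[OF val_mod[OF mod_X xa(1)] val_mod[OF assms(1) xa(1)] nat_trans_hom[OF assms(2) xa(1)]]
    by (simp add: precomp_apply)
  then show ?thesis
    using Hom_mod_eq_zero_iff[OF mod_X assms(1) precomp_mem[OF assms(1) precomp_mem[OF assms]]] by blast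
qed

lemma mem_cocycles:
  assumes "right_module R C M"
  shows "\<phi> \<in> cocycles R C X d M n \<longleftrightarrow> \<phi> \<in> nat_trans R C (X n) M \<and>
    (\<forall>x\<in>Ob C. \<forall>a\<in>elts (X (Suc n)) x. \<phi> x (d n x a) = \<zero>\<^bsub>val M x\<^esub>)"
  using Hom_mod_eq_zero_iff[OF mod_X assms precomp_mem[OF assms]]
  by (auto simp: cocycles_def a_kernel_def' carrier_Hom_mod precomp_apply)

lemma mem_coboundaries_Suc:
  assumes "right_module R C M" "\<phi> \<in> nat_trans R C (X (Suc n)) M"
  shows "\<phi> \<in> coboundaries R C X d M (Suc n) \<longleftrightarrow>
    (\<exists>\<psi>\<in>nat_trans R C (X n) M. \<forall>x\<in>Ob C. \<forall>a\<in>elts (X (Suc n)) x. \<phi> x a = \<psi> x (d n x a))"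
proof -
  have "\<phi> = precomp C X d n \<psi> \<longleftrightarrow> (\<forall>x\<in>Ob C. \<forall>a\<in>elts (X (Suc n)) x. \<phi> x a = \<psi> x (d n x a))"
    if "\<psi> \<in> nat_trans R C (X n) M" for \<psi>
    using nat_trans_eqI[OF assms(2) precomp_mem[OF assms(1) that]] by (auto simp: precomp_apply)
  then show ?thesis by (auto simp: coboundaries_def carrier_Hom_mod image_iff)
qed

lemma mem_coboundaries_0:
  assumes "right_module R C M" "\<phi> \<in> nat_trans R C (X 0) M"
  shows "\<phi> \<in> coboundaries R C X d M 0 \<longleftrightarrow> (\<forall>x\<in>Ob C. \<forall>a\<in>elts (X 0) x. \<phi> x a = \<zero>\<^bsub>val M x\<^esub>)"
  using Hom_mod_eq_zero_iff[OF mod_X assms] by (simp add: coboundaries_def)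

lemma sq_Ext:
  assumes M: "right_module R C M"
  shows "subquotient R (Hom_mod R C (X n) M) (cocycles R C X d M n) (coboundaries R C X d M n)"
proof (intro subquotient.intro subquotient_axioms.intro module_Hom[OF mod_X M])
  show "submodule (cocycles R C X d M n) R (Hom_mod R C (X n) M)"
    unfolding cocycles_def by (rule submodule_kernel[OF module_Hom[OF mod_X M] module_Hom[OF mod_X M] precomp_hom[OF M]])
  show "submodule (coboundaries R C X d M n) R (Hom_mod R C (X n) M)"
    unfolding coboundaries_def
    by (cases n) (auto intro: submodule_zero_set[OF module_Hom[OF mod_X M]]
        submodule_image[OF module_Hom[OF mod_X M] module_Hom[OF mod_X M] precomp_hom[OF M] submodule_carrier[OF module_Hom[OF mod_X M]]])
  show "coboundaries R C X d M n \<subseteq> cocycles R C X d M n"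
  proof (cases n)
    case 0
    have "submodule (cocycles R C X d M n) R (Hom_mod R C (X n) M)"
      unfolding cocycles_def by (rule submodule_kernel[OF module_Hom[OF mod_X M] module_Hom[OF mod_X M] precomp_hom[OF M]])
    then show ?thesis using submodule_zero by (fastforce simp: coboundaries_def 0)
  next
    case (Suc m)
    then show ?thesis
      using precomp_mem[OF M] precomp_precomp[OF M]
      by (auto simp: coboundaries_def cocycles_def a_kernel_def' carrier_Hom_mod)
  qed
qed

lemma module_Ext: "right_module R C M \<Longrightarrow> module R (Ext R C X d M n)"
  unfolding Ext_eq by (rule subquotient.module_SQ[OF sq_Ext])

end

text \<open>From d h + h d = u and \<phi> d = 0 it follows that \<phi> u = (\<phi> h) d, the
  coboundary of \<phi> h one degree lower; in degree 0 it is zero. \<theta> stands for \<phi> u as a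
  member of \<open>nat_trans\<close>.\<close>

lemma (in res) cocycle_homotopy:
  assumes M: "right_module R C M" and \<phi>: "\<phi> \<in> cocycles R C X d M n"
    and h: "\<And>n. h n \<in> nat_trans R C (X n) (X (Suc n))"
    and u: "\<theta> \<in> nat_trans R C (X n) M" "\<And>x a. x \<in> Ob C \<Longrightarrow> a \<in> elts (X n) x \<Longrightarrow> \<theta> x a = \<phi> x (u n x a)"
    and h0: "\<And>x a. x \<in> Ob C \<Longrightarrow> a \<in> elts (X 0) x \<Longrightarrow> d 0 x (h 0 x a) = u 0 x a"
    and hS: "\<And>n x a. x \<in> Ob C \<Longrightarrow> a \<in> elts (X (Suc n)) x
      \<Longrightarrow> d (Suc n) x (h (Suc n) x a) = u (Suc n) x a \<ominus>\<^bsub>val (X (Suc n)) x\<^esub> h n x (d n x a)"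
    and uc: "\<And>n x a. x \<in> Ob C \<Longrightarrow> a \<in> elts (X n) x \<Longrightarrow> u n x a \<in> elts (X n) x"
  shows "\<theta> \<in> coboundaries R C X d M n"
proof -
  have \<phi>n: "\<phi> \<in> nat_trans R C (X n) M" and \<phi>d: "\<And>x a. x \<in> Ob C \<Longrightarrow> a \<in> elts (X (Suc n)) x \<Longrightarrow> \<phi> x (d n x a) = \<zero>\<^bsub>val M x\<^esub>"
    using \<phi> mem_cocycles[OF M] by auto
  show ?thesis
  proof (cases n)
    case 0
    have "\<theta> x a = \<zero>\<^bsub>val M x\<^esub>" if "x \<in> Ob C" "a \<in> elts (X 0) x" for x a
      using \<phi>d[OF that(1), of "h 0 x a"] u(2)[of x a] h0[OF that] that nat_trans_closed[OF h that] 0 by simp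
    then show ?thesis using mem_coboundaries_0[OF M] u(1) 0 by simp
  next
    case (Suc m)
    let ?\<psi> = "nt_comp C (X m) \<phi> (h m)"
    have \<psi>: "?\<psi> \<in> nat_trans R C (X m) M" using nt_comp_mem[OF mod_X h] \<phi>n Suc by simp
    have "\<theta> x a = ?\<psi> x (d m x a)" if xa: "x \<in> Ob C" "a \<in> elts (X (Suc m)) x" for x a
    proof -
      interpret Xn: module R "val (X (Suc m)) x" by (rule val_mod[OF mod_X xa(1)])
      interpret Mx: module R "val M x" by (rule val_mod[OF M xa(1)])
      note dc = nat_trans_closed[OF d_nat xa]
      note hc = nat_trans_closed[OF h xa(1) dc]
      have "\<phi> x (u (Suc m) x a \<ominus>\<^bsub>val (X (Suc m)) x\<^esub> h m x (d m x a)) = \<zero>\<^bsub>val M x\<^esub>"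
        using \<phi>d[OF xa(1), of "h (Suc m) x a"] hS[OF xa] nat_trans_closed[OF h xa] Suc by simp
      then have "\<phi> x (u (Suc m) x a) \<ominus>\<^bsub>val M x\<^esub> \<phi> x (h m x (d m x a)) = \<zero>\<^bsub>val M x\<^esub>"
        using mod_hom_minus[OF val_mod[OF mod_X xa(1)] val_mod[OF M xa(1)] nat_trans_hom[OF \<phi>n xa(1)], of "u (Suc m) x a" "h m x (d m x a)"]
          uc[OF xa] hc Suc by simp
      then have "\<phi> x (u (Suc m) x a) = \<phi> x (h m x (d m x a))"
        using Mx.M.minus_eq_zero_iff nat_trans_closed[OF \<phi>n xa(1)] uc[OF xa] hc Suc by simp
      then show ?thesis using u(2)[of x a] xa dc Suc by simp
    qed
    then show ?thesis using mem_coboundaries_Suc[OF M, of \<theta> m] u(1) \<psi> Suc by auto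
  qed
qed

text \<open>The difference of \<open>k\<close> and the identity lies over the zero map, hence is
  null-homotopic.\<close>

lemma chain_endomorphism_cohomologous:
  assumes M: "right_module R C M" and Z: "resolution R C N Z dZ \<epsilon>Z"
    and ZZ: "\<And>n. lifts R C (Z n) (Z (Suc n)) (Z n)"
    and k: "\<And>n. k n \<in> nat_trans R C (Z n) (Z n)"
      "\<And>x a. x \<in> Ob C \<Longrightarrow> a \<in> elts (Z 0) x \<Longrightarrow> \<epsilon>Z x (k 0 x a) = \<epsilon>Z x a"
      "\<And>n x a. x \<in> Ob C \<Longrightarrow> a \<in> elts (Z (Suc n)) x \<Longrightarrow> dZ n x (k (Suc n) x a) = k n x (dZ n x a)"
    and \<phi>: "\<phi> \<in> cocycles R C Z dZ M n" and \<theta>: "\<theta> \<in> nat_trans R C (Z n) M"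
      "\<And>x a. x \<in> Ob C \<Longrightarrow> a \<in> elts (Z n) x \<Longrightarrow> \<theta> x a = \<phi> x (k n x a) \<ominus>\<^bsub>val M x\<^esub> \<phi> x a"
  shows "\<theta> \<in> coboundaries R C Z dZ M n"
proof -
  interpret Z: res R C N Z dZ \<epsilon>Z by (rule res.intro[OF Z])
  let ?i = "\<lambda>n. nt C (Z n) (\<lambda>x a. a)"
  note i = nt_ident_mem[OF Z.mod_X]
  define u where "u n = k n \<ominus>\<^bsub>Hom_mod R C (Z n) (Z n)\<^esub> ?i n" for n
  have un: "u n \<in> nat_trans R C (Z n) (Z n)" for n
    unfolding u_def by (rule Hom_mod_minus_mem[OF Z.mod_X Z.mod_X k(1) i])
  have uv: "u n x a = k n x a \<ominus>\<^bsub>val (Z n) x\<^esub> a" if "x \<in> Ob C" "a \<in> elts (Z n) x" for n x a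
    using Hom_mod_minus[OF Z.mod_X Z.mod_X k(1) i that] that by (simp add: u_def)
  note kc = nat_trans_closed[OF k(1)] and dc = nat_trans_closed[OF Z.d_nat]
  obtain h where h: "\<And>n. h n \<in> nat_trans R C (Z n) (Z (Suc n))"
    "\<And>x a. x \<in> Ob C \<Longrightarrow> a \<in> elts (Z 0) x \<Longrightarrow> dZ 0 x (h 0 x a) = u 0 x a"
    "\<And>n x a. x \<in> Ob C \<Longrightarrow> a \<in> elts (Z (Suc n)) x
      \<Longrightarrow> dZ (Suc n) x (h (Suc n) x a) = u (Suc n) x a \<ominus>\<^bsub>val (Z (Suc n)) x\<^esub> h n x (dZ n x a)"
  proof (rule comparison_homotopy[OF Z Z ZZ un])
    fix x a assume xa: "x \<in> Ob C" "a \<in> elts (Z 0) x"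
    interpret Nx: module R "val N x" by (rule val_mod[OF Z.mod_N xa(1)])
    show "\<epsilon>Z x (u 0 x a) = \<zero>\<^bsub>val N x\<^esub>"
      using mod_hom_minus[OF val_mod[OF Z.mod_X xa(1)] val_mod[OF Z.mod_N xa(1)] nat_trans_hom[OF Z.\<epsilon>_nat xa(1)] kc[OF xa] xa(2)]
        k(2)[OF xa] nat_trans_closed[OF Z.\<epsilon>_nat xa] by (simp add: uv[OF xa] Nx.M.minus_self)
  next
    fix n x a assume xa: "x \<in> Ob C" "a \<in> elts (Z (Suc n)) x"
    show "dZ n x (u (Suc n) x a) = u n x (dZ n x a)"
      using mod_hom_minus[OF val_mod[OF Z.mod_X xa(1)] val_mod[OF Z.mod_X xa(1)] nat_trans_hom[OF Z.d_nat xa(1)] kc[OF xa] xa(2)]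
        k(3)[OF xa] by (simp add: uv[OF xa] uv[OF xa(1) dc[OF xa]])
  qed blast
  show ?thesis
  proof (rule Z.cocycle_homotopy[OF M \<phi> h(1) \<theta>(1) _ h(2,3) nat_trans_closed[OF un]])
    fix x a assume xa: "x \<in> Ob C" "a \<in> elts (Z n) x"
    have "\<phi> \<in> nat_trans R C (Z n) M" using \<phi> Z.mem_cocycles[OF M] by blast
    then show "\<theta> x a = \<phi> x (u n x a)"
      using mod_hom_minus[OF val_mod[OF Z.mod_X xa(1)] val_mod[OF M xa(1)] nat_trans_hom kc[OF xa] xa(2)]
        xa by (simp add: uv[OF xa] \<theta>(2))
  qed
qed

lemma chain_map_cohomology:
  assumes X: "resolution R C N X dX \<epsilon>X" and Y: "resolution R C N Y dY \<epsilon>Y" and M: "right_module R C M"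
    and f: "\<And>n. f n \<in> nat_trans R C (X n) (Y n)"
      "\<And>n x a. x \<in> Ob C \<Longrightarrow> a \<in> elts (X (Suc n)) x \<Longrightarrow> dY n x (f (Suc n) x a) = f n x (dX n x a)"
  shows "\<phi> \<in> cocycles R C Y dY M n \<Longrightarrow> nt_comp C (X n) \<phi> (f n) \<in> cocycles R C X dX M n"
    and "\<phi> \<in> coboundaries R C Y dY M n \<Longrightarrow> nt_comp C (X n) \<phi> (f n) \<in> coboundaries R C X dX M n"
proof -
  interpret X: res R C N X dX \<epsilon>X by (rule res.intro[OF X])
  interpret Y: res R C N Y dY \<epsilon>Y by (rule res.intro[OF Y])
  note fc = nat_trans_closed[OF f(1)]
  show "nt_comp C (X n) \<phi> (f n) \<in> cocycles R C X dX M n" if \<phi>: "\<phi> \<in> cocycles R C Y dY M n"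
    using \<phi> nt_comp_mem[OF X.mod_X f(1)] fc nat_trans_closed[OF X.d_nat] f(2)
    unfolding X.mem_cocycles[OF M] Y.mem_cocycles[OF M] by (auto simp flip: f(2))
  show "nt_comp C (X n) \<phi> (f n) \<in> coboundaries R C X dX M n" if \<phi>: "\<phi> \<in> coboundaries R C Y dY M n"
  proof -
    have \<phi>n: "\<phi> \<in> nat_trans R C (Y n) M"
      using subquotient.B_carrier[OF Y.sq_Ext[OF M] \<phi>] by (simp add: carrier_Hom_mod)
    note F = nt_comp_mem[OF X.mod_X f(1) \<phi>n]
    show ?thesis
    proof (cases n)
      case 0
      then show ?thesis using \<phi> fc X.mem_coboundaries_0[OF M] Y.mem_coboundaries_0[OF M] F \<phi>n by auto
    next
      case (Suc m)
      then obtain \<psi> where \<psi>: "\<psi> \<in> nat_trans R C (Y m) M"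
        "\<forall>x\<in>Ob C. \<forall>a\<in>elts (Y (Suc m)) x. \<phi> x a = \<psi> x (dY m x a)"
        using \<phi> Y.mem_coboundaries_Suc[OF M] \<phi>n by auto
      have "\<forall>x\<in>Ob C. \<forall>a\<in>elts (X (Suc m)) x. nt_comp C (X n) \<phi> (f n) x a = nt_comp C (X m) \<psi> (f m) x (dX m x a)"
        using \<psi>(2) fc nat_trans_closed[OF X.d_nat] f(2) Suc by simp
      then show ?thesis
        using X.mem_coboundaries_Suc[OF M, of "nt_comp C (X n) \<phi> (f n)" m] F nt_comp_mem[OF X.mod_X f(1) \<psi>(1)] Suc by auto
    qed
  qed
qed

lemma comparison_round_trip:
  assumes X: "resolution R C N X dX \<epsilon>X" and Y: "resolution R C N Y dY \<epsilon>Y" and M: "right_module R C M"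
    and XX: "\<And>n. lifts R C (X n) (X (Suc n)) (X n)"
    and f: "\<And>n. f n \<in> nat_trans R C (X n) (Y n)"
      "\<And>x a. x \<in> Ob C \<Longrightarrow> a \<in> elts (X 0) x \<Longrightarrow> \<epsilon>Y x (f 0 x a) = \<epsilon>X x a"
      "\<And>n x a. x \<in> Ob C \<Longrightarrow> a \<in> elts (X (Suc n)) x \<Longrightarrow> dY n x (f (Suc n) x a) = f n x (dX n x a)"
    and g: "\<And>n. g n \<in> nat_trans R C (Y n) (X n)"
      "\<And>x a. x \<in> Ob C \<Longrightarrow> a \<in> elts (Y 0) x \<Longrightarrow> \<epsilon>X x (g 0 x a) = \<epsilon>Y x a"
      "\<And>n x a. x \<in> Ob C \<Longrightarrow> a \<in> elts (Y (Suc n)) x \<Longrightarrow> dX n x (g (Suc n) x a) = g n x (dY n x a)"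
    and \<phi>: "\<phi> \<in> cocycles R C X dX M n"
  shows "nt_comp C (X n) (nt_comp C (Y n) \<phi> (g n)) (f n) \<ominus>\<^bsub>Hom_mod R C (X n) M\<^esub> \<phi> \<in> coboundaries R C X dX M n"
    (is "?F \<ominus>\<^bsub>_\<^esub> _ \<in> _")
proof -
  interpret X: res R C N X dX \<epsilon>X by (rule res.intro[OF X])
  interpret Y: res R C N Y dY \<epsilon>Y by (rule res.intro[OF Y])
  note fc = nat_trans_closed[OF f(1)]
  have \<phi>n: "\<phi> \<in> nat_trans R C (X n) M" using \<phi> X.mem_cocycles[OF M] by blast
  show ?thesis
  proof (rule chain_endomorphism_cohomologous[OF M X XX, where k = "\<lambda>n. nt_comp C (X n) (g n) (f n)" and \<phi> = \<phi>])
    note m = nt_comp_mem[OF X.mod_X f(1) nt_comp_mem[OF Y.mod_X g(1) \<phi>n]]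
    show "?F \<ominus>\<^bsub>Hom_mod R C (X n) M\<^esub> \<phi> \<in> nat_trans R C (X n) M" by (rule Hom_mod_minus_mem[OF X.mod_X M m \<phi>n])
    show "(?F \<ominus>\<^bsub>Hom_mod R C (X n) M\<^esub> \<phi>) x a = \<phi> x (nt_comp C (X n) (g n) (f n) x a) \<ominus>\<^bsub>val M x\<^esub> \<phi> x a"
      if "x \<in> Ob C" "a \<in> elts (X n) x" for x a
      using Hom_mod_minus[OF X.mod_X M m \<phi>n that] that fc by simp
  qed (use nt_comp_mem[OF X.mod_X f(1) g(1)] f g fc nat_trans_closed[OF X.d_nat] \<phi> in auto)
qed

text \<open>Only precomposition with \<open>f\<close> has to be a homomorphism on cocycles; the map
  \<open>g\<close> in the other direction merely shows that it is onto and injective modulo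
  coboundaries.\<close>

theorem Ext_comparison:
  assumes X: "resolution R C N X dX \<epsilon>X" and Y: "resolution R C N Y dY \<epsilon>Y" and M: "right_module R C M"
    and XY: "lifts R C (X 0) (Y 0) N" "\<And>n. lifts R C (X (Suc n)) (Y (Suc n)) (Y n)"
    and YX: "lifts R C (Y 0) (X 0) N" "\<And>n. lifts R C (Y (Suc n)) (X (Suc n)) (X n)"
    and XX: "\<And>n. lifts R C (X n) (X (Suc n)) (X n)" and YY: "\<And>n. lifts R C (Y n) (Y (Suc n)) (Y n)"
  shows "mod_iso R (Ext R C X dX M n) (Ext R C Y dY M n)"
proof -
  interpret X: res R C N X dX \<epsilon>X by (rule res.intro[OF X])
  interpret Y: res R C N Y dY \<epsilon>Y by (rule res.intro[OF Y])
  obtain f where f: "\<And>n. f n \<in> nat_trans R C (X n) (Y n)"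
    "\<And>x a. x \<in> Ob C \<Longrightarrow> a \<in> elts (X 0) x \<Longrightarrow> \<epsilon>Y x (f 0 x a) = \<epsilon>X x a"
    "\<And>n x a. x \<in> Ob C \<Longrightarrow> a \<in> elts (X (Suc n)) x \<Longrightarrow> dY n x (f (Suc n) x a) = f n x (dX n x a)"
    using comparison_map[OF X Y XY] by blast
  obtain g where g: "\<And>n. g n \<in> nat_trans R C (Y n) (X n)"
    "\<And>x a. x \<in> Ob C \<Longrightarrow> a \<in> elts (Y 0) x \<Longrightarrow> \<epsilon>X x (g 0 x a) = \<epsilon>Y x a"
    "\<And>n x a. x \<in> Ob C \<Longrightarrow> a \<in> elts (Y (Suc n)) x \<Longrightarrow> dX n x (g (Suc n) x a) = g n x (dY n x a)"
    using comparison_map[OF Y X YX] by blast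
  let ?F = "\<lambda>\<phi>. nt_comp C (X n) \<phi> (f n)" and ?G = "\<lambda>\<phi>. nt_comp C (Y n) \<phi> (g n)"
  note F = chain_map_cohomology[where f = f and n = n, OF X Y M f(1,3)] and G = chain_map_cohomology[where f = g and n = n, OF Y X M g(1,3)]
  interpret SX: subquotient R "Hom_mod R C (X n) M" "cocycles R C X dX M n" "coboundaries R C X dX M n"
    by (rule X.sq_Ext[OF M])
  interpret SY: subquotient R "Hom_mod R C (Y n) M" "cocycles R C Y dY M n" "coboundaries R C Y dY M n"
    by (rule Y.sq_Ext[OF M])
  have hom: "?F \<in> mod_hom R (Hom_mod R C (Y n) M\<lparr>carrier := cocycles R C Y dY M n\<rparr>)
      (Hom_mod R C (X n) M\<lparr>carrier := cocycles R C X dX M n\<rparr>)"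
    by (rule mod_hom_restrict[OF nt_precomp_hom[OF X.mod_X Y.mod_X M f(1)]]) (use SY.Z_carrier F(1) in auto)
  have "mod_iso R SY.SQ SX.SQ"
  proof (rule subquotient_iso[OF Y.sq_Ext[OF M] X.sq_Ext[OF M] hom])
    fix \<phi> assume \<phi>: "\<phi> \<in> cocycles R C Y dY M n"
    show "?F \<phi> \<in> coboundaries R C X dX M n \<longleftrightarrow> \<phi> \<in> coboundaries R C Y dY M n"
    proof
      assume "?F \<phi> \<in> coboundaries R C X dX M n"
      then have 1: "?G (?F \<phi>) \<in> coboundaries R C Y dY M n" using G(2) by blast
      \<comment> \<open>Both terms on the right are coboundaries: the first because
        \<open>?F \<phi>\<close> is one, the second by the round trip.\<close>
      have "\<phi> = ?G (?F \<phi>) \<ominus>\<^bsub>Hom_mod R C (Y n) M\<^esub> (?G (?F \<phi>) \<ominus>\<^bsub>Hom_mod R C (Y n) M\<^esub> \<phi>)"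
        using SY.Z_carrier[OF \<phi>] SY.B_carrier[OF 1]
        by (simp add: a_minus_def SY.M.minus_add SY.M.a_assoc[symmetric] SY.M.r_neg)
      then show "\<phi> \<in> coboundaries R C Y dY M n"
        using submodule_minus[OF SY.B 1 comparison_round_trip[where f = g and g = f, OF Y X M YY g f \<phi>]] by simp
    qed (rule F(2))
  next
    fix \<phi> assume "\<phi> \<in> cocycles R C X dX M n"
    then show "\<exists>z\<in>cocycles R C Y dY M n. ?F z \<ominus>\<^bsub>Hom_mod R C (X n) M\<^esub> \<phi> \<in> coboundaries R C X dX M n"
      using G(1) comparison_round_trip[where f = f and g = g, OF X Y M XX f g] by blast
  qed (rule mod_isoI)
  then show ?thesis unfolding Ext_eq using mod_iso_sym[OF SY.module_SQ] by blast
qed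

section \<open>Alternating sums and the prism operator\<close>

text \<open>\<open>faces [x\<^sub>0, \<dots>, x\<^sub>n]\<close> omits each \<open>x\<^sub>i\<close> in turn and \<open>prisms a b [x\<^sub>0, \<dots>, x\<^sub>n]\<close> lists
  \<open>[a x\<^sub>0, \<dots>, a x\<^sub>i, b x\<^sub>i, \<dots>, b x\<^sub>n]\<close>, both in the order \<open>i = 0, \<dots>, n\<close> of the signs in \<open>altsum\<close>.\<close>

fun altsum :: "('a, 'z) ring_scheme \<Rightarrow> 'a list \<Rightarrow> 'a" where
  "altsum A [] = \<zero>\<^bsub>A\<^esub>"
| "altsum A (x # xs) = x \<ominus>\<^bsub>A\<^esub> altsum A xs"

fun faces :: "'g list \<Rightarrow> 'g list list" where
  "faces [] = []"
| "faces (x # l) = l # map ((#) x) (faces l)"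

fun prisms :: "('h \<Rightarrow> 'g) \<Rightarrow> ('h \<Rightarrow> 'g) \<Rightarrow> 'h list \<Rightarrow> 'g list list" where
  "prisms a b [] = []"
| "prisms a b (x # l) = (a x # b x # map b l) # map ((#) (a x)) (prisms a b l)"

text \<open>The simplicial coboundary. Its signs come from the nested differences x0 - (x1 - (x2 -
  ...)), so that identities go by induction on the list instead of by sums over signed
  indices.\<close>

definition alt :: "('a, 'z) ring_scheme \<Rightarrow> ('g list \<Rightarrow> 'a) \<Rightarrow> 'g list \<Rightarrow> 'a" where
  "alt A v l = altsum A (map v (faces l))"

definition prism :: "('a, 'z) ring_scheme \<Rightarrow> ('h \<Rightarrow> 'g) \<Rightarrow> ('h \<Rightarrow> 'g) \<Rightarrow> ('g list \<Rightarrow> 'a) \<Rightarrow> 'h list \<Rightarrow> 'a" where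
  "prism A a b v l = altsum A (map v (prisms a b l))"

lemma alt_simps [simp]:
  "alt A v [] = \<zero>\<^bsub>A\<^esub>" "alt A v (x # l) = v l \<ominus>\<^bsub>A\<^esub> alt A (\<lambda>m. v (x # m)) l"
  by (simp_all add: alt_def comp_def)

lemma prism_simps [simp]:
  "prism A a b v [] = \<zero>\<^bsub>A\<^esub>"
  "prism A a b v (x # l) = v (a x # b x # map b l) \<ominus>\<^bsub>A\<^esub> prism A a b (\<lambda>m. v (a x # m)) l"
  by (simp_all add: prism_def comp_def)

lemma mem_faces: "m \<in> set (faces l) \<Longrightarrow> set m \<subseteq> set l \<and> Suc (length m) = length l"
  by (induction l arbitrary: m) fastforce+

lemma mem_prisms: "m \<in> set (prisms a b l) \<Longrightarrow> set m \<subseteq> a ` set l \<union> b ` set l \<and> length m = Suc (length l)"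
  by (induction l arbitrary: m) fastforce+

lemma mod_hom_scalar:
  assumes M: "module R M" and r: "r \<in> carrier R"
  shows "(\<lambda>a. r \<odot>\<^bsub>M\<^esub> a) \<in> mod_hom R M M"
proof -
  interpret module R M by (rule M)
  show ?thesis using r by (auto simp: mod_hom_def smult_r_distr R.m_comm simp flip: smult_assoc1)
qed

lemma alt_cong: "(\<And>m. set m \<subseteq> set l \<Longrightarrow> Suc (length m) = length l \<Longrightarrow> u m = v m) \<Longrightarrow> alt A u l = alt A v l"
  unfolding alt_def by (rule arg_cong[where f = "altsum A"], rule map_cong) (auto dest: mem_faces)

lemma alt_map: "alt A v (map b l) = alt A (\<lambda>m. v (map b m)) l"
  by (induction l arbitrary: v) simp_all

lemma prism_map: "prism A a b v (map c l) = prism A (\<lambda>x. a (c x)) (\<lambda>x. b (c x)) v l"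
  by (induction l arbitrary: v) (simp_all add: comp_def)

lemma prism_comp: "prism A (\<lambda>x. c (a x)) (\<lambda>x. c (b x)) v l = prism A a b (\<lambda>m. v (map c m)) l"
  by (induction l arbitrary: v) (simp_all add: comp_def)

lemma prism_cong: "(\<And>x. x \<in> set l \<Longrightarrow> a x = a' x \<and> b x = b' x) \<Longrightarrow> prism A a b v l = prism A a' b' v l"
proof (induction l arbitrary: v)
  case (Cons x l)
  have "map b l = map b' l" "a x = a' x" "b x = b' x" using Cons.prems by simp_all
  moreover have "prism A a b (\<lambda>m. v (a' x # m)) l = prism A a' b' (\<lambda>m. v (a' x # m)) l"
    by (rule Cons.IH) (simp add: Cons.prems)
  ultimately show ?case by (simp only: prism_simps)
qed simp

lemma prism_cong_fun:
  "(\<And>m. set m \<subseteq> a ` set l \<union> b ` set l \<Longrightarrow> length m = Suc (length l) \<Longrightarrow> u m = v m)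
    \<Longrightarrow> prism A a b u l = prism A a b v l"
  unfolding prism_def by (rule arg_cong[where f = "altsum A"], rule map_cong) (auto dest: mem_prisms)

context module
begin

lemma altsum_closed: "set xs \<subseteq> carrier M \<Longrightarrow> altsum M xs \<in> carrier M"
  by (induction xs) simp_all

lemma altsum_minus:
  "(\<And>m. m \<in> set ms \<Longrightarrow> u m \<in> carrier M \<and> v m \<in> carrier M)
    \<Longrightarrow> altsum M (map (\<lambda>m. u m \<ominus>\<^bsub>M\<^esub> v m) ms) = altsum M (map u ms) \<ominus>\<^bsub>M\<^esub> altsum M (map v ms)"
proof (induction ms)
  case (Cons m ms)
  have "altsum M (map u ms) \<in> carrier M" "altsum M (map v ms) \<in> carrier M"
    by (rule altsum_closed, use Cons.prems in force)+
  then show ?case using Cons by (simp add: M.minus_minus_minus)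
qed (simp add: M.minus_self)

lemma altsum_zero: "altsum M (map (\<lambda>m. \<zero>\<^bsub>M\<^esub>) ms) = \<zero>\<^bsub>M\<^esub>"
  by (induction ms) (simp_all add: M.minus_self)

lemma alt_closed:
  "(\<And>m. set m \<subseteq> set l \<Longrightarrow> Suc (length m) = length l \<Longrightarrow> v m \<in> carrier M) \<Longrightarrow> alt M v l \<in> carrier M"
  unfolding alt_def by (rule altsum_closed) (auto dest: mem_faces)

lemma alt_minus:
  assumes "\<And>m. set m \<subseteq> set l \<Longrightarrow> Suc (length m) = length l \<Longrightarrow> u m \<in> carrier M"
    "\<And>m. set m \<subseteq> set l \<Longrightarrow> Suc (length m) = length l \<Longrightarrow> v m \<in> carrier M"
  shows "alt M (\<lambda>m. u m \<ominus>\<^bsub>M\<^esub> v m) l = alt M u l \<ominus>\<^bsub>M\<^esub> alt M v l"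
  unfolding alt_def by (rule altsum_minus) (use assms in \<open>auto dest: mem_faces\<close>)

lemma alt_add:
  assumes u: "\<And>m. set m \<subseteq> set l \<Longrightarrow> Suc (length m) = length l \<Longrightarrow> u m \<in> carrier M"
    and v: "\<And>m. set m \<subseteq> set l \<Longrightarrow> Suc (length m) = length l \<Longrightarrow> v m \<in> carrier M"
  shows "alt M (\<lambda>m. u m \<oplus>\<^bsub>M\<^esub> v m) l = alt M u l \<oplus>\<^bsub>M\<^esub> alt M v l"
proof -
  have c: "alt M u l \<in> carrier M" "alt M v l \<in> carrier M" "alt M (\<lambda>m. u m \<oplus>\<^bsub>M\<^esub> v m) l \<in> carrier M"
    by (rule alt_closed, simp add: u v)+
  have "alt M u l = alt M (\<lambda>m. (u m \<oplus>\<^bsub>M\<^esub> v m) \<ominus>\<^bsub>M\<^esub> v m) l"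
    by (rule alt_cong) (simp add: M.add_minus_self u v)
  also have "\<dots> = alt M (\<lambda>m. u m \<oplus>\<^bsub>M\<^esub> v m) l \<ominus>\<^bsub>M\<^esub> alt M v l"
    by (rule alt_minus) (simp_all add: u v)
  finally show ?thesis using c M.eq_minus_iff by auto
qed

lemma alt_zero: "alt M (\<lambda>m. \<zero>\<^bsub>M\<^esub>) l = \<zero>\<^bsub>M\<^esub>"
  unfolding alt_def by (rule altsum_zero)

text \<open>Splitting off the first vertex x and writing w m = v (x # m), the double sum becomes alt
  v l - (alt v l - alt (alt w) l), and the inner double sum vanishes by induction.\<close>

lemma alt_alt:
  "(\<And>m. set m \<subseteq> set l \<Longrightarrow> Suc (Suc (length m)) = length l \<Longrightarrow> v m \<in> carrier M) \<Longrightarrow> alt M (alt M v) l = \<zero>\<^bsub>M\<^esub>"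
proof (induction l arbitrary: v)
  case (Cons x l)
  have IH: "alt M (alt M (\<lambda>m. v (x # m))) l = \<zero>\<^bsub>M\<^esub>"
    by (rule Cons.IH) (auto intro!: Cons.prems)
  have c: "alt M v l \<in> carrier M" by (rule alt_closed) (auto intro!: Cons.prems)
  have "alt M (\<lambda>m. v m \<ominus>\<^bsub>M\<^esub> alt M (\<lambda>m. v (x # m)) m) l = alt M v l \<ominus>\<^bsub>M\<^esub> alt M (alt M (\<lambda>m. v (x # m))) l"
  proof (rule alt_minus)
    fix m assume m: "set m \<subseteq> set l" "Suc (length m) = length l"
    show "v m \<in> carrier M" using m by (auto intro!: Cons.prems)
    show "alt M (\<lambda>m. v (x # m)) m \<in> carrier M"
      using m by (intro alt_closed Cons.prems) auto
  qed
  then show ?case using IH c by (simp add: M.minus_zero_right M.minus_self)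
qed simp

lemma prism_closed:
  "(\<And>m. set m \<subseteq> a ` set l \<union> b ` set l \<Longrightarrow> length m = Suc (length l) \<Longrightarrow> v m \<in> carrier M) \<Longrightarrow> prism M a b v l \<in> carrier M"
  unfolding prism_def by (rule altsum_closed) (auto dest: mem_prisms)

lemma prism_minus:
  assumes "\<And>m. set m \<subseteq> a ` set l \<union> b ` set l \<Longrightarrow> length m = Suc (length l) \<Longrightarrow> u m \<in> carrier M"
    "\<And>m. set m \<subseteq> a ` set l \<union> b ` set l \<Longrightarrow> length m = Suc (length l) \<Longrightarrow> v m \<in> carrier M"
  shows "prism M a b (\<lambda>m. u m \<ominus>\<^bsub>M\<^esub> v m) l = prism M a b u l \<ominus>\<^bsub>M\<^esub> prism M a b v l"
  unfolding prism_def by (rule altsum_minus) (use assms in \<open>auto dest: mem_prisms\<close>)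

lemma prism_zero: "prism M a b (\<lambda>m. \<zero>\<^bsub>M\<^esub>) l = \<zero>\<^bsub>M\<^esub>"
  unfolding prism_def by (rule altsum_zero)

text \<open>The standard triangulation of a prism, one vertex at a time: \<open>p\<close> and
  \<open>q\<close> occur in the two sums with opposite signs, and s + t is the same identity for the
  shorter list with \<open>a x\<close> prepended.\<close>

lemma prism_homotopy:
  "(\<And>m. set m \<subseteq> a ` set l \<union> b ` set l \<Longrightarrow> length m = length l \<Longrightarrow> v m \<in> carrier M)
    \<Longrightarrow> alt M (prism M a b v) l \<oplus>\<^bsub>M\<^esub> prism M a b (alt M v) l = v (map b l) \<ominus>\<^bsub>M\<^esub> v (map a l)"
proof (induction l arbitrary: v)
  case Nil
  have "v [] \<in> carrier M" by (rule Nil) auto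
  then show ?case by (simp add: M.minus_self)
next
  case (Cons x l)
  define w where "w = (\<lambda>m. v (a x # m))"
  define p where "p = prism M a b v l"
  define q where "q = alt M (\<lambda>m. v (a x # b x # m)) (map b l)"
  define s where "s = alt M (prism M a b w) l"
  define t where "t = prism M a b (alt M w) l"
  have wc: "w m \<in> carrier M" if "set m \<subseteq> a ` set l \<union> b ` set l" "length m = length l" for m
    unfolding w_def by (rule Cons.prems) (use that in auto)
  have IH: "s \<oplus>\<^bsub>M\<^esub> t = w (map b l) \<ominus>\<^bsub>M\<^esub> w (map a l)"
    unfolding s_def t_def by (rule Cons.IH) (auto intro!: wc)
  have pc: "p \<in> carrier M" unfolding p_def
    by (rule prism_closed) (auto intro!: Cons.prems)
  have qc: "q \<in> carrier M" unfolding q_def by (rule alt_closed) (auto intro!: Cons.prems)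
  have sc: "s \<in> carrier M" unfolding s_def
  proof (rule alt_closed)
    fix m assume m: "set m \<subseteq> set l" "Suc (length m) = length l"
    show "prism M a b w m \<in> carrier M"
      by (rule prism_closed, rule wc, use m in blast, use m in simp)
  qed
  have tc: "t \<in> carrier M" unfolding t_def
  proof (rule prism_closed)
    fix m assume m: "set m \<subseteq> a ` set l \<union> b ` set l" "length m = Suc (length l)"
    show "alt M w m \<in> carrier M" by (rule alt_closed, rule wc) (use m in auto)
  qed
  have vc: "v (b x # map b l) \<in> carrier M" "w (map b l) \<in> carrier M" "w (map a l) \<in> carrier M"
    by (auto intro!: Cons.prems wc)
  have 1: "alt M (prism M a b v) (x # l) = p \<ominus>\<^bsub>M\<^esub> (q \<ominus>\<^bsub>M\<^esub> s)"
  proof -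
    have "alt M (\<lambda>m. prism M a b v (x # m)) l
        = alt M (\<lambda>m. v (a x # b x # map b m)) l \<ominus>\<^bsub>M\<^esub> alt M (prism M a b w) l"
      unfolding prism_simps w_def[symmetric]
    proof (rule alt_minus)
      fix m assume m: "set m \<subseteq> set l" "Suc (length m) = length l"
      show "v (a x # b x # map b m) \<in> carrier M" using m by (intro Cons.prems) auto
      show "prism M a b w m \<in> carrier M"
        by (rule prism_closed, rule wc, use m in blast, use m in simp)
    qed
    then show ?thesis by (simp add: p_def q_def s_def alt_map)
  qed
  have 2: "prism M a b (alt M v) (x # l) = (v (b x # map b l) \<ominus>\<^bsub>M\<^esub> (w (map b l) \<ominus>\<^bsub>M\<^esub> q)) \<ominus>\<^bsub>M\<^esub> (p \<ominus>\<^bsub>M\<^esub> t)"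
  proof -
    have "prism M a b (\<lambda>m. v m \<ominus>\<^bsub>M\<^esub> alt M w m) l = p \<ominus>\<^bsub>M\<^esub> t"
      unfolding p_def t_def
    proof (rule prism_minus)
      fix m assume m: "set m \<subseteq> a ` set l \<union> b ` set l" "length m = Suc (length l)"
      show "v m \<in> carrier M" using m by (intro Cons.prems) auto
      show "alt M w m \<in> carrier M" by (rule alt_closed, rule wc) (use m in auto)
    qed
    then show ?thesis by (simp add: w_def q_def)
  qed
  have "(p \<ominus>\<^bsub>M\<^esub> (q \<ominus>\<^bsub>M\<^esub> s)) \<oplus>\<^bsub>M\<^esub> ((v (b x # map b l) \<ominus>\<^bsub>M\<^esub> (w (map b l) \<ominus>\<^bsub>M\<^esub> q)) \<ominus>\<^bsub>M\<^esub> (p \<ominus>\<^bsub>M\<^esub> t))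
      = (v (b x # map b l) \<ominus>\<^bsub>M\<^esub> w (map b l)) \<oplus>\<^bsub>M\<^esub> (s \<oplus>\<^bsub>M\<^esub> t)"
  proof -
    have "(p \<ominus>\<^bsub>M\<^esub> (q \<ominus>\<^bsub>M\<^esub> s)) = (p \<ominus>\<^bsub>M\<^esub> q) \<oplus>\<^bsub>M\<^esub> s" using pc qc sc
      by (simp add: a_minus_def M.minus_add M.a_ac)
    moreover have "((v (b x # map b l) \<ominus>\<^bsub>M\<^esub> (w (map b l) \<ominus>\<^bsub>M\<^esub> q)) \<ominus>\<^bsub>M\<^esub> (p \<ominus>\<^bsub>M\<^esub> t))
        = (v (b x # map b l) \<ominus>\<^bsub>M\<^esub> w (map b l)) \<oplus>\<^bsub>M\<^esub> t \<oplus>\<^bsub>M\<^esub> (q \<ominus>\<^bsub>M\<^esub> p)"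
      using pc qc tc vc by (simp add: a_minus_def M.minus_add M.a_ac)
    moreover have "(p \<ominus>\<^bsub>M\<^esub> q) \<oplus>\<^bsub>M\<^esub> s \<oplus>\<^bsub>M\<^esub> ((v (b x # map b l) \<ominus>\<^bsub>M\<^esub> w (map b l)) \<oplus>\<^bsub>M\<^esub> t \<oplus>\<^bsub>M\<^esub> (q \<ominus>\<^bsub>M\<^esub> p))
        = ((p \<ominus>\<^bsub>M\<^esub> q) \<oplus>\<^bsub>M\<^esub> (q \<ominus>\<^bsub>M\<^esub> p)) \<oplus>\<^bsub>M\<^esub> ((v (b x # map b l) \<ominus>\<^bsub>M\<^esub> w (map b l)) \<oplus>\<^bsub>M\<^esub> (s \<oplus>\<^bsub>M\<^esub> t))"
      using pc qc sc tc vc M.minus_closed by (simp add: M.a_ac)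
    moreover have "(p \<ominus>\<^bsub>M\<^esub> q) \<oplus>\<^bsub>M\<^esub> (q \<ominus>\<^bsub>M\<^esub> p) = \<zero>\<^bsub>M\<^esub>"
      using pc qc by (simp add: M.minus_telescope M.minus_self)
    ultimately show ?thesis using sc tc vc by simp
  qed
  also have "\<dots> = v (b x # map b l) \<ominus>\<^bsub>M\<^esub> w (map a l)"
    unfolding IH using vc by (simp add: M.minus_telescope)
  finally show ?case unfolding 1 2 by (simp add: w_def)
qed

lemma finsum_lessThan_Suc:
  assumes "\<And>i. i < Suc n \<Longrightarrow> f i \<in> carrier M"
  shows "(\<Oplus>\<^bsub>M\<^esub>i\<in>{..<Suc n}. f i) = (\<Oplus>\<^bsub>M\<^esub>i\<in>{..<n}. f i) \<oplus>\<^bsub>M\<^esub> f n"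
proof -
  have "(\<Oplus>\<^bsub>M\<^esub>i\<in>{..<n}. f i) \<in> carrier M" using assms by (intro M.finsum_closed) auto
  then show ?thesis using assms by (simp add: lessThan_Suc M.finsum_insert Pi_iff M.a_comm)
qed

lemma finsum_lessThan_Suc_shift:
  assumes "\<And>i. i < Suc n \<Longrightarrow> f i \<in> carrier M"
  shows "(\<Oplus>\<^bsub>M\<^esub>i\<in>{..<Suc n}. f i) = f 0 \<oplus>\<^bsub>M\<^esub> (\<Oplus>\<^bsub>M\<^esub>i\<in>{..<n}. f (Suc i))"
proof -
  have "(\<Oplus>\<^bsub>M\<^esub>i\<in>Suc ` {..<n}. f i) = (\<Oplus>\<^bsub>M\<^esub>i\<in>{..<n}. f (Suc i))"
    by (rule M.finsum_reindex) (use assms in auto)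
  moreover have "(\<Oplus>\<^bsub>M\<^esub>i\<in>insert 0 (Suc ` {..<n}). f i) = f 0 \<oplus>\<^bsub>M\<^esub> (\<Oplus>\<^bsub>M\<^esub>i\<in>Suc ` {..<n}. f i)"
    by (rule M.finsum_insert) (use assms in auto)
  ultimately show ?thesis by (simp add: lessThan_Suc_eq_insert_0)
qed

text \<open>This links the recursive sum with the explicit signs in
  \<open>grp_coboundary\<close>.\<close>

lemma alt_finsum:
  "(\<And>m. set m \<subseteq> set l \<Longrightarrow> Suc (length m) = length l \<Longrightarrow> v m \<in> carrier M)
    \<Longrightarrow> alt M v l = (\<Oplus>\<^bsub>M\<^esub>i\<in>{..<length l}. ((\<ominus>\<^bsub>R\<^esub> \<one>\<^bsub>R\<^esub>) [^]\<^bsub>R\<^esub> i) \<odot>\<^bsub>M\<^esub> v (take i l @ drop (Suc i) l))"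
proof (induction l arbitrary: v)
  case (Cons x l)
  let ?s = "\<lambda>i::nat. (\<ominus>\<^bsub>R\<^esub> \<one>\<^bsub>R\<^esub>) [^]\<^bsub>R\<^esub> i"
  have c: "v (take i (x # l) @ drop (Suc i) (x # l)) \<in> carrier M" if "i < length (x # l)" for i
  proof (rule Cons.prems)
    show "set (take i (x # l) @ drop (Suc i) (x # l)) \<subseteq> set (x # l)"
      by (simp only: set_append Un_subset_iff set_take_subset set_drop_subset simp_thms)
    show "Suc (length (take i (x # l) @ drop (Suc i) (x # l))) = length (x # l)" using that by simp
  qed
  have IH: "alt M (\<lambda>m. v (x # m)) l = (\<Oplus>\<^bsub>M\<^esub>i\<in>{..<length l}. ?s i \<odot>\<^bsub>M\<^esub> v (x # take i l @ drop (Suc i) l))"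
    by (rule Cons.IH) (auto intro!: Cons.prems)
  have c': "v (x # take i l @ drop (Suc i) l) \<in> carrier M" if "i < length l" for i
    using c[of "Suc i"] that by simp
  have "(\<Oplus>\<^bsub>M\<^esub>i\<in>{..<length (x # l)}. ?s i \<odot>\<^bsub>M\<^esub> v (take i (x # l) @ drop (Suc i) (x # l)))
      = ?s 0 \<odot>\<^bsub>M\<^esub> v l \<oplus>\<^bsub>M\<^esub> (\<Oplus>\<^bsub>M\<^esub>i\<in>{..<length l}. ?s (Suc i) \<odot>\<^bsub>M\<^esub> v (x # take i l @ drop (Suc i) l))"
    using c finsum_lessThan_Suc_shift[of "length l" "\<lambda>i. ?s i \<odot>\<^bsub>M\<^esub> v (take i (x # l) @ drop (Suc i) (x # l))"] by simp
  also have "(\<Oplus>\<^bsub>M\<^esub>i\<in>{..<length l}. ?s (Suc i) \<odot>\<^bsub>M\<^esub> v (x # take i l @ drop (Suc i) l))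
      = (\<Oplus>\<^bsub>M\<^esub>i\<in>{..<length l}. (\<ominus>\<^bsub>R\<^esub> \<one>\<^bsub>R\<^esub>) \<odot>\<^bsub>M\<^esub> (?s i \<odot>\<^bsub>M\<^esub> v (x # take i l @ drop (Suc i) l)))"
    by (rule M.finsum_cong') (use c' in \<open>auto simp: smult_assoc1[symmetric] R.m_comm\<close>)
  also have "\<dots> = (\<ominus>\<^bsub>R\<^esub> \<one>\<^bsub>R\<^esub>) \<odot>\<^bsub>M\<^esub> alt M (\<lambda>m. v (x # m)) l"
    unfolding IH by (rule finsum_smult_ldistr[symmetric]) (use c' in auto)
  also have "\<dots> = \<ominus>\<^bsub>M\<^esub> alt M (\<lambda>m. v (x # m)) l"
    by (rule module_minus_one[OF module_axioms, symmetric], rule alt_closed) (auto intro!: Cons.prems)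
  finally show ?case using c[of 0] by (simp add: a_minus_def)
qed simp

end

lemma altsum_hom:
  assumes "module R A" "module R B" "f \<in> mod_hom R A B"
  shows "set xs \<subseteq> carrier A \<Longrightarrow> f (altsum A xs) = altsum B (map f xs)"
proof (induction xs)
  case (Cons x xs)
  then show ?case using module.altsum_closed[OF assms(1), of xs] by (simp add: mod_hom_minus[OF assms])
qed (simp add: mod_hom_zero[OF assms])

lemma alt_hom:
  assumes "module R A" "module R B" "f \<in> mod_hom R A B"
    and "\<And>m. set m \<subseteq> set l \<Longrightarrow> Suc (length m) = length l \<Longrightarrow> v m \<in> carrier A"
  shows "f (alt A v l) = alt B (\<lambda>m. f (v m)) l"
  using altsum_hom[OF assms(1-3), of "map v (faces l)"] assms(4) mem_faces[of _ l] by (auto simp: alt_def comp_def)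

lemma alt_fun_hom:
  assumes A: "module R A" and B: "module R B"
    and v: "\<And>m. set m \<subseteq> set l \<Longrightarrow> Suc (length m) = length l \<Longrightarrow> (\<lambda>a. v a m) \<in> mod_hom R A B"
  shows "(\<lambda>a. alt B (v a) l) \<in> mod_hom R A B"
proof (rule mod_homI)
  interpret B: module R B by (rule B)
  note c = mod_hom_closed[OF v]
  fix a assume a: "a \<in> carrier A"
  show "alt B (v a) l \<in> carrier B" by (rule B.alt_closed) (rule c[OF _ _ a])
  { fix b assume b: "b \<in> carrier A"
    have "alt B (v (a \<oplus>\<^bsub>A\<^esub> b)) l = alt B (\<lambda>m. v a m \<oplus>\<^bsub>B\<^esub> v b m) l"
      by (rule alt_cong) (rule mod_hom_add[OF v a b])
    then show "alt B (v (a \<oplus>\<^bsub>A\<^esub> b)) l = alt B (v a) l \<oplus>\<^bsub>B\<^esub> alt B (v b) l"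
      using B.alt_add[of l "v a" "v b"] c a b by simp }
  { fix r assume r: "r \<in> carrier R"
    have "alt B (v (r \<odot>\<^bsub>A\<^esub> a)) l = alt B (\<lambda>m. r \<odot>\<^bsub>B\<^esub> v a m) l"
      by (rule alt_cong) (rule mod_hom_smult[OF v r a])
    also have "\<dots> = r \<odot>\<^bsub>B\<^esub> alt B (v a) l"
      by (rule alt_hom[symmetric, OF B B mod_hom_scalar[OF B r]]) (rule c[OF _ _ a])
    finally show "alt B (v (r \<odot>\<^bsub>A\<^esub> a)) l = r \<odot>\<^bsub>B\<^esub> alt B (v a) l" . }
qed

lemma prism_hom:
  assumes "module R A" "module R B" "f \<in> mod_hom R A B"
    and "\<And>m. set m \<subseteq> a ` set l \<union> b ` set l \<Longrightarrow> length m = Suc (length l) \<Longrightarrow> v m \<in> carrier A"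
  shows "f (prism A a b v l) = prism B a b (\<lambda>m. f (v m)) l"
proof -
  have "set (map v (prisms a b l)) \<subseteq> carrier A" using assms(4) by (auto dest!: mem_prisms)
  from altsum_hom[OF assms(1-3) this] show ?thesis by (simp add: prism_def comp_def)
qed

section \<open>Homogeneous cochains\<close>

lemma grp_cochains_prod: "grp_cochains K A q = prod_mod (tuples K q) (\<lambda>_. A)"
  by (simp add: grp_cochains_def prod_mod_def)

lemma module_cochains: "module R A \<Longrightarrow> module R (grp_cochains K A q)"
  unfolding grp_cochains_prod by (rule module_prod) (simp_all add: module_def)

lemma cochains_simps:
  "carrier (grp_cochains K A q) = (tuples K q \<rightarrow>\<^sub>E carrier A)"
  "\<zero>\<^bsub>grp_cochains K A q\<^esub> = (\<lambda>ks\<in>tuples K q. \<zero>\<^bsub>A\<^esub>)"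
  "u \<oplus>\<^bsub>grp_cochains K A q\<^esub> v = (\<lambda>ks\<in>tuples K q. u ks \<oplus>\<^bsub>A\<^esub> v ks)"
  "r \<odot>\<^bsub>grp_cochains K A q\<^esub> u = (\<lambda>ks\<in>tuples K q. r \<odot>\<^bsub>A\<^esub> u ks)"
  by (simp_all add: grp_cochains_def)

text \<open>\<open>R[G\<^sup>q\<^sup>+\<^sup>1]\<close> is a free \<open>K\<close>-module for every \<open>K \<le> G\<close>, so the \<open>K\<close>-equivariant maps \<open>G\<^sup>q\<^sup>+\<^sup>1 \<rightarrow> M(K)\<close> also
  compute \<open>H\<^sup>*(K; M(K))\<close>. Unlike the inhomogeneous cochains of \<open>K\<close> they form a module over the
  orbit category.\<close>

definition equivariant_cochains :: "('g, 'y) monoid_scheme \<Rightarrow> ('g set, 'g, 'r, 'a) rcmod \<Rightarrow> nat \<Rightarrow> 'g set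
    \<Rightarrow> ('g list \<Rightarrow> 'a) set" where
  "equivariant_cochains G M q K = {v \<in> tuples G (Suc q) \<rightarrow>\<^sub>E elts M K.
     \<forall>k\<in>K. \<forall>l\<in>tuples G (Suc q). act M K K k (v (map ((\<otimes>\<^bsub>G\<^esub>) k) l)) = v l}"

text \<open>A morphism translates the arguments by a representative g and then applies M(g). Another
  representative k g gives the same result by equivariance under k, which is \<open>D_rep\<close>
  below.\<close>

definition hcochains :: "('g, 'y) monoid_scheme \<Rightarrow> ('g set, 'g, 'r, 'a) rcmod \<Rightarrow> nat
    \<Rightarrow> ('g set, 'g set, 'r, 'g list \<Rightarrow> 'a) rcmod" where
  "hcochains G M q =
     \<lparr>val = (\<lambda>K. grp_cochains G (val M K) (Suc q)\<lparr>carrier := equivariant_cochains G M q K\<rparr>),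
      act = (\<lambda>H K X v. let g = (SOME g. g \<in> X) in
        (\<lambda>l\<in>tuples G (Suc q). act M H K g (v (map ((\<otimes>\<^bsub>G\<^esub>) g) l))))\<rparr>"

lemma (in group) tuples_mult: "g \<in> carrier G \<Longrightarrow> l \<in> tuples G n \<Longrightarrow> map ((\<otimes>) g) l \<in> tuples G n"
  by (auto simp: tuples_def)

lemma (in group) map_mult_mult:
  "g \<in> carrier G \<Longrightarrow> h \<in> carrier G \<Longrightarrow> l \<in> tuples G n \<Longrightarrow> map ((\<otimes>) g) (map ((\<otimes>) h) l) = map ((\<otimes>) (g \<otimes> h)) l"
  by (auto simp: tuples_def m_assoc subset_iff)

locale transporter_setting = group G for R :: "('r, 'x) ring_scheme" and G :: "('g, 'y) monoid_scheme" (structure)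
  and \<H> :: "'g set set" +
  assumes cring: "cring R" and subgroups: "\<And>H. H \<in> \<H> \<Longrightarrow> subgroup H G"
begin

abbreviation "TC \<equiv> transporter_category G \<H>"
abbreviation "OC \<equiv> orbit_category G \<H>"
abbreviation "mv \<equiv> (\<lambda>g l. map ((\<otimes>) g) l)"
lemma Ob [simp]: "Ob TC = \<H>" "Ob OC = \<H>" and Mor_T [simp]: "Mor TC = transporter G"
  and Mor_O: "Mor OC H K = (\<lambda>g. K #> g) ` transporter G H K"
  by (simp_all add: transporter_category_def orbit_category_def)

lemma transporter_carrier: "g \<in> transporter G H K \<Longrightarrow> g \<in> carrier G"
  by (simp add: transporter_def)

lemma sub_carrier: "K \<in> \<H> \<Longrightarrow> k \<in> K \<Longrightarrow> k \<in> carrier G"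
  using subgroup.mem_carrier[OF subgroups] .

lemma transporter_conj: "g \<in> transporter G H K \<Longrightarrow> h \<in> H \<Longrightarrow> g \<otimes> h \<otimes> inv g \<in> K"
  by (auto simp: transporter_def conj_eq_image)

lemma sub_transporter: "K \<in> \<H> \<Longrightarrow> k \<in> K \<Longrightarrow> k \<in> transporter G K K"
  using subgroup.m_closed[OF subgroups] subgroup.m_inv_closed[OF subgroups] sub_carrier
  by (auto simp: transporter_def conj_eq_image)

end

locale transporter_module = transporter_setting R G \<H> for R :: "('r, 'x) ring_scheme"
  and G :: "('g, 'y) monoid_scheme" (structure) and \<H> :: "'g set set" +
  fixes M :: "('g set, 'g, 'r, 'a) rcmod"
  assumes M: "right_module R (transporter_category G \<H>) M"
begin

abbreviation "D \<equiv> hcochains G M"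

lemma mod_M: "K \<in> \<H> \<Longrightarrow> module R (val M K)"
  using val_mod[OF M] by simp

lemma act_M_hom: "H \<in> \<H> \<Longrightarrow> K \<in> \<H> \<Longrightarrow> g \<in> transporter G H K \<Longrightarrow> act M H K g \<in> mod_hom R (val M K) (val M H)"
  using right_module.act_hom[OF M] by simp

lemma act_M_closed: "H \<in> \<H> \<Longrightarrow> K \<in> \<H> \<Longrightarrow> g \<in> transporter G H K \<Longrightarrow> a \<in> elts M K \<Longrightarrow> act M H K g a \<in> elts M H"
  using act_closed[OF M] by simp

lemma act_M_mult: "H \<in> \<H> \<Longrightarrow> K \<in> \<H> \<Longrightarrow> L \<in> \<H> \<Longrightarrow> g \<in> transporter G H K \<Longrightarrow> g' \<in> transporter G K L
    \<Longrightarrow> a \<in> elts M L \<Longrightarrow> act M H L (g' \<otimes> g) a = act M H K g (act M K L g' a)"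
  using right_module.act_Cmp[OF M, of H K L g g' a] by (simp add: transporter_category_def)

lemma act_M_one: "K \<in> \<H> \<Longrightarrow> a \<in> elts M K \<Longrightarrow> act M K K \<one> a = a"
  using right_module.act_Idn[OF M, of K a] by (simp add: transporter_category_def)

lemma D_simps:
  "elts (D q) K = equivariant_cochains G M q K"
  "\<zero>\<^bsub>val (D q) K\<^esub> = (\<lambda>l\<in>tuples G (Suc q). \<zero>\<^bsub>val M K\<^esub>)"
  "u \<oplus>\<^bsub>val (D q) K\<^esub> v = (\<lambda>l\<in>tuples G (Suc q). u l \<oplus>\<^bsub>val M K\<^esub> v l)"
  "r \<odot>\<^bsub>val (D q) K\<^esub> u = (\<lambda>l\<in>tuples G (Suc q). r \<odot>\<^bsub>val M K\<^esub> u l)"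
  by (simp_all add: hcochains_def cochains_simps)

lemma D_closed: "v \<in> equivariant_cochains G M q K \<Longrightarrow> l \<in> tuples G (Suc q) \<Longrightarrow> v l \<in> elts M K"
  by (auto simp: equivariant_cochains_def)

lemma D_equivariant: "v \<in> equivariant_cochains G M q K \<Longrightarrow> k \<in> K \<Longrightarrow> l \<in> tuples G (Suc q)
    \<Longrightarrow> act M K K k (v (mv k l)) = v l"
  by (auto simp: equivariant_cochains_def)

lemma D_memI:
  assumes "\<And>l. l \<in> tuples G (Suc q) \<Longrightarrow> v l \<in> elts M K"
    "\<And>k l. k \<in> K \<Longrightarrow> l \<in> tuples G (Suc q) \<Longrightarrow> act M K K k (v (mv k l)) = v l" "K \<in> \<H>"
  shows "(\<lambda>l\<in>tuples G (Suc q). v l) \<in> equivariant_cochains G M q K"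
  using assms tuples_mult sub_carrier by (auto simp: equivariant_cochains_def)

lemma D_eqI:
  assumes "u \<in> equivariant_cochains G M q K" "v \<in> equivariant_cochains G M q K'"
    "\<And>l. l \<in> tuples G (Suc q) \<Longrightarrow> u l = v l"
  shows "u = v"
proof -
  have "u \<in> extensional (tuples G (Suc q))" "v \<in> extensional (tuples G (Suc q))"
    using assms(1,2) by (auto simp: equivariant_cochains_def PiE_iff)
  then show ?thesis by (rule extensionalityI) (rule assms(3))
qed

lemma D_sub: "K \<in> \<H> \<Longrightarrow> submodule (equivariant_cochains G M q K) R (grp_cochains G (val M K) (Suc q))"
proof -
  assume K: "K \<in> \<H>"
  interpret A: module R "val M K" by (rule mod_M[OF K])
  note hom = act_M_hom[OF K K sub_transporter[OF K]]
  show ?thesis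
  proof (rule submoduleI'[OF module_cochains[OF mod_M[OF K]]])
    show "equivariant_cochains G M q K \<subseteq> carrier (grp_cochains G (val M K) (Suc q))"
      by (auto simp: equivariant_cochains_def cochains_simps)
    show "\<zero>\<^bsub>grp_cochains G (val M K) (Suc q)\<^esub> \<in> equivariant_cochains G M q K"
      unfolding cochains_simps
      by (rule D_memI[OF _ _ K]) (simp_all add: mod_hom_zero[OF mod_M[OF K] mod_M[OF K] hom])
  next
    fix u v assume uv: "u \<in> equivariant_cochains G M q K" "v \<in> equivariant_cochains G M q K"
    show "u \<oplus>\<^bsub>grp_cochains G (val M K) (Suc q)\<^esub> v \<in> equivariant_cochains G M q K"
      unfolding cochains_simps
      by (rule D_memI[OF _ _ K])
        (simp_all add: D_closed[OF uv(1)] D_closed[OF uv(2)] mod_hom_add[OF hom] tuples_mult sub_carrier[OF K]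
          D_equivariant[OF uv(1)] D_equivariant[OF uv(2)])
  next
    fix r u assume r: "r \<in> carrier R" and u: "u \<in> equivariant_cochains G M q K"
    show "r \<odot>\<^bsub>grp_cochains G (val M K) (Suc q)\<^esub> u \<in> equivariant_cochains G M q K"
      unfolding cochains_simps
      by (rule D_memI[OF _ _ K])
        (simp_all add: r D_closed[OF u] mod_hom_smult[OF hom] tuples_mult sub_carrier[OF K] D_equivariant[OF u])
  qed
qed

lemma D_val: "K \<in> \<H> \<Longrightarrow> module R (val (D q) K)"
  using module_restrict[OF module_cochains[OF mod_M] D_sub] by (simp add: hcochains_def)

lemma EC_eval: "l \<in> tuples G (Suc q) \<Longrightarrow> (\<lambda>v. v l) \<in> mod_hom R (val (D q) K) (val M K)"
  by (rule mod_homI) (simp_all add: D_simps D_closed)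

lemma EC_hom:
  assumes "module R A" "\<And>a. a \<in> carrier A \<Longrightarrow> f a \<in> equivariant_cochains G M q K"
    and "\<And>l. l \<in> tuples G (Suc q) \<Longrightarrow> (\<lambda>a. f a l) \<in> mod_hom R A (val M K)"
  shows "f \<in> mod_hom R A (val (D q) K)"
proof -
  have "equivariant_cochains G M q K \<subseteq> carrier (prod_mod (tuples G (Suc q)) (\<lambda>_. val M K))"
    by (auto simp: equivariant_cochains_def prod_mod_def)
  from prod_hom[OF assms(2) this assms(1,3)] show ?thesis by (simp add: hcochains_def grp_cochains_prod)
qed

lemma D_rep:
  assumes H: "H \<in> \<H>" and K: "K \<in> \<H>" and g: "g \<in> transporter G H K" and g': "g' \<in> K #> g"
    and v: "v \<in> equivariant_cochains G M q K" and l: "l \<in> tuples G (Suc q)"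
  shows "act M H K g' (v (mv g' l)) = act M H K g (v (mv g l))"
proof -
  obtain k where k: "k \<in> K" "g' = k \<otimes> g" using g' by (auto simp: r_coset_def)
  note gc = transporter_carrier[OF g] and kc = sub_carrier[OF K k(1)]
  have "act M H K g' (v (mv g' l)) = act M H K g (act M K K k (v (mv k (mv g l))))"
    unfolding k(2) map_mult_mult[OF kc gc l]
    by (rule act_M_mult[OF H K K g sub_transporter[OF K k(1)]]) (rule D_closed[OF v tuples_mult[OF _ l]], use kc gc in simp)
  then show ?thesis using D_equivariant[OF v k(1) tuples_mult[OF gc l]] by simp
qed

lemma D_act:
  assumes H: "H \<in> \<H>" and K: "K \<in> \<H>" and g: "g \<in> transporter G H K" and v: "v \<in> equivariant_cochains G M q K"
  shows "act (D q) H K (K #> g) v = (\<lambda>l\<in>tuples G (Suc q). act M H K g (v (mv g l)))"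
proof -
  have "(SOME g'. g' \<in> K #> g) \<in> K #> g"
    using rcos_self[OF transporter_carrier[OF g] subgroups[OF K]] by (rule someI)
  from D_rep[OF H K g this v] show ?thesis
    unfolding hcochains_def by (auto simp: Let_def intro!: restrict_ext)
qed

lemma D_act_mem:
  assumes H: "H \<in> \<H>" and K: "K \<in> \<H>" and g: "g \<in> transporter G H K" and v: "v \<in> equivariant_cochains G M q K"
  shows "(\<lambda>l\<in>tuples G (Suc q). act M H K g (v (mv g l))) \<in> equivariant_cochains G M q H"
proof (rule D_memI[OF _ _ H])
  note gc = transporter_carrier[OF g]
  fix l assume l: "l \<in> tuples G (Suc q)"
  show "act M H K g (v (mv g l)) \<in> elts M H"
    by (rule act_M_closed[OF H K g D_closed[OF v tuples_mult[OF gc l]]])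
  fix h assume h: "h \<in> H"
  note hc = sub_carrier[OF H h]
  have "act M H H h (act M H K g (v (mv g (mv h l)))) = act M H K (g \<otimes> h) (v (mv (g \<otimes> h) l))"
    unfolding map_mult_mult[OF gc hc l]
    by (rule act_M_mult[symmetric, OF H H K sub_transporter[OF H h] g D_closed[OF v tuples_mult[OF _ l]]])
      (use gc hc in simp)
  also have "\<dots> = act M H K g (v (mv g l))"
  proof (rule D_rep[OF H K g _ v l])
    \<comment> \<open>As \<open>g\<close> conjugates \<open>H\<close> into \<open>K\<close>, the
      product g h is another representative of the coset Kg, so \<open>D_rep\<close>
      applies.\<close>
    have "g \<otimes> h = (g \<otimes> h \<otimes> inv g) \<otimes> g" using gc hc by (simp add: m_assoc)
    then show "g \<otimes> h \<in> K #> g" using transporter_conj[OF g h] unfolding r_coset_def by blast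
  qed
  finally show "act M H H h (act M H K g (v (mv g (mv h l)))) = act M H K g (v (mv g l))" .
qed

lemma right_module_D: "right_module R OC (D q)"
proof (intro right_module.intro right_module_axioms.intro cring small_category_orbit subgroups D_val)
  fix H K X assume "H \<in> Ob OC" "K \<in> Ob OC" "X \<in> Mor OC H K"
  then obtain g where g: "H \<in> \<H>" "K \<in> \<H>" "g \<in> transporter G H K" "X = K #> g" by (auto simp: Mor_O)
  note gc = transporter_carrier[OF g(3)] and hom = act_M_hom[OF g(1,2,3)]
  interpret A: module R "val (D q) K" by (rule D_val[OF g(2)])
  show "act (D q) H K X \<in> mod_hom R (val (D q) K) (val (D q) H)"
  proof (rule EC_hom[OF D_val[OF g(2)]])
    show "act (D q) H K X u \<in> equivariant_cochains G M q H" if "u \<in> elts (D q) K" for u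
      using D_act_mem[OF g(1,2,3)] D_act[OF g(1,2,3)] that by (simp add: g(4) D_simps)
    fix l assume l: "l \<in> tuples G (Suc q)"
    have "(\<lambda>u. act (D q) H K X u l) \<in> mod_hom R (val (D q) K) (val M H)
        \<longleftrightarrow> (\<lambda>u. act M H K g (u (mv g l))) \<in> mod_hom R (val (D q) K) (val M H)"
      by (rule mod_hom_cong[OF D_val[OF g(2)]]) (use l D_act[OF g(1,2,3)] in \<open>simp add: g(4) D_simps\<close>)
    then show "(\<lambda>u. act (D q) H K X u l) \<in> mod_hom R (val (D q) K) (val M H)"
      using mod_hom_comp[OF EC_eval[OF tuples_mult[OF gc l]] hom] by blast
  qed
next
  fix K v assume K: "K \<in> Ob OC" and v: "v \<in> elts (D q) K"
  then have K': "K \<in> \<H>" and v': "v \<in> equivariant_cochains G M q K" by (simp_all add: D_simps)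
  have "act (D q) K K (K #> \<one>) v = v"
    unfolding D_act[OF K' K' transporter_one[OF subgroups[OF K']] v']
  proof (rule D_eqI[OF D_act_mem[OF K' K' transporter_one[OF subgroups[OF K']] v'] v'])
    fix l assume l: "l \<in> tuples G (Suc q)"
    then have "mv \<one> l = l" by (auto simp: tuples_def subset_iff intro: map_idI)
    then show "(\<lambda>l\<in>tuples G (Suc q). act M K K \<one> (v (mv \<one> l))) l = v l"
      using l act_M_one[OF K' D_closed[OF v' l]] by simp
  qed
  then show "act (D q) K K (Idn OC K) v = v"
    using subgroup.subset[OF subgroups[OF K']] by (simp add: orbit_category_def)
next
  fix H K L X Y v assume "H \<in> Ob OC" "K \<in> Ob OC" "L \<in> Ob OC" "X \<in> Mor OC H K" "Y \<in> Mor OC K L"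
    and v: "v \<in> elts (D q) L"
  then obtain g h where g: "H \<in> \<H>" "K \<in> \<H>" "L \<in> \<H>" "g \<in> transporter G H K" "X = K #> g" "h \<in> transporter G K L" "Y = L #> h"
    by (auto simp: Mor_O)
  have v': "v \<in> equivariant_cochains G M q L" using v by (simp add: D_simps)
  note gc = transporter_carrier[OF g(4)] and hc = transporter_carrier[OF g(6)]
  have c: "Cmp OC Y X = L #> (h \<otimes> g)"
    using orbit_comp[OF subgroups[OF g(2)] subgroups[OF g(3)] gc g(6)] by (simp add: orbit_category_def g)
  have hg: "h \<otimes> g \<in> transporter G H L" by (rule transporter_mult[OF subgroups[OF g(1)] g(4,6)])
  have "act M H L (h \<otimes> g) (v (mv (h \<otimes> g) l)) = act M H K g (act M K L h (v (mv h (mv g l))))"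
    if l: "l \<in> tuples G (Suc q)" for l
    unfolding map_mult_mult[OF hc gc l]
    by (rule act_M_mult[OF g(1,2,3,4,6) D_closed[OF v' tuples_mult[OF _ l]]]) (use gc hc in simp)
  then show "act (D q) H L (Cmp OC Y X) v = act (D q) H K X (act (D q) K L Y v)"
    unfolding c D_act[OF g(1,3) hg v']
    by (auto simp: g(5,7) D_act[OF g(2,3,6) v'] D_act[OF g(1,2,4) D_act_mem[OF g(2,3,6) v']] tuples_mult[OF gc] intro!: restrict_ext)
qed (auto simp: D_simps)

definition coboundary :: "nat \<Rightarrow> 'g set \<Rightarrow> ('g list \<Rightarrow> 'a) \<Rightarrow> ('g list \<Rightarrow> 'a)" where
  "coboundary q K v = (\<lambda>l\<in>tuples G (Suc (Suc q)). alt (val M K) v l)"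

lemma tuples_face: "l \<in> tuples G (Suc n) \<Longrightarrow> set m \<subseteq> set l \<Longrightarrow> Suc (length m) = length l \<Longrightarrow> m \<in> tuples G n"
  by (auto simp: tuples_def)

lemma coboundary_mem:
  assumes K: "K \<in> \<H>" and v: "v \<in> equivariant_cochains G M q K"
  shows "coboundary q K v \<in> equivariant_cochains G M (Suc q) K"
  unfolding coboundary_def
proof (rule D_memI[OF _ _ K])
  interpret A: module R "val M K" by (rule mod_M[OF K])
  fix l assume l: "l \<in> tuples G (Suc (Suc q))"
  show "alt (val M K) v l \<in> elts M K"
    by (rule A.alt_closed) (rule D_closed[OF v tuples_face[OF l]])
  fix k assume k: "k \<in> K"
  note kc = sub_carrier[OF K k]
  have "act M K K k (alt (val M K) v (mv k l)) = alt (val M K) (\<lambda>m. act M K K k (v (mv k m))) l"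
    unfolding alt_map
    by (rule alt_hom[OF mod_M[OF K] mod_M[OF K] act_M_hom[OF K K sub_transporter[OF K k]]])
      (rule D_closed[OF v tuples_mult[OF kc tuples_face[OF l]]])
  also have "\<dots> = alt (val M K) v l"
    by (rule alt_cong) (rule D_equivariant[OF v k tuples_face[OF l]])
  finally show "act M K K k (alt (val M K) v (mv k l)) = alt (val M K) v l" .
qed

lemma coboundary_coboundary:
  assumes K: "K \<in> \<H>" and v: "v \<in> equivariant_cochains G M q K"
  shows "coboundary (Suc q) K (coboundary q K v) = \<zero>\<^bsub>val (D (Suc (Suc q))) K\<^esub>"
  unfolding D_simps coboundary_def[of "Suc q"]
proof (rule restrict_ext)
  interpret A: module R "val M K" by (rule mod_M[OF K])
  fix l assume l: "l \<in> tuples G (Suc (Suc (Suc q)))"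
  have "alt (val M K) (coboundary q K v) l = alt (val M K) (alt (val M K) v) l"
    by (rule alt_cong) (simp add: coboundary_def tuples_face[OF l])
  also have "\<dots> = \<zero>\<^bsub>val M K\<^esub>"
  proof (rule A.alt_alt)
    fix m assume "set m \<subseteq> set l" "Suc (Suc (length m)) = length l"
    then show "v m \<in> elts M K" using l by (intro D_closed[OF v]) (auto simp: tuples_def)
  qed
  finally show "alt (val M K) (coboundary q K v) l = \<zero>\<^bsub>val M K\<^esub>" .
qed

lemma coboundary_hom:
  assumes K: "K \<in> \<H>"
  shows "coboundary q K \<in> mod_hom R (val (D q) K) (val (D (Suc q)) K)"
proof (rule EC_hom[OF D_val[OF K]])
  show "coboundary q K v \<in> equivariant_cochains G M (Suc q) K" if "v \<in> elts (D q) K" for v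
    using coboundary_mem[OF K] that by (simp add: D_simps)
  fix l assume l: "l \<in> tuples G (Suc (Suc q))"
  have "(\<lambda>v. alt (val M K) v l) \<in> mod_hom R (val (D q) K) (val M K)"
    by (rule alt_fun_hom[OF D_val[OF K] mod_M[OF K]]) (rule EC_eval[OF tuples_face[OF l]])
  then show "(\<lambda>v. coboundary q K v l) \<in> mod_hom R (val (D q) K) (val M K)" using l by (simp add: coboundary_def)
qed

lemma coboundary_act:
  assumes H: "H \<in> \<H>" and K: "K \<in> \<H>" and X: "X \<in> Mor OC H K" and v: "v \<in> equivariant_cochains G M q K"
  shows "coboundary q H (act (D q) H K X v) = act (D (Suc q)) H K X (coboundary q K v)"
proof -
  obtain g where g: "g \<in> transporter G H K" "X = K #> g" using X by (auto simp: Mor_O)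
  note gc = transporter_carrier[OF g(1)]
  show ?thesis
    unfolding g(2) D_act[OF H K g(1) v] D_act[OF H K g(1) coboundary_mem[OF K v]]
    unfolding coboundary_def
  proof (rule restrict_ext)
    fix l assume l: "l \<in> tuples G (Suc (Suc q))"
    have "alt (val M H) (\<lambda>l\<in>tuples G (Suc q). act M H K g (v (mv g l))) l
        = alt (val M H) (\<lambda>l. act M H K g (v (mv g l))) l"
      by (rule alt_cong) (simp add: tuples_face[OF l])
    also have "\<dots> = act M H K g (alt (val M K) v (mv g l))"
      unfolding alt_map
      by (rule alt_hom[symmetric, OF mod_M[OF K] mod_M[OF H] act_M_hom[OF H K g(1)]])
        (rule D_closed[OF v tuples_mult[OF gc tuples_face[OF l]]])
    finally show "alt (val M H) (\<lambda>l\<in>tuples G (Suc q). act M H K g (v (mv g l))) l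
        = act M H K g ((\<lambda>l\<in>tuples G (Suc (Suc q)). alt (val M K) v l) (mv g l))"
      using tuples_mult[OF gc l] by simp
  qed
qed

definition "dD q = nt OC (D q) (coboundary q)"

lemma dD_mem: "dD q \<in> nat_trans R OC (D q) (D (Suc q))"
  unfolding dD_def by (rule nat_transI[OF right_module_D])
    (simp_all add: coboundary_hom coboundary_act D_simps)

lemma dD_apply: "K \<in> \<H> \<Longrightarrow> v \<in> elts (D q) K \<Longrightarrow> dD q K v = coboundary q K v"
  by (simp add: dD_def)

end

section \<open>The coefficient system as a quotient of equivariant cocycles\<close>

text \<open>With x = 1 this is the passage from an inhomogeneous tuple (k1, ..., kq) to the
  homogeneous one (1, k1, k1 k2, ...); \<open>quotients\<close> undoes it.\<close>

fun partial_products :: "('g, 'y) monoid_scheme \<Rightarrow> 'g \<Rightarrow> 'g list \<Rightarrow> 'g list" where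
  "partial_products G x [] = [x]"
| "partial_products G x (k # ks) = x # partial_products G (x \<otimes>\<^bsub>G\<^esub> k) ks"

fun quotients :: "('g, 'y) monoid_scheme \<Rightarrow> 'g \<Rightarrow> 'g list \<Rightarrow> 'g list" where
  "quotients G x [] = []"
| "quotients G x (y # l) = (inv\<^bsub>G\<^esub> x \<otimes>\<^bsub>G\<^esub> y) # quotients G y l"

lemma length_partial_products [simp]: "length (partial_products G x ks) = Suc (length ks)"
  by (induction ks arbitrary: x) simp_all

lemma length_quotients [simp]: "length (quotients G x l) = length l"
  by (induction l arbitrary: x) simp_all

lemma partial_products_neq_Nil [simp]: "partial_products G x ks \<noteq> []"
  by (cases ks) simp_all

context group
begin

lemma partial_products_quotients:
  "x \<in> carrier G \<Longrightarrow> set l \<subseteq> carrier G \<Longrightarrow> partial_products G x (quotients G x l) = x # l"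
  by (induction l arbitrary: x) (simp_all flip: m_assoc)

lemma quotients_partial_products:
  "x \<in> carrier G \<Longrightarrow> set ks \<subseteq> carrier G \<Longrightarrow> quotients G x (tl (partial_products G x ks)) = ks"
proof (induction ks arbitrary: x)
  case (Cons k ks)
  have "partial_products G (x \<otimes> k) ks = (x \<otimes> k) # tl (partial_products G (x \<otimes> k) ks)"
    by (cases ks) simp_all
  then have "quotients G x (partial_products G (x \<otimes> k) ks) = (inv x \<otimes> (x \<otimes> k)) # quotients G (x \<otimes> k) (tl (partial_products G (x \<otimes> k) ks))"
    by (metis quotients.simps(2))
  then show ?case using Cons by (simp add: m_assoc[symmetric])
qed simp

lemma partial_products_closed:
  "subgroup K G \<Longrightarrow> x \<in> K \<Longrightarrow> set ks \<subseteq> K \<Longrightarrow> set (partial_products G x ks) \<subseteq> K"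
  by (induction ks arbitrary: x) (simp_all add: subgroup.m_closed)

lemma quotients_closed:
  "subgroup K G \<Longrightarrow> x \<in> K \<Longrightarrow> set l \<subseteq> K \<Longrightarrow> set (quotients G x l) \<subseteq> K"
  by (induction l arbitrary: x) (simp_all add: subgroup.m_closed subgroup.m_inv_closed)

lemma partial_products_mult:
  "g \<in> carrier G \<Longrightarrow> x \<in> carrier G \<Longrightarrow> set ks \<subseteq> carrier G
    \<Longrightarrow> map ((\<otimes>) g) (partial_products G x ks) = partial_products G (g \<otimes> x) ks"
  by (induction ks arbitrary: x) (simp_all add: m_assoc)

lemma quotients_mult:
  "g \<in> carrier G \<Longrightarrow> x \<in> carrier G \<Longrightarrow> set l \<subseteq> carrier G
    \<Longrightarrow> quotients G (g \<otimes> x) (map ((\<otimes>) g) l) = quotients G x l"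
proof (induction l arbitrary: x)
  case (Cons y l)
  have "inv (g \<otimes> x) \<otimes> (g \<otimes> y) = inv x \<otimes> y"
    using Cons.prems inv_solve_left m_assoc by (simp add: inv_mult_group) (metis inv_closed l_inv l_one m_closed m_assoc)
  then show ?case using Cons by simp
qed simp

lemma partial_products_conj:
  "g \<in> carrier G \<Longrightarrow> x \<in> carrier G \<Longrightarrow> set ks \<subseteq> carrier G
    \<Longrightarrow> map (\<lambda>h. g \<otimes> h \<otimes> inv g) (partial_products G x ks)
      = partial_products G (g \<otimes> x \<otimes> inv g) (map (\<lambda>h. g \<otimes> h \<otimes> inv g) ks)"
proof (induction ks arbitrary: x)
  case (Cons k ks)
  have "g \<otimes> x \<otimes> inv g \<otimes> (g \<otimes> k \<otimes> inv g) = g \<otimes> (x \<otimes> k) \<otimes> inv g"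
  proof -
    have "inv g \<otimes> (g \<otimes> (k \<otimes> inv g)) = k \<otimes> inv g" using Cons.prems by (simp flip: m_assoc)
    then show ?thesis using Cons.prems by (simp add: m_assoc)
  qed
  then show ?case using Cons by simp
qed simp

lemma partial_products_face:
  "x \<in> carrier G \<Longrightarrow> set ks \<subseteq> carrier G \<Longrightarrow> Suc i < length ks \<Longrightarrow>
    take (Suc i) (partial_products G x ks) @ drop (Suc (Suc i)) (partial_products G x ks)
      = partial_products G x (take i ks @ [ks ! i \<otimes> ks ! Suc i] @ drop (i + 2) ks)"
proof (induction ks arbitrary: x i)
  case (Cons k ks)
  show ?case
  proof (cases i)
    case 0
    with Cons.prems obtain k' ks' where "ks = k' # ks'" by (cases ks) auto
    then show ?thesis using 0 Cons.prems by (simp add: m_assoc)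
  next
    case (Suc j)
    then show ?thesis using Cons.IH[of "x \<otimes> k" j] Cons.prems by simp
  qed
qed simp

lemma partial_products_butlast:
  "ks \<noteq> [] \<Longrightarrow> butlast (partial_products G x ks) = partial_products G x (butlast ks)"
  by (induction ks arbitrary: x) auto

text \<open>As a left \<open>K\<close>-set, \<open>G\<close> is free on a set of representatives of
  the cosets Kg; s g is the factor from \<open>K\<close> when g is written in terms of its
  representative.\<close>

lemma subgroup_retraction:
  assumes K: "subgroup K G"
  shows "\<exists>s. (\<forall>g\<in>carrier G. s g \<in> K) \<and> (\<forall>k\<in>K. \<forall>g\<in>carrier G. s (k \<otimes> g) = k \<otimes> s g) \<and> (\<forall>k\<in>K. s k = k)"
proof -
  \<comment> \<open>The coset \<open>K\<close> itself is represented by the unit, which makes s the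
    identity on \<open>K\<close>.\<close>
  define r where "r C = (if C = K then \<one> else SOME x. x \<in> C)" for C
  have r: "r (K #> g) \<in> K #> g" if "g \<in> carrier G" for g
    using rcos_self[OF that K] subgroup.one_closed[OF K] by (auto simp: r_def intro: someI)
  define s where "s g = g \<otimes> inv r (K #> g)" for g
  note Kc = subgroup.mem_carrier[OF K]
  have rc: "r (K #> g) \<in> carrier G" if "g \<in> carrier G" for g
    using r[OF that] Kc that by (auto simp: r_coset_def)
  show ?thesis
  proof (intro exI[of _ s] conjI ballI)
    fix g assume g: "g \<in> carrier G"
    from r[OF g] obtain k where k: "k \<in> K" "r (K #> g) = k \<otimes> g" by (auto simp: r_coset_def)
    have "s g = inv k" unfolding s_def k(2) using Kc[OF k(1)] g by (simp add: inv_mult_group m_assoc[symmetric])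
    then show "s g \<in> K" using k(1) subgroup.m_inv_closed[OF K] by simp
  next
    fix k g assume k: "k \<in> K" and g: "g \<in> carrier G"
    have "K #> (k \<otimes> g) = K #> g"
      using coset_mult_assoc[OF subgroup.subset[OF K] Kc[OF k] g] coset_join2[OF Kc[OF k] K k] by simp
    then show "s (k \<otimes> g) = k \<otimes> s g" using Kc[OF k] g rc[OF g] by (simp add: s_def m_assoc)
  next
    fix k assume k: "k \<in> K"
    have "K #> k = K" by (rule coset_join2[OF Kc[OF k] K k])
    then show "s k = k" using Kc[OF k] by (simp add: s_def r_def)
  qed
qed

end

text \<open>\<open>cohom_rcmod\<close> takes the image of a whole coset and adds the coboundaries;
  the result is a coset again as soon as that image lies in one.\<close>

lemma (in subquotient) set_add_coset:
  assumes "y \<in> carrier M" "S \<subseteq> B +>\<^bsub>M\<^esub> y" "S \<noteq> {}"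
  shows "B <+>\<^bsub>M\<^esub> S = B +>\<^bsub>M\<^esub> y"
proof
  show "B <+>\<^bsub>M\<^esub> S \<subseteq> B +>\<^bsub>M\<^esub> y"
  proof
    fix x assume "x \<in> B <+>\<^bsub>M\<^esub> S"
    then obtain b b' where b: "b \<in> B" "b' \<in> B" "x = b \<oplus>\<^bsub>M\<^esub> (b' \<oplus>\<^bsub>M\<^esub> y)"
      using assms(2) by (auto simp: mem_set_add a_r_coset_def')
    then have "x = (b \<oplus>\<^bsub>M\<^esub> b') \<oplus>\<^bsub>M\<^esub> y" using B_carrier assms(1) by (simp add: M.a_assoc)
    then show "x \<in> B +>\<^bsub>M\<^esub> y" using submodule_add[OF B b(1,2)] by (auto simp: a_r_coset_def')
  qed
  show "B +>\<^bsub>M\<^esub> y \<subseteq> B <+>\<^bsub>M\<^esub> S"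
  proof
    fix x assume "x \<in> B +>\<^bsub>M\<^esub> y"
    then obtain b where b: "b \<in> B" "x = b \<oplus>\<^bsub>M\<^esub> y" by (auto simp: a_r_coset_def')
    from assms(3) obtain s where s: "s \<in> S" by blast
    then obtain b' where b': "b' \<in> B" "s = b' \<oplus>\<^bsub>M\<^esub> y" using assms(2) by (auto simp: a_r_coset_def')
    have "x = (b \<ominus>\<^bsub>M\<^esub> b') \<oplus>\<^bsub>M\<^esub> s"
      using b b' B_carrier assms(1) by (simp add: a_minus_def M.a_assoc M.r_neg1)
    then show "x \<in> B <+>\<^bsub>M\<^esub> S" using submodule_minus[OF B b(1) b'(1)] s by (auto simp: mem_set_add)
  qed
qed

text \<open>Functor laws pass to the target of an objectwise surjection that commutes with the
  actions. They need not be verified directly for an action defined through chosen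
  representatives.\<close>

lemma right_module_surjective_image:
  assumes A: "right_module R C A" and B: "\<And>x. x \<in> Ob C \<Longrightarrow> module R (val B x)"
    and \<theta>: "\<And>x. x \<in> Ob C \<Longrightarrow> \<theta> x \<in> mod_hom R (val A x) (val B x)"
    and surj: "\<And>x. x \<in> Ob C \<Longrightarrow> elts B x \<subseteq> \<theta> x ` elts A x"
    and nat: "\<And>x y f a. x \<in> Ob C \<Longrightarrow> y \<in> Ob C \<Longrightarrow> f \<in> Mor C x y \<Longrightarrow> a \<in> elts A y
      \<Longrightarrow> act B x y f (\<theta> y a) = \<theta> x (act A x y f a)"
  shows "right_module R C B"
proof -
  interpret A: right_module R C A by (rule A)
  have s: "\<exists>a\<in>elts A x. b = \<theta> x a" if "x \<in> Ob C" "b \<in> elts B x" for x b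
    using surj[OF that(1)] that(2) by auto
  show ?thesis
  proof (intro right_module.intro right_module_axioms.intro A.R.is_cring A.small_category_axioms B)
    fix x y f assume f: "x \<in> Ob C" "y \<in> Ob C" "f \<in> Mor C x y"
    interpret Ay: module R "val A y" by (rule val_mod[OF A f(2)])
    note ac = act_closed[OF A f]
    show "act B x y f \<in> mod_hom R (val B y) (val B x)"
    proof (rule mod_homI)
      fix b assume "b \<in> elts B y"
      then obtain a where a: "a \<in> elts A y" "b = \<theta> y a" using s[OF f(2)] by blast
      show "act B x y f b \<in> elts B x"
        using mod_hom_closed[OF \<theta>[OF f(1)] ac[OF a(1)]] by (simp add: a nat[OF f])
      { fix b' assume "b' \<in> elts B y"
        then obtain a' where a': "a' \<in> elts A y" "b' = \<theta> y a'" using s[OF f(2)] by blast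
        have "act B x y f (\<theta> y (a \<oplus>\<^bsub>val A y\<^esub> a')) = \<theta> x (act A x y f a) \<oplus>\<^bsub>val B x\<^esub> \<theta> x (act A x y f a')"
          using a a' by (simp add: nat[OF f] act_add[OF A f] mod_hom_add[OF \<theta>[OF f(1)]] ac)
        then show "act B x y f (b \<oplus>\<^bsub>val B y\<^esub> b') = act B x y f b \<oplus>\<^bsub>val B x\<^esub> act B x y f b'"
          using a a' by (simp add: nat[OF f] mod_hom_add[OF \<theta>[OF f(2)]]) }
      { fix r assume r: "r \<in> carrier R"
        have "act B x y f (\<theta> y (r \<odot>\<^bsub>val A y\<^esub> a)) = r \<odot>\<^bsub>val B x\<^esub> \<theta> x (act A x y f a)"
          using a r by (simp add: nat[OF f] act_smult[OF A f] mod_hom_smult[OF \<theta>[OF f(1)]] ac)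
        then show "act B x y f (r \<odot>\<^bsub>val B y\<^esub> b) = r \<odot>\<^bsub>val B x\<^esub> act B x y f b"
          using a r by (simp add: nat[OF f] mod_hom_smult[OF \<theta>[OF f(2)]]) }
    qed
  next
    fix x b assume x: "x \<in> Ob C" and "b \<in> elts B x"
    then obtain a where a: "a \<in> elts A x" "b = \<theta> x a" using s by blast
    then show "act B x x (Idn C x) b = b" using x by (simp add: nat A.Idn_closed A.act_Idn)
  next
    fix x y z f g b assume f: "x \<in> Ob C" "y \<in> Ob C" "z \<in> Ob C" "f \<in> Mor C x y" "g \<in> Mor C y z"
      and "b \<in> elts B z"
    then obtain a where a: "a \<in> elts A z" "b = \<theta> z a" using s by blast
    then show "act B x z (Cmp C g f) b = act B x y f (act B y z g b)"
      using f by (simp add: nat A.Cmp_closed[of x y z] A.act_Cmp[of x y z] act_closed[OF A])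
  qed
qed

section \<open>Restriction to inhomogeneous cochains of a subgroup\<close>

context transporter_module
begin

abbreviation "EC \<equiv> equivariant_cochains G M"
abbreviation "KC \<equiv> \<lambda>q K. grp_cochains (G\<lparr>carrier := K\<rparr>) (val M K) q"
abbreviation "cob \<equiv> \<lambda>q K. grp_coboundary R (G\<lparr>carrier := K\<rparr>) (val M K) (left_act G M K) q"

lemma mem_tuples_sub: "ks \<in> tuples (G\<lparr>carrier := K\<rparr>) q \<longleftrightarrow> length ks = q \<and> set ks \<subseteq> K"
  by (simp add: tuples_def)

lemma KC_val: "K \<in> \<H> \<Longrightarrow> module R (KC q K)"
  by (rule module_cochains[OF mod_M])

text \<open>Restriction of a homogeneous cochain from tuples in \<open>G\<close> to tuples in
  \<open>K\<close> beginning with 1, in inhomogeneous notation.\<close>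

definition rho :: "nat \<Rightarrow> 'g set \<Rightarrow> ('g list \<Rightarrow> 'a) \<Rightarrow> ('g list \<Rightarrow> 'a)" where
  "rho q K v = (\<lambda>ks\<in>tuples (G\<lparr>carrier := K\<rparr>) q. v (partial_products G \<one> ks))"

lemma pp_tuples: "K \<in> \<H> \<Longrightarrow> x \<in> K \<Longrightarrow> ks \<in> tuples (G\<lparr>carrier := K\<rparr>) q \<Longrightarrow> partial_products G x ks \<in> tuples G (Suc q)"
  using partial_products_closed[OF subgroups, of K x ks] sub_carrier[of K] by (auto simp: tuples_def)

lemmas one_mem = subgroup.one_closed[OF subgroups]

lemma rho_hom: "K \<in> \<H> \<Longrightarrow> rho q K \<in> mod_hom R (val (D q) K) (KC q K)"
  by (rule mod_homI)
    (auto simp: rho_def D_simps cochains_simps pp_tuples one_mem D_closed intro!: restrict_ext)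

lemma rho_mem: "K \<in> \<H> \<Longrightarrow> v \<in> EC q K \<Longrightarrow> rho q K v \<in> carrier (KC q K)"
  using mod_hom_closed[OF rho_hom] by (simp add: D_simps)

text \<open>Read in terms of the left action, membership in \<open>EC\<close> is the familiar
  condition v(k l) = k v(l).\<close>

lemma left_act_eq:
  assumes K: "K \<in> \<H>" and v: "v \<in> EC q K" and k: "k \<in> K" and l: "l \<in> tuples G (Suc q)"
  shows "left_act G M K k (v l) = v (mv k l)"
proof -
  note kc = sub_carrier[OF K k]
  have "mv (inv k) (mv k l) = l"
    using map_mult_mult[OF inv_closed[OF kc] kc l] kc l by (auto simp: tuples_def subset_iff intro!: map_idI)
  then show ?thesis
    using D_equivariant[OF v subgroup.m_inv_closed[OF subgroups[OF K] k] tuples_mult[OF kc l]]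
    by (simp add: left_act_def)
qed

text \<open>Face by face: omitting the leading 1 leaves a tuple beginning with the first entry,
  which equivariance turns into the action term; omitting an inner vertex multiplies two neighbours;
  omitting the last vertex drops the last entry.\<close>

lemma cob_rho:
  assumes K: "K \<in> \<H>" and v: "v \<in> EC q K"
  shows "cob q K (rho q K v) = rho (Suc q) K (coboundary q K v)"
  unfolding grp_coboundary_def rho_def[of "Suc q"]
proof (rule restrict_ext)
  fix ks assume ks: "ks \<in> tuples (G\<lparr>carrier := K\<rparr>) (Suc q)"
  interpret A: module R "val M K" by (rule mod_M[OF K])
  note sub = subgroups[OF K]
  have len: "length ks = Suc q" and set: "set ks \<subseteq> K" using ks by (auto simp: tuples_def)
  then obtain k ks' where k: "ks = k # ks'" by (cases ks) auto
  have kK: "k \<in> K" "set ks' \<subseteq> K" and kc: "set ks \<subseteq> carrier G" "k \<in> carrier G" "set ks' \<subseteq> carrier G"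
    using set k sub_carrier[OF K] by auto
  let ?p = "partial_products G \<one> ks"
  let ?s = "\<lambda>i::nat. (\<ominus>\<^bsub>R\<^esub> \<one>\<^bsub>R\<^esub>) [^]\<^bsub>R\<^esub> i"
  let ?m = "\<lambda>i. take i ks @ [ks ! i \<otimes>\<^bsub>G\<lparr>carrier := K\<rparr>\<^esub> ks ! Suc i] @ drop (i + 2) ks"
  let ?f = "\<lambda>i. ?s i \<odot>\<^bsub>val M K\<^esub> v (take i ?p @ drop (Suc i) ?p)"
  have p: "?p \<in> tuples G (Suc (Suc q))" by (rule pp_tuples[OF K one_mem[OF K] ks])
  have sc: "?s i \<in> carrier R" for i by simp
  have face: "take i ?p @ drop (Suc i) ?p \<in> tuples G (Suc q)" if "i < Suc (Suc q)" for i
  proof (rule tuples_face[OF p])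
    show "set (take i ?p @ drop (Suc i) ?p) \<subseteq> set ?p"
      by (simp only: set_append Un_subset_iff set_take_subset set_drop_subset simp_thms)
    show "Suc (length (take i ?p @ drop (Suc i) ?p)) = length ?p" using that len by simp
  qed
  note vc = D_closed[OF v face]
  have fc: "?f i \<in> elts M K" if "i < Suc (Suc q)" for i using vc[OF that] sc by auto
  have "coboundary q K v ?p = (\<Oplus>\<^bsub>val M K\<^esub>i\<in>{..<Suc (Suc q)}. ?f i)"
    using A.alt_finsum[of ?p v] D_closed[OF v tuples_face[OF p]] p len by (simp add: coboundary_def)
  also have "\<dots> = ?f 0 \<oplus>\<^bsub>val M K\<^esub> (\<Oplus>\<^bsub>val M K\<^esub>i\<in>{..<Suc q}. ?f (Suc i))"
    by (rule A.finsum_lessThan_Suc_shift) (rule fc)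
  also have "(\<Oplus>\<^bsub>val M K\<^esub>i\<in>{..<Suc q}. ?f (Suc i)) = (\<Oplus>\<^bsub>val M K\<^esub>i\<in>{..<q}. ?f (Suc i)) \<oplus>\<^bsub>val M K\<^esub> ?f (Suc q)"
    by (rule A.finsum_lessThan_Suc) (rule fc, simp)
  also have "?f 0 \<oplus>\<^bsub>val M K\<^esub> ((\<Oplus>\<^bsub>val M K\<^esub>i\<in>{..<q}. ?f (Suc i)) \<oplus>\<^bsub>val M K\<^esub> ?f (Suc q))
      = ?f 0 \<oplus>\<^bsub>val M K\<^esub> (\<Oplus>\<^bsub>val M K\<^esub>i\<in>{..<q}. ?f (Suc i)) \<oplus>\<^bsub>val M K\<^esub> ?f (Suc q)"
  proof (rule A.M.a_assoc[symmetric])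
    show "?f 0 \<in> elts M K" by (rule fc) simp
    show "(\<Oplus>\<^bsub>val M K\<^esub>i\<in>{..<q}. ?f (Suc i)) \<in> elts M K"
      by (rule A.M.finsum_closed, rule Pi_I, rule fc) simp
    show "?f (Suc q) \<in> elts M K" by (rule fc) simp
  qed
  also have "?f 0 = left_act G M K (hd ks) (rho q K v (tl ks))"
  proof -
    have t: "ks' \<in> tuples (G\<lparr>carrier := K\<rparr>) q" using ks k by (simp add: mem_tuples_sub)
    have "left_act G M K k (v (partial_products G \<one> ks')) = v (partial_products G k ks')"
      using left_act_eq[OF K v kK(1) pp_tuples[OF K one_mem[OF K] t]] partial_products_mult[OF kc(2) one_closed kc(3)] kc
      by simp
    moreover have "v (partial_products G k ks') \<in> elts M K" by (rule D_closed[OF v pp_tuples[OF K kK(1) t]])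
    ultimately show ?thesis using t kc by (simp add: rho_def k)
  qed
  also have "(\<Oplus>\<^bsub>val M K\<^esub>i\<in>{..<q}. ?f (Suc i)) = (\<Oplus>\<^bsub>val M K\<^esub>i\<in>{..<q}. ?s (Suc i) \<odot>\<^bsub>val M K\<^esub>
        rho q K v (?m i))"
  proof -
    have "?f (Suc i) = ?s (Suc i) \<odot>\<^bsub>val M K\<^esub>
        rho q K v (?m i)" if "i \<in> {..<q}" for i
    proof -
    have i: "Suc i < length ks" using len that by simp
    have "ks ! i \<in> K" "ks ! Suc i \<in> K" using i set nth_mem[of i ks] nth_mem[of "Suc i" ks] by auto
    then have "take i ks @ [ks ! i \<otimes> ks ! Suc i] @ drop (i + 2) ks \<in> tuples (G\<lparr>carrier := K\<rparr>) q"
      using set set_take_subset[of i ks] set_drop_subset[of "i + 2" ks] i len subgroup.m_closed[OF sub]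
      by (auto simp: mem_tuples_sub)
    then show ?thesis
      using partial_products_face[OF one_closed kc(1) i] by (simp add: rho_def)
    qed
    note fe = this
    have "?s (Suc i) \<odot>\<^bsub>val M K\<^esub>
        rho q K v (?m i) \<in> elts M K"
      if "i \<in> {..<q}" for i
      unfolding fe[OF that, symmetric] by (rule fc) (use that in simp)
    then show ?thesis by (intro A.M.finsum_cong'[OF refl _ fe] Pi_I)
  qed
  also have "?f (Suc q) = ?s (Suc q) \<odot>\<^bsub>val M K\<^esub> rho q K v (butlast ks)"
  proof -
    have "take (Suc q) ?p @ drop (Suc (Suc q)) ?p = butlast ?p" using len by (simp add: butlast_conv_take)
    moreover have "butlast ks \<in> tuples (G\<lparr>carrier := K\<rparr>) q"
      using set len by (auto simp: mem_tuples_sub dest: in_set_butlastD)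
    ultimately show ?thesis using partial_products_butlast[of ks \<one>] k by (simp add: rho_def)
  qed
  finally show "left_act G M K (hd ks) (rho q K v (tl ks)) \<oplus>\<^bsub>val M K\<^esub>
     (\<Oplus>\<^bsub>val M K\<^esub>i\<in>{..<q}. ?s (Suc i) \<odot>\<^bsub>val M K\<^esub>
        rho q K v (?m i)) \<oplus>\<^bsub>val M K\<^esub>
     ?s (Suc q) \<odot>\<^bsub>val M K\<^esub> rho q K v (butlast ks) = coboundary q K v ?p" by (rule sym)
qed

definition retraction :: "'g set \<Rightarrow> ('g \<Rightarrow> 'g) \<Rightarrow> bool" where
  "retraction K s \<longleftrightarrow> (\<forall>g\<in>carrier G. s g \<in> K) \<and> (\<forall>k\<in>K. \<forall>g\<in>carrier G. s (k \<otimes> g) = k \<otimes> s g) \<and> (\<forall>k\<in>K. s k = k)"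

lemma retraction_exists: "K \<in> \<H> \<Longrightarrow> \<exists>s. retraction K s"
  using subgroup_retraction[OF subgroups] by (simp add: retraction_def)

lemma retraction_map:
  assumes K: "K \<in> \<H>" and s: "retraction K s" and l: "l \<in> tuples G n"
  shows "map s l \<in> tuples G n" "set (map s l) \<subseteq> K" "map s (map s l) = map s l"
    "k \<in> K \<Longrightarrow> map s (mv k l) = mv k (map s l)"
  using s l sub_carrier[OF K] by (auto simp: retraction_def tuples_def subset_iff)

lemma retraction_id: "retraction K s \<Longrightarrow> set l \<subseteq> K \<Longrightarrow> map s l = l"
  by (auto simp: retraction_def intro!: map_idI)

text \<open>The cochain is first made homogeneous on \<open>K\<close> and then extended to
  \<open>G\<close> by composing with \<open>s\<close>. Invariance under \<open>s\<close> is recorded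
  because among such cochains \<open>rho\<close> is injective.\<close>

lemma rho_surj:
  assumes K: "K \<in> \<H>" and s: "retraction K s" and u: "u \<in> carrier (KC q K)"
  obtains v where "v \<in> EC q K" "rho q K v = u" "\<And>l. l \<in> tuples G (Suc q) \<Longrightarrow> v (map s l) = v l"
proof -
  \<comment> \<open>The homogeneous form: (y0, ..., yq) goes to y0 acting on u(y0^{-1} y1, y1^{-1}
    y2, ...).\<close>
  define t where "t l = left_act G M K (hd l) (u (quotients G (hd l) (tl l)))" for l
  note sub = subgroups[OF K]
  have uc: "u ks \<in> elts M K" if "length ks = q" "set ks \<subseteq> K" for ks
    using u that by (auto simp: cochains_simps mem_tuples_sub PiE_iff)
  have split: "l = hd l # tl l \<and> hd l \<in> K \<and> set (tl l) \<subseteq> K \<and> length (tl l) = q"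
    if "l \<in> tuples G (Suc q)" "set l \<subseteq> K" for l
    using that by (cases l) (auto simp: tuples_def)
  have quot: "u (quotients G (hd l) (tl l)) \<in> elts M K" if "l \<in> tuples G (Suc q)" "set l \<subseteq> K" for l
    using split[OF that] quotients_closed[OF sub] by (intro uc) auto
  have inv_tr: "inv k \<in> transporter G K K" if "k \<in> K" for k
    by (rule sub_transporter[OF K subgroup.m_inv_closed[OF sub that]])
  have tc: "t l \<in> elts M K" if "l \<in> tuples G (Suc q)" "set l \<subseteq> K" for l
    unfolding t_def left_act_def
    by (rule act_M_closed[OF K K inv_tr quot[OF that]]) (use split[OF that] in blast)
  have teq: "act M K K k (t (mv k l)) = t l" if l: "l \<in> tuples G (Suc q)" "set l \<subseteq> K" and k: "k \<in> K" for k l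
  proof -
    obtain y ys where y: "l = y # ys" using split[OF l] by metis
    then have yK: "y \<in> K" "set ys \<subseteq> K" using l by auto
    note kc = sub_carrier[OF K k] and yc = sub_carrier[OF K yK(1)]
    have ysc: "set ys \<subseteq> carrier G" using yK(2) sub_carrier[OF K] by auto
    have "inv (k \<otimes> y) \<otimes> k = inv y" using kc yc by (simp add: inv_mult_group m_assoc)
    then have "act M K K k (act M K K (inv (k \<otimes> y)) a) = act M K K (inv y) a" if "a \<in> elts M K" for a
      using act_M_mult[OF K K K sub_transporter[OF K k] inv_tr[OF subgroup.m_closed[OF sub k yK(1)]] that] by simp
    then show ?thesis
      using quot[OF l] by (simp add: t_def left_act_def y quotients_mult[OF kc yc ysc])
  qed
  let ?v = "\<lambda>l\<in>tuples G (Suc q). t (map s l)"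
  have v: "?v \<in> EC q K"
  proof (rule D_memI[OF _ _ K])
    fix l assume l: "l \<in> tuples G (Suc q)"
    note rm = retraction_map[OF K s l]
    show "t (map s l) \<in> elts M K" by (rule tc[OF rm(1,2)])
    show "act M K K k (t (map s (mv k l))) = t (map s l)" if k: "k \<in> K" for k
      unfolding rm(4)[OF k] by (rule teq[OF rm(1,2) k])
  qed
  moreover have "rho q K ?v = u"
  proof (rule extensionalityI[of _ "tuples (G\<lparr>carrier := K\<rparr>) q"])
    show "rho q K ?v \<in> extensional (tuples (G\<lparr>carrier := K\<rparr>) q)" by (simp add: rho_def)
    show "u \<in> extensional (tuples (G\<lparr>carrier := K\<rparr>) q)" using u by (auto simp: cochains_simps PiE_iff)
    fix ks assume ks: "ks \<in> tuples (G\<lparr>carrier := K\<rparr>) q"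
    let ?p = "partial_products G \<one> ks"
    have kK: "set ks \<subseteq> K" "length ks = q" using ks by (auto simp: mem_tuples_sub)
    have kc: "set ks \<subseteq> carrier G" using kK sub_carrier[OF K] by auto
    have pK: "set ?p \<subseteq> K" by (rule partial_products_closed[OF sub one_mem[OF K] kK(1)])
    have hd: "hd ?p = \<one>" by (cases ks) auto
    have "t ?p = u ks"
      unfolding t_def hd quotients_partial_products[OF one_closed kc] left_act_def
      using act_M_one[OF K uc[OF kK(2,1)]] by simp
    then show "rho q K ?v ks = u ks"
      using ks pp_tuples[OF K one_mem[OF K] ks] retraction_id[OF s pK] by (simp add: rho_def)
  qed
  moreover have "?v (map s l) = ?v l" if "l \<in> tuples G (Suc q)" for l
    using retraction_map[OF K s that] that by (simp del: map_map)
  ultimately show ?thesis by (rule that)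
qed

text \<open>A cochain invariant under \<open>s\<close> depends only on its values at tuples in
  \<open>K\<close>, and each of these is a translate by \<open>K\<close> of a tuple beginning with
  1.\<close>

lemma rho_inj:
  assumes K: "K \<in> \<H>" and s: "retraction K s" and u: "u \<in> EC q K" and v: "v \<in> EC q K"
    and inv: "\<And>l. l \<in> tuples G (Suc q) \<Longrightarrow> u (map s l) = u l" "\<And>l. l \<in> tuples G (Suc q) \<Longrightarrow> v (map s l) = v l"
    and eq: "rho q K u = rho q K v"
  shows "u = v"
proof (rule D_eqI[OF u v])
  fix l assume l: "l \<in> tuples G (Suc q)"
  note sub = subgroups[OF K] and rm = retraction_map[OF K s l]
  obtain y ys where y: "map s l = y # ys" using l by (cases l) (auto simp: tuples_def)
  then have yK: "y \<in> K" "set ys \<subseteq> K" using rm(2) by auto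
  have ysc: "y \<in> carrier G" "set ys \<subseteq> carrier G" using yK sub_carrier[OF K] by auto
  let ?ks = "quotients G y ys"
  have ks: "?ks \<in> tuples (G\<lparr>carrier := K\<rparr>) q"
    using quotients_closed[OF sub yK] rm(1) y by (auto simp: mem_tuples_sub tuples_def)
  have ksc: "set ?ks \<subseteq> carrier G" using ks sub_carrier[OF K] by (auto simp: mem_tuples_sub)
  have e: "mv y (partial_products G \<one> ?ks) = map s l"
    using partial_products_mult[OF ysc(1) one_closed ksc] partial_products_quotients[OF ysc] ysc y by simp
  have "w (map s l) = left_act G M K y (rho q K w ?ks)" if "w \<in> EC q K" for w
    using left_act_eq[OF K that yK(1) pp_tuples[OF K one_mem[OF K] ks]] ks unfolding e by (simp add: rho_def)
  then show "u l = v l" using u v inv[OF l] eq by metis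
qed

lemma KC_eq_rho: "K \<in> \<H> \<Longrightarrow> u \<in> carrier (KC q K) \<Longrightarrow> \<exists>v\<in>EC q K. u = rho q K v"
  using retraction_exists rho_surj by metis

lemma cob_mem: "K \<in> \<H> \<Longrightarrow> u \<in> carrier (KC q K) \<Longrightarrow> cob q K u \<in> carrier (KC (Suc q) K)"
  using KC_eq_rho[of K u q] cob_rho coboundary_mem rho_mem by metis

lemma EC_ops:
  assumes "K \<in> \<H>" "u \<in> EC q K" "v \<in> EC q K"
  shows "u \<oplus>\<^bsub>val (D q) K\<^esub> v \<in> EC q K" "u \<ominus>\<^bsub>val (D q) K\<^esub> v \<in> EC q K"
proof -
  interpret module R "val (D q) K" by (rule D_val[OF assms(1)])
  show "u \<oplus>\<^bsub>val (D q) K\<^esub> v \<in> EC q K" "u \<ominus>\<^bsub>val (D q) K\<^esub> v \<in> EC q K"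
    using assms M.a_closed[of u v] M.minus_closed[of u v] by (simp_all add: D_simps)
qed

lemma zero_EC: "K \<in> \<H> \<Longrightarrow> \<zero>\<^bsub>val (D q) K\<^esub> \<in> EC q K"
  using submodule_zero[OF D_sub] by (simp add: D_simps cochains_simps)

lemma D_minus_apply:
  assumes "K \<in> \<H>" "u \<in> EC q K" "v \<in> EC q K" "l \<in> tuples G (Suc q)"
  shows "(u \<ominus>\<^bsub>val (D q) K\<^esub> v) l = u l \<ominus>\<^bsub>val M K\<^esub> v l"
proof -
  interpret A: module R "val M K" by (rule mod_M[OF assms(1)])
  have "\<ominus>\<^bsub>val (D q) K\<^esub> v = (\<ominus>\<^bsub>R\<^esub> \<one>\<^bsub>R\<^esub>) \<odot>\<^bsub>val (D q) K\<^esub> v"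
    by (rule module_minus_one[OF D_val[OF assms(1)]]) (simp add: D_simps assms)
  then show ?thesis
    using assms(4) module_minus_one[OF mod_M[OF assms(1)] D_closed[OF assms(3,4)]] by (simp add: a_minus_def D_simps)
qed

lemma cob_hom: "K \<in> \<H> \<Longrightarrow> cob q K \<in> mod_hom R (KC q K) (KC (Suc q) K)"
proof (rule mod_homI)
  assume K: "K \<in> \<H>"
  interpret AD: module R "val (D q) K" by (rule D_val[OF K])
  fix u assume u: "u \<in> carrier (KC q K)"
  then show "cob q K u \<in> carrier (KC (Suc q) K)" by (rule cob_mem[OF K])
  obtain u0 where u0: "u0 \<in> EC q K" "u = rho q K u0" using KC_eq_rho[OF K u] by blast
  have u0c: "u0 \<in> elts (D q) K" using u0 by (simp add: D_simps)
  note ch = mod_hom_closed[OF coboundary_hom[OF K]]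
  { fix w assume w: "w \<in> carrier (KC q K)"
    obtain w0 where w0: "w0 \<in> EC q K" "w = rho q K w0" using KC_eq_rho[OF K w] by blast
    have w0c: "w0 \<in> elts (D q) K" using w0 by (simp add: D_simps)
    have "u \<oplus>\<^bsub>KC q K\<^esub> w = rho q K (u0 \<oplus>\<^bsub>val (D q) K\<^esub> w0)" using mod_hom_add[OF rho_hom[OF K] u0c w0c] u0 w0 by simp
    then show "cob q K (u \<oplus>\<^bsub>KC q K\<^esub> w) = cob q K u \<oplus>\<^bsub>KC (Suc q) K\<^esub> cob q K w"
      using cob_rho[OF K EC_ops(1)[OF K u0(1) w0(1)]] mod_hom_add[OF coboundary_hom[OF K] u0c w0c]
        mod_hom_add[OF rho_hom[OF K] ch[OF u0c] ch[OF w0c]] cob_rho[OF K u0(1)] cob_rho[OF K w0(1)] u0(2) w0(2) by simp }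
  { fix r assume r: "r \<in> carrier R"
    have "r \<odot>\<^bsub>val (D q) K\<^esub> u0 \<in> EC q K" using AD.smult_closed[OF r u0c] by (simp add: D_simps)
    moreover have "r \<odot>\<^bsub>KC q K\<^esub> u = rho q K (r \<odot>\<^bsub>val (D q) K\<^esub> u0)" using mod_hom_smult[OF rho_hom[OF K] r u0c] u0 by simp
    ultimately show "cob q K (r \<odot>\<^bsub>KC q K\<^esub> u) = r \<odot>\<^bsub>KC (Suc q) K\<^esub> cob q K u"
      using cob_rho[OF K] mod_hom_smult[OF coboundary_hom[OF K] r u0c]
        mod_hom_smult[OF rho_hom[OF K] r ch[OF u0c]] cob_rho[OF K u0(1)] u0(2) by simp }
qed

text \<open>Inherited from the homogeneous side, as is linearity of \<open>cob\<close> before it: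
  \<open>rho\<close> is onto and commutes with the coboundaries.\<close>

lemma cob_cob: "K \<in> \<H> \<Longrightarrow> u \<in> carrier (KC q K) \<Longrightarrow> cob (Suc q) K (cob q K u) = \<zero>\<^bsub>KC (Suc (Suc q)) K\<^esub>"
  using KC_eq_rho[of K u q] cob_rho coboundary_mem coboundary_coboundary mod_hom_zero[OF D_val KC_val rho_hom]
  by metis

section \<open>Cocycles and coboundaries on both sides\<close>

definition gZ where "gZ q K = a_kernel (KC q K) (KC (Suc q) K) (cob q K)"
definition gB where "gB q K = (case q of 0 \<Rightarrow> {\<zero>\<^bsub>KC 0 K\<^esub>} | Suc m \<Rightarrow> cob m K ` carrier (KC m K))"

abbreviation "HM \<equiv> cohom_rcmod R G M"

lemma HM_val: "val (HM q) K = quot_mod (KC q K\<lparr>carrier := gZ q K\<rparr>) (gB q K)"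
  by (simp add: cohom_rcmod_def grp_cohom_def cohom_def gZ_def gB_def Let_def split: nat.split)

lemma sq_KC: "K \<in> \<H> \<Longrightarrow> subquotient R (KC q K) (gZ q K) (gB q K)"
proof -
  assume K: "K \<in> \<H>"
  have Z: "submodule (gZ q K) R (KC q K)"
    unfolding gZ_def by (rule submodule_kernel[OF KC_val[OF K] KC_val[OF K] cob_hom[OF K]])
  show ?thesis
  proof (intro subquotient.intro subquotient_axioms.intro KC_val K Z)
    show "submodule (gB q K) R (KC q K)"
      by (cases q) (auto simp: gB_def intro: submodule_zero_set[OF KC_val[OF K]]
          submodule_image[OF KC_val[OF K] KC_val[OF K] cob_hom[OF K] submodule_carrier[OF KC_val[OF K]]])
    show "gB q K \<subseteq> gZ q K"
      using cob_cob[OF K] cob_mem[OF K] submodule_zero[OF Z] by (cases q) (auto simp: gB_def gZ_def a_kernel_def')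
  qed
qed

lemma mem_gB_Suc: "K \<in> \<H> \<Longrightarrow> b \<in> gB (Suc m) K \<longleftrightarrow> (\<exists>w\<in>EC m K. b = rho (Suc m) K (coboundary m K w))"
  using KC_eq_rho[of K _ m] rho_mem[of K _ m] cob_rho[of K _ m] by (auto simp: gB_def image_iff) metis+

definition ZD :: "nat \<Rightarrow> 'g set \<Rightarrow> ('g list \<Rightarrow> 'a) set" where
  "ZD q K = {v \<in> EC q K. coboundary q K v = \<zero>\<^bsub>val (D (Suc q)) K\<^esub>}"

lemma ZD_sub: "K \<in> \<H> \<Longrightarrow> submodule (ZD q K) R (val (D q) K)"
  using submodule_kernel[OF D_val D_val coboundary_hom, of K q]
  by (simp add: ZD_def a_kernel_def' D_simps(1))

lemma ZD_alt: "v \<in> ZD q K \<Longrightarrow> l \<in> tuples G (Suc (Suc q)) \<Longrightarrow> alt (val M K) v l = \<zero>\<^bsub>val M K\<^esub>"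
proof -
  assume v: "v \<in> ZD q K" and l: "l \<in> tuples G (Suc (Suc q))"
  have "coboundary q K v l = \<zero>\<^bsub>val (D (Suc q)) K\<^esub> l" using v by (simp add: ZD_def)
  then show ?thesis using l by (simp add: coboundary_def D_simps)
qed

lemma rho_ZD: "K \<in> \<H> \<Longrightarrow> v \<in> ZD q K \<Longrightarrow> rho q K v \<in> gZ q K"
  using cob_rho rho_mem mod_hom_zero[OF D_val KC_val rho_hom] by (auto simp: ZD_def gZ_def a_kernel_def')

section \<open>Homotopy between conjugation and translation\<close>

definition pull :: "nat \<Rightarrow> 'g set \<Rightarrow> 'g set \<Rightarrow> 'g \<Rightarrow> ('g \<Rightarrow> 'g) \<Rightarrow> ('g list \<Rightarrow> 'a) \<Rightarrow> 'g list \<Rightarrow> 'a" where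
  "pull q H K g a v = (\<lambda>l\<in>tuples G (Suc q). act M H K g (v (map a l)))"

text \<open>Both x -> g x g^{-1}, which underlies \<open>pullback_cochain\<close>, and x -> g x,
  which underlies the action on \<open>D\<close>, have this property; it is what makes
  \<open>pull\<close> preserve equivariance.\<close>

definition twisted :: "'g set \<Rightarrow> 'g \<Rightarrow> ('g \<Rightarrow> 'g) \<Rightarrow> bool" where
  "twisted H g a \<longleftrightarrow> (\<forall>x\<in>carrier G. a x \<in> carrier G) \<and> (\<forall>h\<in>H. \<forall>x\<in>carrier G. a (h \<otimes> x) = g \<otimes> h \<otimes> inv g \<otimes> a x)"

context
  fixes H K g assumes H: "H \<in> \<H>" and K: "K \<in> \<H>" and g: "g \<in> transporter G H K"
begin

lemma gc: "g \<in> carrier G" by (rule transporter_carrier[OF g])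

text \<open>Both sides are the action of g h, composed once as g after h and once as g h g^{-1}
  after g.\<close>

lemma act_conj:
  assumes "h \<in> H" "a \<in> elts M K"
  shows "act M H H h (act M H K g a) = act M H K g (act M K K (g \<otimes> h \<otimes> inv g) a)"
proof -
  note k = transporter_conj[OF g assms(1)]
  have "g \<otimes> h \<otimes> inv g \<otimes> g = g \<otimes> h" using gc sub_carrier[OF H assms(1)] by (simp add: m_assoc)
  then show ?thesis
    using act_M_mult[OF H H K sub_transporter[OF H assms(1)] g assms(2)]
      act_M_mult[OF H K K g sub_transporter[OF K k] assms(2)] by simp
qed

lemma twisted_tuples: "twisted H g a \<Longrightarrow> l \<in> tuples G n \<Longrightarrow> map a l \<in> tuples G n"
  by (auto simp: twisted_def tuples_def)

lemma pull_mem: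
  assumes a: "twisted H g a" and v: "v \<in> EC q K"
  shows "pull q H K g a v \<in> EC q H"
  unfolding pull_def
proof (rule D_memI[OF _ _ H])
  fix l assume l: "l \<in> tuples G (Suc q)"
  note al = twisted_tuples[OF a l]
  show "act M H K g (v (map a l)) \<in> elts M H" by (rule act_M_closed[OF H K g D_closed[OF v al]])
  fix h assume h: "h \<in> H"
  note k = transporter_conj[OF g h]
  have e: "map a (mv h l) = mv (g \<otimes> h \<otimes> inv g) (map a l)" using a h l by (auto simp: twisted_def tuples_def subset_iff)
  show "act M H H h (act M H K g (v (map a (mv h l)))) = act M H K g (v (map a l))"
    unfolding e
    using act_conj[OF h D_closed[OF v tuples_mult[OF sub_carrier[OF K k] al]]] D_equivariant[OF v k al]
    by (simp del: map_map)
qed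

lemma prism_tuples:
  assumes a: "twisted H g a" and b: "twisted H g b" and l: "l \<in> tuples G n"
    and m: "set m \<subseteq> a ` set l \<union> b ` set l"
  shows "set m \<subseteq> carrier G"
proof -
  have "a ` set l \<union> b ` set l \<subseteq> carrier G" using a b l by (auto simp: twisted_def tuples_def)
  then show ?thesis using m by blast
qed

text \<open>Translating l by h moves all vertices of its prisms by g h g^{-1}, an element of
  \<open>K\<close>, so the homotopy stays inside the equivariant cochains.\<close>

lemma prism_mem:
  assumes a: "twisted H g a" and b: "twisted H g b" and v: "v \<in> EC (Suc q) K"
  shows "(\<lambda>l\<in>tuples G (Suc q). act M H K g (prism (val M K) a b v l)) \<in> EC q H"
proof (rule D_memI[OF _ _ H])
  interpret A: module R "val M K" by (rule mod_M[OF K])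
  fix l assume l: "l \<in> tuples G (Suc q)"
  have mt: "m \<in> tuples G (Suc (Suc q))" if "set m \<subseteq> a ` set l \<union> b ` set l" "length m = Suc (length l)" for m
    using prism_tuples[OF a b l that(1)] that(2) l by (simp add: tuples_def)
  have pc: "prism (val M K) a b v l \<in> elts M K"
    by (rule A.prism_closed) (rule D_closed[OF v mt])
  then show "act M H K g (prism (val M K) a b v l) \<in> elts M H" by (rule act_M_closed[OF H K g])
  fix h assume h: "h \<in> H"
  let ?k = "g \<otimes> h \<otimes> inv g"
  note k = transporter_conj[OF g h] and kc = sub_carrier[OF K transporter_conj[OF g h]]
  have "prism (val M K) a b v (mv h l) = prism (val M K) (\<lambda>x. ?k \<otimes> a x) (\<lambda>x. ?k \<otimes> b x) v l"
    unfolding prism_map by (rule prism_cong) (use a b h l in \<open>auto simp: twisted_def tuples_def\<close>)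
  also have "\<dots> = prism (val M K) a b (\<lambda>m. v (mv ?k m)) l" by (rule prism_comp)
  finally have e: "prism (val M K) a b v (mv h l) = prism (val M K) a b (\<lambda>m. v (mv ?k m)) l" .
  have c: "prism (val M K) a b (\<lambda>m. v (mv ?k m)) l \<in> elts M K"
    by (rule A.prism_closed) (rule D_closed[OF v tuples_mult[OF kc mt]])
  have "act M K K ?k (prism (val M K) a b (\<lambda>m. v (mv ?k m)) l) = prism (val M K) a b (\<lambda>m. act M K K ?k (v (mv ?k m))) l"
    by (rule prism_hom[OF mod_M[OF K] mod_M[OF K] act_M_hom[OF K K sub_transporter[OF K k]]])
      (rule D_closed[OF v tuples_mult[OF kc mt]])
  also have "\<dots> = prism (val M K) a b v l"
    by (rule prism_cong_fun) (rule D_equivariant[OF v k mt])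
  finally show "act M H H h (act M H K g (prism (val M K) a b v (mv h l))) = act M H K g (prism (val M K) a b v l)"
    using act_conj[OF h c] by (simp add: e)
qed

text \<open>On a cocycle one half of the prism identity vanishes, and the other half expresses the
  difference of the two pullbacks.\<close>

lemma pull_homotopy:
  assumes a: "twisted H g a" and b: "twisted H g b" and v: "v \<in> ZD q K" and l: "l \<in> tuples G (Suc q)"
  shows "act M H K g (alt (val M K) (prism (val M K) a b v) l) = pull q H K g b v l \<ominus>\<^bsub>val M H\<^esub> pull q H K g a v l"
proof -
  interpret A: module R "val M K" by (rule mod_M[OF K])
  have vE: "v \<in> EC q K" using v by (simp add: ZD_def)
  have mt: "m \<in> tuples G n" if "set m \<subseteq> a ` set l \<union> b ` set l" "length m = n" for m n
    using prism_tuples[OF a b l that(1)] that(2) by (simp add: tuples_def)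
  have ll: "length l = Suc q" using l by (simp add: tuples_def)
  have "prism (val M K) a b (alt (val M K) v) l = prism (val M K) a b (\<lambda>m. \<zero>\<^bsub>val M K\<^esub>) l"
    by (rule prism_cong_fun) (rule ZD_alt[OF v mt], simp_all add: ll)
  then have z: "prism (val M K) a b (alt (val M K) v) l = \<zero>\<^bsub>val M K\<^esub>" by (simp add: A.prism_zero)
  have c: "alt (val M K) (prism (val M K) a b v) l \<in> elts M K"
  proof (rule A.alt_closed, rule A.prism_closed)
    fix m m' assume "set m \<subseteq> set l" "Suc (length m) = length l" "set m' \<subseteq> a ` set m \<union> b ` set m" "length m' = Suc (length m)"
    then show "v m' \<in> elts M K" by (intro D_closed[OF vE] mt, blast, simp add: ll)
  qed
  have "alt (val M K) (prism (val M K) a b v) l = v (map b l) \<ominus>\<^bsub>val M K\<^esub> v (map a l)"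
    using A.prism_homotopy[of a l b v] D_closed[OF vE mt] c by (simp add: z ll)
  then show ?thesis
    using mod_hom_minus[OF mod_M[OF K] mod_M[OF H] act_M_hom[OF H K g] D_closed[OF vE twisted_tuples[OF b l]]
        D_closed[OF vE twisted_tuples[OF a l]]] l by (simp add: pull_def)
qed

text \<open>In degree 0 the homotopy would be a cochain on empty lists, where the prism is zero, so
  the two pullbacks agree exactly.\<close>

lemma pull_homotopic_0:
  assumes a: "twisted H g a" and b: "twisted H g b" and v: "v \<in> ZD 0 K"
  shows "pull 0 H K g a v = pull 0 H K g b v"
proof -
  have vE: "v \<in> EC 0 K" using v by (simp add: ZD_def)
  interpret A: module R "val M K" by (rule mod_M[OF K])
  interpret B: module R "val M H" by (rule mod_M[OF H])
  show ?thesis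
  proof (rule D_eqI[OF pull_mem[OF a vE] pull_mem[OF b vE]])
    fix l assume l: "l \<in> tuples G (Suc 0)"
    then obtain x where "l = [x]" by (auto simp: tuples_def length_Suc_conv)
    then have "act M H K g (alt (val M K) (prism (val M K) a b v) l) = \<zero>\<^bsub>val M H\<^esub>"
      using mod_hom_zero[OF mod_M[OF K] mod_M[OF H] act_M_hom[OF H K g]] by (simp add: A.M.minus_self)
    then show "pull 0 H K g a v l = pull 0 H K g b v l"
      using pull_homotopy[OF a b v l] B.M.minus_eq_zero_iff D_closed[OF pull_mem[OF a vE] l] D_closed[OF pull_mem[OF b vE] l]
      by simp
  qed
qed

lemma pull_homotopic_Suc:
  assumes a: "twisted H g a" and b: "twisted H g b" and v: "v \<in> ZD (Suc m) K"
  shows "\<exists>w\<in>EC m H. pull (Suc m) H K g b v \<ominus>\<^bsub>val (D (Suc m)) H\<^esub> pull (Suc m) H K g a v = coboundary m H w"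
proof -
  have vE: "v \<in> EC (Suc m) K" using v by (simp add: ZD_def)
  let ?w = "\<lambda>l\<in>tuples G (Suc m). act M H K g (prism (val M K) a b v l)"
  note w = prism_mem[OF a b vE]
  interpret A: module R "val M K" by (rule mod_M[OF K])
  note pm = pull_mem[OF a vE] pull_mem[OF b vE]
  have "pull (Suc m) H K g b v \<ominus>\<^bsub>val (D (Suc m)) H\<^esub> pull (Suc m) H K g a v = coboundary m H ?w"
  proof (rule D_eqI[OF EC_ops(2)[OF H pm(2,1)] coboundary_mem[OF H w]])
    fix l assume l: "l \<in> tuples G (Suc (Suc m))"
    have "alt (val M H) ?w l = alt (val M H) (\<lambda>m. act M H K g (prism (val M K) a b v m)) l"
      by (rule alt_cong) (simp add: tuples_face[OF l])
    also have "\<dots> = act M H K g (alt (val M K) (prism (val M K) a b v) l)"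
    proof (rule alt_hom[symmetric, OF mod_M[OF K] mod_M[OF H] act_M_hom[OF H K g]], rule A.prism_closed)
      fix m' m'' assume m: "set m' \<subseteq> set l" "Suc (length m') = length l" "set m'' \<subseteq> a ` set m' \<union> b ` set m'" "length m'' = Suc (length m')"
      show "v m'' \<in> elts M K"
        using prism_tuples[OF a b tuples_face[OF l m(1,2)] m(3)] m(2,4) l by (intro D_closed[OF vE]) (simp add: tuples_def)
    qed
    finally show "(pull (Suc m) H K g b v \<ominus>\<^bsub>val (D (Suc m)) H\<^esub> pull (Suc m) H K g a v) l = coboundary m H ?w l"
      using pull_homotopy[OF a b v l] D_minus_apply[OF H pm(2,1) l] l by (simp add: coboundary_def)
  qed
  then show ?thesis using w by blast
qed

lemma twisted_conj: "twisted H g (\<lambda>x. g \<otimes> x \<otimes> inv g)"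
  unfolding twisted_def
proof (intro conjI ballI)
  fix h x assume h: "h \<in> H" and x: "x \<in> carrier G"
  have "inv g \<otimes> (g \<otimes> (x \<otimes> inv g)) = x \<otimes> inv g" using gc x by (simp flip: m_assoc)
  then show "g \<otimes> (h \<otimes> x) \<otimes> inv g = g \<otimes> h \<otimes> inv g \<otimes> (g \<otimes> x \<otimes> inv g)"
    using gc x sub_carrier[OF H h] by (simp add: m_assoc)
qed (use gc in simp)

lemma twisted_mult: "twisted H g (\<lambda>x. g \<otimes> x)"
  unfolding twisted_def
proof (intro conjI ballI)
  fix h x assume h: "h \<in> H" and x: "x \<in> carrier G"
  have "inv g \<otimes> (g \<otimes> x) = x" using gc x by (simp flip: m_assoc)
  then show "g \<otimes> (h \<otimes> x) = g \<otimes> h \<otimes> inv g \<otimes> (g \<otimes> x)"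
    using gc x sub_carrier[OF H h] by (simp add: m_assoc)
qed (use gc in simp)

lemma pullback_rho:
  assumes v: "v \<in> EC q K"
  shows "pullback_cochain G M q H K g (rho q K v) = rho q H (pull q H K g (\<lambda>x. g \<otimes> x \<otimes> inv g) v)"
  unfolding pullback_cochain_def rho_def[of q H]
proof (rule restrict_ext)
  fix hs assume hs: "hs \<in> tuples (G\<lparr>carrier := H\<rparr>) q"
  then have hc: "set hs \<subseteq> carrier G" using sub_carrier[OF H] by (auto simp: mem_tuples_sub)
  have "map (\<lambda>h. g \<otimes> h \<otimes> inv g) hs \<in> tuples (G\<lparr>carrier := K\<rparr>) q"
    using hs transporter_conj[OF g] by (auto simp: mem_tuples_sub)
  then show "act M H K g (rho q K v (map (\<lambda>h. g \<otimes> h \<otimes> inv g) hs))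
      = pull q H K g (\<lambda>x. g \<otimes> x \<otimes> inv g) v (partial_products G \<one> hs)"
    using pp_tuples[OF H one_mem[OF H] hs] partial_products_conj[OF gc one_closed hc] gc
    by (simp add: rho_def pull_def)
qed

lemma D_act_pull: "v \<in> EC q K \<Longrightarrow> act (D q) H K (K #> g) v = pull q H K g (\<lambda>x. g \<otimes> x) v"
  by (simp add: D_act[OF H K g] pull_def)

text \<open>Conjugating an inhomogeneous cocycle and translating its homogeneous form give
  cohomologous results. This ties the prescribed action on cohomology to that of
  \<open>D\<close>.\<close>

lemma pullback_mem_coset:
  assumes v: "v \<in> ZD q K"
  shows "pullback_cochain G M q H K g (rho q K v) \<in> gB q H +>\<^bsub>KC q H\<^esub> rho q H (act (D q) H K (K #> g) v)"
proof -
  have vE: "v \<in> EC q K" using v by (simp add: ZD_def)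
  interpret S: subquotient R "KC q H" "gZ q H" "gB q H" by (rule sq_KC[OF H])
  let ?a = "pull q H K g (\<lambda>x. g \<otimes> x \<otimes> inv g) v" and ?b = "pull q H K g (\<lambda>x. g \<otimes> x) v"
  note am = pull_mem[OF twisted_conj vE] and bm = pull_mem[OF twisted_mult vE]
  have "rho q H ?a \<ominus>\<^bsub>KC q H\<^esub> rho q H ?b \<in> gB q H"
  proof (cases q)
    case 0
    then have "?a = ?b" using pull_homotopic_0[OF twisted_conj twisted_mult] v by simp
    then show ?thesis using submodule_zero[OF S.B] rho_mem[OF H bm] by (simp add: S.M.minus_self)
  next
    case (Suc m)
    then obtain w where w: "w \<in> EC m H" "?a \<ominus>\<^bsub>val (D q) H\<^esub> ?b = coboundary m H w"
      using pull_homotopic_Suc[OF twisted_mult twisted_conj, of v m] v by auto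
    have "rho q H ?a \<ominus>\<^bsub>KC q H\<^esub> rho q H ?b = rho q H (?a \<ominus>\<^bsub>val (D q) H\<^esub> ?b)"
      by (rule mod_hom_minus[symmetric, OF D_val[OF H] KC_val[OF H] rho_hom[OF H]]) (simp_all add: D_simps am bm)
    then show ?thesis using mem_gB_Suc[OF H] w Suc by auto
  qed
  then show ?thesis
    using S.mem_coset[OF rho_mem[OF H bm]] rho_mem[OF H am] by (simp add: pullback_rho[OF vE] D_act_pull[OF vE])
qed

end

text \<open>With g = 1 both the identity and the retraction \<open>s\<close> are twisted, so
  \<open>v\<close> is cohomologous to its composite with \<open>s\<close>. On cochains invariant
  under \<open>s\<close> the map \<open>rho\<close> is injective, so an equation between
  \<open>rho q K v\<close> and a coboundary lifts back to equivariant cochains.\<close>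

lemma rho_mem_gB_iff:
  assumes K: "K \<in> \<H>" and v: "v \<in> ZD q K"
  shows "rho q K v \<in> gB q K \<longleftrightarrow> (case q of 0 \<Rightarrow> v = \<zero>\<^bsub>val (D 0) K\<^esub> | Suc m \<Rightarrow> (\<exists>w\<in>EC m K. v = coboundary m K w))"
proof -
  obtain s where s: "retraction K s" using retraction_exists[OF K] by blast
  have vE: "v \<in> EC q K" using v by (simp add: ZD_def)
  note one = transporter_one[OF subgroups[OF K]]
  have tid: "twisted K \<one> (\<lambda>x. x)" using sub_carrier[OF K] by (auto simp: twisted_def)
  have ts: "twisted K \<one> s" using s sub_carrier[OF K] by (auto simp: twisted_def retraction_def)
  have pull_one: "pull q K K \<one> a v l = v (map a l)" if "twisted K \<one> a" "l \<in> tuples G (Suc q)" for a l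
    using act_M_one[OF K D_closed[OF vE twisted_tuples[OF K K one that]]] that by (simp add: pull_def)
  have pid: "pull q K K \<one> (\<lambda>x. x) v = v"
    by (rule D_eqI[OF pull_mem[OF K K one tid vE] vE]) (simp add: pull_one tid)
  let ?vs = "pull q K K \<one> s v"
  have vs: "?vs \<in> EC q K" by (rule pull_mem[OF K K one ts vE])
  have vs_inv: "?vs (map s l) = ?vs l" if "l \<in> tuples G (Suc q)" for l
    using retraction_map[OF K s that] that by (simp add: pull_one ts del: map_map)
  have rvs: "rho q K ?vs = rho q K v"
    unfolding rho_def
  proof (rule restrict_ext)
    fix ks assume ks: "ks \<in> tuples (G\<lparr>carrier := K\<rparr>) q"
    then have "map s (partial_products G \<one> ks) = partial_products G \<one> ks"
      using partial_products_closed[OF subgroups[OF K] one_mem[OF K]] by (intro retraction_id[OF s]) (simp add: mem_tuples_sub)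
    then show "?vs (partial_products G \<one> ks) = v (partial_products G \<one> ks)"
      using pull_one[OF ts pp_tuples[OF K one_mem[OF K] ks]] by simp
  qed
  interpret A: module R "val M K" by (rule mod_M[OF K])
  interpret AD: module R "val (D q) K" by (rule D_val[OF K])
  interpret AK: module R "KC q K" by (rule KC_val[OF K])
  note zero_rho = mod_hom_zero[OF D_val[OF K] KC_val[OF K] rho_hom[OF K]]
  show ?thesis
  proof (cases q)
    case 0
    have "v = \<zero>\<^bsub>val (D q) K\<^esub>" if "rho q K v = \<zero>\<^bsub>KC q K\<^esub>"
    proof -
      have "v = ?vs" using pull_homotopic_0[OF K K one tid ts] v pid 0 by simp
      also have "?vs = \<zero>\<^bsub>val (D q) K\<^esub>"
        by (rule rho_inj[OF K s vs zero_EC[OF K] vs_inv]) (use retraction_map(1)[OF K s] that rvs zero_rho in \<open>simp_all add: D_simps\<close>)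
      finally show ?thesis .
    qed
    then show ?thesis using zero_rho[of q] 0 by (auto simp: gB_def)
  next
    case (Suc m)
    have "\<exists>w\<in>EC m K. v = coboundary m K w" if b: "rho q K v \<in> gB q K"
    proof -
      obtain u where u: "u \<in> carrier (KC m K)" "rho q K v = cob m K u" using b Suc by (auto simp: gB_def)
      obtain w0 where w0: "w0 \<in> EC m K" "rho m K w0 = u" "\<And>l. l \<in> tuples G (Suc m) \<Longrightarrow> w0 (map s l) = w0 l"
        using rho_surj[OF K s u(1)] by blast
      let ?c = "coboundary m K w0"
      have c: "?c \<in> EC q K" using coboundary_mem[OF K w0(1)] Suc by simp
      have c_inv: "?c (map s l) = ?c l" if l: "l \<in> tuples G (Suc q)" for l
      proof -
        have "alt (val M K) w0 (map s l) = alt (val M K) w0 l"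
          unfolding alt_map by (rule alt_cong) (rule w0(3)[OF tuples_face], use l Suc in auto)
        then show ?thesis using l retraction_map(1)[OF K s l] Suc by (simp add: coboundary_def)
      qed
      have "rho q K ?c = rho q K v" using cob_rho[OF K w0(1)] w0(2) u(2) Suc by simp
      then have vsc: "?vs = ?c" using rvs by (intro rho_inj[OF K s vs c vs_inv c_inv]) simp_all
      obtain w where w: "w \<in> EC m K" "?vs \<ominus>\<^bsub>val (D q) K\<^esub> v = coboundary m K w"
        using pull_homotopic_Suc[OF K K one tid ts, of v m] v pid Suc by auto
      have "v = ?c \<ominus>\<^bsub>val (D q) K\<^esub> coboundary m K w"
      proof -
        have "coboundary m K w \<in> EC q K" using coboundary_mem[OF K w(1)] Suc by simp
        then show ?thesis using w(2) vsc vE c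
          by (metis AD.M.minus_add_self AD.M.a_comm AD.M.eq_minus_iff D_simps(1))
      qed
      also have "\<dots> = coboundary m K (w0 \<ominus>\<^bsub>val (D m) K\<^esub> w)"
        unfolding Suc
        by (rule mod_hom_minus[symmetric, OF D_val[OF K] D_val[OF K] coboundary_hom[OF K]]) (simp_all only: D_simps(1) w0(1) w(1))
      finally show ?thesis using EC_ops(2)[OF K w0(1) w(1)] by blast
    qed
    then show ?thesis using mem_gB_Suc[OF K] Suc by auto
  qed
qed

section \<open>The class of an equivariant cocycle\<close>

definition theta :: "nat \<Rightarrow> 'g set \<Rightarrow> ('g list \<Rightarrow> 'a) \<Rightarrow> ('g list \<Rightarrow> 'a) set" where
  "theta q K v = gB q K +>\<^bsub>KC q K\<^esub> rho q K v"

abbreviation "ZDm q \<equiv> sub_rcmod (D q) (ZD q)"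

lemma right_module_ZD: "right_module R OC (ZDm q)"
proof (rule right_module_sub[OF right_module_D])
  fix H K X v assume h: "H \<in> Ob OC" "K \<in> Ob OC" "X \<in> Mor OC H K" and v: "v \<in> ZD q K"
  have "act (D q) H K X v \<in> EC q H"
    using act_closed[OF right_module_D h] v by (simp add: D_simps(1) ZD_def)
  then show "act (D q) H K X v \<in> ZD q H"
    using coboundary_act[of H K X v q] act_zero[OF right_module_D h, of "Suc q"] h v by (simp add: ZD_def)
qed (simp add: ZD_sub)

lemma theta_hom: "K \<in> \<H> \<Longrightarrow> theta q K \<in> mod_hom R (val (ZDm q) K) (val (HM q) K)"
proof -
  assume K: "K \<in> \<H>"
  interpret S: subquotient R "KC q K" "gZ q K" "gB q K" by (rule sq_KC[OF K])
  have "rho q K \<in> mod_hom R (val (D q) K\<lparr>carrier := ZD q K\<rparr>) (KC q K\<lparr>carrier := gZ q K\<rparr>)"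
    by (rule mod_hom_restrict[OF rho_hom[OF K]]) (use rho_ZD[OF K] in \<open>auto simp: D_simps(1) ZD_def\<close>)
  from mod_hom_comp[OF this S.coset_hom] show ?thesis
    unfolding HM_val sub_rcmod_simps theta_def[abs_def] .
qed

lemma theta_zero_iff:
  assumes K: "K \<in> \<H>" and v: "v \<in> ZD q K"
  shows "theta q K v = \<zero>\<^bsub>val (HM q) K\<^esub> \<longleftrightarrow>
    (case q of 0 \<Rightarrow> v = \<zero>\<^bsub>val (D 0) K\<^esub> | Suc m \<Rightarrow> (\<exists>w\<in>EC m K. v = coboundary m K w))"
proof -
  interpret S: subquotient R "KC q K" "gZ q K" "gB q K" by (rule sq_KC[OF K])
  have "rho q K v \<in> carrier (KC q K)" using rho_mem[OF K] v by (simp add: ZD_def)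
  then show ?thesis
    using S.coset_eq_zero rho_mem_gB_iff[OF K v] by (simp add: theta_def HM_val S.zero_SQ)
qed

text \<open>An inhomogeneous cocycle is lifted to a cochain invariant under \<open>s\<close>. Its
  coboundary is then invariant as well and killed by \<open>rho\<close>, hence zero.\<close>

lemma theta_surj: "K \<in> \<H> \<Longrightarrow> elts (HM q) K \<subseteq> theta q K ` ZD q K"
proof
  fix c assume K: "K \<in> \<H>" and c: "c \<in> elts (HM q) K"
  interpret S: subquotient R "KC q K" "gZ q K" "gB q K" by (rule sq_KC[OF K])
  obtain u where u: "u \<in> gZ q K" "c = gB q K +>\<^bsub>KC q K\<^esub> u" using c by (auto simp: HM_val S.carrier_SQ)
  obtain s where s: "retraction K s" using retraction_exists[OF K] by blast
  obtain v where v: "v \<in> EC q K" "rho q K v = u" "\<And>l. l \<in> tuples G (Suc q) \<Longrightarrow> v (map s l) = v l"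
    using rho_surj[OF K s] u(1) by (auto simp: gZ_def a_kernel_def')
  note cm = coboundary_mem[OF K v(1)]
  have "coboundary q K v = \<zero>\<^bsub>val (D (Suc q)) K\<^esub>"
  proof (rule rho_inj[OF K s cm zero_EC[OF K]])
    fix l assume l: "l \<in> tuples G (Suc (Suc q))"
    have "alt (val M K) v (map s l) = alt (val M K) v l"
      unfolding alt_map by (rule alt_cong) (rule v(3)[OF tuples_face[OF l]])
    then show "coboundary q K v (map s l) = coboundary q K v l"
      using l retraction_map(1)[OF K s l] by (simp add: coboundary_def)
    show "\<zero>\<^bsub>val (D (Suc q)) K\<^esub> (map s l) = \<zero>\<^bsub>val (D (Suc q)) K\<^esub> l"
      using l retraction_map(1)[OF K s l] by (simp add: D_simps)
  qed (use cob_rho[OF K v(1)] v(2) u(1) mod_hom_zero[OF D_val[OF K] KC_val[OF K] rho_hom[OF K]] in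
      \<open>simp add: gZ_def a_kernel_def'\<close>)
  then show "c \<in> theta q K ` ZD q K" using v u by (auto simp: ZD_def theta_def)
qed

lemma theta_natural:
  assumes H: "H \<in> \<H>" and K: "K \<in> \<H>" and X: "X \<in> Mor OC H K" and v: "v \<in> ZD q K"
  shows "act (HM q) H K X (theta q K v) = theta q H (act (D q) H K X v)"
proof -
  obtain g0 where g0: "g0 \<in> transporter G H K" "X = K #> g0" using X by (auto simp: Mor_O)
  note g0c = transporter_carrier[OF g0(1)]
  \<comment> \<open>This is the representative that the definition of the action picks. It need not
    be \<open>g0\<close>, but it lies in the transporter and represents the same coset.\<close>
  define g where "g = (SOME g. g \<in> X)"
  have "g0 \<in> X" unfolding g0(2) by (rule rcos_self[OF g0c subgroups[OF K]])
  then have "g \<in> X" unfolding g_def by (rule someI)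
  then obtain k where k: "k \<in> K" "g = k \<otimes> g0" using g0(2) by (auto simp: r_coset_def)
  have g: "g \<in> transporter G H K"
    using transporter_mult[OF subgroups[OF H] g0(1) sub_transporter[OF K k(1)]] k(2) by simp
  have Xg: "X = K #> g"
    using coset_mult_assoc[OF subgroup.subset[OF subgroups[OF K]] sub_carrier[OF K k(1)] g0c]
      coset_join2[OF sub_carrier[OF K k(1)] subgroups[OF K] k(1)] g0(2) k(2) by simp
  interpret S: subquotient R "KC q K" "gZ q K" "gB q K" by (rule sq_KC[OF K])
  interpret T: subquotient R "KC q H" "gZ q H" "gB q H" by (rule sq_KC[OF H])
  interpret DK: module R "val (D q) K" by (rule D_val[OF K])
  have X': "H \<in> Ob OC" "K \<in> Ob OC" "X \<in> Mor OC H K" using H K X by auto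
  have vE: "v \<in> EC q K" using v by (simp add: ZD_def)
  have am: "act (D q) H K X w \<in> EC q H" if "w \<in> EC q K" for w q
    using act_closed[OF right_module_D X', of w q] that by (simp add: D_simps(1))
  let ?y = "rho q H (act (D q) H K X v)"
  have yc: "?y \<in> carrier (KC q H)" by (rule rho_mem[OF H am[OF vE]])
  have sub: "pullback_cochain G M q H K g c \<in> gB q H +>\<^bsub>KC q H\<^esub> ?y" if c: "c \<in> theta q K v" for c
  proof -
    obtain b where b: "b \<in> gB q K" "c = b \<oplus>\<^bsub>KC q K\<^esub> rho q K v" using c by (auto simp: theta_def a_r_coset_def')
    \<comment> \<open>Every member of the coset is \<open>rho\<close> of some cocycle, obtained from
      \<open>v\<close> by adding a coboundary, so each member can be treated by
      \<open>pullback_mem_coset\<close>.\<close>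
    obtain v' where v': "v' \<in> ZD q K" "c = rho q K v'" "rho q H (act (D q) H K X v') \<ominus>\<^bsub>KC q H\<^esub> ?y \<in> gB q H"
    proof (cases q)
      case 0
      then have "b = \<zero>\<^bsub>KC q K\<^esub>" using b(1) by (simp add: gB_def)
      then have "c = rho q K v" using b(2) rho_mem[OF K vE] by simp
      then show ?thesis using that[of v] v submodule_zero[OF T.B] yc by (simp add: T.M.minus_self)
    next
      case (Suc m)
      then obtain w where w: "w \<in> EC m K" "b = rho q K (coboundary m K w)" using b mem_gB_Suc[OF K] by auto
      let ?c = "coboundary m K w"
      have cZ: "?c \<in> ZD q K" using coboundary_mem[OF K w(1)] coboundary_coboundary[OF K w(1)] Suc by (simp add: ZD_def)
      then have cE: "?c \<in> EC q K" by (simp add: ZD_def)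
      have m: "?c \<oplus>\<^bsub>val (D q) K\<^esub> v \<in> ZD q K" by (rule submodule_add[OF ZD_sub[OF K] cZ v])
      have r: "c = rho q K (?c \<oplus>\<^bsub>val (D q) K\<^esub> v)"
        using mod_hom_add[OF rho_hom[OF K], of ?c q v] cE vE b(2) w(2) by (simp add: D_simps(1))
      have "act (D q) H K X (?c \<oplus>\<^bsub>val (D q) K\<^esub> v) = act (D q) H K X ?c \<oplus>\<^bsub>val (D q) H\<^esub> act (D q) H K X v"
        by (rule act_add[OF right_module_D X']) (simp_all add: D_simps(1) cE vE)
      also have "act (D q) H K X ?c = coboundary m H (act (D m) H K X w)"
        using coboundary_act[OF H K X w(1)] Suc by simp
      finally have "rho q H (act (D q) H K X (?c \<oplus>\<^bsub>val (D q) K\<^esub> v)) = rho q H (coboundary m H (act (D m) H K X w)) \<oplus>\<^bsub>KC q H\<^esub> ?y"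
        using mod_hom_add[OF rho_hom[OF H], of "coboundary m H (act (D m) H K X w)" q "act (D q) H K X v"]
          coboundary_mem[OF H am[OF w(1)]] am[OF vE] Suc by (simp add: D_simps(1))
      moreover have "rho q H (coboundary m H (act (D m) H K X w)) \<in> gB q H" using mem_gB_Suc[OF H] am[OF w(1)] Suc by auto
      ultimately have "rho q H (act (D q) H K X (?c \<oplus>\<^bsub>val (D q) K\<^esub> v)) \<ominus>\<^bsub>KC q H\<^esub> ?y \<in> gB q H"
        using T.M.add_minus_self[OF T.B_carrier yc] by simp
      then show ?thesis using that m r by blast
    qed
    have y'c: "rho q H (act (D q) H K X v') \<in> carrier (KC q H)"
      by (rule rho_mem[OF H am]) (use v' in \<open>simp add: ZD_def\<close>)
    have "gB q H +>\<^bsub>KC q H\<^esub> rho q H (act (D q) H K X v') = gB q H +>\<^bsub>KC q H\<^esub> ?y"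
      using T.coset_eq[OF y'c yc] v'(3) by simp
    then show ?thesis using pullback_mem_coset[OF H K g v'(1)] v'(2) Xg by simp
  qed
  have ne: "theta q K v \<noteq> {}" using S.self_coset[OF rho_mem[OF K vE]] by (auto simp: theta_def)
  have "act (HM q) H K X (theta q K v) = gB q H <+>\<^bsub>KC q H\<^esub> (pullback_cochain G M q H K g ` theta q K v)"
    using HM_val[of q H] by (simp add: cohom_rcmod_def Let_def g_def quot_mod_def)
  also have "\<dots> = gB q H +>\<^bsub>KC q H\<^esub> ?y"
    by (rule T.set_add_coset[OF yc]) (use sub ne in auto)
  finally show ?thesis by (simp add: theta_def)
qed

theorem right_module_HM: "right_module R OC (HM q)"
  by (rule right_module_surjective_image[OF right_module_ZD, where \<theta> = "theta q"])
    (use theta_hom theta_surj theta_natural subquotient.module_SQ[OF sq_KC] in \<open>simp_all add: HM_val\<close>)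

definition "Theta q = nt OC (ZDm q) (theta q)"

lemma Theta_mem: "Theta q \<in> nat_trans R OC (ZDm q) (HM q)"
  unfolding Theta_def
  by (rule nat_transI[OF right_module_ZD]) (use theta_hom theta_natural in simp_all)

lemma Theta_apply: "K \<in> \<H> \<Longrightarrow> v \<in> ZD q K \<Longrightarrow> Theta q K v = theta q K v"
  by (simp add: Theta_def)

end

lemma projective_resolution_imp_resolution:
  "projective_resolution R C N X d \<epsilon> \<Longrightarrow> resolution R C N X d \<epsilon>"
  by (auto simp: projective_resolution_def resolution_def projective_def)

lemma (in abelian_group) uminus_zero: "\<ominus> \<zero> = \<zero>"
  by (rule minus_equality) simp_all

lemma mod_hom_zero_map: "module R A \<Longrightarrow> module R B \<Longrightarrow> (\<lambda>a. \<zero>\<^bsub>B\<^esub>) \<in> mod_hom R A B"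
proof -
  assume B: "module R B"
  interpret module R B by fact
  show ?thesis by (simp add: mod_hom_def)
qed

lemma mod_hom_sum:
  assumes B: "module R B" and f: "f \<in> mod_hom R A B" and g: "g \<in> mod_hom R A B"
  shows "(\<lambda>a. f a \<oplus>\<^bsub>B\<^esub> g a) \<in> mod_hom R A B"
proof -
  interpret module R B by fact
  note c = mod_hom_closed[OF f] mod_hom_closed[OF g]
  show ?thesis
    by (rule mod_homI)
      (simp_all add: c mod_hom_add[OF f] mod_hom_add[OF g] mod_hom_smult[OF f] mod_hom_smult[OF g] smult_r_distr M.a_ac)
qed

section \<open>The total complex over the transporter category\<close>

locale orbit_resolution = transporter_setting R G \<H> for R :: "('r, 'x) ring_scheme"
  and G :: "('g, 'y) monoid_scheme" (structure) and \<H> :: "'g set set" +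
  fixes P :: "nat \<Rightarrow> ('g set, 'g set, 'r, 'p) rcmod" and dP :: "nat \<Rightarrow> 'g set \<Rightarrow> 'p \<Rightarrow> 'p"
    and \<epsilon>P :: "'g set \<Rightarrow> 'p \<Rightarrow> 'r"
  assumes P: "projective_resolution R (orbit_category G \<H>) (const_rcmod R) P dP \<epsilon>P"

sublocale orbit_resolution \<subseteq> P: res R "orbit_category G \<H>" "const_rcmod R" P dP \<epsilon>P
  by (rule res.intro[OF projective_resolution_imp_resolution[OF P]])

context orbit_resolution
begin

text \<open>The total complex of \<open>P \<otimes> R[G\<^sup>*\<^sup>+\<^sup>1]\<close>: in degree \<open>n\<close> it is the direct sum over the lists \<open>l\<close> with
  \<open>1 \<le> length l \<le> n + 1\<close> of copies of \<open>P (n + 1 - length l)\<close>.\<close>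

definition idx :: "nat \<Rightarrow> 'g list set" where
  "idx n = {l. set l \<subseteq> carrier G \<and> l \<noteq> [] \<and> length l \<le> Suc n}"

definition NN :: "nat \<Rightarrow> 'g set \<Rightarrow> 'g list \<Rightarrow> ('r, 'p) module" where
  "NN n K l = val (P (n - (length l - 1))) K"

lemma NN_apply [simp]: "NN n K l = val (P (n - (length l - Suc 0))) K"
  by (simp add: NN_def)

abbreviation "TN n K \<equiv> dsum (idx n) (NN n K)"
abbreviation "sg n K \<equiv> single (idx n) (NN n K)"
abbreviation "asgn i \<equiv> (\<ominus>\<^bsub>R\<^esub> \<one>\<^bsub>R\<^esub>) [^]\<^bsub>R\<^esub> (i :: nat)"

text \<open>Contravariance makes a morphism g translate lists by the inverse of g; on the
  coefficients it acts through its class in the orbit category.\<close>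

definition Tot :: "nat \<Rightarrow> ('g set, 'g, 'r, 'g list \<Rightarrow> 'p) rcmod" where
  "Tot n = monomial_rcmod (\<lambda>_. idx n) (NN n) (\<lambda>_ _ g l. mv (inv g) l) (\<lambda>H K g l. act (P (n - (length l - 1))) H K (K #> g))"

lemma Tot_val [simp]: "val (Tot n) K = TN n K" by (simp add: Tot_def monomial_rcmod_def)

lemma sgn_closed [simp]: "asgn i \<in> carrier R"
proof -
  interpret R: cring R by (rule cring)
  show ?thesis by simp
qed

lemma sgn_Suc_smult:
  assumes "module R A" "x \<in> carrier A"
  shows "asgn (Suc i) \<odot>\<^bsub>A\<^esub> x = \<ominus>\<^bsub>A\<^esub> (asgn i \<odot>\<^bsub>A\<^esub> x)"
proof -
  interpret A: module R A by fact
  have "asgn (Suc i) \<odot>\<^bsub>A\<^esub> x = (\<ominus>\<^bsub>R\<^esub> \<one>\<^bsub>R\<^esub>) \<odot>\<^bsub>A\<^esub> (asgn i \<odot>\<^bsub>A\<^esub> x)"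
    using assms(2) by (simp add: A.R.m_comm flip: A.smult_assoc1)
  then show ?thesis using module_minus_one[OF assms(1), of "asgn i \<odot>\<^bsub>A\<^esub> x"] assms(2) by simp
qed

lemma sgn_sgn_smult:
  assumes "module R A" "x \<in> carrier A"
  shows "asgn i \<odot>\<^bsub>A\<^esub> (asgn i \<odot>\<^bsub>A\<^esub> x) = x"
proof (induction i)
  interpret A: module R A by fact
  case 0
  then show ?case using assms by simp
next
  interpret A: module R A by fact
  case (Suc i)
  have "asgn (Suc i) \<odot>\<^bsub>A\<^esub> (asgn (Suc i) \<odot>\<^bsub>A\<^esub> x) = \<ominus>\<^bsub>A\<^esub> (asgn i \<odot>\<^bsub>A\<^esub> (\<ominus>\<^bsub>A\<^esub> (asgn i \<odot>\<^bsub>A\<^esub> x)))"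
    using sgn_Suc_smult[OF assms] sgn_Suc_smult[OF assms(1), of "\<ominus>\<^bsub>A\<^esub> (asgn i \<odot>\<^bsub>A\<^esub> x)"] assms(2)
    by (simp del: nat_pow_Suc)
  also have "\<dots> = asgn i \<odot>\<^bsub>A\<^esub> (asgn i \<odot>\<^bsub>A\<^esub> x)" using assms(2) by (simp add: A.smult_r_minus)
  finally show ?case using Suc by simp
qed

lemma NN: "K \<in> \<H> \<Longrightarrow> module R (NN n K l)" using val_mod[OF P.mod_X] by simp

lemma TN: "K \<in> \<H> \<Longrightarrow> module R (TN n K)" by (rule module_dsum[OF cring NN])

lemma sg_mem: "K \<in> \<H> \<Longrightarrow> (l \<in> idx n \<Longrightarrow> a \<in> carrier (NN n K l)) \<Longrightarrow> sg n K l a \<in> carrier (TN n K)"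
  by (rule single_mem[OF cring NN])

lemma sg_hom: "K \<in> \<H> \<Longrightarrow> l \<in> idx n \<Longrightarrow> sg n K l \<in> mod_hom R (NN n K l) (TN n K)"
  by (rule single_hom[OF cring NN])

lemma sg_out: "l \<notin> idx n \<Longrightarrow> sg n K l a = \<zero>\<^bsub>TN n K\<^esub>"
  by (auto simp: single_def dsum_def prod_mod_def intro!: restrict_ext)

lemma sg_Nil [simp]: "sg n K [] a = \<zero>\<^bsub>TN n K\<^esub>"
  by (rule sg_out) (simp add: idx_def)

lemma sg_zero: "sg n K l \<zero>\<^bsub>NN n K l\<^esub> = \<zero>\<^bsub>TN n K\<^esub>"
  by (cases "l \<in> idx n") (auto simp: sg_out, auto simp: single_def dsum_def prod_mod_def intro!: restrict_ext)

lemma TN_eqI: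
  assumes "K \<in> \<H>" "module R Y" "f \<in> mod_hom R (TN n K) Y" "g \<in> mod_hom R (TN n K) Y"
    "\<And>l a. l \<in> idx n \<Longrightarrow> a \<in> carrier (NN n K l) \<Longrightarrow> f (sg n K l a) = g (sg n K l a)" "t \<in> carrier (TN n K)"
  shows "f t = g t"
  using dsum_hom_eqI[where N = "NN n K" and I = "idx n", OF cring NN[OF assms(1)] assms(2-6)] .

lemma ext_hom:
  assumes "K \<in> \<H>" "module R Y" "\<And>l. l \<in> idx n \<Longrightarrow> \<phi> l \<in> mod_hom R (NN n K l) Y"
  shows "dsum_ext (idx n) (NN n K) Y \<phi> \<in> mod_hom R (TN n K) Y"
  using dsum_ext_hom[where N = "NN n K" and I = "idx n", OF cring NN[OF assms(1)] assms(2,3)] .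

lemma ext_single:
  assumes "K \<in> \<H>" "module R Y" "\<And>l. l \<in> idx n \<Longrightarrow> \<phi> l \<in> mod_hom R (NN n K l) Y"
    "l \<in> idx n" "a \<in> carrier (NN n K l)"
  shows "dsum_ext (idx n) (NN n K) Y \<phi> (sg n K l a) = \<phi> l a"
  using dsum_ext_single[where N = "NN n K" and I = "idx n" and \<phi> = \<phi>, OF cring NN[OF assms(1)] assms(2-5)] .

lemma idx_mult: "g \<in> carrier G \<Longrightarrow> l \<in> idx n \<Longrightarrow> mv g l \<in> idx n"
  by (auto simp: idx_def)

lemma mv_cancel:
  assumes "g \<in> carrier G" "set l \<subseteq> carrier G"
  shows "mv (inv g) (mv g l) = l" "mv g (mv (inv g) l) = l"
  using assms by (auto simp: m_assoc[symmetric] subset_iff intro!: map_idI)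

lemma Mor_coset: "g \<in> transporter G H K \<Longrightarrow> K #> g \<in> Mor OC H K"
  by (auto simp: Mor_O)

lemma act_P_hom: "H \<in> \<H> \<Longrightarrow> K \<in> \<H> \<Longrightarrow> g \<in> transporter G H K
    \<Longrightarrow> act (P j) H K (K #> g) \<in> mod_hom R (val (P j) K) (val (P j) H)"
  using right_module.act_hom[OF P.mod_X] Mor_coset by simp

lemma act_NN_hom: "H \<in> \<H> \<Longrightarrow> K \<in> \<H> \<Longrightarrow> g \<in> transporter G H K
    \<Longrightarrow> act (P (n - (length l - 1))) H K (K #> g) \<in> mod_hom R (NN n K l) (NN n H l)"
  unfolding NN_def by (rule act_P_hom)

lemma act_P_mult:
  assumes "H \<in> \<H>" "K \<in> \<H>" "L \<in> \<H>" "g \<in> transporter G H K" "h \<in> transporter G K L" "a \<in> elts (P j) L"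
  shows "act (P j) H L (L #> (h \<otimes> g)) a = act (P j) H K (K #> g) (act (P j) K L (L #> h) a)"
  using right_module.act_Cmp[OF P.mod_X, of H K L "K #> g" "L #> h" a] assms Mor_coset
    orbit_comp[OF subgroups[OF assms(2)] subgroups[OF assms(3)] transporter_carrier[OF assms(4)] assms(5)]
  by (simp add: orbit_category_def)

lemma act_P_mem:
  assumes "K \<in> \<H>" "k \<in> K" "a \<in> elts (P j) K"
  shows "act (P j) K K (K #> k) a = a"
  using right_module.act_Idn[OF P.mod_X, of K a] assms coset_join2[OF sub_carrier[OF assms(1,2)] subgroups[OF assms(1)] assms(2)]
  by (simp add: orbit_category_def)

lemma Tot_monomial: "monomial_module TC R (\<lambda>_. idx n) (NN n) (\<lambda>_ _ g l. mv (inv g) l)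
    (\<lambda>H K g l. act (P (n - (length l - 1))) H K (K #> g))"
proof (intro monomial_module.intro monomial_module_axioms.intro cring small_category_transporter subgroups)
  show "module R (NN n K l)" if "K \<in> Ob TC" for K l using NN that by simp
next
  fix H K g l assume "H \<in> Ob TC" "K \<in> Ob TC" "g \<in> Mor TC H K" and l: "l \<in> idx n"
  then have HK: "H \<in> \<H>" "K \<in> \<H>" and g: "g \<in> transporter G H K" by simp_all
  show "mv (inv g) l \<in> idx n" using idx_mult[OF _ l] transporter_carrier[OF g] by simp
  show "act (P (n - (length l - 1))) H K (K #> g) \<in> mod_hom R (NN n K l) (NN n H (mv (inv g) l))"
    using act_NN_hom[OF HK g] by simp
next
  fix K l a assume K: "K \<in> Ob TC" and l: "l \<in> idx n" and a: "a \<in> carrier (NN n K l)"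
  have "mv (inv \<one>) l = l" using l by (auto simp: idx_def subset_iff intro!: map_idI)
  then show "mv (inv (Idn TC K)) l = l \<and> act (P (n - (length l - 1))) K K (K #> Idn TC K) a = a"
    using act_P_mem[of K \<one> a] subgroup.one_closed[OF subgroups] K a by (simp add: transporter_category_def)
next
  fix H K L g h l a assume "H \<in> Ob TC" "K \<in> Ob TC" "L \<in> Ob TC" "g \<in> Mor TC H K" "h \<in> Mor TC K L"
    and l: "l \<in> idx n" and a: "a \<in> carrier (NN n L l)"
  then have HK: "H \<in> \<H>" "K \<in> \<H>" "L \<in> \<H>" and g: "g \<in> transporter G H K" and h: "h \<in> transporter G K L" by simp_all
  have "mv (inv (h \<otimes> g)) l = mv (inv g) (mv (inv h) l)"
    using l transporter_carrier[OF g] transporter_carrier[OF h] by (auto simp: idx_def subset_iff inv_mult_group m_assoc)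
  then show "mv (inv (Cmp TC h g)) l = mv (inv g) (mv (inv h) l) \<and>
      act (P (n - (length l - 1))) H L (L #> Cmp TC h g) a
      = act (P (n - (length (mv (inv h) l) - 1))) H K (K #> g) (act (P (n - (length l - 1))) K L (L #> h) a)"
    using act_P_mult[OF HK g h] a by (simp add: transporter_category_def)
qed

lemma right_module_Tot: "right_module R TC (Tot n)"
  unfolding Tot_def by (rule monomial_module.right_module_F[OF Tot_monomial])

lemma Tot_act_hom: "H \<in> \<H> \<Longrightarrow> K \<in> \<H> \<Longrightarrow> g \<in> transporter G H K \<Longrightarrow> act (Tot n) H K g \<in> mod_hom R (TN n K) (TN n H)"
  using right_module.act_hom[OF right_module_Tot, of H K g n] by simp

lemma Tot_act_single:
  assumes HK: "H \<in> \<H>" "K \<in> \<H>" and g: "g \<in> transporter G H K" and l: "set l \<subseteq> carrier G"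
    and a: "l \<in> idx n \<Longrightarrow> a \<in> carrier (NN n K l)"
  shows "act (Tot n) H K g (sg n K l a) = sg n H (mv (inv g) l) (act (P (n - (length l - 1))) H K (K #> g) a)"
proof (cases "l \<in> idx n")
  case True
  then show ?thesis
    using monomial_module.act_single[OF Tot_monomial, of H K g l n a] HK g a unfolding Tot_def by simp
next
  case False
  then have "mv (inv g) l \<notin> idx n" using l by (auto simp: idx_def)
  then show ?thesis using False mod_hom_zero[OF TN[OF HK(2)] TN[OF HK(1)] Tot_act_hom[OF HK g]] by (simp add: sg_out)
qed

lemma Tot_nat_trans:
  assumes M: "right_module R TC M" and \<phi>: "\<And>K l. K \<in> \<H> \<Longrightarrow> l \<in> idx n \<Longrightarrow> \<phi> K l \<in> mod_hom R (NN n K l) (val M K)"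
    and "\<And>H K g l a. H \<in> \<H> \<Longrightarrow> K \<in> \<H> \<Longrightarrow> g \<in> transporter G H K \<Longrightarrow> l \<in> idx n \<Longrightarrow> a \<in> carrier (NN n K l)
      \<Longrightarrow> \<phi> H (mv (inv g) l) (act (P (n - (length l - 1))) H K (K #> g) a) = act M H K g (\<phi> K l a)"
  shows "nt TC (Tot n) (\<lambda>K. dsum_ext (idx n) (NN n K) (val M K) (\<phi> K)) \<in> nat_trans R TC (Tot n) M"
  unfolding Tot_def by (rule monomial_module.F_nat_trans[OF Tot_monomial M]) (use assms in simp_all)

section \<open>The boundary of the total complex\<close>

lemma deg_face:
  assumes "l \<in> idx (Suc n)" "Suc (length m) = length l" "m \<noteq> []"
  shows "n - (length m - 1) = Suc n - (length l - 1)"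
  using assms by (cases m) (auto simp: idx_def)

lemma deg_dP: "l \<in> idx n \<Longrightarrow> Suc n - (length l - Suc 0) = Suc (n - (length l - Suc 0))"
  by (cases l) (auto simp: idx_def)

lemma idx_face: "l \<in> idx (Suc n) \<Longrightarrow> set m \<subseteq> set l \<Longrightarrow> Suc (length m) = length l \<Longrightarrow> m \<noteq> [] \<Longrightarrow> m \<in> idx n"
  by (auto simp: idx_def)

lemma face_mem:
  assumes "K \<in> \<H>" "l \<in> idx (Suc n)" "a \<in> carrier (NN (Suc n) K l)" "set m \<subseteq> set l" "Suc (length m) = length l"
  shows "sg n K m a \<in> carrier (TN n K)"
proof (rule sg_mem[OF assms(1)])
  assume "m \<in> idx n"
  then have "m \<noteq> []" by (simp add: idx_def)
  from deg_face[OF assms(2,5) this] show "a \<in> carrier (NN n K m)" using assms(3) by simp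
qed

lemma dP_closed: "K \<in> \<H> \<Longrightarrow> l \<in> idx n \<Longrightarrow> a \<in> carrier (NN (Suc n) K l) \<Longrightarrow> dP (n - (length l - 1)) K a \<in> carrier (NN n K l)"
  using nat_trans_closed[OF P.d_nat, of K a "n - (length l - 1)"] by (simp add: deg_dP)

lemma dP_mem: "K \<in> \<H> \<Longrightarrow> a \<in> carrier (NN (Suc n) K l) \<Longrightarrow> sg n K l (dP (n - (length l - 1)) K a) \<in> carrier (TN n K)"
  by (rule sg_mem, assumption, rule dP_closed)

text \<open>A list of length i + 1 has simplicial degree i, and the sign (-1)^{i+1} makes the two
  parts of the boundary anticommute. Terms that should not exist, an empty face or a list too long
  for degree \<open>n\<close>, are zero by the convention of \<open>single\<close>; that also makes
  the truncated index of \<open>dP\<close> harmless.\<close>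

definition bdl :: "nat \<Rightarrow> 'g set \<Rightarrow> 'g list \<Rightarrow> 'p \<Rightarrow> ('g list \<Rightarrow> 'p)" where
  "bdl n K l a = alt (TN n K) (\<lambda>m. sg n K m a) l
     \<oplus>\<^bsub>TN n K\<^esub> asgn (length l) \<odot>\<^bsub>TN n K\<^esub> sg n K l (dP (n - (length l - 1)) K a)"

lemma bdl_hom:
  assumes K: "K \<in> \<H>" and l: "l \<in> idx (Suc n)"
  shows "bdl n K l \<in> mod_hom R (NN (Suc n) K l) (TN n K)"
  unfolding bdl_def
proof (rule mod_hom_sum[OF TN[OF K]])
  show "(\<lambda>a. alt (TN n K) (\<lambda>m. sg n K m a) l) \<in> mod_hom R (NN (Suc n) K l) (TN n K)"
  proof (rule alt_fun_hom[OF NN[OF K] TN[OF K]])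
    fix m assume m: "set m \<subseteq> set l" "Suc (length m) = length l"
    show "sg n K m \<in> mod_hom R (NN (Suc n) K l) (TN n K)"
    proof (cases "m = []")
      case True
      then show ?thesis using mod_hom_zero_map[OF NN[OF K] TN[OF K]] by (simp add: sg_Nil[abs_def])
    next
      case False
      then show ?thesis using sg_hom[OF K idx_face[OF l m False]] deg_face[OF l m(2) False] by simp
    qed
  qed
  have "(\<lambda>a. sg n K l (dP (n - (length l - 1)) K a)) \<in> mod_hom R (NN (Suc n) K l) (TN n K)"
  proof (cases "l \<in> idx n")
    case True
    have "dP (n - (length l - 1)) K \<in> mod_hom R (NN (Suc n) K l) (NN n K l)"
      using nat_trans_hom[OF P.d_nat, of K "n - (length l - 1)"] K deg_dP[OF True] by simp
    then show ?thesis using mod_hom_comp[OF _ sg_hom[OF K True]] by blast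
  next
    case False
    then show ?thesis using mod_hom_zero_map[OF NN[OF K] TN[OF K]] by (simp add: sg_out)
  qed
  then show "(\<lambda>a. asgn (length l) \<odot>\<^bsub>TN n K\<^esub> sg n K l (dP (n - (length l - 1)) K a)) \<in> mod_hom R (NN (Suc n) K l) (TN n K)"
    by (rule mod_hom_comp[OF _ mod_hom_scalar[OF TN[OF K] sgn_closed]])
qed

lemma bdl_image:
  assumes K: "K \<in> \<H>" and Y: "module R Y" and f: "f \<in> mod_hom R (TN n K) Y"
    and l: "l \<in> idx (Suc n)" and a: "a \<in> carrier (NN (Suc n) K l)"
  shows "f (bdl n K l a) = alt Y (\<lambda>m. f (sg n K m a)) l
    \<oplus>\<^bsub>Y\<^esub> asgn (length l) \<odot>\<^bsub>Y\<^esub> f (sg n K l (dP (n - (length l - 1)) K a))"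
proof -
  interpret T: module R "TN n K" by (rule TN[OF K])
  have c: "alt (TN n K) (\<lambda>m. sg n K m a) l \<in> carrier (TN n K)"
    by (rule T.alt_closed) (rule face_mem[OF K l a])
  show ?thesis
    unfolding bdl_def
    using mod_hom_add[OF f c, of "asgn (length l) \<odot>\<^bsub>TN n K\<^esub> sg n K l (dP (n - (length l - 1)) K a)"]
      dP_mem[OF K a] mod_hom_smult[OF f sgn_closed dP_mem[OF K a]]
      alt_hom[OF TN[OF K] Y f, of l "\<lambda>m. sg n K m a"] face_mem[OF K l a] by simp
qed

definition bd :: "nat \<Rightarrow> 'g set \<Rightarrow> ('g list \<Rightarrow> 'p) \<Rightarrow> ('g list \<Rightarrow> 'p)" where
  "bd n = nt TC (Tot (Suc n)) (\<lambda>K. dsum_ext (idx (Suc n)) (NN (Suc n) K) (TN n K) (bdl n K))"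

lemma bd_hom:
  assumes K: "K \<in> \<H>"
  shows "bd n K \<in> mod_hom R (TN (Suc n) K) (TN n K)"
  using mod_hom_cong[OF TN[OF K], of "Suc n" "bd n K" "dsum_ext (idx (Suc n)) (NN (Suc n) K) (TN n K) (bdl n K)"]
    ext_hom[OF K TN[OF K] bdl_hom[OF K]] K by (simp add: bd_def)

lemma bd_single:
  assumes K: "K \<in> \<H>" and l: "l \<in> idx (Suc n)" and a: "a \<in> carrier (NN (Suc n) K l)"
  shows "bd n K (sg (Suc n) K l a) = bdl n K l a"
  using ext_single[OF K TN[OF K] bdl_hom[OF K] l a] sg_mem[OF K a] K by (simp add: bd_def)

lemma bd_zero: "K \<in> \<H> \<Longrightarrow> bd n K \<zero>\<^bsub>TN (Suc n) K\<^esub> = \<zero>\<^bsub>TN n K\<^esub>"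
  by (rule mod_hom_zero[OF TN TN bd_hom])

lemma bd_mem: "bd n \<in> nat_trans R TC (Tot (Suc n)) (Tot n)"
  unfolding bd_def Tot_val[symmetric, of n]
proof (rule Tot_nat_trans[OF right_module_Tot], unfold Tot_val)
  show "bdl n K l \<in> mod_hom R (NN (Suc n) K l) (TN n K)" if "K \<in> \<H>" "l \<in> idx (Suc n)" for K l
    by (rule bdl_hom[OF that])
  fix H K g l a assume HK: "H \<in> \<H>" "K \<in> \<H>" and g: "g \<in> transporter G H K" and l: "l \<in> idx (Suc n)" and a: "a \<in> carrier (NN (Suc n) K l)"
  let ?a = "act (P (Suc n - (length l - 1))) H K (K #> g) a"
  let ?l = "mv (inv g) l"
  have lc: "set l \<subseteq> carrier G" using l by (simp add: idx_def)
  have "alt (TN n H) (\<lambda>m. sg n H m ?a) ?l = alt (TN n H) (\<lambda>m. act (Tot n) H K g (sg n K m a)) l"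
    unfolding alt_map
  proof (rule alt_cong)
    fix m assume m: "set m \<subseteq> set l" "Suc (length m) = length l"
    show "sg n H (mv (inv g) m) ?a = act (Tot n) H K g (sg n K m a)"
    proof (cases "m = []")
      case True
      then show ?thesis using mod_hom_zero[OF TN[OF HK(2)] TN[OF HK(1)] Tot_act_hom[OF HK g]] by simp
    next
      case False
      then have "act (Tot n) H K g (sg n K m a) = sg n H (mv (inv g) m) (act (P (n - (length m - 1))) H K (K #> g) a)"
        using m lc a deg_face[OF l m(2)] by (intro Tot_act_single[OF HK g]) auto
      then show ?thesis using deg_face[OF l m(2) False] by simp
    qed
  qed
  moreover have "sg n H ?l (dP (n - (length ?l - 1)) H ?a) = act (Tot n) H K g (sg n K l (dP (n - (length l - 1)) K a))"
  proof (cases "l \<in> idx n")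
    case True
    have "dP (n - (length l - 1)) H ?a = act (P (n - (length l - 1))) H K (K #> g) (dP (n - (length l - 1)) K a)"
      using nat_trans_natural[OF P.d_nat, of H K "K #> g" a "n - (length l - 1)"] HK Mor_coset[OF g] a deg_dP[OF True] by simp
    then show ?thesis
      using Tot_act_single[OF HK g lc, of n "dP (n - (length l - 1)) K a"] dP_closed[OF HK(2) True a] by simp
  next
    case False
    then have "?l \<notin> idx n" using lc by (auto simp: idx_def)
    then show ?thesis using False mod_hom_zero[OF TN[OF HK(2)] TN[OF HK(1)] Tot_act_hom[OF HK g]] by (simp add: sg_out)
  qed
  ultimately have "bdl n H ?l ?a = alt (TN n H) (\<lambda>m. act (Tot n) H K g (sg n K m a)) l
      \<oplus>\<^bsub>TN n H\<^esub> asgn (length l) \<odot>\<^bsub>TN n H\<^esub> act (Tot n) H K g (sg n K l (dP (n - (length l - 1)) K a))"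
    by (simp add: bdl_def)
  then show "bdl n H ?l ?a = act (Tot n) H K g (bdl n K l a)"
    unfolding bdl_image[OF HK(2) TN[OF HK(1)] Tot_act_hom[OF HK g] l a] .
qed

text \<open>Faces of faces cancel, \<open>dP\<close> squares to zero, and the mixed terms cancel
  because a face is one shorter than its list and so carries the opposite sign at
  \<open>dP\<close>.\<close>

lemma bd_bd:
  assumes K: "K \<in> \<H>" and t: "t \<in> carrier (TN (Suc (Suc n)) K)"
  shows "bd n K (bd (Suc n) K t) = \<zero>\<^bsub>TN n K\<^esub>"
proof (rule TN_eqI[OF K TN[OF K] mod_hom_comp[OF bd_hom[OF K] bd_hom[OF K]] mod_hom_zero_map[OF TN[OF K] TN[OF K]] _ t])
  fix l a assume l: "l \<in> idx (Suc (Suc n))" and a: "a \<in> carrier (NN (Suc (Suc n)) K l)"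
  interpret T: module R "TN n K" by (rule TN[OF K])
  let ?j = "Suc n - (length l - 1)"
  let ?b = "dP ?j K a"
  have lc: "set l \<subseteq> carrier G" "l \<noteq> []" "length l \<le> Suc (Suc (Suc n))" using l by (auto simp: idx_def)
  have face2: "sg n K m a \<in> carrier (TN n K)" if m: "set m \<subseteq> set l" "Suc (Suc (length m)) = length l" for m
  proof (rule sg_mem[OF K])
    assume "m \<in> idx n"
    then have "n - (length m - 1) = Suc (Suc n) - (length l - 1)" using m by (cases m) (auto simp: idx_def)
    then show "a \<in> carrier (NN n K m)" using a by simp
  qed
  have faceb: "sg n K m ?b \<in> carrier (TN n K)" if m: "set m \<subseteq> set l" "Suc (length m) = length l" for m
  proof (rule sg_mem[OF K])
    assume mi: "m \<in> idx n"
    then have "l \<in> idx (Suc n)" "n - (length m - 1) = ?j" using m lc by (cases m; auto simp: idx_def)+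
    then show "?b \<in> carrier (NN n K m)" using dP_closed[OF K _ a] by simp
  qed
  let ?X = "alt (TN n K) (\<lambda>m. sg n K m ?b) l"
  have X: "?X \<in> carrier (TN n K)" by (rule T.alt_closed) (rule faceb)
  have alt2: "alt (TN n K) (\<lambda>m'. sg n K m' a) m \<in> carrier (TN n K)" if m: "set m \<subseteq> set l" "Suc (length m) = length l" for m
    by (rule T.alt_closed, rule face2) (use m in auto)
  have face: "bd n K (sg (Suc n) K m a) = alt (TN n K) (\<lambda>m'. sg n K m' a) m \<oplus>\<^bsub>TN n K\<^esub> asgn (length l - 1) \<odot>\<^bsub>TN n K\<^esub> sg n K m ?b"
    if m: "set m \<subseteq> set l" "Suc (length m) = length l" for m
  proof (cases "m = []")
    case True
    then show ?thesis using bd_zero[OF K] by simp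
  next
    case False
    have mi: "m \<in> idx (Suc n)" using idx_face[OF l m False] .
    have am: "a \<in> carrier (NN (Suc n) K m)" using a deg_face[OF l m(2) False] by simp
    have e: "sg n K m (dP (n - (length m - 1)) K a) = sg n K m ?b"
    proof (cases "m \<in> idx n")
      case True
      then have "n - (length m - 1) = ?j" using m by (cases m) (auto simp: idx_def)
      then show ?thesis by simp
    qed (simp add: sg_out)
    have lm: "length m = length l - 1" using m(2) by simp
    show ?thesis unfolding bd_single[OF K mi am] bdl_def e unfolding lm ..
  qed
  \<comment> \<open>For a list of maximal length there is no \<open>dP\<close> term and its faces
    are too long for degree \<open>n\<close>; both sides are then zero.\<close>
  have second: "bd n K (sg (Suc n) K l ?b) = ?X"
  proof (cases "l \<in> idx (Suc n)")
    case True
    have "sg n K l (dP (n - (length l - 1)) K ?b) = \<zero>\<^bsub>TN n K\<^esub>"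
    proof (cases "l \<in> idx n")
      case True
      then have "?j = Suc (n - (length l - 1))" by (simp add: deg_dP)
      moreover have "Suc (Suc n) - (length l - 1) = Suc (Suc (n - (length l - 1)))"
        using True by (cases l) (auto simp: idx_def)
      ultimately show ?thesis using P.d_d[of K a "n - (length l - 1)"] K a sg_zero[of n K l] by simp
    qed (simp add: sg_out)
    then show ?thesis using bd_single[OF K True dP_closed[OF K True a]] X by (simp add: bdl_def)
  next
    case False
    have "?X = alt (TN n K) (\<lambda>m. \<zero>\<^bsub>TN n K\<^esub>) l"
      by (rule alt_cong, rule sg_out) (use False lc in \<open>auto simp: idx_def\<close>)
    then show ?thesis using bd_zero[OF K] by (simp add: sg_out[OF False] T.alt_zero)
  qed
  have "bd n K (bd (Suc n) K (sg (Suc (Suc n)) K l a)) = bd n K (bdl (Suc n) K l a)"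
    by (simp add: bd_single[OF K l a])
  also have "\<dots> = alt (TN n K) (\<lambda>m. bd n K (sg (Suc n) K m a)) l \<oplus>\<^bsub>TN n K\<^esub> asgn (length l) \<odot>\<^bsub>TN n K\<^esub> ?X"
    unfolding bdl_image[OF K TN[OF K] bd_hom[OF K] l a] second ..
  also have "alt (TN n K) (\<lambda>m. bd n K (sg (Suc n) K m a)) l
      = alt (TN n K) (\<lambda>m. alt (TN n K) (\<lambda>m'. sg n K m' a) m \<oplus>\<^bsub>TN n K\<^esub> asgn (length l - 1) \<odot>\<^bsub>TN n K\<^esub> sg n K m ?b) l"
    by (rule alt_cong) (rule face)
  also have "\<dots> = alt (TN n K) (alt (TN n K) (\<lambda>m'. sg n K m' a)) l
      \<oplus>\<^bsub>TN n K\<^esub> alt (TN n K) (\<lambda>m. asgn (length l - 1) \<odot>\<^bsub>TN n K\<^esub> sg n K m ?b) l"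
    by (rule T.alt_add) (blast intro: alt2 T.smult_closed[OF sgn_closed] faceb)+
  also have "alt (TN n K) (alt (TN n K) (\<lambda>m'. sg n K m' a)) l = \<zero>\<^bsub>TN n K\<^esub>"
    by (rule T.alt_alt) (rule face2)
  also have "alt (TN n K) (\<lambda>m. asgn (length l - 1) \<odot>\<^bsub>TN n K\<^esub> sg n K m ?b) l = asgn (length l - 1) \<odot>\<^bsub>TN n K\<^esub> ?X"
    by (rule alt_hom[symmetric, OF TN[OF K] TN[OF K] mod_hom_scalar[OF TN[OF K] sgn_closed]]) (rule faceb)
  also have "asgn (length l) \<odot>\<^bsub>TN n K\<^esub> ?X = \<ominus>\<^bsub>TN n K\<^esub> (asgn (length l - 1) \<odot>\<^bsub>TN n K\<^esub> ?X)"
    using sgn_Suc_smult[OF TN[OF K] X, of "length l - 1"] lc(2) by (cases l) (simp_all del: nat_pow_Suc)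
  finally show "bd n K (bd (Suc n) K (sg (Suc (Suc n)) K l a)) = \<zero>\<^bsub>TN n K\<^esub>"
    by (simp only: T.M.l_zero T.M.r_neg T.smult_closed[OF sgn_closed X])
qed

section \<open>Contraction and exactness\<close>

definition cone :: "nat \<Rightarrow> 'g set \<Rightarrow> ('g list \<Rightarrow> 'p) \<Rightarrow> ('g list \<Rightarrow> 'p)" where
  "cone n K = dsum_ext (idx n) (NN n K) (TN (Suc n) K) (\<lambda>l a. sg (Suc n) K (\<one> # l) a)"

text \<open>This collapses R[G] to R: coefficients at lists of length one are summed and longer
  lists are dropped. Up to sign it is a chain map to \<open>P\<close>.\<close>

definition bottom :: "nat \<Rightarrow> 'g set \<Rightarrow> ('g list \<Rightarrow> 'p) \<Rightarrow> 'p" where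
  "bottom n K = dsum_ext (idx n) (NN n K) (val (P n) K) (\<lambda>l a. if length l = 1 then a else \<zero>\<^bsub>val (P n) K\<^esub>)"

definition augm :: "'g set \<Rightarrow> ('g list \<Rightarrow> 'p) \<Rightarrow> 'r" where
  "augm = nt TC (Tot 0) (\<lambda>K. dsum_ext (idx 0) (NN 0 K) (regular_mod R) (\<lambda>l a. \<epsilon>P K a))"

lemma idx_Cons: "l \<in> idx n \<Longrightarrow> \<one> # l \<in> idx (Suc n)"
  and deg_Cons: "l \<in> idx n \<Longrightarrow> Suc n - (length (\<one> # l) - 1) = n - (length l - 1)"
  by (auto simp: idx_def Suc_diff_le) (cases l; simp)

lemma cone_aux: "K \<in> \<H> \<Longrightarrow> l \<in> idx n \<Longrightarrow> sg (Suc n) K (\<one> # l) \<in> mod_hom R (NN n K l) (TN (Suc n) K)"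
  using sg_hom[OF _ idx_Cons, of K l n] deg_Cons[of l n] by (simp only: NN_def)

lemma cone_hom: "K \<in> \<H> \<Longrightarrow> cone n K \<in> mod_hom R (TN n K) (TN (Suc n) K)"
  unfolding cone_def by (rule ext_hom[OF _ TN cone_aux])

lemma cone_single: "K \<in> \<H> \<Longrightarrow> l \<in> idx n \<Longrightarrow> a \<in> carrier (NN n K l) \<Longrightarrow> cone n K (sg n K l a) = sg (Suc n) K (\<one> # l) a"
  unfolding cone_def by (rule ext_single[OF _ TN cone_aux])

lemma bottom_aux:
  assumes K: "K \<in> \<H>" and l: "l \<in> idx n"
  shows "(\<lambda>a. if length l = 1 then a else \<zero>\<^bsub>val (P n) K\<^esub>) \<in> mod_hom R (NN n K l) (val (P n) K)"
proof (cases "length l = 1")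
  case True
  then show ?thesis by (auto simp: mod_hom_def)
next
  case False
  then show ?thesis using mod_hom_zero_map[OF NN[OF K] val_mod[OF P.mod_X, of K n]] K by simp
qed

lemma P_val: "K \<in> \<H> \<Longrightarrow> module R (val (P n) K)" using val_mod[OF P.mod_X] by simp

lemma bottom_hom: "K \<in> \<H> \<Longrightarrow> bottom n K \<in> mod_hom R (TN n K) (val (P n) K)"
  unfolding bottom_def by (rule ext_hom[OF _ P_val bottom_aux])

lemma bottom_single: "K \<in> \<H> \<Longrightarrow> l \<in> idx n \<Longrightarrow> a \<in> carrier (NN n K l)
    \<Longrightarrow> bottom n K (sg n K l a) = (if length l = 1 then a else \<zero>\<^bsub>val (P n) K\<^esub>)"
  unfolding bottom_def by (rule ext_single[OF _ P_val bottom_aux])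

lemma val_const [simp]: "val (const_rcmod R) K = regular_mod R"
  by (simp add: const_rcmod_def)

lemma const_val: "module R (regular_mod R)"
  by (rule module_regular[OF cring])

lemma augm_aux: "K \<in> \<H> \<Longrightarrow> l \<in> idx 0 \<Longrightarrow> \<epsilon>P K \<in> mod_hom R (NN 0 K l) (regular_mod R)"
  using nat_trans_hom[OF P.\<epsilon>_nat, of K] by (simp add: const_rcmod_def)

lemma augm_hom:
  assumes K: "K \<in> \<H>"
  shows "augm K \<in> mod_hom R (TN 0 K) (regular_mod R)"
  using mod_hom_cong[OF TN[OF K], of 0 "augm K" "dsum_ext (idx 0) (NN 0 K) (regular_mod R) (\<lambda>l a. \<epsilon>P K a)"]
    ext_hom[OF K const_val augm_aux[OF K]] K by (simp add: augm_def)

lemma augm_single: "K \<in> \<H> \<Longrightarrow> l \<in> idx 0 \<Longrightarrow> a \<in> carrier (NN 0 K l) \<Longrightarrow> augm K (sg 0 K l a) = \<epsilon>P K a"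
  using ext_single[OF _ const_val augm_aux, of K l a] sg_mem[of K l 0 a] by (simp add: augm_def)

lemma right_module_const: "right_module R TC (const_rcmod R)"
proof (intro right_module.intro right_module_axioms.intro cring small_category_transporter subgroups)
  show "act (const_rcmod R) H K g \<in> mod_hom R (val (const_rcmod R) K) (val (const_rcmod R) H)" for H K g
    by (simp add: const_rcmod_def mod_hom_def)
  show "module R (val (const_rcmod R) K)" for K using const_val by (simp only: val_const)
qed (simp_all add: const_rcmod_def)

lemma augm_mem: "augm \<in> nat_trans R TC (Tot 0) (const_rcmod R)"
proof -
  have "\<epsilon>P H (act (P (0 - (length l - 1))) H K (K #> g) a) = act (const_rcmod R) H K g (\<epsilon>P K a)"
    if "H \<in> \<H>" "K \<in> \<H>" and g: "g \<in> transporter G H K" and "a \<in> carrier (NN 0 K l)" for H K g l a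
    using nat_trans_natural[OF P.\<epsilon>_nat, of H K "K #> g" a] that Mor_coset[OF g] by (simp add: const_rcmod_def)
  from Tot_nat_trans[where \<phi> = "\<lambda>K l. \<epsilon>P K", OF right_module_const, unfolded val_const, OF augm_aux this]
  show ?thesis unfolding augm_def .
qed

lemma one_idx: "[\<one>] \<in> idx n" by (simp add: idx_def)

lemma augm_bottom:
  assumes K: "K \<in> \<H>" and t: "t \<in> carrier (TN 0 K)"
  shows "augm K t = \<epsilon>P K (bottom 0 K t)"
proof (rule TN_eqI[OF K const_val augm_hom[OF K] mod_hom_comp[OF bottom_hom[OF K]] _ t])
  show "\<epsilon>P K \<in> mod_hom R (val (P 0) K) (regular_mod R)"
    using nat_trans_hom[OF P.\<epsilon>_nat, of K] K by (simp add: const_rcmod_def)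
  fix l a assume l: "l \<in> idx 0" and a: "a \<in> carrier (NN 0 K l)"
  then have "length l = 1" by (cases l) (auto simp: idx_def)
  then show "augm K (sg 0 K l a) = \<epsilon>P K (bottom 0 K (sg 0 K l a))"
    using augm_single[OF K l a] bottom_single[OF K l a] by simp
qed

text \<open>Only short lists matter: the two faces of a list of length two have the same coefficient
  and cancel, and on lists of length one the \<open>dP\<close> term carries the sign -1.\<close>

lemma bottom_bd:
  assumes K: "K \<in> \<H>" and t: "t \<in> carrier (TN (Suc n) K)"
  shows "bottom n K (bd n K t) = \<ominus>\<^bsub>val (P n) K\<^esub> dP n K (bottom (Suc n) K t)"
proof -
  interpret N: module R "val (P n) K" by (rule P_val[OF K])
  have dh: "dP n K \<in> mod_hom R (val (P (Suc n)) K) (val (P n) K)" using nat_trans_hom[OF P.d_nat, of K n] K by simp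
  have neg: "(\<lambda>x. \<ominus>\<^bsub>val (P n) K\<^esub> x) \<in> mod_hom R (val (P n) K) (val (P n) K)"
    by (rule mod_homI) (simp_all add: N.M.minus_add N.smult_r_minus)
  show ?thesis
  proof (rule TN_eqI[OF K P_val[OF K] mod_hom_comp[OF bd_hom[OF K] bottom_hom[OF K]]
        mod_hom_comp[OF mod_hom_comp[OF bottom_hom[OF K] dh] neg] _ t])
    fix l a assume l: "l \<in> idx (Suc n)" and a: "a \<in> carrier (NN (Suc n) K l)"
    note bz = mod_hom_zero[OF TN[OF K] P_val[OF K] bottom_hom[OF K]]
    have eq: "bottom n K (bd n K (sg (Suc n) K l a)) = alt (val (P n) K) (\<lambda>m. bottom n K (sg n K m a)) l
      \<oplus>\<^bsub>val (P n) K\<^esub> asgn (length l) \<odot>\<^bsub>val (P n) K\<^esub> bottom n K (sg n K l (dP (n - (length l - 1)) K a))"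
      using bdl_image[OF K P_val[OF K] bottom_hom[OF K] l a] bd_single[OF K l a] by simp
    have nz: "bottom n K (sg n K l (dP (n - (length l - 1)) K a)) = \<zero>\<^bsub>val (P n) K\<^esub>" if "length l \<noteq> 1"
    proof (cases "l \<in> idx n")
      case True
      then show ?thesis using bottom_single[OF K True dP_closed[OF K True a]] that by simp
    qed (simp add: sg_out bz)
    have rz: "dP n K (bottom (Suc n) K (sg (Suc n) K l a)) = \<zero>\<^bsub>val (P n) K\<^esub>" if "length l \<noteq> 1"
      using bottom_single[OF K l a] that mod_hom_zero[OF P_val[OF K] P_val[OF K] dh] by simp
    have lne: "l \<noteq> []" using l by (simp add: idx_def)
    show "bottom n K (bd n K (sg (Suc n) K l a)) = \<ominus>\<^bsub>val (P n) K\<^esub> dP n K (bottom (Suc n) K (sg (Suc n) K l a))"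
    proof (cases "length l = 1")
      case True
      then obtain x where x: "l = [x]" by (cases l) auto
      have ln: "l \<in> idx n" using l x by (simp add: idx_def)
      have ac: "a \<in> elts (P (Suc n)) K" using a x by simp
      have dc: "dP n K a \<in> elts (P n) K" by (rule mod_hom_closed[OF dh ac])
      have "bottom n K (sg n K l (dP n K a)) = dP n K a" using bottom_single[OF K ln, of "dP n K a"] dc x by simp
      moreover have "bottom (Suc n) K (sg (Suc n) K l a) = a" using bottom_single[OF K l a] x by simp
      ultimately show ?thesis unfolding eq using x bz dc
          sgn_Suc_smult[OF P_val[OF K] dc, of 0] by (simp add: N.M.minus_self)
    next
      case False
      have "alt (val (P n) K) (\<lambda>m. bottom n K (sg n K m a)) l = \<zero>\<^bsub>val (P n) K\<^esub>"
      proof (cases "length l = 2")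
        case True
        then obtain x y where xy: "l = [x, y]" by (auto simp: length_Suc_conv numeral_2_eq_2)
        then have i: "[x] \<in> idx n" "[y] \<in> idx n" using l by (auto simp: idx_def)
        have ac: "a \<in> elts (P n) K" using a xy by simp
        have "bottom n K (sg n K [x] a) = a" "bottom n K (sg n K [y] a) = a"
          using bottom_single[OF K i(1), of a] bottom_single[OF K i(2), of a] ac by simp_all
        then show ?thesis using xy bz ac by (simp add: N.M.minus_zero_right N.M.minus_self)
      next
        case l2: False
        have "alt (val (P n) K) (\<lambda>m. bottom n K (sg n K m a)) l = alt (val (P n) K) (\<lambda>m. \<zero>\<^bsub>val (P n) K\<^esub>) l"
        proof (rule alt_cong)
          fix m assume m: "set m \<subseteq> set l" "Suc (length m) = length l"
          then have "m \<noteq> []" "length m \<noteq> 1" using l2 False by auto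
          then show "bottom n K (sg n K m a) = \<zero>\<^bsub>val (P n) K\<^esub>"
            using bottom_single[OF K idx_face[OF l m \<open>m \<noteq> []\<close>], of a] a deg_face[OF l m(2)] by simp
        qed
        then show ?thesis by (simp add: N.alt_zero)
      qed
      then show ?thesis unfolding eq using nz[OF False] rz[OF False] by (simp add: N.M.uminus_zero)
    qed
  qed
qed

lemma augm_bd:
  assumes K: "K \<in> \<H>" and t: "t \<in> carrier (TN (Suc 0) K)"
  shows "augm K (bd 0 K t) = \<zero>\<^bsub>regular_mod R\<^esub>"
proof -
  have \<epsilon>: "\<epsilon>P K \<in> mod_hom R (val (P 0) K) (regular_mod R)"
    using nat_trans_hom[OF P.\<epsilon>_nat, of K] K by (simp add: const_rcmod_def)
  have b: "bottom (Suc 0) K t \<in> elts (P (Suc 0)) K" by (rule mod_hom_closed[OF bottom_hom[OF K] t])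
  have d: "dP 0 K (bottom (Suc 0) K t) \<in> elts (P 0) K" using nat_trans_closed[OF P.d_nat, of K _ 0] K b by simp
  have z: "\<epsilon>P K (dP 0 K (bottom (Suc 0) K t)) = \<zero>\<^bsub>regular_mod R\<^esub>"
    using P.cycle_d[of K "bottom (Suc 0) K t" 0] K b by (simp add: P.cycle_def)
  have "abelian_group (regular_mod R)" using const_val by (simp add: module_def)
  then show ?thesis
    unfolding augm_bottom[OF K mod_hom_closed[OF bd_hom[OF K] t]] bottom_bd[OF K t]
      mod_hom_uminus[OF P_val[OF K] const_val \<epsilon> d] z by (rule abelian_group.uminus_zero)
qed

lemma cone_homotopy_0:
  assumes K: "K \<in> \<H>" and t: "t \<in> carrier (TN 0 K)"
  shows "bd 0 K (cone 0 K t) \<oplus>\<^bsub>TN 0 K\<^esub> sg 0 K [\<one>] (bottom 0 K t) = t"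
proof -
  interpret T: module R "TN 0 K" by (rule TN[OF K])
  have s1: "sg 0 K [\<one>] \<in> mod_hom R (val (P 0) K) (TN 0 K)" using sg_hom[OF K one_idx, of 0] by simp
  have idh: "(\<lambda>t. t) \<in> mod_hom R (TN 0 K) (TN 0 K)" by (simp add: mod_hom_def)
  show ?thesis
  proof (rule TN_eqI[OF K TN[OF K] mod_hom_sum[OF TN[OF K] mod_hom_comp[OF cone_hom[OF K] bd_hom[OF K]]
        mod_hom_comp[OF bottom_hom[OF K] s1]] idh _ t])
    fix l a assume l: "l \<in> idx 0" and a: "a \<in> carrier (NN 0 K l)"
    then obtain x where x: "l = [x]" "x \<in> carrier G" by (cases l) (auto simp: idx_def)
    have ac: "a \<in> elts (P 0) K" using a by simp
    have c1: "\<one> # l \<in> idx (Suc 0)" "\<one> # l \<notin> idx 0" using x by (auto simp: idx_def)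
    have m: "sg 0 K [x] a \<in> carrier (TN 0 K)" "sg 0 K [\<one>] a \<in> carrier (TN 0 K)" using ac by (auto intro!: sg_mem[OF K])
    have "bd 0 K (cone 0 K (sg 0 K l a)) = bdl 0 K (\<one> # l) a"
      using cone_single[OF K l a] bd_single[OF K c1(1)] ac x by simp
    also have "\<dots> = sg 0 K [x] a \<ominus>\<^bsub>TN 0 K\<^esub> sg 0 K [\<one>] a"
      unfolding bdl_def sg_out[OF c1(2)] using x m by (simp add: T.M.minus_zero_right)
    finally show "bd 0 K (cone 0 K (sg 0 K l a)) \<oplus>\<^bsub>TN 0 K\<^esub> sg 0 K [\<one>] (bottom 0 K (sg 0 K l a)) = sg 0 K l a"
      using bottom_single[OF K l a] x m by (simp add: T.M.minus_add_self)
  qed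
qed

text \<open>The face of \<one> # l that omits the new vertex is l itself; the other faces and the
  \<open>dP\<close> term cancel against the cone over the boundary of l. For l of length one the
  face [\<one>] has no partner, since the empty face counts as zero, and the \<open>bottom\<close>
  term makes up for it.\<close>

lemma cone_homotopy_Suc:
  assumes K: "K \<in> \<H>" and t: "t \<in> carrier (TN (Suc n) K)"
  shows "bd (Suc n) K (cone (Suc n) K t) \<oplus>\<^bsub>TN (Suc n) K\<^esub> cone n K (bd n K t)
    \<oplus>\<^bsub>TN (Suc n) K\<^esub> sg (Suc n) K [\<one>] (bottom (Suc n) K t) = t"
proof -
  interpret T: module R "TN (Suc n) K" by (rule TN[OF K])
  let ?T = "TN (Suc n) K"
  have s1: "sg (Suc n) K [\<one>] \<in> mod_hom R (val (P (Suc n)) K) ?T" using sg_hom[OF K one_idx, of "Suc n"] by simp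
  have idh: "(\<lambda>t. t) \<in> mod_hom R ?T ?T" by (simp add: mod_hom_def)
  show ?thesis
  proof (rule TN_eqI[OF K TN[OF K] mod_hom_sum[OF TN[OF K] mod_hom_sum[OF TN[OF K]
        mod_hom_comp[OF cone_hom[OF K] bd_hom[OF K]] mod_hom_comp[OF bd_hom[OF K] cone_hom[OF K]]]
        mod_hom_comp[OF bottom_hom[OF K] s1]] idh _ t])
    fix l a assume l: "l \<in> idx (Suc n)" and a: "a \<in> carrier (NN (Suc n) K l)"
    have lne: "l \<noteq> []" using l by (simp add: idx_def)
    let ?b = "dP (n - (length l - 1)) K a"
    let ?Y = "sg (Suc n) K (\<one> # l) ?b"
    let ?A = "alt ?T (\<lambda>m. sg (Suc n) K (\<one> # m) a) l" and ?A' = "alt ?T (\<lambda>m. cone n K (sg n K m a)) l"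
    have c1: "\<one> # l \<in> idx (Suc (Suc n))" by (rule idx_Cons[OF l])
    have ac1: "a \<in> carrier (NN (Suc (Suc n)) K (\<one> # l))" using a deg_Cons[OF l] by (simp only: NN_def)
    have la: "sg (Suc n) K l a \<in> carrier ?T" by (rule sg_mem[OF K a])
    have fm: "sg (Suc n) K (\<one> # m) a \<in> carrier ?T" if "set m \<subseteq> set l" "Suc (length m) = length l" for m
      by (rule face_mem[OF K c1 ac1]) (use that in auto)
    have A: "?A \<in> carrier ?T" by (rule T.alt_closed) (rule fm)
    have Y: "?Y \<in> carrier ?T"
    proof -
      have "Suc n - (length (\<one> # l) - 1) = n - (length l - 1)" using lne by (cases l) auto
      then show ?thesis using dP_mem[OF K ac1] by (simp only:)
    qed
    have 1: "bd (Suc n) K (cone (Suc n) K (sg (Suc n) K l a))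
        = (sg (Suc n) K l a \<ominus>\<^bsub>?T\<^esub> ?A) \<oplus>\<^bsub>?T\<^esub> (\<ominus>\<^bsub>?T\<^esub> (asgn (length l) \<odot>\<^bsub>?T\<^esub> ?Y))"
    proof -
      have e: "Suc n - (length (\<one> # l) - 1) = n - (length l - 1)" using lne by (cases l) auto
      have "bdl (Suc n) K (\<one> # l) a = (sg (Suc n) K l a \<ominus>\<^bsub>?T\<^esub> ?A) \<oplus>\<^bsub>?T\<^esub> asgn (Suc (length l)) \<odot>\<^bsub>?T\<^esub> ?Y"
        unfolding bdl_def e unfolding alt_simps length_Cons ..
      then show ?thesis
        using cone_single[OF K l a] bd_single[OF K c1 ac1] sgn_Suc_smult[OF TN[OF K] Y] by (simp del: nat_pow_Suc)
    qed
    have 2: "cone n K (bd n K (sg (Suc n) K l a)) = ?A' \<oplus>\<^bsub>?T\<^esub> asgn (length l) \<odot>\<^bsub>?T\<^esub> ?Y"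
    proof -
      have "cone n K (sg n K l ?b) = ?Y"
      proof (cases "l \<in> idx n")
        case True
        then show ?thesis using cone_single[OF K True dP_closed[OF K True a]] by simp
      next
        case False
        then have "\<one> # l \<notin> idx (Suc n)" using l by (auto simp: idx_def)
        then show ?thesis using False mod_hom_zero[OF TN[OF K] TN[OF K] cone_hom[OF K]] by (simp add: sg_out)
      qed
      then show ?thesis
        using bdl_image[OF K TN[OF K] cone_hom[OF K] l a] bd_single[OF K l a] by simp
    qed
    have cf: "cone n K (sg n K m a) = sg (Suc n) K (\<one> # m) a" if "set m \<subseteq> set l" "Suc (length m) = length l" "m \<noteq> []" for m
      using cone_single[OF K idx_face[OF l that], of a] a deg_face[OF l that(2,3)] by simp
    have A': "?A' \<in> carrier ?T"
      by (rule T.alt_closed) (rule mod_hom_closed[OF cone_hom[OF K] face_mem[OF K l a]])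
    have 3: "(sg (Suc n) K l a \<ominus>\<^bsub>?T\<^esub> ?A) \<oplus>\<^bsub>?T\<^esub> ?A' \<oplus>\<^bsub>?T\<^esub> sg (Suc n) K [\<one>] (bottom (Suc n) K (sg (Suc n) K l a)) = sg (Suc n) K l a"
    proof (cases "length l = 1")
      case True
      then obtain x where x: "l = [x]" by (cases l) auto
      have ac: "a \<in> elts (P (Suc n)) K" using a x by simp
      have o: "sg (Suc n) K [\<one>] a \<in> carrier ?T" using ac by (auto intro!: sg_mem[OF K])
      have "?A' = \<zero>\<^bsub>?T\<^esub>" using x mod_hom_zero[OF TN[OF K] TN[OF K] cone_hom[OF K]] by (simp add: T.M.minus_self)
      moreover have "?A = sg (Suc n) K [\<one>] a" using x o by (simp add: T.M.minus_zero_right)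
      moreover have "bottom (Suc n) K (sg (Suc n) K l a) = a" using bottom_single[OF K l a] x by simp
      ultimately show ?thesis using o la T.M.minus_add_self by simp
    next
      case False
      have "?A' = ?A" by (rule alt_cong, rule cf) (use False lne in \<open>auto simp: length_Suc_conv neq_Nil_conv\<close>)
      moreover have "sg (Suc n) K [\<one>] (bottom (Suc n) K (sg (Suc n) K l a)) = \<zero>\<^bsub>?T\<^esub>"
        using bottom_single[OF K l a] False mod_hom_zero[OF P_val[OF K] TN[OF K] s1] by simp
      ultimately show ?thesis using A la T.M.minus_add_self by simp
    qed
    have bc: "sg (Suc n) K [\<one>] (bottom (Suc n) K (sg (Suc n) K l a)) \<in> carrier ?T"
      by (rule mod_hom_closed[OF s1 mod_hom_closed[OF bottom_hom[OF K] la]])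
    let ?y = "asgn (length l) \<odot>\<^bsub>?T\<^esub> ?Y" and ?u = "sg (Suc n) K l a \<ominus>\<^bsub>?T\<^esub> ?A" and ?z = "sg (Suc n) K [\<one>] (bottom (Suc n) K (sg (Suc n) K l a))"
    have yc: "?y \<in> carrier ?T" "?u \<in> carrier ?T" using Y A la by auto
    have "?u \<oplus>\<^bsub>?T\<^esub> \<ominus>\<^bsub>?T\<^esub> ?y \<oplus>\<^bsub>?T\<^esub> (?A' \<oplus>\<^bsub>?T\<^esub> ?y) \<oplus>\<^bsub>?T\<^esub> ?z = (\<ominus>\<^bsub>?T\<^esub> ?y \<oplus>\<^bsub>?T\<^esub> ?y) \<oplus>\<^bsub>?T\<^esub> (?u \<oplus>\<^bsub>?T\<^esub> ?A' \<oplus>\<^bsub>?T\<^esub> ?z)"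
      using yc A' bc T.M.a_inv_closed[OF yc(1)] by (simp only: T.M.a_ac T.M.a_closed)
    also have "\<dots> = ?u \<oplus>\<^bsub>?T\<^esub> ?A' \<oplus>\<^bsub>?T\<^esub> ?z" using yc A' bc by (simp add: T.M.l_neg)
    finally show "bd (Suc n) K (cone (Suc n) K (sg (Suc n) K l a)) \<oplus>\<^bsub>?T\<^esub> cone n K (bd n K (sg (Suc n) K l a))
        \<oplus>\<^bsub>?T\<^esub> ?z = sg (Suc n) K l a"
      unfolding 1 2 3 .
  qed
qed

lemma bd_bottom:
  assumes K: "K \<in> \<H>" and b: "b \<in> elts (P (Suc n)) K"
  shows "bd n K (sg (Suc n) K [\<one>] b) = \<ominus>\<^bsub>TN n K\<^esub> sg n K [\<one>] (dP n K b)"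
proof -
  interpret T: module R "TN n K" by (rule TN[OF K])
  have d: "dP n K b \<in> elts (P n) K" using nat_trans_closed[OF P.d_nat, of K b n] K b by simp
  have m: "sg n K [\<one>] (dP n K b) \<in> carrier (TN n K)" using d by (auto intro!: sg_mem[OF K])
  show ?thesis
    using bd_single[OF K one_idx, of b n] b sgn_Suc_smult[OF TN[OF K] m, of 0] m
    by (simp add: bdl_def T.M.minus_self)
qed

text \<open>If \<open>bottom\<close> of t is dP c, the term left over by the contraction is minus
  the boundary of c placed on [\<one>]. So t is the boundary of the cone over t minus c placed on
  [\<one>].\<close>

lemma Tot_exact_aux:
  assumes K: "K \<in> \<H>" and t: "t \<in> carrier (TN n K)"
    and eq: "bd n K (cone n K t) \<oplus>\<^bsub>TN n K\<^esub> sg n K [\<one>] (bottom n K t) = t"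
    and b: "bottom n K t \<in> dP n K ` elts (P (Suc n)) K"
  shows "t \<in> bd n K ` carrier (TN (Suc n) K)"
proof -
  interpret T: module R "TN n K" by (rule TN[OF K])
  interpret T1: module R "TN (Suc n) K" by (rule TN[OF K])
  obtain c where c: "c \<in> elts (P (Suc n)) K" "bottom n K t = dP n K c" using b by auto
  have d: "dP n K c \<in> elts (P n) K" using nat_trans_closed[OF P.d_nat, of K c n] K c by simp
  have m: "sg n K [\<one>] (dP n K c) \<in> carrier (TN n K)" using d by (auto intro!: sg_mem[OF K])
  have s: "sg (Suc n) K [\<one>] c \<in> carrier (TN (Suc n) K)" using c(1) by (auto intro!: sg_mem[OF K])
  have ct: "cone n K t \<in> carrier (TN (Suc n) K)" by (rule mod_hom_closed[OF cone_hom[OF K] t])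
  have "bd n K (cone n K t \<ominus>\<^bsub>TN (Suc n) K\<^esub> sg (Suc n) K [\<one>] c)
      = bd n K (cone n K t) \<ominus>\<^bsub>TN n K\<^esub> (\<ominus>\<^bsub>TN n K\<^esub> sg n K [\<one>] (dP n K c))"
    unfolding mod_hom_minus[OF TN[OF K] TN[OF K] bd_hom[OF K] ct s] bd_bottom[OF K c(1)] ..
  also have "\<dots> = t" using eq m by (simp add: a_minus_def c(2))
  finally show ?thesis using ct s by (metis T1.M.minus_closed imageI)
qed

text \<open>The contraction reduces exactness at a cycle t to exactness of \<open>P\<close> at
  \<open>bottom\<close> of t.\<close>

theorem Tot_resolution: "resolution R TC (const_rcmod R) Tot bd augm"
  unfolding resolution_def val_const
proof (intro conjI allI ballI right_module_const right_module_Tot bd_mem augm_mem)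
  fix K assume "K \<in> Ob TC"
  then have K: "K \<in> \<H>" by simp
  have KO: "K \<in> Ob OC" using K by simp
  note exP = P.exact[OF KO]
  have dh: "dP n K \<in> mod_hom R (val (P (Suc n)) K) (val (P n) K)" for n using nat_trans_hom[OF P.d_nat KO] .
  show "augm K ` elts (Tot 0) K = carrier (regular_mod R)"
  proof
    show "augm K ` elts (Tot 0) K \<subseteq> carrier (regular_mod R)"
      using mod_hom_closed[OF augm_hom[OF K]] by auto
    have "\<epsilon>P K ` elts (P 0) K = carrier (regular_mod R)"
      using P.surj[OF KO] by (simp add: const_rcmod_def)
    moreover have "\<epsilon>P K ` elts (P 0) K \<subseteq> augm K ` carrier (TN 0 K)"
    proof (rule image_subsetI, rule rev_image_eqI)
      fix a assume a: "a \<in> elts (P 0) K"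
      show "sg 0 K [\<one>] a \<in> carrier (TN 0 K)" by (rule sg_mem[OF K]) (use a in simp)
      show "\<epsilon>P K a = augm K (sg 0 K [\<one>] a)" by (rule augm_single[OF K one_idx, symmetric]) (use a in simp)
    qed
    ultimately show "carrier (regular_mod R) \<subseteq> augm K ` elts (Tot 0) K"
      unfolding Tot_val by (simp only:)
  qed
  show "bd 0 K ` elts (Tot 1) K = a_kernel (val (Tot 0) K) (regular_mod R) (augm K)"
    unfolding One_nat_def Tot_val
  proof
    show "bd 0 K ` carrier (TN (Suc 0) K) \<subseteq> a_kernel (TN 0 K) (regular_mod R) (augm K)"
      using augm_bd[OF K] mod_hom_closed[OF bd_hom[OF K]] by (auto simp: a_kernel_def')
    show "a_kernel (TN 0 K) (regular_mod R) (augm K) \<subseteq> bd 0 K ` carrier (TN (Suc 0) K)"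
    proof
      fix t assume "t \<in> a_kernel (TN 0 K) (regular_mod R) (augm K)"
      then have t: "t \<in> carrier (TN 0 K)" "augm K t = \<zero>\<^bsub>regular_mod R\<^esub>" by (auto simp: a_kernel_def')
      have bc: "bottom 0 K t \<in> elts (P 0) K" by (rule mod_hom_closed[OF bottom_hom[OF K] t(1)])
      have "P.cycle 0 K (bottom 0 K t)"
        unfolding P.cycle_def using augm_bottom[OF K t(1)] t(2) by simp
      then show "t \<in> bd 0 K ` carrier (TN (Suc 0) K)"
        using Tot_exact_aux[OF K t(1) cone_homotopy_0[OF K t(1)]] exP[OF bc] by blast
    qed
  qed
  fix n
  show "bd (Suc n) K ` elts (Tot (Suc (Suc n))) K = a_kernel (val (Tot (Suc n)) K) (val (Tot n) K) (bd n K)"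
    unfolding Tot_val
  proof
    show "bd (Suc n) K ` carrier (TN (Suc (Suc n)) K) \<subseteq> a_kernel (TN (Suc n) K) (TN n K) (bd n K)"
      using bd_bd[OF K] mod_hom_closed[OF bd_hom[OF K]] by (auto simp: a_kernel_def')
    show "a_kernel (TN (Suc n) K) (TN n K) (bd n K) \<subseteq> bd (Suc n) K ` carrier (TN (Suc (Suc n)) K)"
    proof
      fix t assume "t \<in> a_kernel (TN (Suc n) K) (TN n K) (bd n K)"
      then have t: "t \<in> carrier (TN (Suc n) K)" "bd n K t = \<zero>\<^bsub>TN n K\<^esub>" by (auto simp: a_kernel_def')
      interpret T: module R "TN (Suc n) K" by (rule TN[OF K])
      interpret N: module R "val (P n) K" by (rule P_val[OF K])
      have bc: "bottom (Suc n) K t \<in> elts (P (Suc n)) K" by (rule mod_hom_closed[OF bottom_hom[OF K] t(1)])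
      have "\<ominus>\<^bsub>val (P n) K\<^esub> dP n K (bottom (Suc n) K t) = \<zero>\<^bsub>val (P n) K\<^esub>"
        using bottom_bd[OF K t(1)] t(2) mod_hom_zero[OF TN[OF K] P_val[OF K] bottom_hom[OF K]] by simp
      then have "dP n K (bottom (Suc n) K t) = \<zero>\<^bsub>val (P n) K\<^esub>"
        using mod_hom_closed[OF dh bc] by (metis N.M.minus_minus N.M.uminus_zero)
      then have "P.cycle (Suc n) K (bottom (Suc n) K t)" by (simp add: P.cycle_def)
      moreover have "bd (Suc n) K (cone (Suc n) K t) \<oplus>\<^bsub>TN (Suc n) K\<^esub> sg (Suc n) K [\<one>] (bottom (Suc n) K t) = t"
      proof -
        have "cone n K (bd n K t) = \<zero>\<^bsub>TN (Suc n) K\<^esub>" using t(2) mod_hom_zero[OF TN[OF K] TN[OF K] cone_hom[OF K]] by simp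
        then show ?thesis
          using cone_homotopy_Suc[OF K t(1)] mod_hom_closed[OF bd_hom[OF K] mod_hom_closed[OF cone_hom[OF K] t(1)]] by simp
      qed
      ultimately show "t \<in> bd (Suc n) K ` carrier (TN (Suc (Suc n)) K)"
        using Tot_exact_aux[OF K t(1)] exP[OF bc] by blast
    qed
  qed
qed

subsection \<open>Maps out of the total complex\<close>

lemma projective_P: "projective R OC (P n)"
  using P by (simp add: projective_resolution_def)

lemma tuples_idx: "l \<in> tuples G (Suc i) \<Longrightarrow> i \<le> n \<Longrightarrow> l \<in> idx n"
  by (auto simp: tuples_def idx_def)

lemma idx_tuples:
  assumes "l \<in> idx n"
  shows "l \<in> tuples G (Suc (length l - 1))" "length l - 1 \<le> n"
  using assms by (cases l; auto simp: tuples_def idx_def)+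

lemma setting_module: "right_module R TC N \<Longrightarrow> transporter_module R G \<H> N"
  by (intro transporter_module.intro transporter_setting_axioms transporter_module_axioms.intro)

lemma hom_at:
  assumes K: "K \<in> \<H>" and w: "w \<in> nat_trans R OC (P j) (hcochains G N q)" and N: "right_module R TC N"
    and l: "l \<in> tuples G (Suc q)"
  shows "(\<lambda>a. w K a l) \<in> mod_hom R (val (P j) K) (val N K)"
proof -
  interpret N: transporter_module R G \<H> N by (rule setting_module[OF N])
  have KO: "K \<in> Ob OC" using K by simp
  have "w K a \<in> N.EC q K" if "a \<in> elts (P j) K" for a
    using nat_trans_closed[OF w KO that] by (simp add: N.D_simps)
  from N.D_closed[OF this l] show ?thesis
    by (intro mod_homI) (use l in \<open>simp_all add: nat_trans_add[OF w KO] nat_trans_smult[OF w KO] N.D_simps\<close>)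
qed

text \<open>Half of an adjunction: maps to N from degree n of the total complex, over the
  transporter category, amount to families of maps from \<open>P (n - q)\<close> to the equivariant
  q-cochains of N, over the orbit category. The other half is \<open>component\<close>.\<close>

lemma assemble:
  assumes N: "right_module R TC N"
    and w: "\<And>q. q \<le> n \<Longrightarrow> w q \<in> nat_trans R OC (P (n - q)) (hcochains G N q)"
  obtains \<phi> where "\<phi> \<in> nat_trans R TC (Tot n) N"
    "\<And>K l a. K \<in> \<H> \<Longrightarrow> l \<in> idx n \<Longrightarrow> a \<in> carrier (NN n K l) \<Longrightarrow> \<phi> K (sg n K l a) = w (length l - 1) K a l"
proof -
  interpret N: transporter_module R G \<H> N by (rule setting_module[OF N])
  define \<phi> where "\<phi> = nt TC (Tot n) (\<lambda>K. dsum_ext (idx n) (NN n K) (val N K) (\<lambda>l a. w (length l - 1) K a l))"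
  have aux: "(\<lambda>a. w (length l - 1) K a l) \<in> mod_hom R (NN n K l) (val N K)" if "K \<in> \<H>" "l \<in> idx n" for K l
    using hom_at[OF that(1) w[OF idx_tuples(2)[OF that(2)]] N idx_tuples(1)[OF that(2)]] by (simp only: NN_def)
  have "\<phi> \<in> nat_trans R TC (Tot n) N"
    unfolding \<phi>_def
  proof (rule Tot_nat_trans[OF N aux])
    fix H K g l a assume HK: "H \<in> \<H>" "K \<in> \<H>" and g: "g \<in> transporter G H K" and l: "l \<in> idx n" and a: "a \<in> carrier (NN n K l)"
    note gc = transporter_carrier[OF g]
    have lc: "set l \<subseteq> carrier G" using l by (simp add: idx_def)
    let ?l = "mv (inv g) l" and ?q = "length l - 1"
    have a': "a \<in> elts (P (n - ?q)) K" using a by simp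
    note wq = w[OF idx_tuples(2)[OF l]]
    have wc: "w ?q K a \<in> N.EC ?q K" using nat_trans_closed[OF wq, of K a] HK a' by (simp add: N.D_simps)
    have tl: "?l \<in> tuples G (Suc ?q)" using idx_tuples(1)[OF idx_mult[OF inv_closed[OF gc] l]] by simp
    have e: "w ?q H (act (P (n - ?q)) H K (K #> g) a) = act (hcochains G N ?q) H K (K #> g) (w ?q K a)"
      using nat_trans_natural[OF wq, of H K "K #> g" a] HK Mor_coset[OF g] a' by simp
    have "w ?q H (act (P (n - ?q)) H K (K #> g) a) ?l = act (hcochains G N ?q) H K (K #> g) (w ?q K a) ?l"
      by (simp only: e)
    also have "\<dots> = act N H K g (w ?q K a (mv g ?l))"
      using N.D_act[OF HK g wc] tl by simp
    also have "mv g ?l = l" by (rule mv_cancel(2)[OF gc lc])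
    finally show "w (length ?l - 1) H (act (P (n - ?q)) H K (K #> g) a) ?l = act N H K g (w ?q K a l)" by simp
  qed
  moreover have "\<phi> K (sg n K l a) = w (length l - 1) K a l"
    if K: "K \<in> \<H>" and l: "l \<in> idx n" "a \<in> carrier (NN n K l)" for K l a
    using ext_single[OF K N.mod_M[OF K] aux[OF K] l] sg_mem[OF K l(2)] K by (simp add: \<phi>_def)
  ultimately show ?thesis by (rule that)
qed

definition component :: "nat \<Rightarrow> nat \<Rightarrow> ('g set \<Rightarrow> ('g list \<Rightarrow> 'p) \<Rightarrow> 'b) \<Rightarrow> 'g set \<Rightarrow> 'p \<Rightarrow> 'g list \<Rightarrow> 'b" where
  "component n q \<phi> = nt OC (P (n - q)) (\<lambda>K a. \<lambda>l\<in>tuples G (Suc q). \<phi> K (sg n K l a))"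

lemma component_apply: "K \<in> \<H> \<Longrightarrow> a \<in> elts (P (n - q)) K \<Longrightarrow> l \<in> tuples G (Suc q)
    \<Longrightarrow> component n q \<phi> K a l = \<phi> K (sg n K l a)"
  by (simp add: component_def)

lemma component_mem:
  assumes N: "right_module R TC N" and \<phi>: "\<phi> \<in> nat_trans R TC (Tot n) N" and q: "q \<le> n"
  shows "component n q \<phi> \<in> nat_trans R OC (P (n - q)) (hcochains G N q)"
  unfolding component_def
proof (rule nat_transI[OF P.mod_X])
  interpret N: transporter_module R G \<H> N by (rule setting_module[OF N])
  let ?c = "\<lambda>K a. \<lambda>l\<in>tuples G (Suc q). \<phi> K (sg n K l a)"
  have len: "length l - 1 = q" if "l \<in> tuples G (Suc q)" for l using that by (simp add: tuples_def)
  have NNq: "NN n K l = val (P (n - q)) K" if "l \<in> tuples G (Suc q)" for K l using len[OF that] by (simp only: NN_def)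
  have \<phi>h: "\<phi> K \<in> mod_hom R (TN n K) (val N K)" if "K \<in> \<H>" for K using nat_trans_hom[OF \<phi>, of K] that by simp
  have sh: "sg n K l \<in> mod_hom R (val (P (n - q)) K) (TN n K)" if "K \<in> \<H>" "l \<in> tuples G (Suc q)" for K l
    using sg_hom[OF that(1) tuples_idx[OF that(2) q]] by (simp only: NNq[OF that(2)])
  have nat: "\<phi> H (sg n H (mv (inv g) l) (act (P (n - q)) H K (K #> g) a)) = act N H K g (\<phi> K (sg n K l a))"
    if HK: "H \<in> \<H>" "K \<in> \<H>" and g: "g \<in> transporter G H K" and a: "a \<in> elts (P (n - q)) K" and l: "l \<in> tuples G (Suc q)"
    for H K g a l
  proof -
    have "set l \<subseteq> carrier G" using l by (simp add: tuples_def)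
    from Tot_act_single[OF HK g this, of n a] a
    have "act (Tot n) H K g (sg n K l a) = sg n H (mv (inv g) l) (act (P (n - q)) H K (K #> g) a)"
      by (simp only: NNq[OF l] len[OF l])
    then show ?thesis
      using nat_trans_natural[OF \<phi>, of H K g "sg n K l a"] HK g mod_hom_closed[OF sh[OF HK(2) l] a] by simp
  qed
  have mem: "?c K a \<in> N.EC q K" if K: "K \<in> \<H>" and a: "a \<in> elts (P (n - q)) K" for K a
  proof (rule N.D_memI[OF _ _ K])
    fix l assume l: "l \<in> tuples G (Suc q)"
    show "\<phi> K (sg n K l a) \<in> elts N K" by (rule mod_hom_closed[OF \<phi>h[OF K] mod_hom_closed[OF sh[OF K l] a]])
    fix k assume k: "k \<in> K"
    have kc: "k \<in> carrier G" by (rule sub_carrier[OF K k])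
    \<comment> \<open>Equivariance is naturality along k : K -> K, because the coefficients are
      pulled back from the orbit category, where this morphism is the identity.\<close>
    have "act N K K k (\<phi> K (sg n K (mv k l) a)) = \<phi> K (sg n K (mv (inv k) (mv k l)) (act (P (n - q)) K K (K #> k) a))"
      by (rule nat[symmetric, OF K K sub_transporter[OF K k] a tuples_mult[OF kc l]])
    then show "act N K K k (\<phi> K (sg n K (mv k l) a)) = \<phi> K (sg n K l a)"
      using mv_cancel(1)[OF kc, of l] l act_P_mem[OF K k a] by (simp add: tuples_def)
  qed
  show "?c K \<in> mod_hom R (val (P (n - q)) K) (val (hcochains G N q) K)" if "K \<in> Ob OC" for K
  proof -
    have K: "K \<in> \<H>" using that by simp
    show ?thesis
      by (rule N.EC_hom[OF P_val[OF K]])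
        (use mem[OF K] mod_hom_comp[OF sh[OF K] \<phi>h[OF K]] in simp_all)
  qed
  fix H K X a assume "H \<in> Ob OC" "K \<in> Ob OC" "X \<in> Mor OC H K" and a: "a \<in> elts (P (n - q)) K"
  then obtain g where HK: "H \<in> \<H>" "K \<in> \<H>" and g: "g \<in> transporter G H K" and X: "X = K #> g" by (auto simp: Mor_O)
  note gc = transporter_carrier[OF g]
  show "?c H (act (P (n - q)) H K X a) = act (hcochains G N q) H K X (?c K a)"
    unfolding X N.D_act[OF HK g mem[OF HK(2) a]]
  proof (rule restrict_ext)
    fix l assume l: "l \<in> tuples G (Suc q)"
    then have "mv (inv g) (mv g l) = l" by (intro mv_cancel(1)[OF gc]) (simp add: tuples_def)
    then show "\<phi> H (sg n H l (act (P (n - q)) H K (K #> g) a)) = act N H K g (?c K a (mv g l))"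
      using nat[OF HK g a tuples_mult[OF gc l]] tuples_mult[OF gc l] by simp
  qed
qed

lemma Tot_hom_eqI:
  assumes N: "right_module R TC N" and \<phi>: "\<phi> \<in> nat_trans R TC (Tot n) N" and \<psi>: "\<psi> \<in> nat_trans R TC (Tot n) N"
    and eq: "\<And>K l a. K \<in> \<H> \<Longrightarrow> l \<in> idx n \<Longrightarrow> a \<in> carrier (NN n K l) \<Longrightarrow> \<phi> K (sg n K l a) = \<psi> K (sg n K l a)"
  shows "\<phi> = \<psi>"
proof (rule nat_trans_eqI[OF \<phi> \<psi>])
  fix K t assume K: "K \<in> Ob TC" and t: "t \<in> elts (Tot n) K"
  then have K': "K \<in> \<H>" by simp
  show "\<phi> K t = \<psi> K t"
    by (rule TN_eqI[OF K' val_mod[OF N K]])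
      (use nat_trans_hom[OF \<phi> K] nat_trans_hom[OF \<psi> K] eq[OF K'] t in simp_all)
qed

text \<open>Preimages are chosen only at lists whose first entry goes to 1 under \<open>s\<close>,
  and are carried to all other lists by \<open>K\<close>. Since \<open>K\<close> acts freely, this
  is consistent.\<close>

lemma hcochains_lift:
  assumes A: "right_module R TC A" and N: "right_module R TC N" and \<delta>: "\<delta> \<in> nat_trans R TC A N" and K: "K \<in> \<H>"
    and v: "v \<in> equivariant_cochains G N q K"
    and img: "\<And>l. l \<in> tuples G (Suc q) \<Longrightarrow> v l \<in> \<delta> K ` elts A K"
  shows "\<exists>u\<in>equivariant_cochains G A q K. \<forall>l\<in>tuples G (Suc q). \<delta> K (u l) = v l"
proof -
  interpret A: transporter_module R G \<H> A by (rule setting_module[OF A])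
  interpret N: transporter_module R G \<H> N by (rule setting_module[OF N])
  obtain s where s: "N.retraction K s" using N.retraction_exists[OF K] by blast
  have sK: "s (hd l) \<in> K" if "l \<in> tuples G (Suc q)" for l
    using s that by (cases l) (auto simp: N.retraction_def tuples_def)
  define c where "c = inv_into (elts A K) (\<delta> K)"
  have c: "c x \<in> elts A K" "\<delta> K (c x) = x" if "x \<in> \<delta> K ` elts A K" for x
    unfolding c_def using inv_into_into[OF that] f_inv_into_f[OF that] by auto
  let ?m = "\<lambda>l. mv (inv (s (hd l))) l"
  let ?u = "\<lambda>l. left_act G A K (s (hd l)) (c (v (?m l)))"
  have m: "?m l \<in> tuples G (Suc q)" if "l \<in> tuples G (Suc q)" for l
    by (rule tuples_mult[OF _ that]) (use sK[OF that] sub_carrier[OF K] in simp)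
  note cm = c[OF img[OF m]]
  have inv_tr: "inv k \<in> transporter G K K" if "k \<in> K" for k
    by (rule sub_transporter[OF K subgroup.m_inv_closed[OF subgroups[OF K] that]])
  have "(\<lambda>l\<in>tuples G (Suc q). ?u l) \<in> A.EC q K"
  proof (rule A.D_memI[OF _ _ K])
    fix l assume l: "l \<in> tuples G (Suc q)"
    show "?u l \<in> elts A K"
      unfolding left_act_def by (rule A.act_M_closed[OF K K inv_tr[OF sK[OF l]] cm(1)[OF l]])
    fix k assume k: "k \<in> K"
    note kc = sub_carrier[OF K k] and sc = sub_carrier[OF K sK[OF l]]
    have hd: "s (hd (mv k l)) = k \<otimes> s (hd l)"
      using s k l by (cases l) (auto simp: N.retraction_def tuples_def)
    have i: "inv (k \<otimes> s (hd l)) \<otimes> k = inv (s (hd l))" using kc sc by (simp add: inv_mult_group m_assoc)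
    have mm: "?m (mv k l) = ?m l"
      unfolding hd by (subst map_mult_mult[OF _ kc l]) (use i kc sc in simp_all)
    have ks: "k \<otimes> s (hd l) \<in> K" by (rule subgroup.m_closed[OF subgroups[OF K] k sK[OF l]])
    have mm': "mv (inv (k \<otimes> s (hd l))) (mv k l) = ?m l" using mm unfolding hd .
    show "act A K K k (?u (mv k l)) = ?u l"
      unfolding hd left_act_def mm'
      using A.act_M_mult[OF K K K sub_transporter[OF K k] inv_tr[OF ks] cm(1)[OF l]] by (simp only: i)
  qed
  moreover have "\<delta> K (?u l) = v l" if l: "l \<in> tuples G (Suc q)" for l
  proof -
    note sc = sub_carrier[OF K sK[OF l]]
    have lc: "set l \<subseteq> carrier G" using l by (simp add: tuples_def)
    have "\<delta> K (?u l) = left_act G N K (s (hd l)) (v (?m l))"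
      using nat_trans_natural[OF \<delta>, of K K "inv (s (hd l))" "c (v (?m l))"] K inv_tr[OF sK[OF l]] cm[OF l]
      by (simp add: left_act_def)
    also have "\<dots> = v (mv (s (hd l)) (?m l))" by (rule N.left_act_eq[OF K v sK[OF l] m[OF l]])
    also have "mv (s (hd l)) (?m l) = l" by (rule mv_cancel(2)[OF sc lc])
    finally show ?thesis .
  qed
  ultimately show ?thesis by (intro bexI[of _ "\<lambda>l\<in>tuples G (Suc q). ?u l"]) auto
qed

lemma hcochains_map:
  assumes A: "right_module R TC A" and N: "right_module R TC N" and \<delta>: "\<delta> \<in> nat_trans R TC A N"
  shows "nt OC (hcochains G A q) (\<lambda>K v. \<lambda>l\<in>tuples G (Suc q). \<delta> K (v l)) \<in> nat_trans R OC (hcochains G A q) (hcochains G N q)"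
proof -
  interpret A: transporter_module R G \<H> A by (rule setting_module[OF A])
  interpret N: transporter_module R G \<H> N by (rule setting_module[OF N])
  let ?d = "\<lambda>K v. \<lambda>l\<in>tuples G (Suc q). \<delta> K (v l)"
  have \<delta>h: "\<delta> K \<in> mod_hom R (val A K) (val N K)" if "K \<in> \<H>" for K using nat_trans_hom[OF \<delta>, of K] that by simp
  have \<delta>n: "\<delta> H (act A H K g a) = act N H K g (\<delta> K a)"
    if "H \<in> \<H>" "K \<in> \<H>" "g \<in> transporter G H K" "a \<in> elts A K" for H K g a
    using nat_trans_natural[OF \<delta>, of H K g a] that by simp
  have mem: "?d K v \<in> N.EC q K" if K: "K \<in> \<H>" and v: "v \<in> A.EC q K" for K v
  proof (rule N.D_memI[OF _ _ K])
    fix l assume l: "l \<in> tuples G (Suc q)"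
    show "\<delta> K (v l) \<in> elts N K" by (rule mod_hom_closed[OF \<delta>h[OF K] A.D_closed[OF v l]])
    show "act N K K k (\<delta> K (v (mv k l))) = \<delta> K (v l)" if k: "k \<in> K" for k
      using \<delta>n[OF K K sub_transporter[OF K k] A.D_closed[OF v tuples_mult[OF sub_carrier[OF K k] l]]]
        A.D_equivariant[OF v k l] by simp
  qed
  show ?thesis
  proof (rule nat_transI[OF A.right_module_D])
    fix K assume "K \<in> Ob OC"
    then have K: "K \<in> \<H>" by simp
    show "?d K \<in> mod_hom R (val (hcochains G A q) K) (val (hcochains G N q) K)"
      by (rule N.EC_hom[OF A.D_val[OF K]])
        (use mem[OF K] mod_hom_comp[OF A.EC_eval \<delta>h[OF K]] in \<open>simp_all add: A.D_simps\<close>)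
  next
    fix H K X v assume "H \<in> Ob OC" "K \<in> Ob OC" "X \<in> Mor OC H K" and "v \<in> elts (hcochains G A q) K"
    then obtain g where HK: "H \<in> \<H>" "K \<in> \<H>" and g: "g \<in> transporter G H K" and X: "X = K #> g" and v: "v \<in> A.EC q K"
      by (auto simp: Mor_O A.D_simps)
    show "?d H (act (hcochains G A q) H K X v) = act (hcochains G N q) H K X (?d K v)"
      unfolding X A.D_act[OF HK g v] N.D_act[OF HK g mem[OF HK(2) v]]
      by (rule restrict_ext)
        (simp add: tuples_mult transporter_carrier[OF g] \<delta>n[OF HK g] A.D_closed[OF v])
  qed
qed

text \<open>Bidegree by bidegree: \<open>hcochains_lift\<close> finds preimages object by object,
  projectivity of \<open>P (n - q)\<close> makes them natural, and \<open>assemble\<close> puts the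
  lifted components together.\<close>

theorem Tot_lifts:
  assumes A: "right_module R TC A" and N: "right_module R TC N"
  shows "lifts R TC (Tot n) A N"
  unfolding lifts_def
proof (intro ballI impI)
  interpret A: transporter_module R G \<H> A by (rule setting_module[OF A])
  interpret N: transporter_module R G \<H> N by (rule setting_module[OF N])
  fix \<delta> \<phi> assume \<delta>: "\<delta> \<in> nat_trans R TC A N" and \<phi>: "\<phi> \<in> nat_trans R TC (Tot n) N"
    and img: "\<forall>K\<in>Ob TC. \<forall>t\<in>elts (Tot n) K. \<phi> K t \<in> \<delta> K ` elts A K"
  let ?d = "\<lambda>q. nt OC (hcochains G A q) (\<lambda>K v. \<lambda>l\<in>tuples G (Suc q). \<delta> K (v l))"
  have "\<exists>w. q \<le> n \<longrightarrow> w \<in> nat_trans R OC (P (n - q)) (hcochains G A q) \<and>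
      (\<forall>K\<in>\<H>. \<forall>a\<in>elts (P (n - q)) K. ?d q K (w K a) = component n q \<phi> K a)" for q
  proof (cases "q \<le> n")
    case q: True
    note cm = component_mem[OF N \<phi> q]
    obtain w where "w \<in> nat_trans R OC (P (n - q)) (hcochains G A q)"
      "\<And>K a. K \<in> Ob OC \<Longrightarrow> a \<in> elts (P (n - q)) K \<Longrightarrow> ?d q K (w K a) = component n q \<phi> K a"
    proof (rule liftsE[OF projective_lifts[OF projective_P A.right_module_D N.right_module_D] hcochains_map[OF A N \<delta>] cm])
      fix K a assume KO: "K \<in> Ob OC" and a: "a \<in> elts (P (n - q)) K"
      then have K: "K \<in> \<H>" by simp
      have v: "component n q \<phi> K a \<in> N.EC q K" using nat_trans_closed[OF cm KO a] by (simp add: N.D_simps)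
      have "component n q \<phi> K a l \<in> \<delta> K ` elts A K" if l: "l \<in> tuples G (Suc q)" for l
      proof -
        have "sg n K l a \<in> elts (Tot n) K"
          using sg_mem[OF K, of l n a] a l by (simp add: tuples_def)
        then show ?thesis unfolding component_apply[OF K a l] using img K by simp
      qed
      from hcochains_lift[OF A N \<delta> K v this]
      obtain u where u: "u \<in> A.EC q K" "\<And>l. l \<in> tuples G (Suc q) \<Longrightarrow> \<delta> K (u l) = component n q \<phi> K a l" by blast
      have uc: "u \<in> elts (hcochains G A q) K" using u(1) by (simp add: A.D_simps)
      have "?d q K u = component n q \<phi> K a"
      proof (rule N.D_eqI[OF _ v])
        show "?d q K u \<in> N.EC q K"
          using nat_trans_closed[OF hcochains_map[OF A N \<delta>] KO uc] by (simp add: N.D_simps)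
        show "?d q K u l = component n q \<phi> K a l" if l: "l \<in> tuples G (Suc q)" for l
          unfolding nt_apply[OF KO uc] u(2)[OF l, symmetric] using l by simp
      qed
      then show "component n q \<phi> K a \<in> ?d q K ` elts (hcochains G A q) K" by (rule image_eqI[OF sym uc])
    qed blast
    then show ?thesis by auto
  qed simp
  then obtain w where w: "\<And>q. q \<le> n \<Longrightarrow> w q \<in> nat_trans R OC (P (n - q)) (hcochains G A q)"
    "\<And>q K a. q \<le> n \<Longrightarrow> K \<in> \<H> \<Longrightarrow> a \<in> elts (P (n - q)) K \<Longrightarrow> ?d q K (w q K a) = component n q \<phi> K a" by metis
  obtain \<psi> where \<psi>: "\<psi> \<in> nat_trans R TC (Tot n) A"
    "\<And>K l a. K \<in> \<H> \<Longrightarrow> l \<in> idx n \<Longrightarrow> a \<in> carrier (NN n K l) \<Longrightarrow> \<psi> K (sg n K l a) = w (length l - 1) K a l"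
    using assemble[of A n w, OF A w(1)] by blast
  show "\<exists>\<psi>\<in>nat_trans R TC (Tot n) A. \<forall>K\<in>Ob TC. \<forall>t\<in>elts (Tot n) K. \<delta> K (\<psi> K t) = \<phi> K t"
  proof (intro bexI[OF _ \<psi>(1)] ballI)
    fix K t assume KT: "K \<in> Ob TC" and t: "t \<in> elts (Tot n) K"
    then have K: "K \<in> \<H>" and t': "t \<in> carrier (TN n K)" by simp_all
    have KO: "K \<in> Ob OC" using K by simp
    have h: "(\<lambda>t. \<delta> K (\<psi> K t)) \<in> mod_hom R (TN n K) (val N K)" "\<phi> K \<in> mod_hom R (TN n K) (val N K)"
      using mod_hom_comp[OF nat_trans_hom[OF \<psi>(1) KT] nat_trans_hom[OF \<delta> KT]] nat_trans_hom[OF \<phi> KT] by simp_all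
    show "\<delta> K (\<psi> K t) = \<phi> K t"
    proof (rule TN_eqI[OF K N.mod_M[OF K] h _ t'])
      fix l a assume l: "l \<in> idx n" and a: "a \<in> carrier (NN n K l)"
      let ?q = "length l - 1"
      note q = idx_tuples(2)[OF l] and lt = idx_tuples(1)[OF l]
      have a': "a \<in> elts (P (n - ?q)) K" using a by simp
      have "\<delta> K (w ?q K a l) = ?d ?q K (w ?q K a) l"
        using nat_trans_closed[OF w(1)[OF q] KO a'] KO lt by simp
      also have "\<dots> = \<phi> K (sg n K l a)" unfolding w(2)[OF q K a'] by (rule component_apply[OF K a' lt])
      finally show "\<delta> K (\<psi> K (sg n K l a)) = \<phi> K (sg n K l a)" unfolding \<psi>(2)[OF K l a] .
    qed
  qed
qed

theorem Ext_Tot: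
  assumes Q: "projective_resolution R TC (const_rcmod R) Q dQ \<epsilon>Q" and M: "right_module R TC M"
  shows "mod_iso R (Ext R TC Tot bd M n) (Ext R TC Q dQ M n)"
proof -
  note Qr = projective_resolution_imp_resolution[OF Q]
  have Qp: "projective R TC (Q n)" and Qm: "right_module R TC (Q n)" for n
    using Q by (simp_all add: projective_resolution_def projective_def)
  show ?thesis
    by (rule Ext_comparison[OF Tot_resolution Qr M])
      (intro Tot_lifts projective_lifts Qp Qm right_module_const right_module_Tot)+
qed

end

sublocale orbit_resolution \<subseteq> T: res R "transporter_category G \<H>" "const_rcmod R" Tot bd augm
  by (rule res.intro[OF Tot_resolution])

section \<open>The spectral sequence\<close>

locale orbit_resolution_module = orbit_resolution R G \<H> P dP \<epsilon>P + transporter_module R G \<H> M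
  for R :: "('r, 'x) ring_scheme" and G :: "('g, 'y) monoid_scheme" (structure) and \<H> :: "'g set set"
    and P :: "nat \<Rightarrow> ('g set, 'g set, 'r, 'p) rcmod" and dP :: "nat \<Rightarrow> 'g set \<Rightarrow> 'p \<Rightarrow> 'p"
    and \<epsilon>P :: "'g set \<Rightarrow> 'p \<Rightarrow> 'r" and M :: "('g set, 'g, 'r, 'a) rcmod"
begin

section \<open>Cochains on the total complex\<close>

abbreviation "Hm n \<equiv> Hom_mod R TC (Tot n) M"
abbreviation "NT n \<equiv> nat_trans R TC (Tot n) M"
abbreviation "dT n \<equiv> precomp TC Tot bd n"

lemma Hm: "module R (Hm n)" by (rule module_Hom[OF right_module_Tot M])

lemma NT_hom: "\<phi> \<in> NT n \<Longrightarrow> K \<in> \<H> \<Longrightarrow> \<phi> K \<in> mod_hom R (TN n K) (val M K)"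
  using nat_trans_hom[of \<phi> R TC "Tot n" M K] by simp

lemma NT_closed: "\<phi> \<in> NT n \<Longrightarrow> K \<in> \<H> \<Longrightarrow> t \<in> carrier (TN n K) \<Longrightarrow> \<phi> K t \<in> elts M K"
  using mod_hom_closed[OF NT_hom] .

lemma NT_zero: "\<phi> \<in> NT n \<Longrightarrow> K \<in> \<H> \<Longrightarrow> \<phi> K \<zero>\<^bsub>TN n K\<^esub> = \<zero>\<^bsub>val M K\<^esub>"
  using mod_hom_zero[OF TN mod_M NT_hom] by blast

lemma Hm_apply:
  assumes "K \<in> \<H>" "t \<in> carrier (TN n K)"
  shows "(\<phi> \<oplus>\<^bsub>Hm n\<^esub> \<psi>) K t = \<phi> K t \<oplus>\<^bsub>val M K\<^esub> \<psi> K t" "(r \<odot>\<^bsub>Hm n\<^esub> \<phi>) K t = r \<odot>\<^bsub>val M K\<^esub> \<phi> K t"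
    "\<zero>\<^bsub>Hm n\<^esub> K t = \<zero>\<^bsub>val M K\<^esub>"
    "\<phi> \<in> NT n \<Longrightarrow> \<psi> \<in> NT n \<Longrightarrow> (\<phi> \<ominus>\<^bsub>Hm n\<^esub> \<psi>) K t = \<phi> K t \<ominus>\<^bsub>val M K\<^esub> \<psi> K t"
  using assms Hom_mod_minus[OF right_module_Tot M, of \<phi> n \<psi> K t]
  by (simp_all add: Hom_mod_add[OF right_module_Tot M] Hom_mod_smult[OF right_module_Tot M] Hom_mod_zero[OF right_module_Tot M])

lemma dT_mem: "\<phi> \<in> NT n \<Longrightarrow> dT n \<phi> \<in> NT (Suc n)"
  by (rule T.precomp_mem[OF M])

lemma dT_value:
  assumes \<phi>: "\<phi> \<in> NT n" and K: "K \<in> \<H>" and l: "l \<in> idx (Suc n)" and a: "a \<in> carrier (NN (Suc n) K l)"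
  shows "dT n \<phi> K (sg (Suc n) K l a) = alt (val M K) (\<lambda>m. \<phi> K (sg n K m a)) l
    \<oplus>\<^bsub>val M K\<^esub> asgn (length l) \<odot>\<^bsub>val M K\<^esub> \<phi> K (sg n K l (dP (n - (length l - 1)) K a))"
  using bdl_image[OF K mod_M[OF K] NT_hom[OF \<phi> K] l a] bd_single[OF K l a] K sg_mem[OF K a]
  by (simp add: T.precomp_apply)

section \<open>The filtration by degree in \<open>P\<close>\<close>

definition W :: "int \<Rightarrow> nat \<Rightarrow> ('g set \<Rightarrow> ('g list \<Rightarrow> 'p) \<Rightarrow> 'a) set" where
  "W p n = {\<phi> \<in> NT n. \<forall>K\<in>\<H>. \<forall>l\<in>idx n. \<forall>a\<in>carrier (NN n K l).
     int (n - (length l - 1)) < p \<longrightarrow> \<phi> K (sg n K l a) = \<zero>\<^bsub>val M K\<^esub>}"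

lemma W_mem: "\<phi> \<in> W p n \<Longrightarrow> \<phi> \<in> NT n" by (simp add: W_def)

lemma WD: "\<phi> \<in> W p n \<Longrightarrow> K \<in> \<H> \<Longrightarrow> l \<in> idx n \<Longrightarrow> a \<in> carrier (NN n K l) \<Longrightarrow> int (n - (length l - 1)) < p
    \<Longrightarrow> \<phi> K (sg n K l a) = \<zero>\<^bsub>val M K\<^esub>"
  by (simp add: W_def)

lemma WI:
  assumes "\<phi> \<in> NT n"
    "\<And>K l a. K \<in> \<H> \<Longrightarrow> l \<in> idx n \<Longrightarrow> a \<in> carrier (NN n K l) \<Longrightarrow> int (n - (length l - 1)) < p
      \<Longrightarrow> \<phi> K (sg n K l a) = \<zero>\<^bsub>val M K\<^esub>"
  shows "\<phi> \<in> W p n"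
  using assms by (simp add: W_def)

lemma W_sub: "submodule (W p n) R (Hm n)"
proof (rule submoduleI'[OF Hm])
  show "W p n \<subseteq> carrier (Hm n)" by (auto simp: W_def carrier_Hom_mod)
  have z: "\<zero>\<^bsub>Hm n\<^esub> \<in> NT n" unfolding Hom_mod_zero[OF right_module_Tot M] by (rule nt_zero_mem[OF right_module_Tot M])
  show "\<zero>\<^bsub>Hm n\<^esub> \<in> W p n" by (rule WI[OF z]) (simp add: Hm_apply sg_mem)
next
  fix \<phi> \<psi> assume h: "\<phi> \<in> W p n" "\<psi> \<in> W p n"
  show "\<phi> \<oplus>\<^bsub>Hm n\<^esub> \<psi> \<in> W p n"
  proof (rule WI)
    show "\<phi> \<oplus>\<^bsub>Hm n\<^esub> \<psi> \<in> NT n"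
      unfolding Hom_mod_add[OF right_module_Tot M] by (rule nt_add_mem[OF right_module_Tot M W_mem[OF h(1)] W_mem[OF h(2)]])
    fix K l a assume *: "K \<in> \<H>" "l \<in> idx n" "a \<in> carrier (NN n K l)" "int (n - (length l - 1)) < p"
    interpret A: module R "val M K" by (rule mod_M[OF *(1)])
    show "(\<phi> \<oplus>\<^bsub>Hm n\<^esub> \<psi>) K (sg n K l a) = \<zero>\<^bsub>val M K\<^esub>"
      unfolding Hm_apply(1)[OF *(1) sg_mem[OF *(1,3)]] WD[OF h(1) *] WD[OF h(2) *] by simp
  qed
next
  fix r \<phi> assume r: "r \<in> carrier R" and h: "\<phi> \<in> W p n"
  show "r \<odot>\<^bsub>Hm n\<^esub> \<phi> \<in> W p n"
  proof (rule WI)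
    show "r \<odot>\<^bsub>Hm n\<^esub> \<phi> \<in> NT n"
      unfolding Hom_mod_smult[OF right_module_Tot M] by (rule nt_smult_mem[OF right_module_Tot M r W_mem[OF h]])
    fix K l a assume *: "K \<in> \<H>" "l \<in> idx n" "a \<in> carrier (NN n K l)" "int (n - (length l - 1)) < p"
    interpret A: module R "val M K" by (rule mod_M[OF *(1)])
    show "(r \<odot>\<^bsub>Hm n\<^esub> \<phi>) K (sg n K l a) = \<zero>\<^bsub>val M K\<^esub>"
      unfolding Hm_apply(2)[OF *(1) sg_mem[OF *(1,3)]] WD[OF h *] using r by simp
  qed
qed

lemma alt_vanish: "K \<in> \<H> \<Longrightarrow> (\<And>m. set m \<subseteq> set l \<Longrightarrow> Suc (length m) = length l \<Longrightarrow> v m = \<zero>\<^bsub>val M K\<^esub>)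
    \<Longrightarrow> alt (val M K) v l = \<zero>\<^bsub>val M K\<^esub>"
  using alt_cong[of l v "\<lambda>m. \<zero>\<^bsub>val M K\<^esub>"] module.alt_zero[OF mod_M] by metis

text \<open>In the boundary of a summand the faces keep the degree in \<open>P\<close> and the
  \<open>dP\<close> term lowers it by one, so vanishing below p persists.\<close>

lemma dT_W:
  assumes h: "\<phi> \<in> W p n"
  shows "dT n \<phi> \<in> W p (Suc n)"
proof (rule WI[OF dT_mem[OF W_mem[OF h]]])
  fix K l a assume *: "K \<in> \<H>" "l \<in> idx (Suc n)" "a \<in> carrier (NN (Suc n) K l)" and d: "int (Suc n - (length l - 1)) < p"
  interpret A: module R "val M K" by (rule mod_M[OF *(1)])
  have "\<phi> K (sg n K m a) = \<zero>\<^bsub>val M K\<^esub>" if m: "set m \<subseteq> set l" "Suc (length m) = length l" for m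
  proof (cases "m = []")
    case True
    then show ?thesis using NT_zero[OF W_mem[OF h] *(1)] by simp
  next
    case False
    have deg: "n - (length m - 1) = Suc n - (length l - 1)" by (rule deg_face[OF *(2) m(2) False])
    have "a \<in> carrier (NN n K m)" using *(3) unfolding NN_def deg .
    then show ?thesis using WD[OF h *(1) idx_face[OF *(2) m False]] d deg by simp
  qed
  then have 1: "alt (val M K) (\<lambda>m. \<phi> K (sg n K m a)) l = \<zero>\<^bsub>val M K\<^esub>" by (rule alt_vanish[OF *(1)])
  have 2: "\<phi> K (sg n K l (dP (n - (length l - 1)) K a)) = \<zero>\<^bsub>val M K\<^esub>"
  proof (cases "l \<in> idx n")
    case True
    show ?thesis by (rule WD[OF h *(1) True dP_closed[OF *(1) True *(3)]]) (use d deg_dP[OF True] in simp)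
  next
    case False
    then show ?thesis using NT_zero[OF W_mem[OF h] *(1)] by (simp add: sg_out)
  qed
  show "dT n \<phi> K (sg (Suc n) K l a) = \<zero>\<^bsub>val M K\<^esub>"
    unfolding dT_value[OF W_mem[OF h] *] 1 2 by simp
qed

text \<open>In negative degrees this is \<open>Hm 0\<close> again and not zero; that is harmless
  because the filtration and the differential are zero there.\<close>

definition Acx :: "int \<Rightarrow> ('r, 'g set \<Rightarrow> ('g list \<Rightarrow> 'p) \<Rightarrow> 'a) module" where "Acx k = Hm (nat k)"
definition dcx where "dcx k = (if 0 \<le> k then dT (nat k) else (\<lambda>_. \<zero>\<^bsub>Acx (k + 1)\<^esub>))"
definition Vcx where "Vcx p k = (if 0 \<le> k then W p (nat k) else {\<zero>\<^bsub>Acx k\<^esub>})"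

lemma dT_hom: "dT n \<in> mod_hom R (Hm n) (Hm (Suc n))"
  by (rule T.precomp_hom[OF M])

lemma W_top: "p > int n \<Longrightarrow> W p n = {\<zero>\<^bsub>Hm n\<^esub>}"
proof
  assume p: "p > int n"
  show "W p n \<subseteq> {\<zero>\<^bsub>Hm n\<^esub>}"
  proof
    fix \<phi> assume h: "\<phi> \<in> W p n"
    have z: "\<zero>\<^bsub>Hm n\<^esub> \<in> NT n" unfolding Hom_mod_zero[OF right_module_Tot M] by (rule nt_zero_mem[OF right_module_Tot M])
    have "\<phi> = \<zero>\<^bsub>Hm n\<^esub>"
    proof (rule Tot_hom_eqI[OF M W_mem[OF h] z])
      fix K l a assume *: "K \<in> \<H>" "l \<in> idx n" "a \<in> carrier (NN n K l)"
      show "\<phi> K (sg n K l a) = \<zero>\<^bsub>Hm n\<^esub> K (sg n K l a)"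
        using WD[OF h *] p Hm_apply(3)[OF *(1) sg_mem[OF *(1,3)]] by simp
    qed
    then show "\<phi> \<in> {\<zero>\<^bsub>Hm n\<^esub>}" by simp
  qed
  show "{\<zero>\<^bsub>Hm n\<^esub>} \<subseteq> W p n" using submodule_zero[OF W_sub] by simp
qed

lemma nat_Suc: "0 \<le> k \<Longrightarrow> nat (k + 1) = Suc (nat k)" by simp

sublocale F: filtered_complex R Acx dcx Vcx
proof (rule filtered_complex.intro)
  show "module R (Acx n)" for n unfolding Acx_def by (rule Hm)
  show "dcx n \<in> mod_hom R (Acx n) (Acx (n + 1))" for n
    using dT_hom mod_hom_zero_map[OF Hm Hm] by (auto simp: dcx_def Acx_def nat_Suc)
  show "submodule (Vcx p n) R (Acx n)" for p n
    using W_sub submodule_zero_set[OF Hm] by (auto simp: Vcx_def Acx_def)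
  show "Vcx (p + 1) n \<subseteq> Vcx p n" for p n by (auto simp: Vcx_def W_def)
  show "dcx (n + 1) (dcx n a) = \<zero>\<^bsub>Acx (n + 2)\<^esub>" if "a \<in> carrier (Acx n)" for a n
  proof (cases "0 \<le> n")
    case True
    have "nat (n + 2) = Suc (Suc (nat n))" using True by simp
    then show ?thesis using T.precomp_precomp[OF M, of a "nat n"] that True
      by (simp add: dcx_def Acx_def nat_Suc carrier_Hom_mod)
  next
    case False
    show ?thesis
    proof (cases "n = - 1")
      case True
      then show ?thesis using mod_hom_zero[OF Hm Hm dT_hom, of 0] by (simp add: dcx_def Acx_def)
    next
      case f: False
      then have "\<not> 0 \<le> n + 1" using False by simp
      then show ?thesis by (simp add: dcx_def add.assoc)
    qed
  qed
  show "dcx n a \<in> Vcx p (n + 1)" if "a \<in> Vcx p n" for a p n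
  proof (cases "0 \<le> n")
    case True
    then show ?thesis using dT_W that by (simp add: dcx_def Vcx_def nat_Suc)
  next
    case False
    then show ?thesis using submodule_zero[OF W_sub, of 0 p] by (auto simp: dcx_def Vcx_def Acx_def)
  qed
  show "Vcx p n = Vcx 0 n" if "p \<le> 0" for p n using that by (auto simp: Vcx_def W_def)
  show "Vcx p n = {\<zero>\<^bsub>Acx n\<^esub>}" if "n < p" for p n
    using that W_top[of "nat n" p] by (auto simp: Vcx_def Acx_def)
  show "Vcx 0 n = carrier (Acx n)" if "0 \<le> n" for n
    using that by (auto simp: Vcx_def Acx_def W_def carrier_Hom_mod)
qed

text \<open>In degree 0 both sides divide by zero coboundaries, the left one because the
  differential from degree -1 is zero.\<close>

lemma HH_eq: "F.HH (int n) = Ext R TC Tot bd M n"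
proof -
  have "dcx (int n - 1) ` Vcx 0 (int n - 1) = coboundaries R TC Tot bd M n"
  proof (cases n)
    case 0
    then show ?thesis by (simp add: dcx_def Vcx_def coboundaries_def Acx_def)
  next
    case (Suc m)
    have "Vcx 0 (int m) = carrier (Hm m)" using F.V_0[of "int m"] by (simp add: Acx_def)
    then show ?thesis using Suc by (simp add: dcx_def coboundaries_def)
  qed
  then show ?thesis
    unfolding F.HH_def Ext_eq cocycles_def by (simp add: Acx_def dcx_def nat_Suc nat_add_distrib)
qed

section \<open>Components of bidegree (p, q)\<close>

lemma dT_pt:
  assumes \<phi>: "\<phi> \<in> NT n" and K: "K \<in> \<H>" and l: "l \<in> tuples G (Suc q)" and q: "q \<le> Suc n"
    and a: "a \<in> elts (P (Suc n - q)) K"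
  shows "dT n \<phi> K (sg (Suc n) K l a) = alt (val M K) (\<lambda>m. \<phi> K (sg n K m a)) l
    \<oplus>\<^bsub>val M K\<^esub> asgn (Suc q) \<odot>\<^bsub>val M K\<^esub> \<phi> K (sg n K l (dP (n - q) K a))"
proof -
  have len: "length l = Suc q" using l by (simp add: tuples_def)
  have "a \<in> carrier (NN (Suc n) K l)" using a len by (simp add: NN_def)
  from dT_value[OF \<phi> K tuples_idx[OF l q] this] show ?thesis by (simp add: len)
qed

lemma alt_pt_Suc:
  assumes K: "K \<in> \<H>" and l: "l \<in> tuples G (Suc (Suc q))" and a: "a \<in> elts (P (n - q)) K"
  shows "alt (val M K) (\<lambda>m. \<phi> K (sg n K m a)) l = coboundary q K (component n q \<phi> K a) l"
proof -
  have "alt (val M K) (\<lambda>m. \<phi> K (sg n K m a)) l = alt (val M K) (component n q \<phi> K a) l"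
    by (rule alt_cong) (simp add: component_apply[OF K a tuples_face[OF l]])
  then show ?thesis using l by (simp add: coboundary_def)
qed

lemma alt_pt_0:
  assumes \<phi>: "\<phi> \<in> NT n" and K: "K \<in> \<H>" and l: "l \<in> tuples G (Suc 0)"
  shows "alt (val M K) (\<lambda>m. \<phi> K (sg n K m a)) l = \<zero>\<^bsub>val M K\<^esub>"
  by (rule alt_vanish[OF K]) (use l NT_zero[OF \<phi> K] in \<open>simp add: tuples_def\<close>)

abbreviation "cp p q \<equiv> component (p + q) q"

lemma cp_mem: "\<phi> \<in> NT (p + q) \<Longrightarrow> cp p q \<phi> \<in> nat_trans R OC (P p) (D q)"
  using component_mem[OF M, of \<phi> "p + q" q] by simp

lemma cp_closed: "\<phi> \<in> NT (p + q) \<Longrightarrow> K \<in> \<H> \<Longrightarrow> a \<in> elts (P p) K \<Longrightarrow> cp p q \<phi> K a \<in> EC q K"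
  using nat_trans_closed[OF cp_mem, of \<phi> p q K a] by (simp add: D_simps)

lemma cp_apply: "K \<in> \<H> \<Longrightarrow> a \<in> elts (P p) K \<Longrightarrow> l \<in> tuples G (Suc q)
    \<Longrightarrow> cp p q \<phi> K a l = \<phi> K (sg (p + q) K l a)"
  using component_apply[of K a "p + q" q l] by simp

lemma sg_pt: "K \<in> \<H> \<Longrightarrow> a \<in> elts (P p) K \<Longrightarrow> l \<in> tuples G (Suc q) \<Longrightarrow> sg (p + q) K l a \<in> carrier (TN (p + q) K)"
  by (rule sg_mem) (simp_all add: tuples_def)

lemma cp_hom:
  assumes K: "K \<in> \<H>" and a: "a \<in> elts (P p) K"
  shows "(\<lambda>\<phi>. cp p q \<phi> K a) \<in> mod_hom R (Hm (p + q)) (val (D q) K)"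
proof (rule EC_hom[OF Hm])
  show "cp p q \<phi> K a \<in> EC q K" if "\<phi> \<in> carrier (Hm (p + q))" for \<phi>
    using cp_closed[OF _ K a] that by (simp add: carrier_Hom_mod)
  fix l assume l: "l \<in> tuples G (Suc q)"
  note s = sg_pt[OF K a l]
  show "(\<lambda>\<phi>. cp p q \<phi> K a l) \<in> mod_hom R (Hm (p + q)) (val M K)"
    unfolding cp_apply[OF K a l]
    by (rule mod_homI) (use NT_closed[OF _ K s] in \<open>simp_all add: carrier_Hom_mod Hm_apply(1,2)[OF K s]\<close>)
qed

lemma W_pt: "\<phi> \<in> W i (p + q) \<Longrightarrow> int p < i \<Longrightarrow> K \<in> \<H> \<Longrightarrow> a \<in> elts (P p) K \<Longrightarrow> l \<in> tuples G (Suc q)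
    \<Longrightarrow> \<phi> K (sg (p + q) K l a) = \<zero>\<^bsub>val M K\<^esub>"
  by (rule WD[of \<phi> i "p + q" K l a]) (auto simp: tuples_def idx_def)

lemma W_mono: "\<phi> \<in> W i n \<Longrightarrow> j \<le> i \<Longrightarrow> \<phi> \<in> W j n"
  by (auto simp: W_def)

text \<open>In a fixed total degree the steps p and p + 1 differ only in the component of bidegree
  (p, q), so a cochain whose leading component vanishes moves one step deeper.\<close>

lemma W_step:
  assumes \<phi>: "\<phi> \<in> W (int p) (p + q)"
    and z: "\<And>K a l. K \<in> \<H> \<Longrightarrow> a \<in> elts (P p) K \<Longrightarrow> l \<in> tuples G (Suc q) \<Longrightarrow> \<phi> K (sg (p + q) K l a) = \<zero>\<^bsub>val M K\<^esub>"
  shows "\<phi> \<in> W (int p + 1) (p + q)"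
proof (rule WI[OF W_mem[OF \<phi>]])
  fix K l a assume *: "K \<in> \<H>" "l \<in> idx (p + q)" "a \<in> carrier (NN (p + q) K l)" and d: "int (p + q - (length l - 1)) < int p + 1"
  show "\<phi> K (sg (p + q) K l a) = \<zero>\<^bsub>val M K\<^esub>"
  proof (cases "length l = Suc q")
    case True
    then have "l \<in> tuples G (Suc q)" using *(2) by (simp add: tuples_def idx_def)
    then show ?thesis using z[OF *(1)] *(3) True by simp
  next
    case False
    have "length l \<noteq> 0" "length l \<le> Suc (p + q)" using *(2) by (simp_all add: idx_def)
    with d False show ?thesis by (intro WD[OF \<phi> *]) linarith
  qed
qed

text \<open>\<open>dP\<close> leads to degree p - 1, where a member of
  \<open>W (int p) (p + q)\<close> vanishes; for p = 0 the list is too long for the total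
  degree.\<close>

lemma W_dP:
  assumes \<phi>: "\<phi> \<in> W (int p) (p + q)" and K: "K \<in> \<H>" and l: "l \<in> tuples G (Suc (Suc q))" and a: "a \<in> elts (P p) K"
  shows "\<phi> K (sg (p + q) K l (dP (p + q - Suc q) K a)) = \<zero>\<^bsub>val M K\<^esub>"
proof (cases "l \<in> idx (p + q)")
  case True
  have len: "length l = Suc (Suc q)" using l by (simp add: tuples_def)
  have "a \<in> carrier (NN (Suc (p + q)) K l)" using a len by (simp add: NN_def)
  from dP_closed[OF K True this] have "dP (p + q - Suc q) K a \<in> carrier (NN (p + q) K l)" by (simp add: len)
  moreover have "int (p + q - (length l - 1)) < int p" using True len by (simp add: idx_def)
  ultimately show ?thesis using WD[OF \<phi> K True] by blast
next
  case False
  then show ?thesis using NT_zero[OF W_mem[OF \<phi>] K] by (simp add: sg_out)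
qed

text \<open>At filtration degree p the differential of \<phi> is just the group coboundary of the
  leading component, and it vanishes because \<open>dT\<close> takes \<phi> one step deeper.\<close>

lemma cp_ZD:
  assumes \<phi>: "\<phi> \<in> W (int p) (p + q)" and d\<phi>: "dT (p + q) \<phi> \<in> W (int p + 1) (Suc (p + q))"
    and K: "K \<in> \<H>" and a: "a \<in> elts (P p) K"
  shows "cp p q \<phi> K a \<in> ZD q K"
proof -
  interpret A: module R "val M K" by (rule mod_M[OF K])
  note c = cp_closed[OF W_mem[OF \<phi>] K a]
  have "coboundary q K (cp p q \<phi> K a) = \<zero>\<^bsub>val (D (Suc q)) K\<^esub>"
  proof (rule D_eqI[OF coboundary_mem[OF K c] zero_EC[OF K]])
    fix l assume l: "l \<in> tuples G (Suc (Suc q))"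
    have v: "coboundary q K (cp p q \<phi> K a) l \<in> elts M K" by (rule D_closed[OF coboundary_mem[OF K c] l])
    have "\<zero>\<^bsub>val M K\<^esub> = dT (p + q) \<phi> K (sg (Suc (p + q)) K l a)"
      using W_pt[of _ _ p "Suc q", OF _ _ K a l] d\<phi> by simp
    also have "\<dots> = coboundary q K (cp p q \<phi> K a) l \<oplus>\<^bsub>val M K\<^esub> asgn (Suc (Suc q)) \<odot>\<^bsub>val M K\<^esub> \<zero>\<^bsub>val M K\<^esub>"
      using dT_pt[OF W_mem[OF \<phi>] K l, of a] a W_dP[OF \<phi> K l a] alt_pt_Suc[OF K l, of a "p + q"] by simp
    finally show "coboundary q K (cp p q \<phi> K a) l = \<zero>\<^bsub>val (D (Suc q)) K\<^esub> l" using v l by (simp add: D_simps)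
  qed
  then show ?thesis using c by (simp add: ZD_def)
qed

lemma ZD_coboundary: "K \<in> \<H> \<Longrightarrow> w \<in> EC q K \<Longrightarrow> coboundary q K w \<in> ZD (Suc q) K"
  using coboundary_mem coboundary_coboundary by (simp add: ZD_def)

lemma theta_coboundary: "K \<in> \<H> \<Longrightarrow> w \<in> EC q K \<Longrightarrow> theta (Suc q) K (coboundary q K w) = \<zero>\<^bsub>val (HM (Suc q)) K\<^esub>"
  using theta_zero_iff[OF _ ZD_coboundary] by auto

lemma theta_add: "K \<in> \<H> \<Longrightarrow> v \<in> ZD q K \<Longrightarrow> w \<in> ZD q K
    \<Longrightarrow> theta q K (v \<oplus>\<^bsub>val (D q) K\<^esub> w) = theta q K v \<oplus>\<^bsub>val (HM q) K\<^esub> theta q K w"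
  using mod_hom_add[OF theta_hom, of K v q w] by simp

lemma theta_smult: "K \<in> \<H> \<Longrightarrow> r \<in> carrier R \<Longrightarrow> v \<in> ZD q K
    \<Longrightarrow> theta q K (r \<odot>\<^bsub>val (D q) K\<^esub> v) = r \<odot>\<^bsub>val (HM q) K\<^esub> theta q K v"
  using mod_hom_smult[OF theta_hom, of K r v q] by simp

lemma HM_val: "K \<in> \<H> \<Longrightarrow> module R (val (HM q) K)"
  using val_mod[OF right_module_HM] by simp

lemma theta_closed: "K \<in> \<H> \<Longrightarrow> v \<in> ZD q K \<Longrightarrow> theta q K v \<in> elts (HM q) K"
  using mod_hom_closed[OF theta_hom, of K v q] by simp

text \<open>This computes the first differential. At p + 1, the differential of \<phi> is, up to
  sign, the leading component after \<open>dP\<close>, plus the coboundary of the component in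
  bidegree (p + 1, q - 1), which \<open>theta\<close> kills; for q = 0 the latter is absent.\<close>

lemma theta_dT:
  assumes \<phi>: "\<phi> \<in> W (int p) (p + q)" and d\<phi>: "dT (p + q) \<phi> \<in> W (int p + 1) (Suc (p + q))"
    and K: "K \<in> \<H>" and b: "b \<in> elts (P (Suc p)) K"
  shows "theta q K (cp (Suc p) q (dT (p + q) \<phi>) K b)
    = asgn (Suc q) \<odot>\<^bsub>val (HM q) K\<^esub> theta q K (cp p q \<phi> K (dP p K b))"
proof -
  interpret A: module R "val M K" by (rule mod_M[OF K])
  interpret Dq: module R "val (D q) K" by (rule D_val[OF K])
  interpret H: module R "val (HM q) K" by (rule HM_val[OF K])
  have dT: "dT (p + q) \<phi> \<in> NT (Suc p + q)" using W_mem[OF d\<phi>] by simp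
  have db: "dP p K b \<in> elts (P p) K" using nat_trans_closed[OF P.d_nat, of K b p] K b by simp
  note z = cp_ZD[OF \<phi> d\<phi> K db]
  let ?x = "cp p q \<phi> K (dP p K b)"
  let ?y = "asgn (Suc q) \<odot>\<^bsub>val (D q) K\<^esub> ?x"
  have y: "?y \<in> ZD q K" by (rule submodule_smult[OF ZD_sub[OF K] sgn_closed z])
  then have yE: "?y \<in> EC q K" by (simp add: ZD_def)
  have val: "cp (Suc p) q (dT (p + q) \<phi>) K b l = alt (val M K) (\<lambda>m. \<phi> K (sg (p + q) K m b)) l \<oplus>\<^bsub>val M K\<^esub> ?y l"
    if l: "l \<in> tuples G (Suc q)" for l
    using dT_pt[OF W_mem[OF \<phi>] K l, of b] b cp_apply[OF K b l, of "dT (p + q) \<phi>"] cp_apply[OF K db l, of \<phi>] l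
    by (simp add: D_simps)
  have "\<exists>x. x \<in> ZD q K \<and> theta q K x = \<zero>\<^bsub>val (HM q) K\<^esub> \<and> cp (Suc p) q (dT (p + q) \<phi>) K b = x \<oplus>\<^bsub>val (D q) K\<^esub> ?y"
  proof (cases q)
    case 0
    have "cp (Suc p) q (dT (p + q) \<phi>) K b = ?y"
    proof (rule D_eqI[OF cp_closed[OF dT K b] yE])
      fix l assume l: "l \<in> tuples G (Suc q)"
      show "cp (Suc p) q (dT (p + q) \<phi>) K b l = ?y l"
        unfolding val[OF l] using alt_pt_0[OF W_mem[OF \<phi>] K, of l b] l 0 D_closed[OF yE l] by simp
    qed
    moreover have "\<zero>\<^bsub>val (D q) K\<^esub> \<in> ZD q K" by (rule submodule_zero[OF ZD_sub[OF K]])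
    moreover have "?y \<in> elts (D q) K" using yE by (simp add: D_simps)
    ultimately show ?thesis
      using theta_zero_iff[OF K, of "\<zero>\<^bsub>val (D q) K\<^esub>" q] Dq.M.l_zero[of ?y] 0
      by (intro exI[of _ "\<zero>\<^bsub>val (D q) K\<^esub>"]) simp
  next
    case (Suc q')
    have b': "b \<in> elts (P (p + q - q')) K" using b Suc by simp
    have w: "component (p + q) q' \<phi> K b \<in> EC q' K"
      using nat_trans_closed[OF component_mem[OF M W_mem[OF \<phi>], of q'], of K b] K b' Suc by (simp add: D_simps)
    let ?w = "coboundary q' K (component (p + q) q' \<phi> K b)"
    have wZ: "?w \<in> ZD q K" using ZD_coboundary[OF K w] Suc by simp
    have "?w \<oplus>\<^bsub>val (D q) K\<^esub> ?y \<in> ZD q K" by (rule submodule_add[OF ZD_sub[OF K] wZ y])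
    then have wy: "?w \<oplus>\<^bsub>val (D q) K\<^esub> ?y \<in> EC q K" by (simp add: ZD_def)
    have "cp (Suc p) q (dT (p + q) \<phi>) K b = ?w \<oplus>\<^bsub>val (D q) K\<^esub> ?y"
    proof (rule D_eqI[OF cp_closed[OF dT K b] wy])
      fix l assume l: "l \<in> tuples G (Suc q)"
      show "cp (Suc p) q (dT (p + q) \<phi>) K b l = (?w \<oplus>\<^bsub>val (D q) K\<^esub> ?y) l"
        unfolding val[OF l] using alt_pt_Suc[OF K _ b', of l \<phi>] l Suc by (simp add: D_simps)
    qed
    then show ?thesis using wZ theta_coboundary[OF K w] Suc by blast
  qed
  then obtain x where x: "x \<in> ZD q K" "theta q K x = \<zero>\<^bsub>val (HM q) K\<^esub>"
    "cp (Suc p) q (dT (p + q) \<phi>) K b = x \<oplus>\<^bsub>val (D q) K\<^esub> ?y" by blast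
  have "theta q K (cp (Suc p) q (dT (p + q) \<phi>) K b) = theta q K ?y"
    unfolding x(3) theta_add[OF K x(1) y] x(2) using theta_closed[OF K y] by simp
  then show ?thesis by (simp only: theta_smult[OF K sgn_closed z])
qed

text \<open>At p = 0 nothing comes in through \<open>dP\<close>, so the component is a
  coboundary.\<close>

lemma theta_dT_0:
  assumes \<phi>: "\<phi> \<in> NT q" and K: "K \<in> \<H>" and a: "a \<in> elts (P 0) K"
  shows "theta (Suc q) K (cp 0 (Suc q) (dT q \<phi>) K a) = \<zero>\<^bsub>val (HM (Suc q)) K\<^esub>"
proof -
  interpret A: module R "val M K" by (rule mod_M[OF K])
  have \<phi>': "\<phi> \<in> NT (0 + q)" and d: "dT q \<phi> \<in> NT (0 + Suc q)" using \<phi> dT_mem[OF \<phi>] by simp_all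
  note c = cp_closed[OF \<phi>' K a]
  have "cp 0 (Suc q) (dT q \<phi>) K a = coboundary q K (cp 0 q \<phi> K a)"
  proof (rule D_eqI[OF cp_closed[OF d K a] coboundary_mem[OF K c]])
    fix l assume l: "l \<in> tuples G (Suc (Suc q))"
    have "l \<notin> idx q" using l by (simp add: tuples_def idx_def)
    then have "\<phi> K (sg q K l (dP (q - Suc q) K a)) = \<zero>\<^bsub>val M K\<^esub>" using NT_zero[OF \<phi> K] by (simp add: sg_out)
    then show "cp 0 (Suc q) (dT q \<phi>) K a l = coboundary q K (cp 0 q \<phi> K a) l"
      using dT_pt[OF \<phi> K l, of a] a alt_pt_Suc[OF K l, of a q \<phi>] cp_apply[OF K a l, of "dT q \<phi>"]
        D_closed[OF coboundary_mem[OF K c] l] by simp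
  qed
  then show ?thesis using theta_coboundary[OF K c] by simp
qed

text \<open>Extension by zero of a single component. Its differential has two components: the group
  coboundary of \<open>w\<close> and, up to sign, \<open>w\<close> after \<open>dP\<close>.\<close>

lemma one_component:
  assumes w: "w \<in> nat_trans R OC (P p) (D q)"
  obtains \<beta> where "\<beta> \<in> W (int p) (p + q)"
    "\<And>K a. K \<in> \<H> \<Longrightarrow> a \<in> elts (P p) K \<Longrightarrow> cp p q \<beta> K a = w K a"
    "\<And>K a l. K \<in> \<H> \<Longrightarrow> a \<in> elts (P p) K \<Longrightarrow> l \<in> tuples G (Suc (Suc q))
      \<Longrightarrow> dT (p + q) \<beta> K (sg (Suc (p + q)) K l a) = coboundary q K (w K a) l"
    "\<And>K a l. K \<in> \<H> \<Longrightarrow> a \<in> elts (P (Suc p)) K \<Longrightarrow> l \<in> tuples G (Suc q)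
      \<Longrightarrow> dT (p + q) \<beta> K (sg (Suc (p + q)) K l a) = asgn (Suc q) \<odot>\<^bsub>val M K\<^esub> w K (dP p K a) l"
proof -
  let ?w = "\<lambda>i. if i = q then w else nt OC (P (p + q - i)) (\<lambda>K a. \<zero>\<^bsub>val (D i) K\<^esub>)"
  have "?w i \<in> nat_trans R OC (P (p + q - i)) (D i)" for i
    using w nt_zero_mem[OF P.mod_X right_module_D] by simp
  from assemble[OF M this]
  obtain \<beta> where \<beta>: "\<beta> \<in> NT (p + q)"
    "\<And>K l a. K \<in> \<H> \<Longrightarrow> l \<in> idx (p + q) \<Longrightarrow> a \<in> carrier (NN (p + q) K l)
      \<Longrightarrow> \<beta> K (sg (p + q) K l a) = ?w (length l - 1) K a l" by blast
  have at: "\<beta> K (sg (p + q) K l a) = w K a l"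
    if "K \<in> \<H>" "a \<in> elts (P p) K" "l \<in> tuples G (Suc q)" for K a l
  proof -
    have "length l = Suc q" using that by (simp add: tuples_def)
    then show ?thesis using \<beta>(2)[OF that(1) tuples_idx[OF that(3)], of a] that by simp
  qed
  have off: "\<beta> K (sg (p + q) K l a) = \<zero>\<^bsub>val M K\<^esub>"
    if K: "K \<in> \<H>" and l: "l \<in> idx (p + q)" and a: "a \<in> carrier (NN (p + q) K l)" and len: "length l \<noteq> Suc q" for K l a
  proof -
    have "length l - 1 \<noteq> q" using l len by (cases l) (auto simp: idx_def)
    then show ?thesis using \<beta>(2)[OF K l a] idx_tuples(1)[OF l] K a by (simp add: D_simps)
  qed
  have W: "\<beta> \<in> W (int p) (p + q)"
    by (rule WI[OF \<beta>(1)], rule off) auto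
  have cp: "cp p q \<beta> K a = w K a" if K: "K \<in> \<H>" and a: "a \<in> elts (P p) K" for K a
  proof (rule D_eqI[OF cp_closed[OF \<beta>(1) K a]])
    show "w K a \<in> EC q K" using nat_trans_closed[OF w, of K a] K a by (simp add: D_simps)
  qed (simp add: cp_apply[OF K a] at[OF K a])
  show ?thesis
  proof (rule that[OF W cp])
    fix K a l assume K: "K \<in> \<H>"
    interpret A: module R "val M K" by (rule mod_M[OF K])
    { assume a: "a \<in> elts (P p) K" and l: "l \<in> tuples G (Suc (Suc q))"
      have "coboundary q K (w K a) l \<in> elts M K"
        using D_closed[OF coboundary_mem[OF K cp_closed[OF \<beta>(1) K a]] l] cp[OF K a] by simp
      then show "dT (p + q) \<beta> K (sg (Suc (p + q)) K l a) = coboundary q K (w K a) l"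
        using dT_pt[OF \<beta>(1) K l, of a] a W_dP[OF W K l a] alt_pt_Suc[OF K l, of a "p + q" \<beta>] cp[OF K a] by simp }
    { assume a: "a \<in> elts (P (Suc p)) K" and l: "l \<in> tuples G (Suc q)"
      have da: "dP p K a \<in> elts (P p) K" using nat_trans_closed[OF P.d_nat, of K a p] K a by simp
      have "\<beta> K (sg (p + q) K m a) = \<zero>\<^bsub>val M K\<^esub>" if m: "set m \<subseteq> set l" "Suc (length m) = length l" for m
      proof (cases "m = []")
        case True
        then show ?thesis using NT_zero[OF \<beta>(1) K] by simp
      next
        case False
        have len: "length l = Suc q" using l by (simp add: tuples_def)
        with m False obtain q' where q': "q = Suc q'" "length m = Suc q'" by (cases q) auto
        have mi: "m \<in> idx (p + q)" using l m False len by (auto simp: idx_def tuples_def)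
        show ?thesis by (rule off[OF K mi]) (use a q' in simp_all)
      qed
      then have "alt (val M K) (\<lambda>m. \<beta> K (sg (p + q) K m a)) l = \<zero>\<^bsub>val M K\<^esub>" by (rule alt_vanish[OF K])
      moreover have "w K (dP p K a) l \<in> elts M K"
        using D_closed[OF cp_closed[OF \<beta>(1) K da] l] cp[OF K da] by simp
      ultimately show "dT (p + q) \<beta> K (sg (Suc (p + q)) K l a) = asgn (Suc q) \<odot>\<^bsub>val M K\<^esub> w K (dP p K a) l"
        using dT_pt[OF \<beta>(1) K l, of a] a at[OF K da l] by simp }
  qed
qed

section \<open>The map from the second page to Ext over the orbit category\<close>

lemma cyc_iff: "\<phi> \<in> F.cyc r p (int n) \<longleftrightarrow> \<phi> \<in> W p n \<and> dT n \<phi> \<in> W (p + r) (Suc n)"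
  by (simp add: F.cyc_def Vcx_def dcx_def nat_Suc)

lemma Acx_int [simp]: "Acx (int n) = Hm n"
  by (simp add: Acx_def)

lemma dcx_int [simp]: "dcx (int n) = dT n"
  by (simp add: dcx_def)

definition Psi :: "nat \<Rightarrow> nat \<Rightarrow> ('g set \<Rightarrow> ('g list \<Rightarrow> 'p) \<Rightarrow> 'a) \<Rightarrow> 'g set \<Rightarrow> 'p \<Rightarrow> ('g list \<Rightarrow> 'a) set" where
  "Psi p q \<phi> = nt_comp OC (P p) (Theta q) (cp p q \<phi>)"

lemma cyc_1:
  assumes "\<phi> \<in> F.cyc r (int p) (int (p + q))" "1 \<le> r"
  shows "\<phi> \<in> W (int p) (p + q)" "dT (p + q) \<phi> \<in> W (int p + 1) (Suc (p + q))"
  using assms W_mono[of "dT (p + q) \<phi>" "int p + r" "Suc (p + q)" "int p + 1"] unfolding cyc_iff by auto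

lemma Psi_apply:
  assumes "\<phi> \<in> F.cyc r (int p) (int (p + q))" "1 \<le> r" "K \<in> \<H>" "a \<in> elts (P p) K"
  shows "Psi p q \<phi> K a = theta q K (cp p q \<phi> K a)"
  using assms(3,4) Theta_apply[OF assms(3) cp_ZD[OF cyc_1[OF assms(1,2)] assms(3,4)]] by (simp add: Psi_def)

lemma Psi_mem:
  assumes "\<phi> \<in> F.cyc r (int p) (int (p + q))" "1 \<le> r"
  shows "Psi p q \<phi> \<in> nat_trans R OC (P p) (HM q)"
  unfolding Psi_def
  by (rule nt_comp_mem[OF P.mod_X nat_trans_sub[OF cp_mem[OF W_mem[OF cyc_1(1)[OF assms]]]] Theta_mem])
    (use cp_ZD[OF cyc_1[OF assms]] in simp)

abbreviation Z2 :: "nat \<Rightarrow> nat \<Rightarrow> _" where "Z2 p q \<equiv> F.cyc 2 (int p) (int (p + q))"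
abbreviation B2 :: "nat \<Rightarrow> nat \<Rightarrow> _" where "B2 p q \<equiv> F.bnd 2 (int p) (int (p + q))"

text \<open>Membership in Z_2 makes the component of the differential at p + 1 zero. By
  \<open>theta_dT\<close> its class is, up to a sign, that of the leading component after
  \<open>dP\<close>; applying the sign once more removes it.\<close>

lemma Psi_cocycle:
  assumes \<phi>: "\<phi> \<in> Z2 p q"
  shows "Psi p q \<phi> \<in> cocycles R OC P dP (HM q) p"
  unfolding P.mem_cocycles[OF right_module_HM]
proof (intro conjI ballI Psi_mem[OF \<phi>])
  fix K b assume "K \<in> Ob OC" and b: "b \<in> elts (P (Suc p)) K"
  then have K: "K \<in> \<H>" by simp
  interpret H: module R "val (HM q) K" by (rule HM_val[OF K])
  interpret A: module R "val M K" by (rule mod_M[OF K])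
  have db: "dP p K b \<in> elts (P p) K" using nat_trans_closed[OF P.d_nat, of K b p] K b by simp
  note c = cyc_1[OF \<phi>, simplified]
  note x = theta_closed[OF K cp_ZD[OF c K db]]
  have d: "dT (p + q) \<phi> \<in> W (int p + 2) (Suc p + q)" using \<phi> unfolding cyc_iff by simp
  have "cp (Suc p) q (dT (p + q) \<phi>) K b = \<zero>\<^bsub>val (D q) K\<^esub>"
    by (rule D_eqI[OF cp_closed[OF W_mem[OF d] K b] zero_EC[OF K]])
      (use cp_apply[OF K b, of _ q "dT (p + q) \<phi>"] W_pt[OF d _ K b] in \<open>simp add: D_simps\<close>)
  then have "asgn (Suc q) \<odot>\<^bsub>val (HM q) K\<^esub> theta q K (cp p q \<phi> K (dP p K b)) = theta q K \<zero>\<^bsub>val (D q) K\<^esub>"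
    using theta_dT[OF c K b] by simp
  also have "\<dots> = \<zero>\<^bsub>val (HM q) K\<^esub>"
    using mod_hom_zero[OF _ HM_val[OF K] theta_hom[OF K]] val_mod[OF right_module_ZD, of K] K by simp
  finally have "theta q K (cp p q \<phi> K (dP p K b)) = \<zero>\<^bsub>val (HM q) K\<^esub>"
    using sgn_sgn_smult[OF HM_val[OF K] x, of "Suc q"] by (metis H.smult_r_null sgn_closed)
  then show "Psi p q \<phi> K (dP p K b) = \<zero>\<^bsub>val (HM q) K\<^esub>" using Psi_apply[OF \<phi> _ K db] by simp
qed simp

lemma Psi_eqI:
  assumes \<phi>: "\<phi> \<in> Z2 p q" and y: "y \<in> nat_trans R OC (P p) (HM q)"
    and eq: "\<And>K a. K \<in> \<H> \<Longrightarrow> a \<in> elts (P p) K \<Longrightarrow> theta q K (cp p q \<phi> K a) = y K a"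
  shows "Psi p q \<phi> = y"
  by (rule nat_trans_eqI[OF Psi_mem[OF \<phi>] y]) (use Psi_apply[OF \<phi>] eq in simp_all)

lemma Psi_hom:
  "Psi p q \<in> mod_hom R (Hm (p + q)\<lparr>carrier := Z2 p q\<rparr>)
    (Hom_mod R OC (P p) (HM q)\<lparr>carrier := cocycles R OC P dP (HM q) p\<rparr>)"
proof (rule mod_homI)
  let ?Z = "Z2 p q"
  have sub: "submodule ?Z R (Hm (p + q))" using F.cyc_sub[of 2 "int p" "int (p + q)"] by (simp del: of_nat_add)
  fix \<phi> assume "\<phi> \<in> carrier (Hm (p + q)\<lparr>carrier := ?Z\<rparr>)"
  then have \<phi>: "\<phi> \<in> ?Z" by simp
  note \<phi>c = submodule_subset[OF sub \<phi>]
  show "Psi p q \<phi> \<in> carrier (Hom_mod R OC (P p) (HM q)\<lparr>carrier := cocycles R OC P dP (HM q) p\<rparr>)"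
    using Psi_cocycle[OF \<phi>] by simp
  have zd: "cp p q \<psi> K a \<in> ZD q K" if "\<psi> \<in> ?Z" "K \<in> \<H>" "a \<in> elts (P p) K" for \<psi> K a
    by (rule cp_ZD[OF cyc_1[OF that(1)] that(2,3)]) simp_all
  have m: "Psi p q \<psi> \<in> nat_trans R OC (P p) (HM q)" if "\<psi> \<in> ?Z" for \<psi> by (rule Psi_mem[OF that]) simp
  { fix \<psi> assume "\<psi> \<in> carrier (Hm (p + q)\<lparr>carrier := ?Z\<rparr>)"
    then have \<psi>: "\<psi> \<in> ?Z" by simp
    have "Psi p q (\<phi> \<oplus>\<^bsub>Hm (p + q)\<^esub> \<psi>) = Psi p q \<phi> \<oplus>\<^bsub>Hom_mod R OC (P p) (HM q)\<^esub> Psi p q \<psi>"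
      unfolding Hom_mod_add[OF P.mod_X right_module_HM]
    proof (rule Psi_eqI[OF submodule_add[OF sub \<phi> \<psi>] nt_add_mem[OF P.mod_X right_module_HM m[OF \<phi>] m[OF \<psi>]]])
      fix K a assume K: "K \<in> \<H>" and a: "a \<in> elts (P p) K"
      show "theta q K (cp p q (\<phi> \<oplus>\<^bsub>Hm (p + q)\<^esub> \<psi>) K a)
          = nt OC (P p) (\<lambda>K a. Psi p q \<phi> K a \<oplus>\<^bsub>val (HM q) K\<^esub> Psi p q \<psi> K a) K a"
        using K a
        by (simp add: mod_hom_add[OF cp_hom[OF K a] \<phi>c submodule_subset[OF sub \<psi>]]
            theta_add[OF K zd[OF \<phi> K a] zd[OF \<psi> K a]] Psi_apply[OF \<phi> _ K a] Psi_apply[OF \<psi> _ K a])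
    qed
    then show "Psi p q (\<phi> \<oplus>\<^bsub>Hm (p + q)\<lparr>carrier := ?Z\<rparr>\<^esub> \<psi>)
        = Psi p q \<phi> \<oplus>\<^bsub>Hom_mod R OC (P p) (HM q)\<lparr>carrier := cocycles R OC P dP (HM q) p\<rparr>\<^esub> Psi p q \<psi>"
      by simp }
  { fix r assume r: "r \<in> carrier R"
    have "Psi p q (r \<odot>\<^bsub>Hm (p + q)\<^esub> \<phi>) = r \<odot>\<^bsub>Hom_mod R OC (P p) (HM q)\<^esub> Psi p q \<phi>"
      unfolding Hom_mod_smult[OF P.mod_X right_module_HM]
    proof (rule Psi_eqI[OF submodule_smult[OF sub r \<phi>] nt_smult_mem[OF P.mod_X right_module_HM r m[OF \<phi>]]])
      fix K a assume K: "K \<in> \<H>" and a: "a \<in> elts (P p) K"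
      show "theta q K (cp p q (r \<odot>\<^bsub>Hm (p + q)\<^esub> \<phi>) K a)
          = nt OC (P p) (\<lambda>K a. r \<odot>\<^bsub>val (HM q) K\<^esub> Psi p q \<phi> K a) K a"
        using K a
        by (simp add: mod_hom_smult[OF cp_hom[OF K a] r \<phi>c] theta_smult[OF K r zd[OF \<phi> K a]] Psi_apply[OF \<phi> _ K a])
    qed
    then show "Psi p q (r \<odot>\<^bsub>Hm (p + q)\<lparr>carrier := ?Z\<rparr>\<^esub> \<phi>)
        = r \<odot>\<^bsub>Hom_mod R OC (P p) (HM q)\<lparr>carrier := cocycles R OC P dP (HM q) p\<rparr>\<^esub> Psi p q \<phi>"
      by simp }
qed

lemma bnd_Hm: "submodule (F.bnd 2 (int p) (int n)) R (Hm n)"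
  using F.bnd_sub[of 2 "int p" "int n"] unfolding Acx_int .

lemma bnd_left:
  assumes "u \<in> W (int p + 1) n" "dT n u \<in> W (int p + 2) (Suc n)"
  shows "u \<in> F.bnd 2 (int p) (int n)"
  by (rule F.bnd_left) (use assms in \<open>simp add: cyc_iff add.commute\<close>)

lemma bnd_right:
  assumes "v \<in> W (int p - 1) m" "dT m v \<in> W (int p) (Suc m)"
  shows "dT m v \<in> F.bnd 2 (int p) (int (Suc m))"
  using F.bnd_right[of v 2 "int p" "int (Suc m)"] assms by (simp add: cyc_iff)

text \<open>This returns from integer degrees to natural ones; in degree 0 the incoming differential
  is zero, which is the first alternative.\<close>

lemma bndE:
  assumes "z \<in> F.bnd 2 (int p) (int n)"
  obtains (zero) "n = 0" "z \<in> W (int p + 1) n"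
  | (Suc) m u v where "n = Suc m" "u \<in> W (int p + 1) n" "v \<in> W (int p - 1) m" "dT m v \<in> W (int p) n"
    "z = u \<oplus>\<^bsub>Hm n\<^esub> dT m v"
proof -
  obtain u v where uv: "u \<in> F.cyc (2 - 1) (int p + 1) (int n)" "v \<in> F.cyc (2 - 1) (int p - 2 + 1) (int n - 1)"
    "z = u \<oplus>\<^bsub>Acx (int n)\<^esub> dcx (int n - 1) v" by (rule F.bndE[OF assms])
  have u: "u \<in> W (int p + 1) n" using uv(1) by (simp add: cyc_iff)
  show ?thesis
  proof (cases n)
    case 0
    interpret H: module R "Hm 0" by (rule Hm)
    have "z = u" using uv(3) 0 F.cyc_closed[OF uv(1)] by (simp add: dcx_def Acx_def)
    then show ?thesis using zero u 0 by simp
  next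
    case (Suc m)
    then have v: "v \<in> F.cyc 1 (int p - 1) (int m)" using uv(2) by simp
    then have "v \<in> W (int p - 1) m" "dT m v \<in> W (int p) n" unfolding cyc_iff using Suc by simp_all
    moreover have "z = u \<oplus>\<^bsub>Hm n\<^esub> dT m v" using uv(3) unfolding Acx_int Suc by simp
    ultimately show ?thesis by (rule that(2)[OF Suc u])
  qed
qed

lemma carrier_Hm: "carrier (Hm n) = NT n"
  by (rule carrier_Hom_mod)

lemma W_carrier: "\<phi> \<in> W i n \<Longrightarrow> \<phi> \<in> carrier (Hm n)"
  using W_mem by (simp add: carrier_Hm)

lemma cp_zero:
  assumes \<phi>: "\<phi> \<in> W (int p + 1) (p + q)" and K: "K \<in> \<H>" and a: "a \<in> elts (P p) K"
  shows "cp p q \<phi> K a = \<zero>\<^bsub>val (D q) K\<^esub>"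
  by (rule D_eqI[OF cp_closed[OF W_mem[OF \<phi>] K a] zero_EC[OF K]])
    (use cp_apply[OF K a, of _ q \<phi>] W_pt[OF \<phi> _ K a] in \<open>simp add: D_simps\<close>)

lemma theta_zero: "K \<in> \<H> \<Longrightarrow> theta q K \<zero>\<^bsub>val (D q) K\<^esub> = \<zero>\<^bsub>val (HM q) K\<^esub>"
  using mod_hom_zero[OF val_mod[OF right_module_ZD] HM_val theta_hom] by simp

text \<open>The deeper summand \<open>u\<close> has no leading component. The summand dT v
  contributes a coboundary over the orbit category by \<open>theta_dT\<close>, or zero by
  \<open>theta_dT_0\<close> when p = 0.\<close>

lemma Psi_bnd:
  assumes z: "z \<in> B2 p q"
  shows "Psi p q z \<in> coboundaries R OC P dP (HM q) p"
proof -
  have zc: "z \<in> Z2 p q" using F.bnd_cyc z by blast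
  note zm = Psi_mem[OF zc]
  from z show ?thesis
  proof (cases rule: bndE)
    case zero
    then have "p = 0" by simp
    have "Psi p q z K a = \<zero>\<^bsub>val (HM q) K\<^esub>" if "K \<in> \<H>" "a \<in> elts (P p) K" for K a
      using Psi_apply[OF zc _ that] cp_zero[OF zero(2) that] theta_zero[OF that(1)] by simp
    then show ?thesis using P.mem_coboundaries_0[OF right_module_HM, of "Psi p q z" q] zm \<open>p = 0\<close> by simp
  next
    case (Suc m u v)
    have dv: "dT m v \<in> W (int p) (p + q)" by (rule Suc(4))
    have val: "Psi p q z K a = theta q K (cp p q (dT m v) K a)" if K: "K \<in> \<H>" and a: "a \<in> elts (P p) K" for K a
    proof -
      interpret Dq: module R "val (D q) K" by (rule D_val[OF K])
      have "cp p q z K a = \<zero>\<^bsub>val (D q) K\<^esub> \<oplus>\<^bsub>val (D q) K\<^esub> cp p q (dT m v) K a"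
        unfolding Suc(5) mod_hom_add[OF cp_hom[OF K a] W_carrier[OF Suc(2)] W_carrier[OF dv]] cp_zero[OF Suc(2) K a] ..
      also have "\<dots> = cp p q (dT m v) K a" using cp_closed[OF W_mem[OF dv] K a] by (intro Dq.M.l_zero) (simp add: D_simps)
      finally show ?thesis using Psi_apply[OF zc _ K a] by simp
    qed
    show ?thesis
    proof (cases p)
      case 0
      then have q: "q = Suc m" using Suc(1) by simp
      have "Psi p q z K a = \<zero>\<^bsub>val (HM q) K\<^esub>" if "K \<in> \<H>" "a \<in> elts (P p) K" for K a
        using val[OF that] theta_dT_0[OF W_mem[OF Suc(3)] that(1), of a] that(2) 0 q by simp
      then show ?thesis using P.mem_coboundaries_0[OF right_module_HM, of "Psi p q z" q] zm 0 by simp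
    next
      case p: (Suc p')
      then have m: "m = p' + q" using Suc(1) by simp
      have v: "v \<in> F.cyc 1 (int p') (int (p' + q))" using Suc(3,4) p m by (simp add: cyc_iff add.commute del: of_nat_add)
      note vc = cyc_1[OF v order_refl]
      \<comment> \<open>The sign is the one that \<open>theta_dT\<close> produces.\<close>
      let ?y = "nt OC (P p') (\<lambda>K a. asgn (Suc q) \<odot>\<^bsub>val (HM q) K\<^esub> Psi p' q v K a)"
      have "?y \<in> nat_trans R OC (P p') (HM q)"
        by (rule nt_smult_mem[OF P.mod_X right_module_HM sgn_closed Psi_mem[OF v order_refl]])
      moreover have "Psi p q z K a = ?y K (dP p' K a)" if K: "K \<in> \<H>" and a: "a \<in> elts (P p) K" for K a
      proof -
        have a': "a \<in> elts (P (Suc p')) K" using a p by simp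
        have da: "dP p' K a \<in> elts (P p') K" using nat_trans_closed[OF P.d_nat, of K a p'] K a' by simp
        have "Psi p q z K a = asgn (Suc q) \<odot>\<^bsub>val (HM q) K\<^esub> theta q K (cp p' q v K (dP p' K a))"
          using val[OF K a] theta_dT[OF vc K a'] p m by simp
        also have "\<dots> = ?y K (dP p' K a)" using K da Psi_apply[OF v order_refl K da] by simp
        finally show ?thesis .
      qed
      ultimately show ?thesis using P.mem_coboundaries_Suc[OF right_module_HM, of "Psi p q z" p' q] zm p by auto
    qed
  qed
qed

section \<open>The kernel of \<open>Psi\<close>\<close>

lemma EC_carrier: "v \<in> EC q K \<longleftrightarrow> v \<in> elts (D q) K"
  by (simp add: D_simps)

text \<open>The values of the leading component are coboundaries, but with preimages found only
  object by object. Projectivity of \<open>P p\<close> provides a natural map to the (q -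
  1)-cochains, and subtracting the differential of its extension by zero pushes \<phi> one
  filtration step deeper. For q = 0 the leading component is already zero.\<close>

lemma bnd_of_theta_zero:
  assumes \<phi>: "\<phi> \<in> Z2 p q"
    and \<theta>: "\<And>K a. K \<in> \<H> \<Longrightarrow> a \<in> elts (P p) K \<Longrightarrow> theta q K (cp p q \<phi> K a) = \<zero>\<^bsub>val (HM q) K\<^esub>"
  shows "\<phi> \<in> B2 p q"
proof -
  have W: "\<phi> \<in> W (int p) (p + q)" and dW: "dT (p + q) \<phi> \<in> W (int p + 2) (Suc (p + q))"
    using \<phi> unfolding cyc_iff by auto
  have zd: "cp p q \<phi> K a \<in> ZD q K" if "K \<in> \<H>" "a \<in> elts (P p) K" for K a
    by (rule cp_ZD[OF cyc_1[OF \<phi>] that]) simp_all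
  show ?thesis
  proof (cases q)
    case 0
    have "\<phi> \<in> W (int p + 1) (p + q)"
    proof (rule W_step[OF W])
      fix K a l assume *: "K \<in> \<H>" "a \<in> elts (P p) K" "l \<in> tuples G (Suc q)"
      have "cp p q \<phi> K a = \<zero>\<^bsub>val (D 0) K\<^esub>"
        using \<theta>[OF *(1,2)] theta_zero_iff[OF *(1) zd[OF *(1,2)]] 0 by simp
      then show "\<phi> K (sg (p + q) K l a) = \<zero>\<^bsub>val M K\<^esub>"
        using cp_apply[OF *, of \<phi>] *(3) 0 by (simp add: D_simps)
    qed
    then show ?thesis using dW by (rule bnd_left)
  next
    case (Suc q')
    obtain v where v: "v \<in> nat_trans R OC (P p) (D q')"
      "\<And>K a. K \<in> Ob OC \<Longrightarrow> a \<in> elts (P p) K \<Longrightarrow> dD q' K (v K a) = cp p q \<phi> K a"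
    proof (rule liftsE[OF projective_lifts[OF projective_P right_module_D right_module_D] dD_mem])
      show "cp p q \<phi> \<in> nat_trans R OC (P p) (D (Suc q'))" using cp_mem[OF W_mem[OF W]] Suc by simp
      fix K a assume "K \<in> Ob OC" and a: "a \<in> elts (P p) K"
      then have K: "K \<in> \<H>" by simp
      obtain w where w: "w \<in> EC q' K" "cp p q \<phi> K a = coboundary q' K w"
        using \<theta>[OF K a] theta_zero_iff[OF K zd[OF K a]] Suc by auto
      then show "cp p q \<phi> K a \<in> dD q' K ` elts (D q') K"
        using dD_apply[OF K] by (intro image_eqI[of _ _ w]) (simp_all add: EC_carrier)
    qed blast
    obtain \<beta> where \<beta>: "\<beta> \<in> W (int p) (p + q')"
      "\<And>K a l. K \<in> \<H> \<Longrightarrow> a \<in> elts (P p) K \<Longrightarrow> l \<in> tuples G (Suc (Suc q'))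
        \<Longrightarrow> dT (p + q') \<beta> K (sg (Suc (p + q')) K l a) = coboundary q' K (v K a) l"
      by (rule one_component[OF v(1)]) blast
    have n: "Suc (p + q') = p + q" using Suc by simp
    have d\<beta>: "dT (p + q') \<beta> \<in> W (int p) (p + q)" using dT_W[OF \<beta>(1)] unfolding n .
    interpret H: module R "Hm (p + q)" by (rule Hm)
    interpret H': module R "Hm (Suc (p + q))" by (rule Hm)
    let ?u = "\<phi> \<ominus>\<^bsub>Hm (p + q)\<^esub> dT (p + q') \<beta>"
    have uW: "?u \<in> W (int p) (p + q)" by (rule submodule_minus[OF W_sub W d\<beta>])
    have "?u \<in> W (int p + 1) (p + q)"
    proof (rule W_step[OF uW])
      fix K a l assume *: "K \<in> \<H>" "a \<in> elts (P p) K" "l \<in> tuples G (Suc q)"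
      interpret A: module R "val M K" by (rule mod_M[OF *(1)])
      have s: "sg (p + q) K l a \<in> carrier (TN (p + q) K)" by (rule sg_pt[OF *])
      have "dT (p + q') \<beta> K (sg (p + q) K l a) = coboundary q' K (v K a) l"
        using \<beta>(2)[OF *(1,2), of l] *(3) Suc by simp
      also have "v K a \<in> elts (D q') K" using nat_trans_closed[OF v(1), of K a] * by simp
      then have "coboundary q' K (v K a) = cp p q \<phi> K a"
        using v(2)[of K a] * dD_apply[OF *(1)] by simp
      also have "cp p q \<phi> K a l = \<phi> K (sg (p + q) K l a)" by (rule cp_apply[OF *])
      finally have e: "dT (p + q') \<beta> K (sg (p + q) K l a) = \<phi> K (sg (p + q) K l a)" .
      show "?u K (sg (p + q) K l a) = \<zero>\<^bsub>val M K\<^esub>"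
        unfolding Hm_apply(4)[OF *(1) s W_mem[OF W] W_mem[OF d\<beta>]] e
        by (rule A.M.minus_self[OF NT_closed[OF W_mem[OF W] *(1) s]])
    qed
    moreover have "dT (p + q) ?u \<in> W (int p + 2) (Suc (p + q))"
    proof -
      have "dT (p + q) (dT (p + q') \<beta>) = \<zero>\<^bsub>Hm (Suc (p + q))\<^esub>"
        using T.precomp_precomp[OF M W_mem[OF \<beta>(1)]] unfolding n .
      then have "dT (p + q) ?u = dT (p + q) \<phi>"
        using mod_hom_minus[OF Hm Hm dT_hom W_carrier[OF W] W_carrier[OF d\<beta>]] W_carrier[OF dW] H'.M.minus_zero_right by simp
      then show ?thesis using dW by simp
    qed
    ultimately have "?u \<in> B2 p q" by (rule bnd_left)
    moreover have "dT (p + q') \<beta> \<in> B2 p q"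
      using bnd_right[OF W_mono[OF \<beta>(1), of "int p - 1"]] dT_W[OF \<beta>(1)] unfolding n by simp
    ultimately have "?u \<oplus>\<^bsub>Hm (p + q)\<^esub> dT (p + q') \<beta> \<in> B2 p q"
      by (rule submodule_add[OF bnd_Hm])
    then show ?thesis using H.M.minus_add_self[OF W_carrier[OF W] W_carrier[OF d\<beta>]] by simp
  qed
qed

lemma cyc_Hm: "submodule (F.cyc 2 (int p) (int n)) R (Hm n)"
  using F.cyc_sub[of 2 "int p" "int n"] unfolding Acx_int .

lemma ZDm_D: "w \<in> nat_trans R OC X (ZDm q) \<Longrightarrow> w \<in> nat_trans R OC X (D q)"
  by (rule nat_trans_sub_incl) (auto simp: ZD_def D_simps)

text \<open>\<open>theta_surj\<close> gives cocycles object by object; projectivity of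
  \<open>P p\<close> chooses them naturally.\<close>

lemma lift_Theta:
  assumes "y \<in> nat_trans R OC (P p) (HM q)"
  shows "\<exists>w\<in>nat_trans R OC (P p) (ZDm q). \<forall>K\<in>Ob OC. \<forall>a\<in>elts (P p) K. Theta q K (w K a) = y K a"
proof (rule liftsE[OF projective_lifts[OF projective_P right_module_ZD right_module_HM] Theta_mem assms])
  fix K a assume KO: "K \<in> Ob OC" and a: "a \<in> elts (P p) K"
  then have K: "K \<in> \<H>" by simp
  obtain v where v: "v \<in> ZD q K" "y K a = theta q K v"
    using theta_surj[OF K] nat_trans_closed[OF assms KO a] by blast
  show "y K a \<in> Theta q K ` elts (ZDm q) K"
    by (rule image_eqI[of _ _ v]) (use v Theta_apply[OF K v(1)] in simp_all)
qed blast

lemma theta_minus: "K \<in> \<H> \<Longrightarrow> v \<in> ZD q K \<Longrightarrow> w \<in> ZD q K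
    \<Longrightarrow> theta q K (v \<ominus>\<^bsub>val (D q) K\<^esub> w) = theta q K v \<ominus>\<^bsub>val (HM q) K\<^esub> theta q K w"
  using mod_hom_minus[OF val_mod[OF right_module_ZD] HM_val theta_hom, of K v q w]
    a_minus_restrict[OF D_val ZD_sub, of K w q v] by simp

lemma dT_W_step:
  assumes w: "w \<in> nat_trans R OC (P p) (D q)" and \<beta>: "\<beta> \<in> W (int p) (p + q)"
    and d: "\<And>K a l. K \<in> \<H> \<Longrightarrow> a \<in> elts (P p) K \<Longrightarrow> l \<in> tuples G (Suc (Suc q))
      \<Longrightarrow> dT (p + q) \<beta> K (sg (Suc (p + q)) K l a) = coboundary q K (w K a) l"
    and z: "\<And>K a. K \<in> \<H> \<Longrightarrow> a \<in> elts (P p) K \<Longrightarrow> w K a \<in> ZD q K"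
  shows "dT (p + q) \<beta> \<in> W (int p + 1) (Suc (p + q))"
proof -
  have "dT (p + q) \<beta> \<in> W (int p + 1) (p + Suc q)"
  proof (rule W_step)
    show "dT (p + q) \<beta> \<in> W (int p) (p + Suc q)" using dT_W[OF \<beta>] by simp
    fix K a l assume *: "K \<in> \<H>" "a \<in> elts (P p) K" "l \<in> tuples G (Suc (Suc q))"
    show "dT (p + q) \<beta> K (sg (p + Suc q) K l a) = \<zero>\<^bsub>val M K\<^esub>"
      using d[OF *] z[OF *(1,2)] *(3) by (simp add: ZD_def D_simps)
  qed
  then show ?thesis by simp
qed

text \<open>When Psi \<phi> is y after \<open>dP\<close>, the map y is lifted to one with cocycle
  values. Subtracting the differential of the corresponding single component makes the class of the
  leading component vanish, and \<open>bnd_of_theta_zero\<close> takes over. For p = 0 that class is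
  zero from the outset.\<close>

lemma bnd_of_Psi:
  assumes \<phi>: "\<phi> \<in> Z2 p q" and c: "Psi p q \<phi> \<in> coboundaries R OC P dP (HM q) p"
  shows "\<phi> \<in> B2 p q"
proof (cases p)
  case 0
  note m = Psi_mem[OF \<phi>, unfolded 0, simplified]
  show ?thesis
  proof (rule bnd_of_theta_zero[OF \<phi>])
    fix K a assume K: "K \<in> \<H>" and a: "a \<in> elts (P p) K"
    have "Psi p q \<phi> K a = \<zero>\<^bsub>val (HM q) K\<^esub>"
      using c m P.mem_coboundaries_0[OF right_module_HM, of "Psi 0 q \<phi>" q] K a 0 by simp
    then show "theta q K (cp p q \<phi> K a) = \<zero>\<^bsub>val (HM q) K\<^esub>" using Psi_apply[OF \<phi> _ K a] by simp
  qed
next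
  case (Suc p')
  note m = Psi_mem[OF \<phi>, unfolded Suc, simplified]
  obtain y where y: "y \<in> nat_trans R OC (P p') (HM q)"
    "\<And>K a. K \<in> \<H> \<Longrightarrow> a \<in> elts (P (Suc p')) K \<Longrightarrow> Psi p q \<phi> K a = y K (dP p' K a)"
    using c m P.mem_coboundaries_Suc[OF right_module_HM, of "Psi (Suc p') q \<phi>" p' q] Suc by auto
  \<comment> \<open>The sign is put in to cancel the one that \<open>theta_dT\<close>
    produces.\<close>
  let ?y = "nt OC (P p') (\<lambda>K a. asgn (Suc q) \<odot>\<^bsub>val (HM q) K\<^esub> y K a)"
  obtain w where w: "w \<in> nat_trans R OC (P p') (ZDm q)"
    "\<And>K a. K \<in> Ob OC \<Longrightarrow> a \<in> elts (P p') K \<Longrightarrow> Theta q K (w K a) = ?y K a"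
    using lift_Theta[OF nt_smult_mem[OF P.mod_X right_module_HM sgn_closed y(1)]] by blast
  have wz: "w K a \<in> ZD q K" if "K \<in> \<H>" "a \<in> elts (P p') K" for K a
    using nat_trans_closed[OF w(1), of K a] that by simp
  obtain \<beta> where \<beta>: "\<beta> \<in> W (int p') (p' + q)"
    "\<And>K a. K \<in> \<H> \<Longrightarrow> a \<in> elts (P p') K \<Longrightarrow> cp p' q \<beta> K a = w K a"
    "\<And>K a l. K \<in> \<H> \<Longrightarrow> a \<in> elts (P p') K \<Longrightarrow> l \<in> tuples G (Suc (Suc q))
      \<Longrightarrow> dT (p' + q) \<beta> K (sg (Suc (p' + q)) K l a) = coboundary q K (w K a) l"
    by (rule one_component[OF ZDm_D[OF w(1)]]) blast
  have d\<beta>: "dT (p' + q) \<beta> \<in> W (int p' + 1) (Suc (p' + q))"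
    by (rule dT_W_step[OF ZDm_D[OF w(1)] \<beta>(1) \<beta>(3) wz])
  have n: "Suc (p' + q) = p + q" and p': "int p' + 1 = int p" "int p - 1 = int p'" using Suc by simp_all
  let ?u = "\<phi> \<ominus>\<^bsub>Hm (p + q)\<^esub> dT (p' + q) \<beta>"
  have dB: "dT (p' + q) \<beta> \<in> B2 p q"
    using bnd_right[of \<beta> p "p' + q"] \<beta>(1) d\<beta> unfolding n p' by blast
  have dZ: "dT (p' + q) \<beta> \<in> Z2 p q" using dB F.bnd_cyc by blast
  have uZ: "?u \<in> Z2 p q" by (rule submodule_minus[OF cyc_Hm \<phi> dZ])
  interpret H: module R "Hm (p + q)" by (rule Hm)
  note carr = submodule_subset[OF cyc_Hm]
  have "?u \<in> B2 p q"
  proof (rule bnd_of_theta_zero[OF uZ])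
    fix K a assume K: "K \<in> \<H>" and a: "a \<in> elts (P p) K"
    interpret HK: module R "val (HM q) K" by (rule HM_val[OF K])
    have a': "a \<in> elts (P (Suc p')) K" using a Suc by simp
    have da: "dP p' K a \<in> elts (P p') K" using nat_trans_closed[OF P.d_nat, of K a p'] K a' by simp
    have yc: "y K (dP p' K a) \<in> elts (HM q) K" using nat_trans_closed[OF y(1), of K "dP p' K a"] K da by simp
    have zd: "cp p q \<psi> K a \<in> ZD q K" if "\<psi> \<in> Z2 p q" for \<psi>
      by (rule cp_ZD[OF cyc_1[OF that] K a]) simp_all
    have "theta q K (cp p q (dT (p' + q) \<beta>) K a) = asgn (Suc q) \<odot>\<^bsub>val (HM q) K\<^esub> theta q K (w K (dP p' K a))"
      using theta_dT[OF \<beta>(1) d\<beta> K a'] \<beta>(2)[OF K da] Suc by simp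
    also have "theta q K (w K (dP p' K a)) = asgn (Suc q) \<odot>\<^bsub>val (HM q) K\<^esub> y K (dP p' K a)"
      using w(2)[of K "dP p' K a"] K da Theta_apply[OF K wz[OF K da]] by simp
    also have "asgn (Suc q) \<odot>\<^bsub>val (HM q) K\<^esub> \<dots> = y K (dP p' K a)" by (rule sgn_sgn_smult[OF HM_val[OF K] yc])
    also have "\<dots> = theta q K (cp p q \<phi> K a)" using y(2)[OF K a'] Psi_apply[OF \<phi> _ K a] by simp
    finally have e: "theta q K (cp p q (dT (p' + q) \<beta>) K a) = theta q K (cp p q \<phi> K a)" .
    have "theta q K (cp p q ?u K a) = theta q K (cp p q \<phi> K a) \<ominus>\<^bsub>val (HM q) K\<^esub> theta q K (cp p q (dT (p' + q) \<beta>) K a)"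
      unfolding mod_hom_minus[OF Hm D_val[OF K] cp_hom[OF K a] carr[OF \<phi>] carr[OF dZ]]
      by (rule theta_minus[OF K zd[OF \<phi>] zd[OF dZ]])
    then show "theta q K (cp p q ?u K a) = \<zero>\<^bsub>val (HM q) K\<^esub>"
      unfolding e using HK.M.minus_self[OF theta_closed[OF K zd[OF \<phi>]]] by simp
  qed
  then have "?u \<oplus>\<^bsub>Hm (p + q)\<^esub> dT (p' + q) \<beta> \<in> B2 p q" by (rule submodule_add[OF bnd_Hm _ dB])
  then show ?thesis using H.M.minus_add_self[OF carr[OF \<phi>] carr[OF dZ]] by simp
qed

section \<open>Surjectivity of \<open>Psi\<close>\<close>

lemma W_step_dT:
  assumes \<phi>: "\<phi> \<in> W (int p + 1) (Suc (p + q))"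
    and z: "\<And>K a l. K \<in> \<H> \<Longrightarrow> a \<in> elts (P (Suc p)) K \<Longrightarrow> l \<in> tuples G (Suc q)
      \<Longrightarrow> \<phi> K (sg (Suc (p + q)) K l a) = \<zero>\<^bsub>val M K\<^esub>"
  shows "\<phi> \<in> W (int p + 2) (Suc (p + q))"
proof -
  have "\<phi> \<in> W (int (Suc p) + 1) (Suc p + q)"
    by (rule W_step) (use \<phi> z in \<open>simp_all add: add.commute\<close>)
  then show ?thesis by (simp add: add.commute)
qed

text \<open>A lift w of y with cocycle values yields \<beta>, whose differential lies one step
  deeper. What keeps \<beta> out of Z_2 is w after \<open>dP\<close>; its class is zero, so by
  projectivity it is the coboundary of a natural map in bidegree (p + 1, q - 1). Adding that
  component removes the obstruction without touching the leading one.\<close>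

lemma Psi_surj:
  assumes y: "y \<in> cocycles R OC P dP (HM q) p"
  shows "\<exists>\<phi>\<in>Z2 p q. Psi p q \<phi> = y"
proof -
  have ym: "y \<in> nat_trans R OC (P p) (HM q)"
    and yd: "\<And>K b. K \<in> \<H> \<Longrightarrow> b \<in> elts (P (Suc p)) K \<Longrightarrow> y K (dP p K b) = \<zero>\<^bsub>val (HM q) K\<^esub>"
    using y P.mem_cocycles[OF right_module_HM] by auto
  obtain w where w: "w \<in> nat_trans R OC (P p) (ZDm q)"
    "\<And>K a. K \<in> Ob OC \<Longrightarrow> a \<in> elts (P p) K \<Longrightarrow> Theta q K (w K a) = y K a"
    using lift_Theta[OF ym] by blast
  have wz: "w K a \<in> ZD q K" if "K \<in> \<H>" "a \<in> elts (P p) K" for K a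
    using nat_trans_closed[OF w(1), of K a] that by simp
  have wy: "theta q K (w K a) = y K a" if "K \<in> \<H>" "a \<in> elts (P p) K" for K a
    using w(2)[of K a] Theta_apply[OF that(1) wz[OF that]] that by simp
  have db: "dP p K b \<in> elts (P p) K" if "K \<in> \<H>" "b \<in> elts (P (Suc p)) K" for K b
    using nat_trans_closed[OF P.d_nat, of K b p] that by simp
  obtain \<beta> where \<beta>: "\<beta> \<in> W (int p) (p + q)"
    "\<And>K a. K \<in> \<H> \<Longrightarrow> a \<in> elts (P p) K \<Longrightarrow> cp p q \<beta> K a = w K a"
    "\<And>K a l. K \<in> \<H> \<Longrightarrow> a \<in> elts (P p) K \<Longrightarrow> l \<in> tuples G (Suc (Suc q))
      \<Longrightarrow> dT (p + q) \<beta> K (sg (Suc (p + q)) K l a) = coboundary q K (w K a) l"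
    "\<And>K a l. K \<in> \<H> \<Longrightarrow> a \<in> elts (P (Suc p)) K \<Longrightarrow> l \<in> tuples G (Suc q)
      \<Longrightarrow> dT (p + q) \<beta> K (sg (Suc (p + q)) K l a) = asgn (Suc q) \<odot>\<^bsub>val M K\<^esub> w K (dP p K a) l"
    by (rule one_component[OF ZDm_D[OF w(1)]]) blast
  have d\<beta>: "dT (p + q) \<beta> \<in> W (int p + 1) (Suc (p + q))"
    by (rule dT_W_step[OF ZDm_D[OF w(1)] \<beta>(1) \<beta>(3) wz])
  \<comment> \<open>The correction term; its sign (-1)^q is opposite to the sign (-1)^{q+1} in the
    differential of \<beta>.\<close>
  have "\<exists>\<gamma>. \<gamma> \<in> W (int p + 1) (p + q) \<and> (\<forall>K\<in>\<H>. \<forall>b\<in>elts (P (Suc p)) K. \<forall>l\<in>tuples G (Suc q).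
      dT (p + q) \<gamma> K (sg (Suc (p + q)) K l b) = asgn q \<odot>\<^bsub>val M K\<^esub> w K (dP p K b) l)"
  proof (cases q)
    \<comment> \<open>In cochain degree 0 the only coboundary is zero, so w after \<open>dP\<close>
      is itself zero and so is the correction.\<close>
    case 0
    have z: "\<zero>\<^bsub>Hm (p + q)\<^esub> \<in> W (int p + 1) (p + q)" by (rule submodule_zero[OF W_sub])
    have "dT (p + q) \<zero>\<^bsub>Hm (p + q)\<^esub> K (sg (Suc (p + q)) K l b) = asgn q \<odot>\<^bsub>val M K\<^esub> w K (dP p K b) l"
      if K: "K \<in> \<H>" and b: "b \<in> elts (P (Suc p)) K" and l: "l \<in> tuples G (Suc q)" for K b l
    proof -
      interpret A: module R "val M K" by (rule mod_M[OF K])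
      have s: "sg (Suc (p + q)) K l b \<in> carrier (TN (Suc (p + q)) K)" using sg_pt[OF K b l] by simp
      have "dT (p + q) \<zero>\<^bsub>Hm (p + q)\<^esub> K (sg (Suc (p + q)) K l b) = \<zero>\<^bsub>val M K\<^esub>"
        unfolding mod_hom_zero[OF Hm Hm dT_hom] by (rule Hm_apply(3)[OF K s])
      moreover have "w K (dP p K b) = \<zero>\<^bsub>val (D 0) K\<^esub>"
        using theta_zero_iff[OF K wz[OF K db[OF K b]]] wy[OF K db[OF K b]] yd[OF K b] 0 by simp
      ultimately show ?thesis using l 0 by (simp add: D_simps)
    qed
    with z show ?thesis by blast
  next
    case (Suc q')
    let ?x = "nt OC (P (Suc p)) (\<lambda>K b. asgn q \<odot>\<^bsub>val (D q) K\<^esub> nt_comp OC (P (Suc p)) w (dP p) K b)"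
    obtain v where v: "v \<in> nat_trans R OC (P (Suc p)) (D q')"
      "\<And>K b. K \<in> Ob OC \<Longrightarrow> b \<in> elts (P (Suc p)) K \<Longrightarrow> dD q' K (v K b) = ?x K b"
    proof (rule liftsE[OF projective_lifts[OF projective_P right_module_D right_module_D] dD_mem])
      show "?x \<in> nat_trans R OC (P (Suc p)) (D (Suc q'))"
        using nt_smult_mem[OF P.mod_X right_module_D sgn_closed nt_comp_mem[OF P.mod_X P.d_nat ZDm_D[OF w(1)]]]
        unfolding Suc .
      fix K b assume KO: "K \<in> Ob OC" and b: "b \<in> elts (P (Suc p)) K"
      then have K: "K \<in> \<H>" by simp
      have "theta q K (w K (dP p K b)) = \<zero>\<^bsub>val (HM q) K\<^esub>" using wy[OF K db[OF K b]] yd[OF K b] by simp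
      then obtain u where u: "u \<in> EC q' K" "w K (dP p K b) = coboundary q' K u"
        using theta_zero_iff[OF K wz[OF K db[OF K b]]] Suc by auto
      have uc: "u \<in> elts (D q') K" using u(1) by (simp only: EC_carrier)
      interpret Dq: module R "val (D q') K" by (rule D_val[OF K])
      have "?x K b = asgn q \<odot>\<^bsub>val (D q) K\<^esub> coboundary q' K u" using KO b u(2) by simp
      also have "\<dots> = coboundary q' K (asgn q \<odot>\<^bsub>val (D q') K\<^esub> u)"
        unfolding mod_hom_smult[OF coboundary_hom[OF K] sgn_closed uc] Suc ..
      also have "\<dots> = dD q' K (asgn q \<odot>\<^bsub>val (D q') K\<^esub> u)"
        by (rule dD_apply[OF K, symmetric]) (rule Dq.smult_closed[OF sgn_closed uc])
      finally show "?x K b \<in> dD q' K ` elts (D q') K"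
        using Dq.smult_closed[OF sgn_closed uc] by (rule image_eqI)
    qed blast
    obtain \<gamma> where \<gamma>: "\<gamma> \<in> W (int (Suc p)) (Suc p + q')"
      "\<And>K a l. K \<in> \<H> \<Longrightarrow> a \<in> elts (P (Suc p)) K \<Longrightarrow> l \<in> tuples G (Suc (Suc q'))
        \<Longrightarrow> dT (Suc p + q') \<gamma> K (sg (Suc (Suc p + q')) K l a) = coboundary q' K (v K a) l"
      by (rule one_component[OF v(1)]) blast
    have n: "Suc p + q' = p + q" and p: "int (Suc p) = int p + 1" using Suc by simp_all
    have "dT (p + q) \<gamma> K (sg (Suc (p + q)) K l b) = asgn q \<odot>\<^bsub>val M K\<^esub> w K (dP p K b) l"
      if K: "K \<in> \<H>" and b: "b \<in> elts (P (Suc p)) K" and l: "l \<in> tuples G (Suc q)" for K b l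
    proof -
      have vc: "v K b \<in> elts (D q') K" using nat_trans_closed[OF v(1), of K b] K b by simp
      have "dT (p + q) \<gamma> K (sg (Suc (p + q)) K l b) = coboundary q' K (v K b) l"
        using \<gamma>(2)[OF K b, unfolded n] l Suc by blast
      also have "coboundary q' K (v K b) = ?x K b"
        using v(2)[of K b] K b dD_apply[OF K vc] by simp
      also have "\<dots> l = asgn q \<odot>\<^bsub>val M K\<^esub> w K (dP p K b) l" using K b l by (simp add: D_simps)
      finally show ?thesis .
    qed
    with \<gamma>(1)[unfolded n p] show ?thesis by blast
  qed
  then obtain \<gamma> where \<gamma>: "\<gamma> \<in> W (int p + 1) (p + q)"
    "\<And>K b l. K \<in> \<H> \<Longrightarrow> b \<in> elts (P (Suc p)) K \<Longrightarrow> l \<in> tuples G (Suc q)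
      \<Longrightarrow> dT (p + q) \<gamma> K (sg (Suc (p + q)) K l b) = asgn q \<odot>\<^bsub>val M K\<^esub> w K (dP p K b) l" by blast
  let ?\<phi> = "\<beta> \<oplus>\<^bsub>Hm (p + q)\<^esub> \<gamma>"
  have \<phi>: "?\<phi> \<in> W (int p) (p + q)" by (rule submodule_add[OF W_sub \<beta>(1) W_mono[OF \<gamma>(1)]]) simp
  have d: "dT (p + q) ?\<phi> = dT (p + q) \<beta> \<oplus>\<^bsub>Hm (Suc (p + q))\<^esub> dT (p + q) \<gamma>"
    by (rule mod_hom_add[OF dT_hom W_carrier[OF \<beta>(1)] W_carrier[OF \<gamma>(1)]])
  have d\<phi>: "dT (p + q) ?\<phi> \<in> W (int p + 2) (Suc (p + q))"
    unfolding d
  proof (rule W_step_dT[OF submodule_add[OF W_sub d\<beta> dT_W[OF \<gamma>(1)]]])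
    fix K b l assume K: "K \<in> \<H>" and b: "b \<in> elts (P (Suc p)) K" and l: "l \<in> tuples G (Suc q)"
    interpret A: module R "val M K" by (rule mod_M[OF K])
    have s: "sg (Suc (p + q)) K l b \<in> carrier (TN (Suc (p + q)) K)" using sg_pt[OF K b l] by simp
    have x: "w K (dP p K b) l \<in> elts M K"
      using wz[OF K db[OF K b]] D_closed[OF _ l] by (simp add: ZD_def)
    show "(dT (p + q) \<beta> \<oplus>\<^bsub>Hm (Suc (p + q))\<^esub> dT (p + q) \<gamma>) K (sg (Suc (p + q)) K l b) = \<zero>\<^bsub>val M K\<^esub>"
      unfolding Hm_apply(1)[OF K s] \<beta>(4)[OF K b l] \<gamma>(2)[OF K b l] sgn_Suc_smult[OF mod_M[OF K] x]
      by (rule A.M.l_neg) (rule A.smult_closed[OF sgn_closed x])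
  qed
  have \<phi>Z: "?\<phi> \<in> Z2 p q" unfolding cyc_iff using \<phi> d\<phi> by blast
  have "Psi p q ?\<phi> = y"
  proof (rule Psi_eqI[OF \<phi>Z ym])
    fix K a assume K: "K \<in> \<H>" and a: "a \<in> elts (P p) K"
    interpret Dq: module R "val (D q) K" by (rule D_val[OF K])
    have "w K a \<in> elts (D q) K" using submodule_subset[OF ZD_sub[OF K] wz[OF K a]] .
    then have "cp p q ?\<phi> K a = w K a"
      unfolding mod_hom_add[OF cp_hom[OF K a] W_carrier[OF \<beta>(1)] W_carrier[OF \<gamma>(1)]] cp_zero[OF \<gamma>(1) K a] \<beta>(2)[OF K a]
      by (rule Dq.M.r_zero)
    then show "theta q K (cp p q ?\<phi> K a) = y K a" using wy[OF K a] by simp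
  qed
  with \<phi>Z show ?thesis by blast
qed

theorem E2_iso: "mod_iso R (F.E 2 (int p) (int q)) (Ext R OC P dP (HM q) p)"
proof -
  have sq: "subquotient R (Hm (p + q)) (Z2 p q) (B2 p q)"
    using F.sq[of "int (p + q)" 2 "int p"] unfolding Acx_int .
  have e: "F.E 2 (int p) (int q) = quot_mod (Hm (p + q)\<lparr>carrier := Z2 p q\<rparr>) (B2 p q)"
    using Acx_int[of "p + q"] by (simp add: F.E_def F.EE_def)
  interpret E: subquotient R "Hom_mod R OC (P p) (HM q)" "cocycles R OC P dP (HM q) p" "coboundaries R OC P dP (HM q) p"
    by (rule P.sq_Ext[OF right_module_HM])
  show ?thesis unfolding e Ext_eq
  proof (rule subquotient_iso[OF sq E.subquotient_axioms Psi_hom])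
    show "Psi p q z \<in> coboundaries R OC P dP (HM q) p \<longleftrightarrow> z \<in> B2 p q"
      if "z \<in> Z2 p q" for z
      using bnd_of_Psi[OF that] Psi_bnd by blast
  next
    fix y assume y: "y \<in> cocycles R OC P dP (HM q) p"
    have "y \<ominus>\<^bsub>Hom_mod R OC (P p) (HM q)\<^esub> y \<in> coboundaries R OC P dP (HM q) p"
      unfolding E.M.minus_self[OF E.Z_carrier[OF y]] by (rule submodule_zero[OF E.B])
    then show "\<exists>z\<in>Z2 p q. Psi p q z \<ominus>\<^bsub>Hom_mod R OC (P p) (HM q)\<^esub> y \<in> coboundaries R OC P dP (HM q) p"
      using Psi_surj[OF y] by metis
  qed (rule mod_isoI)
qed

end

theorem proposition9p2:
  fixes R :: "('r, 'x) ring_scheme" and G :: "('g, 'y) monoid_scheme"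
    and \<H> :: "'g set set"
    and M :: "('g set, 'g, 'r, 'a) rcmod"
    and P :: "nat \<Rightarrow> ('g set, 'g set, 'r, 'p) rcmod"
    and dP :: "nat \<Rightarrow> 'g set \<Rightarrow> 'p \<Rightarrow> 'p" and \<epsilon>P :: "'g set \<Rightarrow> 'p \<Rightarrow> 'r"
    and Q :: "nat \<Rightarrow> ('g set, 'g, 'r, 'q) rcmod"
    and dQ :: "nat \<Rightarrow> 'g set \<Rightarrow> 'q \<Rightarrow> 'q" and \<epsilon>Q :: "'g set \<Rightarrow> 'q \<Rightarrow> 'r"
  assumes "cring R" and "group G"
    and "\<And>H. H \<in> \<H> \<Longrightarrow> subgroup H G"
    and "\<And>H g. H \<in> \<H> \<Longrightarrow> g \<in> carrier G \<Longrightarrow> g <#\<^bsub>G\<^esub> H #>\<^bsub>G\<^esub> inv\<^bsub>G\<^esub> g \<in> \<H>"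
    and "right_module R (transporter_category G \<H>) M"
    and "projective_resolution R (orbit_category G \<H>) (const_rcmod R) P dP \<epsilon>P"
    and "projective_resolution R (transporter_category G \<H>) (const_rcmod R) Q dQ \<epsilon>Q"
  shows "(\<forall>q. right_module R (orbit_category G \<H>) (cohom_rcmod R G M q)) \<and>
    (\<exists>(E :: nat \<Rightarrow> int \<Rightarrow> int \<Rightarrow> ('r, ('g set \<Rightarrow> 'p \<Rightarrow> ('g list \<Rightarrow> 'a) set) set) module) d.
      first_quadrant_ss R E d \<and>
      (\<forall>p q. mod_iso R (E 2 (int p) (int q))
        (Ext R (orbit_category G \<H>) P dP (cohom_rcmod R G M q) p)) \<and>
      converges_to R E (\<lambda>n. Ext R (transporter_category G \<H>) Q dQ M n))"
proof -
  interpret orbit_resolution_module R G \<H> P dP \<epsilon>P M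
    by (intro orbit_resolution_module.intro orbit_resolution.intro transporter_module.intro
        transporter_setting.intro transporter_setting_axioms.intro orbit_resolution_axioms.intro
        transporter_module_axioms.intro assms)
  interpret Q: res R TC "const_rcmod R" Q dQ \<epsilon>Q
    by (rule res.intro[OF projective_resolution_imp_resolution[OF assms(7)]])
  show ?thesis
  proof (intro conjI allI right_module_HM)
    show "\<exists>(E :: nat \<Rightarrow> int \<Rightarrow> int \<Rightarrow> ('r, ('g set \<Rightarrow> 'p \<Rightarrow> ('g list \<Rightarrow> 'a) set) set) module) d.
      first_quadrant_ss R E d \<and> (\<forall>p q. mod_iso R (E 2 (int p) (int q)) (Ext R OC P dP (HM q) p)) \<and>
      converges_to R E (\<lambda>n. Ext R TC Q dQ M n)"
      \<comment> \<open>The filtered complex converges to Ext computed from \<open>Tot\<close>;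
        \<open>Ext_Tot\<close> passes to the given resolution \<open>Q\<close>.\<close>
      by (rule spectral_sequence_transport[OF F.first_quadrant E2_iso F.converges])
        (simp_all only: HH_eq T.module_Ext[OF M] Q.module_Ext[OF M] Ext_Tot[OF assms(7) M])
  qed
qed

end
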